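(* Assume that, for some $T<\infty$, the following hold. (1) $|q|_\infty<\infty$, and for all $0\le t\le T$, $g_t$ is positive and $|g_t|_\infty<\infty$. (2) $|\omega_t|_\infty<\infty$ for all $0\le t\le T$, and $|\vartheta_t|_\infty<\infty$, $|p_t|_\infty<\infty$ for all $1\le t\le T$. (3) For all $0\le t\le T-1$, $|\vartheta_{t|T}/\gamma_{t+1}|_\infty<\infty$ and $|r_{t|T}|_\infty<\infty$; for all $0\le t\le T$, $|\check\omega_{t|T}|_\infty<\infty$; and for all $1\le t\le T-1$, $|\tilde\vartheta_{t|T}\odot\gamma_{t+1}^{-1}|_\infty<\infty$, $|q\odot\gamma_{t+1}^{-1}|_\infty<\infty$, $|\tilde\omega_{t|T}|_\infty<\infty$ and $|\tilde r_{t|T}|_\infty<\infty$. Then, for all $0\le s<t\le T$ and all bounded measurable $h:\mathsf X\times\mathsf X\to\mathbb R$, as $N\to\infty$, $$\sqrt N\left(\sum_{i,j=1}^N\frac{\omega_s^i}{\Omega_s}\frac{\check\omega_{t|T}^j}{\check\Omega_{t|T}}h(\xi_s^i,\check\xi_{t|T}^j)-\phi_{\chi,s}\otimes\psi_{\gamma,t|T}[h]\right)\xrightarrow{\ \mathcal D\ }\mathcal N\left(0,\tilde\Gamma_{s,t|T}\big[h-\phi_{\chi,s}\otimes\psi_{\gamma,t|T}[h]\big]\right),$$ where $$\tilde\Gamma_{s,t|T}[h]=\Gamma_{\chi,s}\left[\int\psi_{\gamma,t|T}(dx_t)h(\cdot,x_t)\right]+\check\Gamma_{\gamma,t|T}\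left[\int\phi_{\chi,s}(dx_s)h(x_s,\cdot)\right].$$
   Context: **Model.** $(\mathsf X,\mathcal X)$ is a measurable space with countably generated $\sigma$-field, $\lambda$ a ($\sigma$-finite) measure on it; $dx$ stands for $\lambda(dx)$. $Q$ is a Markov kernel on $\mathsf X$ with $Q(x,dx')=q(x,x')\,dx'$. $g_0,\dots,g_T$ are positive measurable functions on $\mathsf X$, $\chi$ a probability on $\mathsf X$. $|\cdot|_\infty$ is the supremum norm and $(f\odot g)(x,x')=f(x,x')g(x')$ for $f:\mathsf X^2\to\mathbb R$, $g:\mathsf X\to\mathbb R$. $\mu[h]$ denotes $\int h\,d\mu$ and $\mu^2[h]=(\mu[h])^2$. The filtering distribution is $$\phi_{\chi,s}[h]=\frac{\int\chi(dx_0)g_0(x_0)\prod_{u=1}^sQ(x_{u-1},dx_u)g_u(x_u)\,h(x_s)}{\int\chi(dx_0)g_0(x_0)\prod_{u=1}^sQ(x_{u-1},dx_u)g_u(x_u)}.$$ $\gamma_0,\dots,\gamma_T$ are positive measurable functions with $\int\gamma_t(x_t)dx_t\left[\prod_{u=t+1}^Tg_{u-1}(x_{u-1})Q(x_{u-1},dx_u)\right]g_T(x_T)<\infty$ for all $0\le t\le T$, and the backward information filter is $$\psi_{\gamma,t|T}[h]=\frac{\int\gamma_t(x_t)dx_t\left[\prod_{u=t+1}^Tg_{u-1}(x_{u-1})Q(x_{u-1},dx_u)\right]g_T(x_T)h(x_t)}{\int\gamma_t(x_t)dx_t\left[\prod_{u=t+1}^Tg_{u-1}(x_{u-1})Q(x_{u-1},dx_u)\right]g_T(x_T)}.$$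 **Forward filter.** $\rho_0$ is a probability with $\chi\ll\rho_0$; for $1\le t\le T$, $\vartheta_t\ge0$ is a measurable function on $\mathsf X$ and $p_t(x,\cdot)$ a Markov transition density w.r.t. $\lambda$. Set $$\omega_0(x)=\frac{d\chi}{d\rho_0}(x)g_0(x),\qquad \omega_t(x,x')=\frac{q(x,x')g_t(x')}{\vartheta_t(x)p_t(x,x')}\ (t\ge1).$$ For each $N$: $\xi_0^1,\dots,\xi_0^N$ are i.i.d. from $\rho_0$, $\omega_0^\ell=\omega_0(\xi_0^\ell)$. For $s\ge1$, conditionally on the past, the pairs $(I_s^\ell,\xi_s^\ell)$, $1\le \ell\le N$, are i.i.d. on $\{1,\dots,N\}\times\mathsf X$ with density proportional to $(i,x)\mapsto\omega_{s-1}^i\vartheta_s(\xi_{s-1}^i)p_s(\xi_{s-1}^i,x)$, and $\omega_s^\ell=\omega_s(\xi_{s-1}^{I_s^\ell},\xi_s^\ell)$. $\Omega_s=\sum_\ell\omega_s^\ell$. **Backward filter.** $\check\rho_T$ is a probability density on $\mathsf X$; for $0\le t\le T-1$, $\vartheta_{t|T}\ge0$ is a measurable function on $\mathsf X$ and $r_{t|T}(x',\cdot)$ a Markov transition density. Set $$\check\omega_{T|T}(x)=\frac{g_T(x)\gamma_T(x)}{\check\rho_T(x)},\qquad\check\omega_{t|T}(x,x')=\frac{\gamma_t(x)g_t(x)q(x,x')}{\vartheta_{t|T}(x')r_{t|T}(x',x)}\ (t<T).$$ $\check\xi_{T|T}^1,\dots,\check\xi_{T|T}^N$ are i.i.d.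 from $\check\rho_T$, $\check\omega_{T|T}^i=\check\omega_{T|T}(\check\xi_{T|T}^i)$. For $t=T-1,\dots,0$, conditionally on the previously generated backward particles, the pairs $(\check I_t^i,\check\xi_{t|T}^i)$, $1\le i\le N$, are i.i.d. with density proportional to $(j,x)\mapsto\check\omega_{t+1|T}^j\,\vartheta_{t|T}(\check\xi_{t+1|T}^j)\,\gamma_{t+1}^{-1}(\check\xi_{t+1|T}^j)\,r_{t|T}(\check\xi_{t+1|T}^j,x)$, and $\check\omega_{t|T}^i=\check\omega_{t|T}(\check\xi_{t|T}^i,\check\xi_{t+1|T}^{\check I_t^i})$. $\check\Omega_{t|T}=\sum_i\check\omega_{t|T}^i$. The forward and backward particle systems are independent. **Filter asymptotic variances.** For functions $h$ on $\mathsf X$, $$\Gamma_{\chi,0}[h]=\frac{\int\rho_0(dx)\omega_0^2(x)h^2(x)}{\left(\int\rho_0(dx)\omega_0(x)\right)^2},$$ and for $s\ge1$, $$\Gamma_{\chi,s}[h]=\frac{\Gamma_{\chi,s-1}\left[\int q(\cdot,x)g_s(x)h(x)dx\right]+\phi_{\chi,s-1}\left[\int\omega_s(\cdot,x)q(\cdot,x)g_s(x)h^2(x)dx\right]\phi_{\chi,s-1}[\vartheta_s]}{\phi_{\chi,s-1}^2\left[\int q(\cdot,x)g_s(x)dx\right]};$$ $$\check\Gamma_{\gamma,T|T}[h]=\frac{\int\check\rho_T(x)\check\omega_{T|T}^2(x)h^2(x)dx}{\left(\int\check\rho_T(x)\check\omega_{T|T}(x)dx\right)^2},$$ and for $t\le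 T-1$, with $K_t(x,x')=\gamma_t(x)g_t(x)q(x,x')\gamma_{t+1}^{-1}(x')$, $$\check\Gamma_{\gamma,t|T}[h]=\frac{\check\Gamma_{\gamma,t+1|T}\left[\int K_t(x,\cdot)h(x)dx\right]+\psi_{\gamma,t+1|T}\left[\int\check\omega_{t|T}(x,\cdot)K_t(x,\cdot)h^2(x)dx\right]\psi_{\gamma,t+1|T}\left[\vartheta_{t|T}\gamma_{t+1}^{-1}\right]}{\psi_{\gamma,t+1|T}^2\left[\int K_t(x,\cdot)dx\right]}.$$ **Smoothing proposals (used only in the assumptions).** For $1\le t\le T-1$, $\tilde\vartheta_{t|T}\ge0$ is a measurable function on $\mathsf X^2$, $\tilde r_{t|T}(x,x';\cdot)$ is a probability density for each $(x,x')$, and $$\tilde\omega_{t|T}(x,x';x'')=\frac{q(x,x'')q(x'',x')g_t(x'')}{\tilde\vartheta_{t|T}(x,x')\tilde r_{t|T}(x,x';x'')}.$$ **Conventions.** In weight functions, $0/0=0$ and $c/0=\infty$ for $c>0$. All sums of weights and normalizing constants appearing in denominators are assumed almost surely positive, so that all estimators and sampling distributions are well defined. $\mathcal N(0,0)$ is the Dirac mass at $0$. *)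

theory Defs
  imports "HOL-Probability.Probability"
begin

section \<open>Densities, supremum norms, normal laws\<close>

definition countably_generated :: "'a measure \<Rightarrow> bool" where
  "countably_generated L \<longleftrightarrow>
     (\<exists>G. countable G \<and> G \<subseteq> Pow (space L) \<and> sets L = sigma_sets (space L) G)"

definition prob_density :: "'a measure \<Rightarrow> ('a \<Rightarrow> real) \<Rightarrow> bool" where
  "prob_density L f \<longleftrightarrow>
     f \<in> borel_measurable L \<and> (\<forall>x\<in>space L. 0 \<le> f x) \<and> (\<integral>\<^sup>+x. ennreal (f x) \<partial>L) = 1"

definition markov_density :: "'a measure \<Rightarrow> ('a \<Rightarrow> 'a \<Rightarrow> real) \<Rightarrow> bool" where
  "markov_density L k \<longleftrightarrow>
     (\<lambda>(x, x'). k x x') \<in> borel_measurable (L \<Otimes>\<^sub>M L) \<and> (\<forall>x\<in>space L. prob_density L (k x))"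

text \<open>Supremum norm of a nonnegative, possibly infinite, function on a set. Nonnegative real
  functions are passed through the coercion \<^const>\<open>ennreal\<close>.\<close>

definition sup_norm :: "'x set \<Rightarrow> ('x \<Rightarrow> ennreal) \<Rightarrow> ennreal" where
  "sup_norm S f = (SUP z\<in>S. f z)"

definition normal_law :: "real \<Rightarrow> real \<Rightarrow> real measure" where
  "normal_law m v =
     (if v = 0 then return borel m else density lborel (\<lambda>x. ennreal (normal_density m (sqrt v) x)))"

definition normalized_density :: "'x measure \<Rightarrow> ('x \<Rightarrow> ennreal) \<Rightarrow> 'x measure" where
  "normalized_density L f = density L (\<lambda>z. f z / (\<integral>\<^sup>+y. f y \<partial>L))"

section \<open>The state space model and the design of the two filters\<close>

text \<open>In the usual notation: \<open>horizon\<close> is \<open>T\<close>, \<open>base\<close> is \<open>\<lambda>\<close> (carrying the measurable space),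
  \<open>qd\<close> is \<open>q\<close>, \<open>pot\<close> is \<open>g\<close>, \<open>init\<close> is \<open>\<chi>\<close>, \<open>gam\<close> is \<open>\<gamma>\<close>; \<open>rho\<close> is \<open>\<rho>\<^sub>0\<close> and \<open>dinit\<close> is the
  version of \<open>d\<chi>/d\<rho>\<^sub>0\<close> that is used in the weights; \<open>fadj t\<close> is \<open>\<vartheta>\<^sub>t\<close>, \<open>fprop t\<close> is \<open>p\<^sub>t\<close>;
  \<open>brho\<close> is the density of the terminal backward proposal, \<open>badj t\<close> is \<open>\<vartheta>\<close> and \<open>bprop t\<close> is \<open>r\<close>
  at \<open>t|T\<close>; \<open>sadj t\<close> and \<open>sprop t\<close> are the smoothing versions (with tilde) at \<open>t|T\<close>.\<close>

record 'a smoothing_model =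
  horizon :: nat
  base :: "'a measure"
  qd :: "'a \<Rightarrow> 'a \<Rightarrow> real"
  pot :: "nat \<Rightarrow> 'a \<Rightarrow> real"
  init :: "'a measure"
  gam :: "nat \<Rightarrow> 'a \<Rightarrow> real"
  rho :: "'a measure"
  dinit :: "'a \<Rightarrow> ennreal"
  fadj :: "nat \<Rightarrow> 'a \<Rightarrow> real"
  fprop :: "nat \<Rightarrow> 'a \<Rightarrow> 'a \<Rightarrow> real"
  brho :: "'a \<Rightarrow> real"
  badj :: "nat \<Rightarrow> 'a \<Rightarrow> real"
  bprop :: "nat \<Rightarrow> 'a \<Rightarrow> 'a \<Rightarrow> real"
  sadj :: "nat \<Rightarrow> 'a \<Rightarrow> 'a \<Rightarrow> real"
  sprop :: "nat \<Rightarrow> 'a \<Rightarrow> 'a \<Rightarrow> 'a \<Rightarrow> real"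

definition Qk :: "'a smoothing_model \<Rightarrow> 'a \<Rightarrow> 'a measure" where
  "Qk M x = density (base M) (\<lambda>x'. ennreal (qd M x x'))"

subsection \<open>Filtering distribution and backward information filter\<close>

text \<open>The iterated integral of
  \<open>\<chi>(dx\<^sub>0) g\<^sub>0(x\<^sub>0) \<Prod>\<^bsub>u=1..s\<^esub> Q(x\<^bsub>u-1\<^esub>, dx\<^sub>u) g\<^sub>u(x\<^sub>u) f(x\<^sub>s)\<close>, evaluated from the innermost variable
  \<open>x\<^sub>s\<close> outwards.\<close>

primrec fwd_integral :: "'a smoothing_model \<Rightarrow> nat \<Rightarrow> ('a \<Rightarrow> ennreal) \<Rightarrow> ennreal" where
  "fwd_integral M 0 f = (\<integral>\<^sup>+x. ennreal (pot M 0 x) * f x \<partial>init M)"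
| "fwd_integral M (Suc s) f =
     fwd_integral M s (\<lambda>x. \<integral>\<^sup>+x'. ennreal (pot M (Suc s) x') * f x' \<partial>Qk M x)"

definition phi :: "'a smoothing_model \<Rightarrow> nat \<Rightarrow> 'a measure" where
  "phi M s = measure_of (space (base M)) (sets (base M))
     (\<lambda>A. fwd_integral M s (indicator A) / fwd_integral M s (\<lambda>_. 1))"

text \<open>\<open>bwd_lik M t x\<close> is the integral of
  \<open>[\<Prod>\<^bsub>u=t+1..T\<^esub> g\<^bsub>u-1\<^esub>(x\<^bsub>u-1\<^esub>) Q(x\<^bsub>u-1\<^esub>, dx\<^sub>u)] g\<^sub>T(x\<^sub>T)\<close> over \<open>x\<^bsub>t+1\<^esub>, \<dots>, x\<^sub>T\<close> for \<open>x\<^sub>t = x\<close>.\<close>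

function bwd_lik :: "'a smoothing_model \<Rightarrow> nat \<Rightarrow> 'a \<Rightarrow> ennreal" where
  "bwd_lik M t x =
     (if t < horizon M then ennreal (pot M t x) * (\<integral>\<^sup>+x'. bwd_lik M (Suc t) x' \<partial>Qk M x)
      else ennreal (pot M (horizon M) x))"
  by pat_completeness auto
termination by (relation "Wellfounded.measure (\<lambda>(M, t, x). horizon M - t)") auto

declare bwd_lik.simps [simp del]

definition bwd_integral :: "'a smoothing_model \<Rightarrow> nat \<Rightarrow> ('a \<Rightarrow> ennreal) \<Rightarrow> ennreal" where
  "bwd_integral M t f = (\<integral>\<^sup>+x. ennreal (gam M t x) * bwd_lik M t x * f x \<partial>base M)"

definition psi :: "'a smoothing_model \<Rightarrow> nat \<Rightarrow> 'a measure" where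
  "psi M t = measure_of (space (base M)) (sets (base M))
     (\<lambda>A. bwd_integral M t (indicator A) / bwd_integral M t (\<lambda>_. 1))"

subsection \<open>Standing assumptions\<close>

locale two_filter_model =
  fixes M :: "'a smoothing_model"
  assumes sigma_finite_base: "sigma_finite_measure (base M)"
    and countably_generated_base: "countably_generated (base M)"
    and markov_q: "markov_density (base M) (qd M)"
    and pot_measurable: "t \<le> horizon M \<Longrightarrow> pot M t \<in> borel_measurable (base M)"
    and pot_pos: "t \<le> horizon M \<Longrightarrow> x \<in> space (base M) \<Longrightarrow> 0 < pot M t x"
    and prob_init: "prob_space (init M)"
    and sets_init: "sets (init M) = sets (base M)"
    and gam_measurable: "t \<le> horizon M \<Longrightarrow> gam M t \<in> borel_measurable (base M)"
    and gam_pos: "t \<le> horizon M \<Longrightarrow> x \<in> space (base M) \<Longrightarrow> 0 < gam M t x"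
    and gam_finite: "t \<le> horizon M \<Longrightarrow> bwd_integral M t (\<lambda>_. 1) < \<infinity>"
    and prob_rho: "prob_space (rho M)"
    and sets_rho: "sets (rho M) = sets (base M)"
    and abs_cont_init: "absolutely_continuous (rho M) (init M)"
    and dinit_measurable: "dinit M \<in> borel_measurable (base M)"
    and density_init: "density (rho M) (dinit M) = init M"
    and fadj_measurable:
      "1 \<le> t \<Longrightarrow> t \<le> horizon M \<Longrightarrow> fadj M t \<in> borel_measurable (base M)"
    and fadj_nonneg:
      "1 \<le> t \<Longrightarrow> t \<le> horizon M \<Longrightarrow> x \<in> space (base M) \<Longrightarrow> 0 \<le> fadj M t x"
    and markov_fprop: "1 \<le> t \<Longrightarrow> t \<le> horizon M \<Longrightarrow> markov_density (base M) (fprop M t)"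
    and density_brho: "prob_density (base M) (brho M)"
    and badj_measurable: "t < horizon M \<Longrightarrow> badj M t \<in> borel_measurable (base M)"
    and badj_nonneg: "t < horizon M \<Longrightarrow> x \<in> space (base M) \<Longrightarrow> 0 \<le> badj M t x"
    and markov_bprop: "t < horizon M \<Longrightarrow> markov_density (base M) (bprop M t)"
    and sadj_measurable: "1 \<le> t \<Longrightarrow> t < horizon M \<Longrightarrow>
      (\<lambda>(x, x'). sadj M t x x') \<in> borel_measurable (base M \<Otimes>\<^sub>M base M)"
    and sadj_nonneg: "1 \<le> t \<Longrightarrow> t < horizon M \<Longrightarrow> x \<in> space (base M) \<Longrightarrow>
      x' \<in> space (base M) \<Longrightarrow> 0 \<le> sadj M t x x'"
    and density_sprop: "1 \<le> t \<Longrightarrow> t < horizon M \<Longrightarrow> x \<in> space (base M) \<Longrightarrow>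
      x' \<in> space (base M) \<Longrightarrow> prob_density (base M) (sprop M t x x')"

subsection \<open>Importance weight functions\<close>

text \<open>Division in \<^typ>\<open>ennreal\<close> has \<open>0 / 0 = 0\<close> and \<open>c / 0 = \<infinity>\<close> for \<open>c > 0\<close>, the convention
  required of the weights.\<close>

definition omega0 :: "'a smoothing_model \<Rightarrow> 'a \<Rightarrow> ennreal" where
  "omega0 M x = dinit M x * ennreal (pot M 0 x)"

definition omega :: "'a smoothing_model \<Rightarrow> nat \<Rightarrow> 'a \<Rightarrow> 'a \<Rightarrow> ennreal" where
  "omega M t x x' = ennreal (qd M x x' * pot M t x') / ennreal (fadj M t x * fprop M t x x')"

definition bomegaT :: "'a smoothing_model \<Rightarrow> 'a \<Rightarrow> ennreal" where
  "bomegaT M x = ennreal (pot M (horizon M) x * gam M (horizon M) x) / ennreal (brho M x)"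

definition bomega :: "'a smoothing_model \<Rightarrow> nat \<Rightarrow> 'a \<Rightarrow> 'a \<Rightarrow> ennreal" where
  "bomega M t x x' =
     ennreal (gam M t x * pot M t x * qd M x x') / ennreal (badj M t x' * bprop M t x' x)"

definition somega :: "'a smoothing_model \<Rightarrow> nat \<Rightarrow> 'a \<Rightarrow> 'a \<Rightarrow> 'a \<Rightarrow> ennreal" where
  "somega M t x x' x'' =
     ennreal (qd M x x'' * qd M x'' x' * pot M t x'') / ennreal (sadj M t x x' * sprop M t x x' x'')"

section \<open>Particle systems\<close>

text \<open>Particles are indexed by \<open>{1..N}\<close>. \<open>particle_sigma P L N S R xi I\<close> is the sub-sigma-field of
  \<open>P\<close> generated by the particles \<open>xi u l\<close> with time \<open>u \<in> S\<close> and the ancestor indices \<open>I u l\<close> with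
  \<open>u \<in> R\<close>.\<close>

definition particle_sigma :: "'w measure \<Rightarrow> 'a measure \<Rightarrow> nat \<Rightarrow> nat set \<Rightarrow> nat set \<Rightarrow>
    (nat \<Rightarrow> nat \<Rightarrow> 'w \<Rightarrow> 'a) \<Rightarrow> (nat \<Rightarrow> nat \<Rightarrow> 'w \<Rightarrow> nat) \<Rightarrow> 'w measure" where
  "particle_sigma P L N S R xi I = sigma (space P)
     ({xi u l -` A \<inter> space P | u l A. u \<in> S \<and> l \<in> {1..N} \<and> A \<in> sets L} \<union>
      {I u l -` B \<inter> space P | u l B. u \<in> R \<and> l \<in> {1..N} \<and> B \<subseteq> {1..N}})"

text \<open>Conditionally on \<open>F\<close>, the variables \<open>Z 1, \<dots>, Z N\<close> are i.i.d. with the random law \<open>D\<close>.\<close>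

definition cond_iid :: "'w measure \<Rightarrow> 'w measure \<Rightarrow> nat \<Rightarrow> 'z measure \<Rightarrow>
    (nat \<Rightarrow> 'w \<Rightarrow> 'z) \<Rightarrow> ('w \<Rightarrow> 'z measure) \<Rightarrow> bool" where
  "cond_iid P F N L Z D \<longleftrightarrow>
     (\<forall>A. (\<forall>l\<in>{1..N}. A l \<in> sets L) \<longrightarrow>
       (AE w in P. real_cond_exp P F (indicator {w \<in> space P. \<forall>l\<in>{1..N}. Z l w \<in> A l}) w =
          (\<Prod>l\<in>{1..N}. measure (D w) (A l))))"

subsection \<open>Forward filter\<close>

definition fwd_weight :: "'a smoothing_model \<Rightarrow> (nat \<Rightarrow> nat \<Rightarrow> 'w \<Rightarrow> 'a) \<Rightarrow>
    (nat \<Rightarrow> nat \<Rightarrow> 'w \<Rightarrow> nat) \<Rightarrow> nat \<Rightarrow> nat \<Rightarrow> 'w \<Rightarrow> ennreal" where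
  "fwd_weight M xi I s l w =
     (if s = 0 then omega0 M (xi 0 l w)
      else omega M s (xi (s - 1) (I s l w) w) (xi s l w))"

definition fwd_target :: "'a smoothing_model \<Rightarrow> (nat \<Rightarrow> nat \<Rightarrow> 'w \<Rightarrow> 'a) \<Rightarrow>
    (nat \<Rightarrow> nat \<Rightarrow> 'w \<Rightarrow> nat) \<Rightarrow> nat \<Rightarrow> 'w \<Rightarrow> nat \<times> 'a \<Rightarrow> ennreal" where
  "fwd_target M xi I s w = (\<lambda>(i, x).
     fwd_weight M xi I (s - 1) i w *
     ennreal (fadj M s (xi (s - 1) i w) * fprop M s (xi (s - 1) i w) x))"

locale forward_filter = prob_space P
  for P :: "'w measure" +
  fixes M :: "'a smoothing_model"
    and N :: nat
    and xi :: "nat \<Rightarrow> nat \<Rightarrow> 'w \<Rightarrow> 'a"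
    and I :: "nat \<Rightarrow> nat \<Rightarrow> 'w \<Rightarrow> nat"
  assumes xi_measurable: "s \<le> horizon M \<Longrightarrow> l \<in> {1..N} \<Longrightarrow> xi s l \<in> measurable P (base M)"
    and I_measurable: "1 \<le> s \<Longrightarrow> s \<le> horizon M \<Longrightarrow> l \<in> {1..N} \<Longrightarrow>
      I s l \<in> measurable P (count_space {1..N})"
    and indep_initial: "indep_vars (\<lambda>_. base M) (xi 0) {1..N}"
    and distr_initial: "l \<in> {1..N} \<Longrightarrow> distr P (base M) (xi 0 l) = rho M"
    and sampling: "1 \<le> s \<Longrightarrow> s \<le> horizon M \<Longrightarrow>
      cond_iid P (particle_sigma P (base M) N {..<s} {1..<s} xi I) N
        (count_space {1..N} \<Otimes>\<^sub>M base M) (\<lambda>l w. (I s l w, xi s l w))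
        (\<lambda>w. normalized_density (count_space {1..N} \<Otimes>\<^sub>M base M) (fwd_target M xi I s w))"
    and sum_weights_pos: "s \<le> horizon M \<Longrightarrow>
      AE w in P. 0 < (\<Sum>l\<in>{1..N}. fwd_weight M xi I s l w)"
    and normalizer_pos: "1 \<le> s \<Longrightarrow> s \<le> horizon M \<Longrightarrow>
      AE w in P. 0 < (\<integral>\<^sup>+z. fwd_target M xi I s w z \<partial>(count_space {1..N} \<Otimes>\<^sub>M base M))"

subsection \<open>Backward filter\<close>

definition bwd_weight :: "'a smoothing_model \<Rightarrow> (nat \<Rightarrow> nat \<Rightarrow> 'w \<Rightarrow> 'a) \<Rightarrow>
    (nat \<Rightarrow> nat \<Rightarrow> 'w \<Rightarrow> nat) \<Rightarrow> nat \<Rightarrow> nat \<Rightarrow> 'w \<Rightarrow> ennreal" where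
  "bwd_weight M xi I t i w =
     (if t < horizon M then bomega M t (xi t i w) (xi (Suc t) (I t i w) w)
      else bomegaT M (xi t i w))"

definition bwd_target :: "'a smoothing_model \<Rightarrow> (nat \<Rightarrow> nat \<Rightarrow> 'w \<Rightarrow> 'a) \<Rightarrow>
    (nat \<Rightarrow> nat \<Rightarrow> 'w \<Rightarrow> nat) \<Rightarrow> nat \<Rightarrow> 'w \<Rightarrow> nat \<times> 'a \<Rightarrow> ennreal" where
  "bwd_target M xi I t w = (\<lambda>(j, x).
     bwd_weight M xi I (Suc t) j w *
     ennreal (badj M t (xi (Suc t) j w) / gam M (Suc t) (xi (Suc t) j w) *
              bprop M t (xi (Suc t) j w) x))"

locale backward_filter = prob_space P
  for P :: "'w measure" +
  fixes M :: "'a smoothing_model"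
    and N :: nat
    and xi :: "nat \<Rightarrow> nat \<Rightarrow> 'w \<Rightarrow> 'a"
    and I :: "nat \<Rightarrow> nat \<Rightarrow> 'w \<Rightarrow> nat"
  assumes xi_measurable: "t \<le> horizon M \<Longrightarrow> i \<in> {1..N} \<Longrightarrow> xi t i \<in> measurable P (base M)"
    and I_measurable: "t < horizon M \<Longrightarrow> i \<in> {1..N} \<Longrightarrow>
      I t i \<in> measurable P (count_space {1..N})"
    and indep_terminal: "indep_vars (\<lambda>_. base M) (xi (horizon M)) {1..N}"
    and distr_terminal: "i \<in> {1..N} \<Longrightarrow>
      distr P (base M) (xi (horizon M) i) = density (base M) (\<lambda>x. ennreal (brho M x))"
    and sampling: "t < horizon M \<Longrightarrow>
      cond_iid P
        (particle_sigma P (base M) N {t<..horizon M} {t<..<horizon M} xi I) N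
        (count_space {1..N} \<Otimes>\<^sub>M base M) (\<lambda>i w. (I t i w, xi t i w))
        (\<lambda>w. normalized_density (count_space {1..N} \<Otimes>\<^sub>M base M) (bwd_target M xi I t w))"
    and sum_weights_pos: "t \<le> horizon M \<Longrightarrow>
      AE w in P. 0 < (\<Sum>i\<in>{1..N}. bwd_weight M xi I t i w)"
    and normalizer_pos: "t < horizon M \<Longrightarrow>
      AE w in P. 0 < (\<integral>\<^sup>+z. bwd_target M xi I t w z \<partial>(count_space {1..N} \<Otimes>\<^sub>M base M))"

subsection \<open>Both filters together\<close>

locale two_filters =
  fwd: forward_filter P M N xi I + bwd: backward_filter P M N bxi bI
  for P :: "'w measure" and M :: "'a smoothing_model" and N :: nat
    and xi :: "nat \<Rightarrow> nat \<Rightarrow> 'w \<Rightarrow> 'a" and I :: "nat \<Rightarrow> nat \<Rightarrow> 'w \<Rightarrow> nat"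
    and bxi :: "nat \<Rightarrow> nat \<Rightarrow> 'w \<Rightarrow> 'a" and bI :: "nat \<Rightarrow> nat \<Rightarrow> 'w \<Rightarrow> nat" +
  assumes indep_filters: "fwd.indep_set
    (sets (particle_sigma P (base M) N {..horizon M} {1..horizon M} xi I))
    (sets (particle_sigma P (base M) N {..horizon M} {..<horizon M} bxi bI))"

definition two_filter_estimator :: "'a smoothing_model \<Rightarrow> nat \<Rightarrow>
    (nat \<Rightarrow> nat \<Rightarrow> 'w \<Rightarrow> 'a) \<Rightarrow> (nat \<Rightarrow> nat \<Rightarrow> 'w \<Rightarrow> nat) \<Rightarrow>
    (nat \<Rightarrow> nat \<Rightarrow> 'w \<Rightarrow> 'a) \<Rightarrow> (nat \<Rightarrow> nat \<Rightarrow> 'w \<Rightarrow> nat) \<Rightarrow>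
    nat \<Rightarrow> nat \<Rightarrow> ('a \<times> 'a \<Rightarrow> real) \<Rightarrow> 'w \<Rightarrow> real" where
  "two_filter_estimator M N xi I bxi bI s t h w =
     (\<Sum>i\<in>{1..N}. \<Sum>j\<in>{1..N}.
        enn2real (fwd_weight M xi I s i w) /
          (\<Sum>l\<in>{1..N}. enn2real (fwd_weight M xi I s l w)) *
        (enn2real (bwd_weight M bxi bI t j w) /
          (\<Sum>l\<in>{1..N}. enn2real (bwd_weight M bxi bI t l w))) *
        h (xi s i w, bxi t j w))"

section \<open>Asymptotic variances\<close>

primrec Gam_fwd :: "'a smoothing_model \<Rightarrow> nat \<Rightarrow> ('a \<Rightarrow> real) \<Rightarrow> real" where
  "Gam_fwd M 0 h =
     (\<integral>x. (enn2real (omega0 M x))\<^sup>2 * (h x)\<^sup>2 \<partial>rho M) / (\<integral>x. enn2real (omega0 M x) \<partial>rho M)\<^sup>2"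
| "Gam_fwd M (Suc s) h =
     (Gam_fwd M s (\<lambda>x. \<integral>x'. qd M x x' * pot M (Suc s) x' * h x' \<partial>base M) +
      (\<integral>x. (\<integral>x'. enn2real (omega M (Suc s) x x') * qd M x x' * pot M (Suc s) x' * (h x')\<^sup>2 \<partial>base M)
         \<partial>phi M s) *
      (\<integral>x. fadj M (Suc s) x \<partial>phi M s)) /
     (\<integral>x. (\<integral>x'. qd M x x' * pot M (Suc s) x' \<partial>base M) \<partial>phi M s)\<^sup>2"

definition Kb :: "'a smoothing_model \<Rightarrow> nat \<Rightarrow> 'a \<Rightarrow> 'a \<Rightarrow> real" where
  "Kb M t x x' = gam M t x * pot M t x * qd M x x' / gam M (Suc t) x'"

function Gam_bwd :: "'a smoothing_model \<Rightarrow> nat \<Rightarrow> ('a \<Rightarrow> real) \<Rightarrow> real" where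
  "Gam_bwd M t h =
     (if t < horizon M then
        (Gam_bwd M (Suc t) (\<lambda>x'. \<integral>x. Kb M t x x' * h x \<partial>base M) +
         (\<integral>x'. (\<integral>x. enn2real (bomega M t x x') * Kb M t x x' * (h x)\<^sup>2 \<partial>base M) \<partial>psi M (Suc t)) *
         (\<integral>x'. badj M t x' / gam M (Suc t) x' \<partial>psi M (Suc t))) /
        (\<integral>x'. (\<integral>x. Kb M t x x' \<partial>base M) \<partial>psi M (Suc t))\<^sup>2
      else
        (\<integral>x. brho M x * (enn2real (bomegaT M x))\<^sup>2 * (h x)\<^sup>2 \<partial>base M) /
        (\<integral>x. brho M x * enn2real (bomegaT M x) \<partial>base M)\<^sup>2)"
  by pat_completeness auto
termination by (relation "Wellfounded.measure (\<lambda>(M, t, h). horizon M - t)") auto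

declare Gam_bwd.simps [simp del]

definition Gam_two :: "'a smoothing_model \<Rightarrow> nat \<Rightarrow> nat \<Rightarrow> ('a \<times> 'a \<Rightarrow> real) \<Rightarrow> real" where
  "Gam_two M s t h =
     Gam_fwd M s (\<lambda>x. \<integral>x'. h (x, x') \<partial>psi M t) + Gam_bwd M t (\<lambda>x'. \<integral>x. h (x, x') \<partial>phi M s)"

section \<open>The filters are measures with the intended values\<close>

lemma sets_phi [simp, measurable_cong]: "sets (phi M s) = sets (base M)"
  and space_phi [simp]: "space (phi M s) = space (base M)"
  by (simp_all add: phi_def sets.space_closed)

lemma sets_psi [simp, measurable_cong]: "sets (psi M t) = sets (base M)"
  and space_psi [simp]: "space (psi M t) = space (base M)"
  by (simp_all add: psi_def sets.space_closed)

context two_filter_model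
begin

interpretation base: sigma_finite_measure "base M" by (rule sigma_finite_base)

lemma qd_measurable [measurable]: "(\<lambda>(x, x'). qd M x x') \<in> borel_measurable (base M \<Otimes>\<^sub>M base M)"
  using markov_q by (simp add: markov_density_def)

lemma nn_integral_Qk:
  assumes "x \<in> space (base M)" and [measurable]: "f \<in> borel_measurable (base M)"
  shows "(\<integral>\<^sup>+x'. f x' \<partial>Qk M x) = (\<integral>\<^sup>+x'. ennreal (qd M x x') * f x' \<partial>base M)"
proof -
  have "qd M x \<in> borel_measurable (base M)"
    using markov_q assms(1) by (simp add: markov_density_def prob_density_def)
  then show ?thesis unfolding Qk_def by (subst nn_integral_density) auto
qed

lemma measurable_Qk [measurable]:
  assumes [measurable]: "f \<in> borel_measurable (base M)"
  shows "(\<lambda>x. \<integral>\<^sup>+x'. f x' \<partial>Qk M x) \<in> borel_measurable (base M)"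
proof -
  have "(\<lambda>x. \<integral>\<^sup>+x'. ennreal (qd M x x') * f x' \<partial>base M) \<in> borel_measurable (base M)"
    by measurable
  then show ?thesis
    by (rule measurable_cong[THEN iffD2, rotated]) (simp add: nn_integral_Qk)
qed

lemma measurable_bwd_lik: "t \<le> horizon M \<Longrightarrow> bwd_lik M t \<in> borel_measurable (base M)"
proof (induction "horizon M - t" arbitrary: t)
  case 0
  then have "bwd_lik M t = (\<lambda>x. ennreal (pot M (horizon M) x))"
    by (intro ext, subst bwd_lik.simps) simp
  then show ?case using pot_measurable[of "horizon M"] by simp
next
  case (Suc k)
  then have t: "t < horizon M" by simp
  have [measurable]: "bwd_lik M (Suc t) \<in> borel_measurable (base M)"
    using Suc by simp
  have [measurable]: "pot M t \<in> borel_measurable (base M)"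
    using t by (simp add: pot_measurable)
  have *: "bwd_lik M t = (\<lambda>x. ennreal (pot M t x) * (\<integral>\<^sup>+x'. bwd_lik M (Suc t) x' \<partial>Qk M x))"
    using t by (intro ext, subst bwd_lik.simps) simp
  show ?case unfolding * by measurable
qed

lemma fwd_integral_cong:
  assumes "\<And>x. x \<in> space (base M) \<Longrightarrow> f x = f' x"
  shows "fwd_integral M s f = fwd_integral M s f'"
  using assms
proof (induction s arbitrary: f f')
  case 0
  have "space (init M) = space (base M)" by (rule sets_eq_imp_space_eq[OF sets_init])
  with 0 show ?case by (auto intro!: nn_integral_cong)
next
  case (Suc s)
  have "space (Qk M x) = space (base M)" for x by (simp add: Qk_def)
  with Suc.prems have
    "(\<integral>\<^sup>+x'. ennreal (pot M (Suc s) x') * f x' \<partial>Qk M x) =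
     (\<integral>\<^sup>+x'. ennreal (pot M (Suc s) x') * f' x' \<partial>Qk M x)" for x
    by (auto intro!: nn_integral_cong)
  then show ?case by simp
qed

lemma fwd_integral_suminf:
  fixes f :: "nat \<Rightarrow> 'a \<Rightarrow> ennreal"
  assumes "s \<le> horizon M" and "\<And>i. f i \<in> borel_measurable (base M)"
  shows "fwd_integral M s (\<lambda>x. \<Sum>i. f i x) = (\<Sum>i. fwd_integral M s (f i))"
  using assms
proof (induction s arbitrary: f)
  case 0
  note [measurable] = 0(2) and [measurable_cong] = sets_init
  have [measurable]: "pot M 0 \<in> borel_measurable (base M)" by (simp add: pot_measurable)
  show ?case
    unfolding fwd_integral.simps ennreal_suminf_cmult[symmetric]
    by (rule nn_integral_suminf) measurable
next
  case (Suc s)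
  note [measurable] = Suc.prems(2)
  have [measurable]: "pot M (Suc s) \<in> borel_measurable (base M)"
    using Suc.prems(1) by (rule pot_measurable)
  have [measurable_cong]: "sets (Qk M x) = sets (base M)" for x by (simp add: Qk_def)
  have "fwd_integral M (Suc s) (\<lambda>x. \<Sum>i. f i x) =
      fwd_integral M s (\<lambda>x. \<Sum>i. \<integral>\<^sup>+x'. ennreal (pot M (Suc s) x') * f i x' \<partial>Qk M x)"
    unfolding fwd_integral.simps ennreal_suminf_cmult[symmetric]
    by (subst nn_integral_suminf) simp_all
  also have "\<dots> = (\<Sum>i. fwd_integral M (Suc s) (f i))"
    using Suc.prems(1) by (subst Suc.IH) simp_all
  finally show ?case .
qed

lemma fwd_integral_zero: "fwd_integral M s (\<lambda>_. 0) = 0"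
  by (induction s) simp_all

lemma bwd_integral_suminf:
  fixes f :: "nat \<Rightarrow> 'a \<Rightarrow> ennreal"
  assumes "t \<le> horizon M" and [measurable]: "\<And>i. f i \<in> borel_measurable (base M)"
  shows "bwd_integral M t (\<lambda>x. \<Sum>i. f i x) = (\<Sum>i. bwd_integral M t (f i))"
proof -
  note [measurable] = measurable_bwd_lik[OF assms(1)] gam_measurable[OF assms(1)]
  show ?thesis
    unfolding bwd_integral_def ennreal_suminf_cmult[symmetric]
    by (rule nn_integral_suminf) measurable
qed

theorem emeasure_phi:
  assumes "s \<le> horizon M" and "A \<in> sets (base M)"
  shows "emeasure (phi M s) A = fwd_integral M s (indicator A) / fwd_integral M s (\<lambda>_. 1)"
proof (rule emeasure_measure_of[OF phi_def])
  show "sets (base M) \<subseteq> Pow (space (base M))" by (rule sets.space_closed)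
  show "A \<in> sets (phi M s)" using assms by simp
  show "positive (sets (phi M s))
      (\<lambda>A. fwd_integral M s (indicator A) / fwd_integral M s (\<lambda>_. 1))"
    using fwd_integral_cong[of "indicator {}" "\<lambda>_. 0" s]
    by (simp add: positive_def fwd_integral_zero)
  show "countably_additive (sets (phi M s))
      (\<lambda>A. fwd_integral M s (indicator A) / fwd_integral M s (\<lambda>_. 1))"
  proof (rule countably_additiveI)
    fix B :: "nat \<Rightarrow> 'a set"
    assume B: "range B \<subseteq> sets (phi M s)" "disjoint_family B"
    then have "(\<Sum>i. fwd_integral M s (indicator (B i))) = fwd_integral M s (indicator (\<Union>i. B i))"
      using assms(1) by (subst fwd_integral_suminf[symmetric])
        (auto intro!: borel_measurable_indicator simp: suminf_indicator)
    then show "(\<Sum>i. fwd_integral M s (indicator (B i)) / fwd_integral M s (\<lambda>_. 1)) =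
        fwd_integral M s (indicator (\<Union>i. B i)) / fwd_integral M s (\<lambda>_. 1)"
      by (simp add: divide_ennreal_def)
  qed
qed

theorem emeasure_psi:
  assumes "t \<le> horizon M" and "A \<in> sets (base M)"
  shows "emeasure (psi M t) A = bwd_integral M t (indicator A) / bwd_integral M t (\<lambda>_. 1)"
proof (rule emeasure_measure_of[OF psi_def])
  show "sets (base M) \<subseteq> Pow (space (base M))" by (rule sets.space_closed)
  show "A \<in> sets (psi M t)" using assms by simp
  show "positive (sets (psi M t))
      (\<lambda>A. bwd_integral M t (indicator A) / bwd_integral M t (\<lambda>_. 1))"
    by (simp add: positive_def bwd_integral_def)
  show "countably_additive (sets (psi M t))
      (\<lambda>A. bwd_integral M t (indicator A) / bwd_integral M t (\<lambda>_. 1))"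
  proof (rule countably_additiveI)
    fix B :: "nat \<Rightarrow> 'a set"
    assume B: "range B \<subseteq> sets (psi M t)" "disjoint_family B"
    then have "(\<Sum>i. bwd_integral M t (indicator (B i))) = bwd_integral M t (indicator (\<Union>i. B i))"
      using assms(1) by (subst bwd_integral_suminf[symmetric])
        (auto intro!: borel_measurable_indicator simp: suminf_indicator)
    then show "(\<Sum>i. bwd_integral M t (indicator (B i)) / bwd_integral M t (\<lambda>_. 1)) =
        bwd_integral M t (indicator (\<Union>i. B i)) / bwd_integral M t (\<lambda>_. 1)"
      by (simp add: divide_ennreal_def)
  qed
qed

end

end

theory Submission
  imports Defs
begin

text \<open>Both filters are instances of one importance sampling step, and both central limit theorems
  come from one induction whose statement lets the test functions \<open>f\<^sub>N\<close> vary with \<open>N\<close> as long as they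
  are uniformly bounded, centred and converge in \<open>L\<^sup>1\<close>. Conditionally on the past a new generation is
  i.i.d., so its characteristic function is Gaussian up to \<open>O(1 / sqrt N)\<close>, while the conditional
  mean is an average over the previous generation, to which the induction hypothesis applies. For
  the two-filter estimator one conditions on the backward particles, which are independent of the
  forward ones: it becomes a forward average of the test function \<open>\<integral> \<psi>\<^sup>N(dy) h(x, y)\<close>, which
  converges in \<open>L\<^sup>1\<close> to \<open>\<integral> \<psi>(dy) h(x, y)\<close> and whose centring is a backward average.\<close>

section \<open>Convergence to zero in probability\<close>

text \<open>The obstacle is that every estimator is a ratio with a random denominator, and so is
  every conditional mean given the previous generation. Replacing a random denominator by its limit
  costs \<open>sqrt N\<close> times a product of two deviations. Splitting the root as
  \<open>root4 N * root4 N\<close> shows that a law of large numbers at rate N^(1/4) pays for this,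
  and that rate follows from the central limit theorem of the previous generation together with
  conditional independence inside the new one. Convergence in L1 suits the test functions because a
  step integrates them against a nonnegative kernel: L1 limits under the new filter become L1 limits
  under the old one. For uniformly bounded functions it also controls the second moments that enter
  the variance. With the backward particles frozen, the forward test function is deterministic, but
  it differs from outcome to outcome. A limit along all admissible sequences is automatically
  uniform over shrinking L1 balls, since a worst function can be selected for each N; outcomes
  outside the ball are rare by Markov's inequality.\<close>

text \<open>Convergence to 0 in probability for variables living on different spaces
  \<open>P N\<close>. The metric form with \<open>min 1\<close> reduces every closure rule to a
  pointwise inequality. Index 0 is left out because nothing is assumed about
  \<open>P 0\<close>.\<close>

definition null_prob :: "(nat \<Rightarrow> 'w measure) \<Rightarrow> (nat \<Rightarrow> 'w \<Rightarrow> real) \<Rightarrow> bool" where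
  "null_prob P X \<longleftrightarrow> (\<forall>N\<ge>1. X N \<in> borel_measurable (P N)) \<and>
     (\<lambda>N. \<integral>w. min 1 \<bar>X N w\<bar> \<partial>P N) \<longlonglongrightarrow> 0"

lemma min1_mult_le: "min 1 (c * \<bar>x::real\<bar>) \<le> max 1 c * min 1 \<bar>x\<bar>"
proof (cases "\<bar>x\<bar> \<le> 1")
  case True
  have "c * \<bar>x\<bar> \<le> max 1 c * \<bar>x\<bar>" by (intro mult_right_mono) auto
  with True show ?thesis by auto
next
  case False
  then have "min 1 (c * \<bar>x\<bar>) \<le> 1" "min 1 \<bar>x\<bar> = 1" by auto
  then show ?thesis by simp
qed

lemma norm_iexp_diff_le: "cmod (iexp x - iexp y) \<le> \<bar>x - y\<bar>"
proof -
  have "cmod (iexp x - iexp y) = cmod (iexp y * (iexp (x - y) - 1))"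
    by (simp add: exp_add[symmetric] algebra_simps)
  also have "\<dots> = cmod (iexp (x - y) - 1)" by (simp add: norm_mult)
  also have "\<dots> \<le> \<bar>x - y\<bar>" using iexp_approx1[of "x - y" 0] by simp
  finally show ?thesis .
qed

locale prob_sequence =
  fixes P :: "nat \<Rightarrow> 'w measure"
  assumes prob_P: "N \<ge> 1 \<Longrightarrow> prob_space (P N)"
begin

lemma integrable_bounded:
  fixes f :: "'w \<Rightarrow> 'b::{banach, second_countable_topology}"
  assumes "N \<ge> 1" "f \<in> borel_measurable (P N)" "AE w in P N. norm (f w) \<le> B"
  shows "integrable (P N) f"
proof -
  interpret prob_space "P N" using assms prob_P by simp
  show ?thesis using assms by (intro integrable_const_bound[where B=B]) auto
qed

lemma integrable_min1:
  fixes X :: "'w \<Rightarrow> real"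
  assumes "N \<ge> 1" "X \<in> borel_measurable (P N)"
  shows "integrable (P N) (\<lambda>w. min 1 \<bar>X w\<bar>)"
  using assms by (intro integrable_bounded[where B=1]) auto

text \<open>The common engine of the closure rules: truncated variables are bounded, so the integral
  is monotone without any integrability assumption on the variables themselves.\<close>

lemma null_prob_comparison:
  assumes X: "null_prob P X" and Y: "null_prob P Y"
    and Z: "\<And>N. N \<ge> 1 \<Longrightarrow> Z N \<in> borel_measurable (P N)"
    and le: "\<And>N. N \<ge> 1 \<Longrightarrow> AE w in P N. min 1 \<bar>Z N w\<bar> \<le> c * (min 1 \<bar>X N w\<bar> + min 1 \<bar>Y N w\<bar>)"
  shows "null_prob P Z"
  unfolding null_prob_def
proof (intro conjI allI impI Z)
  have lim: "(\<lambda>N. c * ((\<integral>w. min 1 \<bar>X N w\<bar> \<partial>P N) + (\<integral>w. min 1 \<bar>Y N w\<bar> \<partial>P N))) \<longlonglongrightarrow> 0"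
    using X Y unfolding null_prob_def by (auto intro!: tendsto_eq_intros)
  show "(\<lambda>N. \<integral>w. min 1 \<bar>Z N w\<bar> \<partial>P N) \<longlonglongrightarrow> 0"
  proof (rule Lim_null_comparison[OF eventually_sequentiallyI[of 1] lim])
    fix N :: nat assume N: "1 \<le> N"
    have [measurable]: "X N \<in> borel_measurable (P N)" "Y N \<in> borel_measurable (P N)"
      using X Y N by (auto simp: null_prob_def)
    have "(\<integral>w. min 1 \<bar>Z N w\<bar> \<partial>P N) \<le> (\<integral>w. c * (min 1 \<bar>X N w\<bar> + min 1 \<bar>Y N w\<bar>) \<partial>P N)"
      using N Z le by (intro integral_mono_AE) (auto intro!: integrable_min1)
    also have "\<dots> = c * ((\<integral>w. min 1 \<bar>X N w\<bar> \<partial>P N) + (\<integral>w. min 1 \<bar>Y N w\<bar> \<partial>P N))"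
      using N by (simp add: integrable_min1)
    finally show "norm (\<integral>w. min 1 \<bar>Z N w\<bar> \<partial>P N)
        \<le> c * ((\<integral>w. min 1 \<bar>X N w\<bar> \<partial>P N) + (\<integral>w. min 1 \<bar>Y N w\<bar> \<partial>P N))"
      by simp
  qed
qed

lemma null_prob_measurable: "null_prob P X \<Longrightarrow> N \<ge> 1 \<Longrightarrow> X N \<in> borel_measurable (P N)"
  by (simp add: null_prob_def)

lemma null_prob_le:
  assumes "null_prob P X" "\<And>N. N \<ge> 1 \<Longrightarrow> Z N \<in> borel_measurable (P N)"
    and "\<And>N. N \<ge> 1 \<Longrightarrow> AE w in P N. \<bar>Z N w\<bar> \<le> \<bar>X N w\<bar>"
  shows "null_prob P Z"
proof (rule null_prob_comparison[OF assms(1) assms(1) assms(2), where c=1])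
  fix N :: nat assume "1 \<le> N"
  from assms(3)[OF this]
  show "AE w in P N. min 1 \<bar>Z N w\<bar> \<le> 1 * (min 1 \<bar>X N w\<bar> + min 1 \<bar>X N w\<bar>)"
    by eventually_elim auto
qed

lemma null_prob_add:
  assumes "null_prob P X" "null_prob P Y"
  shows "null_prob P (\<lambda>N w. X N w + Y N w)"
proof (rule null_prob_comparison[OF assms, where c=1])
  show "(\<lambda>w. X N w + Y N w) \<in> borel_measurable (P N)" if "N \<ge> 1" for N
    using that assms by (intro borel_measurable_add) (auto intro: null_prob_measurable)
qed (auto simp: min_def)

lemma null_prob_mult:
  assumes "null_prob P X" "null_prob P Y"
  shows "null_prob P (\<lambda>N w. X N w * Y N w)"
proof (rule null_prob_comparison[OF assms, where c=1])
  \<comment> \<open>If |x| is at most 1 the product is at most |y|; otherwise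
    \<open>min 1 \<bar>x\<bar>\<close> is already 1 and bounds the left side.\<close>
  have "min 1 \<bar>x * y\<bar> \<le> min 1 \<bar>x\<bar> + min 1 \<bar>y\<bar>" for x y :: real
  proof (cases "\<bar>x\<bar> \<le> 1")
    case True
    then have "\<bar>x\<bar> * \<bar>y\<bar> \<le> \<bar>y\<bar>" by (intro mult_left_le_one_le) auto
    moreover have "0 \<le> min 1 \<bar>x\<bar>" by simp
    ultimately show ?thesis unfolding abs_mult by linarith
  qed (auto simp: min_def)
  then show "AE w in P N. min 1 \<bar>X N w * Y N w\<bar> \<le> 1 * (min 1 \<bar>X N w\<bar> + min 1 \<bar>Y N w\<bar>)" for N
    by simp
  show "(\<lambda>w. X N w * Y N w) \<in> borel_measurable (P N)" if "N \<ge> 1" for N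
    using that assms by (intro borel_measurable_times) (auto intro: null_prob_measurable)
qed

lemma null_prob_bounded_mult:
  assumes X: "null_prob P X" and Y: "\<And>N. N \<ge> 1 \<Longrightarrow> Y N \<in> borel_measurable (P N)"
    and le: "\<And>N. N \<ge> 1 \<Longrightarrow> AE w in P N. \<bar>Y N w\<bar> \<le> c"
  shows "null_prob P (\<lambda>N w. Y N w * X N w)"
proof (rule null_prob_comparison[OF X X, where c="max 1 c"])
  show "(\<lambda>w. Y N w * X N w) \<in> borel_measurable (P N)" if "N \<ge> 1" for N
    using that X Y by (auto simp: null_prob_def)
  fix N :: nat assume "1 \<le> N"
  from le[OF this]
  show "AE w in P N. min 1 \<bar>Y N w * X N w\<bar> \<le> max 1 c * (min 1 \<bar>X N w\<bar> + min 1 \<bar>X N w\<bar>)"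
  proof eventually_elim
    case (elim w)
    then have "\<bar>Y N w * X N w\<bar> \<le> c * \<bar>X N w\<bar>" by (simp add: abs_mult mult_right_mono)
    then have "min 1 \<bar>Y N w * X N w\<bar> \<le> max 1 c * min 1 \<bar>X N w\<bar>"
      using min1_mult_le[of c "X N w"] by linarith
    also have "\<dots> \<le> max 1 c * (min 1 \<bar>X N w\<bar> + min 1 \<bar>X N w\<bar>)"
      by (intro mult_left_mono) auto
    finally show ?case .
  qed
qed

lemma null_prob_cmult: "null_prob P X \<Longrightarrow> null_prob P (\<lambda>N w. c * X N w)"
  by (rule null_prob_bounded_mult[where c="\<bar>c\<bar>"]) auto

lemma null_prob_diff:
  assumes "null_prob P X" "null_prob P Y"
  shows "null_prob P (\<lambda>N w. X N w - Y N w)"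
  using null_prob_add[OF assms(1) null_prob_cmult[OF assms(2), of "-1"]] by simp

lemma null_prob_const:
  assumes "a \<longlonglongrightarrow> 0"
  shows "null_prob P (\<lambda>N w. a N)"
  unfolding null_prob_def
proof (intro conjI allI impI)
  have "(\<lambda>N. \<bar>a N\<bar>) \<longlonglongrightarrow> 0" using tendsto_rabs_zero[OF assms] .
  then show "(\<lambda>N. \<integral>w. min 1 \<bar>a N\<bar> \<partial>P N) \<longlonglongrightarrow> 0"
  proof (rule Lim_null_comparison[OF eventually_sequentiallyI[of 1], rotated])
    fix N :: nat assume "1 \<le> N"
    then interpret prob_space "P N" by (rule prob_P)
    show "norm (\<integral>w. min 1 \<bar>a N\<bar> \<partial>P N) \<le> \<bar>a N\<bar>" by (simp add: prob_space)
  qed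
qed simp

text \<open>The denominator may vanish or be negative with positive probability. Within b/2 of the
  limit b it is at least b/2, so the quotient is at most (2/b)|x|. Farther away only the bound 1 of
  the truncation is left, and there the deviation term on the right, multiplied by the constant, is
  at least 1.\<close>

lemma null_prob_divide:
  assumes X: "null_prob P X" and Y: "null_prob P (\<lambda>N w. Y N w - b)" and b: "b > 0"
    and Ym: "\<And>N. N \<ge> 1 \<Longrightarrow> Y N \<in> borel_measurable (P N)"
  shows "null_prob P (\<lambda>N w. X N w / Y N w)"
proof (rule null_prob_comparison[OF X Y, where c="max 1 (2 / b)"])
  show "(\<lambda>w. X N w / Y N w) \<in> borel_measurable (P N)" if "N \<ge> 1" for N
    using that X Ym by (auto simp: null_prob_def)
  have "min 1 \<bar>x / y\<bar> \<le> max 1 (2 / b) * (min 1 \<bar>x\<bar> + min 1 \<bar>y - b\<bar>)" for x y :: real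
  proof (cases "\<bar>y - b\<bar> \<le> b / 2")
    case True
    then have y: "y \<ge> b / 2" by linarith
    have "\<bar>x / y\<bar> \<le> (2 / b) * \<bar>x\<bar>"
    proof -
      have "\<bar>x\<bar> / y \<le> \<bar>x\<bar> / (b / 2)" using b y by (intro divide_left_mono) auto
      then show ?thesis using b y by (simp add: mult.commute)
    qed
    then have "min 1 \<bar>x / y\<bar> \<le> max 1 (2 / b) * min 1 \<bar>x\<bar>"
      using min1_mult_le[of "2 / b" x] by linarith
    also have "\<dots> \<le> max 1 (2 / b) * (min 1 \<bar>x\<bar> + min 1 \<bar>y - b\<bar>)"
      by (intro mult_left_mono) auto
    finally show ?thesis .
  next
    case False
    have "1 \<le> max 1 (2 / b) * min 1 \<bar>y - b\<bar>"
    proof (cases "\<bar>y - b\<bar> \<ge> 1")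
      case False2: False
      have "1 = (2 / b) * (b / 2)" using b by simp
      also have "\<dots> \<le> max 1 (2 / b) * \<bar>y - b\<bar>"
        using b False by (intro mult_mono) auto
      finally show ?thesis using False2 by simp
    qed simp
    also have "\<dots> \<le> max 1 (2 / b) * (min 1 \<bar>x\<bar> + min 1 \<bar>y - b\<bar>)"
      by (intro mult_left_mono) auto
    finally show ?thesis by linarith
  qed
  then show "AE w in P N. min 1 \<bar>X N w / Y N w\<bar> \<le> max 1 (2 / b) * (min 1 \<bar>X N w\<bar> + min 1 \<bar>Y N w - b\<bar>)" for N
    by simp
qed

lemma null_prob_rate:
  assumes "null_prob P (\<lambda>N w. sqrt (sqrt (real N)) * X N w)"
    and "\<And>N. N \<ge> 1 \<Longrightarrow> X N \<in> borel_measurable (P N)"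
  shows "null_prob P X"
proof (rule null_prob_le[OF assms])
  fix N :: nat assume "1 \<le> N"
  then have "1 * \<bar>x\<bar> \<le> sqrt (sqrt (real N)) * \<bar>x\<bar>" for x
    by (intro mult_right_mono) auto
  then show "AE w in P N. \<bar>X N w\<bar> \<le> \<bar>sqrt (sqrt (real N)) * X N w\<bar>"
    by (simp add: abs_mult)
qed auto

lemma null_prob_L1:
  assumes X: "null_prob P X" and le: "\<And>N. N \<ge> 1 \<Longrightarrow> AE w in P N. \<bar>X N w\<bar> \<le> c"
  shows "(\<lambda>N. \<integral>w. \<bar>X N w\<bar> \<partial>P N) \<longlonglongrightarrow> 0"
proof (rule Lim_null_comparison[OF eventually_sequentiallyI[of 1]])
  show "(\<lambda>N. max 1 c * (\<integral>w. min 1 \<bar>X N w\<bar> \<partial>P N)) \<longlonglongrightarrow> 0"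
    using X unfolding null_prob_def by (auto intro!: tendsto_eq_intros)
  fix N :: nat assume N: "1 \<le> N"
  have [measurable]: "X N \<in> borel_measurable (P N)" using X N by (simp add: null_prob_def)
  have "(\<integral>w. \<bar>X N w\<bar> \<partial>P N) \<le> (\<integral>w. max 1 c * min 1 \<bar>X N w\<bar> \<partial>P N)"
  proof (rule integral_mono_AE)
    show "AE w in P N. \<bar>X N w\<bar> \<le> max 1 c * min 1 \<bar>X N w\<bar>"
      using le[OF N]
    proof eventually_elim
      case (elim w)
      show ?case
      proof (cases "\<bar>X N w\<bar> \<le> 1")
        case True
        have "1 * \<bar>X N w\<bar> \<le> max 1 c * \<bar>X N w\<bar>" by (intro mult_right_mono) auto
        with True show ?thesis by simp
      qed (use elim in auto)
    qed
    show "integrable (P N) (\<lambda>w. \<bar>X N w\<bar>)"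
      using N le[OF N] by (intro integrable_bounded[where B=c]) auto
    show "integrable (P N) (\<lambda>w. max 1 c * min 1 \<bar>X N w\<bar>)"
      using N by (auto intro!: integrable_min1)
  qed
  then show "norm (\<integral>w. \<bar>X N w\<bar> \<partial>P N) \<le> max 1 c * (\<integral>w. min 1 \<bar>X N w\<bar> \<partial>P N)"
    using N by (simp add: integral_nonneg_AE)
qed

section \<open>Characteristic functions and weak limits\<close>

text \<open>Slutsky's lemma for characteristic functions. The difference of two unit exponentials is
  at most both 2 and the distance of their arguments, hence at most twice the truncated
  distance.\<close>

lemma char_diff_tendsto:
  assumes X: "\<And>N. N \<ge> 1 \<Longrightarrow> X N \<in> borel_measurable (P N)"
    and Y: "\<And>N. N \<ge> 1 \<Longrightarrow> Y N \<in> borel_measurable (P N)"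
    and null: "null_prob P (\<lambda>N w. X N w - Y N w)"
    and W: "\<And>N. N \<ge> 1 \<Longrightarrow> W N \<in> borel_measurable (P N)"
      "\<And>N w. N \<ge> 1 \<Longrightarrow> w \<in> space (P N) \<Longrightarrow> cmod (W N w) \<le> 1"
  shows "(\<lambda>N. (\<integral>w. iexp (u * X N w) * W N w \<partial>P N) - (\<integral>w. iexp (u * Y N w) * W N w \<partial>P N)) \<longlonglongrightarrow> 0"
proof (rule Lim_null_comparison[OF eventually_sequentiallyI[of 1]])
  have "null_prob P (\<lambda>N w. u * (X N w - Y N w))" by (rule null_prob_cmult[OF null])
  then show "(\<lambda>N. 2 * (\<integral>w. min 1 \<bar>u * (X N w - Y N w)\<bar> \<partial>P N)) \<longlonglongrightarrow> 0"
    unfolding null_prob_def by (auto intro!: tendsto_eq_intros)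
  fix N :: nat assume N: "1 \<le> N"
  note [measurable] = X[OF N] Y[OF N] W(1)[OF N]
  have int: "integrable (P N) (\<lambda>w. iexp (u * V w) * W N w)" if "V \<in> borel_measurable (P N)" for V
  proof -
    note [measurable] = that
    show ?thesis using N W by (intro integrable_bounded[where B=1]) (auto simp: norm_mult)
  qed
  have "cmod ((\<integral>w. iexp (u * X N w) * W N w \<partial>P N) - (\<integral>w. iexp (u * Y N w) * W N w \<partial>P N))
      = cmod (\<integral>w. iexp (u * X N w) * W N w - iexp (u * Y N w) * W N w \<partial>P N)"
    by (subst Bochner_Integration.integral_diff) (rule int, measurable)+
  also have "\<dots> \<le> (\<integral>w. cmod (iexp (u * X N w) * W N w - iexp (u * Y N w) * W N w) \<partial>P N)"
    by (rule integral_norm_bound)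
  also have "\<dots> \<le> (\<integral>w. 2 * min 1 \<bar>u * (X N w - Y N w)\<bar> \<partial>P N)"
  proof (rule integral_mono)
    show "integrable (P N) (\<lambda>w. cmod (iexp (u * X N w) * W N w - iexp (u * Y N w) * W N w))"
      by (intro integrable_norm Bochner_Integration.integrable_diff int) auto
    show "integrable (P N) (\<lambda>w. 2 * min 1 \<bar>u * (X N w - Y N w)\<bar>)"
      using N by (auto intro!: integrable_min1)
    fix w assume w: "w \<in> space (P N)"
    have "cmod (iexp (u * X N w) * W N w - iexp (u * Y N w) * W N w)
        = cmod (iexp (u * X N w) - iexp (u * Y N w)) * cmod (W N w)"
      by (simp add: left_diff_distrib[symmetric] norm_mult)
    also have "\<dots> \<le> cmod (iexp (u * X N w) - iexp (u * Y N w))"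
      using W(2)[OF N w] by (intro mult_right_le_one_le) auto
    also have "\<dots> \<le> 2 * min 1 \<bar>u * (X N w - Y N w)\<bar>"
      using norm_iexp_diff_le[of "u * X N w" "u * Y N w"]
        norm_triangle_ineq4[of "iexp (u * X N w)" "iexp (u * Y N w)"]
      unfolding right_diff_distrib norm_exp_i_times
      using abs_ge_zero[of "u * X N w - u * Y N w"] by (simp add: min_def del: of_real_mult abs_ge_zero)
    finally show "cmod (iexp (u * X N w) * W N w - iexp (u * Y N w) * W N w) \<le> 2 * min 1 \<bar>u * (X N w - Y N w)\<bar>" .
  qed
  also have "\<dots> = 2 * (\<integral>w. min 1 \<bar>u * (X N w - Y N w)\<bar> \<partial>P N)" by simp
  finally show "norm ((\<integral>w. iexp (u * X N w) * W N w \<partial>P N) - (\<integral>w. iexp (u * Y N w) * W N w \<partial>P N))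
      \<le> 2 * (\<integral>w. min 1 \<bar>u * (X N w - Y N w)\<bar> \<partial>P N)" .
qed

text \<open>Levy's continuity theorem needs a probability law at every index, so it is applied to
  the sequence shifted by one and the shift is undone in the limit.\<close>

lemma weak_conv_of_char:
  assumes X: "\<And>N. N \<ge> 1 \<Longrightarrow> X N \<in> borel_measurable (P N)"
    and "real_distribution \<mu>"
    and lim: "\<And>u. (\<lambda>N. \<integral>w. iexp (u * X N w) \<partial>P N) \<longlonglongrightarrow> char \<mu> u"
  shows "weak_conv_m (\<lambda>N. distr (P N) borel (X N)) \<mu>"
proof -
  have "weak_conv_m (\<lambda>N. distr (P (Suc N)) borel (X (Suc N))) \<mu>"
  proof (rule levy_continuity[OF _ assms(2)])
    show "real_distribution (distr (P (Suc N)) borel (X (Suc N)))" for N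
      using X[of "Suc N"] prob_P[of "Suc N"]
      by (intro prob_space.real_distribution_distr) auto
    show "(\<lambda>N. char (distr (P (Suc N)) borel (X (Suc N))) u) \<longlonglongrightarrow> char \<mu> u" for u
    proof -
      have "char (distr (P (Suc N)) borel (X (Suc N))) u = (\<integral>w. iexp (u * X (Suc N) w) \<partial>P (Suc N))" for N
        unfolding char_def using X[of "Suc N"] by (subst integral_distr) auto
      then show ?thesis using LIMSEQ_Suc[OF lim[of u]] by simp
    qed
  qed
  then show ?thesis
    unfolding weak_conv_m_def weak_conv_def by (auto intro: LIMSEQ_imp_Suc)
qed

text \<open>The constant 1 is the characteristic function of the Dirac mass at 0. Weak convergence
  to that mass is then tested on the bounded continuous function
  \<open>min 1 \<bar>x\<bar>\<close>.\<close>

lemma null_prob_of_char: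
  assumes X: "\<And>N. N \<ge> 1 \<Longrightarrow> X N \<in> borel_measurable (P N)"
    and lim: "\<And>u. (\<lambda>N. \<integral>w. iexp (u * X N w) \<partial>P N) \<longlonglongrightarrow> 1"
  shows "null_prob P X"
  unfolding null_prob_def
proof (intro conjI allI impI X)
  interpret R: prob_space "return borel (0::real)" by (rule prob_space_return) simp
  have R: "real_distribution (return borel (0::real))"
    by (simp add: real_distribution_def real_distribution_axioms_def R.prob_space_axioms)
  have chR: "char (return borel 0) u = 1" for u
    unfolding char_def by (subst integral_return) auto
  have "weak_conv_m (\<lambda>N. distr (P (Suc N)) borel (X (Suc N))) (return borel 0)"
    using weak_conv_of_char[OF X R] lim chR
    unfolding weak_conv_m_def weak_conv_def by (auto intro: LIMSEQ_Suc)
  then have "(\<lambda>N. \<integral>x. min 1 \<bar>x\<bar> \<partial>distr (P (Suc N)) borel (X (Suc N))) \<longlonglongrightarrow> (\<integral>x. min 1 \<bar>x\<bar> \<partial>return borel (0::real))"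
    using X prob_P
    by (intro weak_conv_imp_integral_bdd_continuous_conv[where B=1] R prob_space.real_distribution_distr)
      (auto intro!: continuous_intros)
  also have "(\<lambda>N. \<integral>x. min 1 \<bar>x\<bar> \<partial>distr (P (Suc N)) borel (X (Suc N))) = (\<lambda>N. \<integral>w. min 1 \<bar>X (Suc N) w\<bar> \<partial>P (Suc N))"
    using X by (intro ext, subst integral_distr) auto
  also have "(\<integral>x. min 1 \<bar>x\<bar> \<partial>return borel (0::real)) = 0" by (subst integral_return) auto
  finally show "(\<lambda>N. \<integral>w. min 1 \<bar>X N w\<bar> \<partial>P N) \<longlonglongrightarrow> 0"
    by (rule LIMSEQ_imp_Suc)
qed

end

section \<open>Conditionally independent samples\<close>

text \<open>Makes the conditional law of a whole generation a kernel. Measurability is only checked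
  on boxes, where the product law is a finite product of measurable functions.\<close>

lemma measurable_PiM_const_kernel:
  assumes D: "D \<in> F \<rightarrow>\<^sub>M prob_algebra L" and J: "finite J"
  shows "(\<lambda>w. PiM J (\<lambda>_. D w)) \<in> F \<rightarrow>\<^sub>M prob_algebra (PiM J (\<lambda>_. L))"
proof (rule measurable_prob_algebra_generated[OF sets_PiM Int_stable_prod_algebra prod_algebra_sets_into_space])
  fix w assume "w \<in> space F"
  then have D: "prob_space (D w)" "sets (D w) = sets L"
    using measurable_space[OF D] by (auto simp: space_prob_algebra)
  then show "prob_space (PiM J (\<lambda>_. D w))" "sets (PiM J (\<lambda>_. D w)) = sets (PiM J (\<lambda>_. L))"
    by (auto intro!: prob_space_PiM sets_PiM_cong)
next
  fix A assume "A \<in> prod_algebra J (\<lambda>_. L)"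
  then obtain E where E: "A = Pi\<^sub>E J E" "\<And>j. j \<in> J \<Longrightarrow> E j \<in> sets L"
    using J by (auto simp: prod_algebra_eq_finite)
  have "emeasure (PiM J (\<lambda>_. D w)) A = (\<Prod>j\<in>J. emeasure (D w) (E j))" if "w \<in> space F" for w
  proof -
    have Dw: "prob_space (D w)" "sets (D w) = sets L"
      using measurable_space[OF D that] by (auto simp: space_prob_algebra)
    interpret prob_space "D w" by fact
    interpret product_sigma_finite "\<lambda>_. D w" ..
    show ?thesis unfolding E(1) using J E(2) Dw by (intro emeasure_PiM) auto
  qed
  moreover have "(\<lambda>w. \<Prod>j\<in>J. emeasure (D w) (E j)) \<in> borel_measurable F"
    using E(2) measurable_prob_algebraD[OF D]
    by (intro borel_measurable_prod_ennreal measurable_emeasure_kernel) auto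
  ultimately show "(\<lambda>w. emeasure (PiM J (\<lambda>_. D w)) A) \<in> borel_measurable F"
    by (simp cong: measurable_cong)
qed

text \<open>The integrand depends on the parameter as well. Pushing \<open>D w\<close> forward along
  \<open>\<lambda>z. (w, z)\<close> moves that dependence into the kernel, leaving a fixed integrand
  on the product space.\<close>

lemma integral_measurable_kernel:
  fixes f :: "'w \<Rightarrow> 'z \<Rightarrow> 'b::{banach, second_countable_topology}"
  assumes f [measurable]: "(\<lambda>(w, z). f w z) \<in> borel_measurable (F \<Otimes>\<^sub>M L)"
    and D [measurable]: "D \<in> F \<rightarrow>\<^sub>M subprob_algebra L"
  shows "(\<lambda>w. \<integral>z. f w z \<partial>D w) \<in> borel_measurable F"
proof -
  note measurable_distr2[measurable]
  have "(\<lambda>w. \<integral>y. (case y of (w, z) \<Rightarrow> f w z) \<partial>distr (D w) (F \<Otimes>\<^sub>M L) (\<lambda>z. (w, z))) \<in> borel_measurable F"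
    by measurable
  then show ?thesis
    by (rule measurable_cong[THEN iffD1, rotated]) (simp add: integral_distr)
qed

lemma measurable_subalgebra_id: "subalgebra P F \<Longrightarrow> (\<lambda>w. w) \<in> P \<rightarrow>\<^sub>M F"
  by (rule measurable_from_subalg[where F=F]) auto

section \<open>Gaussian approximation of a power of a characteristic function\<close>

text \<open>The upper bound comes from multiplying the quadratic Taylor lower bound of exp x by 1 -
  x + x^2/2: the product is 1 + x^4/4, which is at least 1.\<close>

lemma exp_minus_approx:
  fixes x :: real
  assumes "0 \<le> x"
  shows "\<bar>exp (- x) - (1 - x)\<bar> \<le> x\<^sup>2 / 2"
proof -
  have "exp x * (1 - x + x\<^sup>2 / 2) \<ge> (1 + x + x\<^sup>2 / 2) * (1 - x + x\<^sup>2 / 2)"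
    using exp_lower_Taylor_quadratic[OF assms] sum_squares_ge_zero[of "1 - x" 1]
    by (intro mult_right_mono) (auto simp: power2_eq_square algebra_simps)
  also have "(1 + x + x\<^sup>2 / 2) * (1 - x + x\<^sup>2 / 2) = 1 + (x\<^sup>2)\<^sup>2 / 4"
    by (simp add: power2_eq_square algebra_simps)
  finally have "1 \<le> exp x * (1 - x + x\<^sup>2 / 2)" using zero_le_power2[of "x\<^sup>2"] by linarith
  then have "exp (- x) \<le> 1 - x + x\<^sup>2 / 2" by (simp add: exp_minus field_simps)
  moreover have "1 - x \<le> exp (- x)" using exp_ge_add_one_self[of "- x"] by simp
  ultimately show ?thesis by (simp add: abs_if)
qed

text \<open>The variable is not centred: its mean is split off as an exact phase, because in the
  application it is a random conditional mean. The cubic term is the Taylor error of the centred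
  variable, which is bounded by 2c; the quartic term is the price of replacing 1 - x by exp (-x)
  with x = t^2 v/2. The powers are compared by |a^N - b^N| <= N |a - b| for moduli at most
  1.\<close>

lemma (in prob_space) char_power_bound:
  fixes X :: "'a \<Rightarrow> real"
  assumes X [measurable]: "random_variable borel X" and c: "\<And>x. x \<in> space M \<Longrightarrow> \<bar>X x\<bar> \<le> c"
  defines "m \<equiv> expectation X" and "v \<equiv> expectation (\<lambda>x. (X x)\<^sup>2) - (expectation X)\<^sup>2"
  shows "cmod ((\<integral>x. iexp (t * X x) \<partial>M) ^ N - iexp (real N * t * m) * of_real (exp (- real N * t\<^sup>2 * v / 2)))
    \<le> real N * (\<bar>t\<bar> ^ 3 * (2 * c) ^ 3 / 6 + t ^ 4 * c ^ 4 / 8)"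
proof -
  have intX: "integrable M X" by (rule integrable_const_bound[where B=c]) (auto intro: AE_I2 c)
  have sq: "(X x)\<^sup>2 \<le> c\<^sup>2" if "x \<in> space M" for x
    using power_mono[OF c[OF that], of 2] by simp
  have intX2: "integrable M (\<lambda>x. (X x)\<^sup>2)"
    by (rule integrable_const_bound[where B="c\<^sup>2"]) (auto intro!: AE_I2 sq)
  have m: "\<bar>m\<bar> \<le> c"
  proof -
    have "\<bar>m\<bar> \<le> expectation (\<lambda>x. \<bar>X x\<bar>)" unfolding m_def by (rule integral_abs_bound)
    also have "\<dots> \<le> expectation (\<lambda>x. c)" using intX by (intro integral_mono) (auto intro: c)
    finally show ?thesis by (simp add: prob_space)
  qed
  have v: "0 \<le> v" "v \<le> c\<^sup>2"
  proof -
    have "v = variance X" unfolding v_def using intX intX2 by (rule variance_eq[symmetric])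
    then show "0 \<le> v" by simp
    have "expectation (\<lambda>x. (X x)\<^sup>2) \<le> expectation (\<lambda>x. c\<^sup>2)"
      using intX2 by (intro integral_mono) (auto intro: sq)
    then have "expectation (\<lambda>x. (X x)\<^sup>2) \<le> c\<^sup>2" by (simp add: prob_space)
    then show "v \<le> c\<^sup>2" unfolding v_def using zero_le_power2[of "expectation X"] by linarith
  qed
  define Y where "Y x = X x - m" for x
  have Y [measurable]: "random_variable borel Y" unfolding Y_def by measurable
  have Yc: "\<bar>Y x\<bar> \<le> 2 * c" if "x \<in> space M" for x
    using c[OF that] m unfolding Y_def by linarith
  have intY: "integrable M Y" unfolding Y_def using intX by auto
  have intY2: "integrable M (\<lambda>x. (Y x)\<^sup>2)"
    by (rule integrable_const_bound[where B="(2 * c)\<^sup>2"])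
      (auto intro!: AE_I2 power_mono[OF Yc, of _ 2, simplified])
  have EY: "expectation Y = 0" unfolding Y_def m_def using intX by (simp add: prob_space)
  have VY: "variance Y = v"
    unfolding EY v_def variance_eq[OF intX intX2, symmetric] by (simp add: Y_def m_def)
  define x where "x = t\<^sup>2 * v / 2"
  have x0: "0 \<le> x" using v by (simp add: x_def)
  define chi where "chi = (\<integral>w. iexp (t * X w) \<partial>M)"
  define chi' where "chi' = (\<integral>w. iexp (t * Y w) \<partial>M)"
  have chi: "chi = iexp (t * m) * chi'"
  proof -
    have "chi = (\<integral>w. iexp (t * m) * iexp (t * Y w) \<partial>M)"
      unfolding chi_def by (intro Bochner_Integration.integral_cong) (auto simp: Y_def exp_add[symmetric] algebra_simps)
    then show ?thesis by (simp add: chi'_def)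
  qed
  have "cmod (chi' - (1 - t\<^sup>2 * v / 2)) \<le> t\<^sup>2 / 6 * expectation (\<lambda>x. min (6 * (Y x)\<^sup>2) (\<bar>t\<bar> * \<bar>Y x\<bar> ^ 3))"
    using char_approx3'[OF Y intY intY2 EY VY refl, of t]
    unfolding chi'_def char_def by (subst (asm) integral_distr) auto
  also have "\<dots> \<le> t\<^sup>2 / 6 * expectation (\<lambda>x. \<bar>t\<bar> * (2 * c) ^ 3)"
  proof (intro mult_left_mono integral_mono)
    show "integrable M (\<lambda>x. min (6 * (Y x)\<^sup>2) (\<bar>t\<bar> * \<bar>Y x\<bar> ^ 3))"
      by (rule Bochner_Integration.integrable_bound[of M "\<lambda>x. 6 * (Y x)\<^sup>2"]) (auto intro!: intY2)
    show "min (6 * (Y w)\<^sup>2) (\<bar>t\<bar> * \<bar>Y w\<bar> ^ 3) \<le> \<bar>t\<bar> * (2 * c) ^ 3" if "w \<in> space M" for w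
      using mult_left_mono[OF power_mono[OF Yc[OF that], of 3], of "\<bar>t\<bar>"] by (simp add: min.coboundedI2)
  qed auto
  also have "\<dots> = \<bar>t\<bar> ^ 3 * (2 * c) ^ 3 / 6"
    by (simp add: prob_space power2_eq_square power3_eq_cube abs_mult[symmetric])
  finally have 1: "cmod (chi' - of_real (1 - x)) \<le> \<bar>t\<bar> ^ 3 * (2 * c) ^ 3 / 6" by (simp add: x_def)
  have "\<bar>exp (- x) - (1 - x)\<bar> \<le> x\<^sup>2 / 2" by (rule exp_minus_approx[OF x0])
  also have "\<dots> = t ^ 4 * v\<^sup>2 / 8" by (simp add: x_def power2_eq_square power4_eq_xxxx)
  also have "\<dots> \<le> t ^ 4 * (c\<^sup>2)\<^sup>2 / 8"
    using v by (intro divide_right_mono mult_left_mono power_mono) auto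
  finally have 2: "cmod (of_real (1 - x) - of_real (exp (- x))) \<le> t ^ 4 * c ^ 4 / 8"
    unfolding of_real_diff[symmetric] norm_of_real by (simp add: abs_minus_commute power_mult[symmetric])
  have "cmod (chi - iexp (t * m) * of_real (exp (- x))) = cmod (iexp (t * m) * (chi' - of_real (exp (- x))))"
    by (simp add: chi algebra_simps)
  also have "\<dots> = cmod ((chi' - of_real (1 - x)) + (of_real (1 - x) - of_real (exp (- x))))"
    by (simp add: norm_mult)
  also have "\<dots> \<le> \<bar>t\<bar> ^ 3 * (2 * c) ^ 3 / 6 + t ^ 4 * c ^ 4 / 8"
    using 1 2 by (rule norm_triangle_mono)
  finally have 3: "cmod (chi - iexp (t * m) * of_real (exp (- x))) \<le> \<bar>t\<bar> ^ 3 * (2 * c) ^ 3 / 6 + t ^ 4 * c ^ 4 / 8" .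
  have "cmod chi \<le> (\<integral>w. cmod (iexp (t * X w)) \<partial>M)" unfolding chi_def by (rule integral_norm_bound)
  then have n1: "cmod chi \<le> 1" by (simp add: prob_space)
  have n2: "cmod (iexp (t * m) * of_real (exp (- x))) \<le> 1" using x0 by (simp add: norm_mult)
  have "(iexp (t * m) * of_real (exp (- x))) ^ N = iexp (real N * t * m) * of_real (exp (- real N * t\<^sup>2 * v / 2))"
    by (simp add: power_mult_distrib exp_of_nat_mult[symmetric] x_def of_real_power[symmetric] algebra_simps del: of_real_power)
  then have "cmod (chi ^ N - iexp (real N * t * m) * of_real (exp (- real N * t\<^sup>2 * v / 2)))
      \<le> real N * cmod (chi - iexp (t * m) * of_real (exp (- x)))"
    using norm_power_diff[OF n1 n2, of N] by simp
  also have "\<dots> \<le> real N * (\<bar>t\<bar> ^ 3 * (2 * c) ^ 3 / 6 + t ^ 4 * c ^ 4 / 8)"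
    by (intro mult_left_mono 3) auto
  finally show ?thesis unfolding chi_def .
qed

section \<open>Disintegration of a conditionally i.i.d. sample with respect to its past\<close>

text \<open>\<open>cond_iid\<close> only provides, for each choice of sets, an identity outside a
  null set that may depend on this choice. Requiring in addition that \<open>D\<close> is a
  probability kernel measurable in the past \<open>F\<close> allows uniqueness of measures to
  upgrade these identities to a regular conditional law of the whole sample.\<close>

locale cond_iid_sample = prob_space P
  for P :: "'w measure" +
  fixes F :: "'w measure" and N :: nat and J :: "nat set" and L :: "'z measure"
    and Z :: "nat \<Rightarrow> 'w \<Rightarrow> 'z" and D :: "'w \<Rightarrow> 'z measure"
  assumes J: "J = {1..N}"
    and subalg: "subalgebra P F"
    and Z_measurable: "l \<in> J \<Longrightarrow> Z l \<in> P \<rightarrow>\<^sub>M L"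
    and kernel: "D \<in> F \<rightarrow>\<^sub>M prob_algebra L"
    and cond_iid: "cond_iid P F N L Z D"
begin

abbreviation "LN \<equiv> PiM J (\<lambda>_. L)"
abbreviation "ZN w \<equiv> \<lambda>l\<in>J. Z l w"
abbreviation "DN w \<equiv> PiM J (\<lambda>_. D w)"

lemma finite_J [simp]: "finite J"
  by (simp add: J)

lemma ZN_measurable [measurable]: "ZN \<in> P \<rightarrow>\<^sub>M LN"
  by (rule measurable_restrict[OF Z_measurable])

lemma id_measurable [measurable]: "(\<lambda>w. w) \<in> P \<rightarrow>\<^sub>M F"
  by (rule measurable_subalgebra_id[OF subalg])

lemma space_F: "space F = space P"
  using subalg by (simp add: subalgebra_def)

lemma DN_kernel: "DN \<in> F \<rightarrow>\<^sub>M prob_algebra LN"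
  by (rule measurable_PiM_const_kernel[OF kernel]) simp

lemma DN_kernel': "DN \<in> P \<rightarrow>\<^sub>M subprob_algebra LN"
  by (rule measurable_prob_algebraD[OF measurable_from_subalg[OF subalg DN_kernel]])

lemma D_prob: "w \<in> space P \<Longrightarrow> prob_space (D w)" and D_sets: "w \<in> space P \<Longrightarrow> sets (D w) = sets L"
  using measurable_space[OF kernel, of w] by (auto simp: space_prob_algebra space_F)

lemma sets_DN: "w \<in> space P \<Longrightarrow> sets (DN w) = sets LN"
  by (auto intro!: sets_PiM_cong D_sets)

text \<open>For a fixed past event B both sides are finite measures in A. They agree on boxes, by
  the defining property of conditional expectation tested against the indicator of B, and the boxes
  determine a measure on the product.\<close>

lemma emeasure_ZN:
  assumes B: "B \<in> sets F" and A: "A \<in> sets LN"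
  shows "emeasure P {w\<in>space P. w \<in> B \<and> ZN w \<in> A} = (\<integral>\<^sup>+w. indicator B w * emeasure (DN w) A \<partial>P)"
proof -
  have [measurable]: "B \<in> sets P" using B subalg by (auto simp: subalgebra_def)
  interpret finite_measure_subalgebra P F
    by unfold_locales (rule subalg)
  define M1 where "M1 = distr (density P (indicator B)) LN ZN"
  define M2 where "M2 = density P (indicator B) \<bind> DN"
  have ker: "DN \<in> density P (indicator B) \<rightarrow>\<^sub>M subprob_algebra LN"
    using DN_kernel' by simp
  have sp: "space P \<noteq> {}" by (rule not_empty)
  have em1: "emeasure M1 E = emeasure P {w\<in>space P. w \<in> B \<and> ZN w \<in> E}" if [measurable]: "E \<in> sets LN" for E
  proof -
    have "emeasure M1 E = (\<integral>\<^sup>+w. indicator B w * indicator (ZN -` E \<inter> space P) w \<partial>P)"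
      unfolding M1_def by (subst emeasure_distr) (auto simp: emeasure_density)
    also have "\<dots> = (\<integral>\<^sup>+w. indicator {w\<in>space P. w \<in> B \<and> ZN w \<in> E} w \<partial>P)"
      by (intro nn_integral_cong) (auto split: split_indicator)
    also have "\<dots> = emeasure P {w\<in>space P. w \<in> B \<and> ZN w \<in> E}"
      by (rule nn_integral_indicator) measurable
    finally show ?thesis .
  qed
  have em2: "emeasure M2 E = (\<integral>\<^sup>+w. indicator B w * emeasure (DN w) E \<partial>P)" if E: "E \<in> sets LN" for E
  proof -
    have [measurable]: "(\<lambda>w. emeasure (DN w) E) \<in> borel_measurable P"
      by (rule measurable_emeasure_kernel[OF DN_kernel' E])
    show ?thesis
      unfolding M2_def by (subst emeasure_bind[OF _ ker E]) (auto simp: sp nn_integral_density)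
  qed
  have "M1 = M2"
  proof (rule measure_eqI_PiM_finite[where I="J" and M="\<lambda>_. L" and A="\<lambda>_. space (PiM J (\<lambda>_. L))"])
    show "sets M1 = sets LN" by (simp add: M1_def)
    show "sets M2 = sets LN" unfolding M2_def by (subst sets_bind[OF sets_kernel[OF ker]]) (auto simp: sp)
    fix A assume A: "\<And>i. i \<in> J \<Longrightarrow> A i \<in> sets L"
    define S where "S = {w \<in> space P. \<forall>l\<in>J. Z l w \<in> A l}"
    have "{w\<in>space P. ZN w \<in> Pi\<^sub>E J A} \<in> sets P"
      using A by measurable
    also have "{w\<in>space P. ZN w \<in> Pi\<^sub>E J A} = S"
      by (auto simp: S_def)
    finally have S [measurable]: "S \<in> sets P" .
    have Sint: "integrable P (\<lambda>w. indicator B w * (indicator S w :: real))"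
      by (rule integrable_const_bound[where B=1]) (auto split: split_indicator)
    have B': "indicator B \<in> borel_measurable F" using B by simp
    note ce = real_cond_exp_intg[OF Sint B' borel_measurable_indicator[OF S]]
    have AE: "AE w in P. real_cond_exp P F (indicator S) w = (\<Prod>l\<in>J. measure (D w) (A l))"
      using cond_iid A unfolding cond_iid_def S_def J by auto
    have DNA: "emeasure (DN w) (Pi\<^sub>E J A) = ennreal (\<Prod>l\<in>J. measure (D w) (A l))" if w: "w \<in> space P" for w
    proof -
      interpret Dw: prob_space "D w" using w by (rule D_prob)
      interpret product_sigma_finite "\<lambda>_. D w" ..
      have "emeasure (DN w) (Pi\<^sub>E J A) = (\<Prod>l\<in>J. emeasure (D w) (A l))"
        using A w D_sets by (intro emeasure_PiM) auto
      then show ?thesis by (simp add: Dw.emeasure_eq_measure prod_ennreal)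
    qed
    have "emeasure M1 (Pi\<^sub>E J A) = emeasure P {w\<in>space P. w \<in> B \<and> ZN w \<in> Pi\<^sub>E J A}"
      using A by (intro em1) auto
    also have "{w\<in>space P. w \<in> B \<and> ZN w \<in> Pi\<^sub>E J A} = B \<inter> S"
      using sets.sets_into_space[OF B] by (auto simp: S_def space_F)
    also have "emeasure P (B \<inter> S) = ennreal (\<integral>w. indicator (B \<inter> S) w \<partial>P)"
      by (simp add: emeasure_eq_measure)
    also have "(\<integral>w. indicator (B \<inter> S) w \<partial>P) = (\<integral>w. indicator B w * (indicator S w :: real) \<partial>P)"
      by (intro Bochner_Integration.integral_cong) (auto split: split_indicator)
    also have "\<dots> = (\<integral>w. indicator B w * real_cond_exp P F (indicator S) w \<partial>P)"
      using ce(2) by simp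
    also have "ennreal \<dots> = (\<integral>\<^sup>+w. ennreal (indicator B w * real_cond_exp P F (indicator S) w) \<partial>P)"
    proof (rule nn_integral_eq_integral[symmetric, OF ce(1)])
      show "AE w in P. 0 \<le> indicator B w * real_cond_exp P F (indicator S) w"
        using AE by eventually_elim (auto intro!: mult_nonneg_nonneg prod_nonneg)
    qed
    also have "\<dots> = (\<integral>\<^sup>+w. indicator B w * emeasure (DN w) (Pi\<^sub>E J A) \<partial>P)"
    proof (rule nn_integral_cong_AE)
      show "AE w in P. ennreal (indicator B w * real_cond_exp P F (indicator S) w)
          = indicator B w * emeasure (DN w) (Pi\<^sub>E J A)"
        using AE AE_space by eventually_elim (auto simp: DNA split: split_indicator)
    qed
    also have "\<dots> = emeasure M2 (Pi\<^sub>E J A)"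
      using A by (intro em2[symmetric]) auto
    finally show "emeasure M1 (Pi\<^sub>E J A) = emeasure M2 (Pi\<^sub>E J A)" .
  next
    have "space LN \<in> prod_algebra J (\<lambda>_. L)"
      unfolding space_PiM by (rule prod_algebraI_finite) auto
    then show "range (\<lambda>_::nat. space LN) \<subseteq> prod_algebra J (\<lambda>_. L)" by auto
    show "emeasure M1 (space LN) \<noteq> \<infinity>" for i :: nat
      by (subst em1) (auto simp: emeasure_eq_measure)
  qed auto
  with em1[OF A] em2[OF A] show ?thesis by simp
qed

text \<open>The semidirect product of \<open>P\<close> with the kernel \<open>DN\<close>. The past
  is represented by the sample point itself, seen through the smaller sigma-field
  \<open>F\<close>.\<close>

definition joint :: "('w \<times> (nat \<Rightarrow> 'z)) measure" where
  "joint = P \<bind> (\<lambda>w. distr (DN w) (F \<Otimes>\<^sub>M LN) (Pair w))"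

lemma joint_kernel: "(\<lambda>w. distr (DN w) (F \<Otimes>\<^sub>M LN) (Pair w)) \<in> P \<rightarrow>\<^sub>M subprob_algebra (F \<Otimes>\<^sub>M LN)"
proof (rule measurable_distr2[OF _ DN_kernel'])
  have "(\<lambda>x. x) \<in> P \<Otimes>\<^sub>M LN \<rightarrow>\<^sub>M F \<Otimes>\<^sub>M LN"
    by (rule measurable_pair) (auto simp: comp_def intro: measurable_compose[OF measurable_fst id_measurable])
  then show "(\<lambda>(x, y). (x, y)) \<in> P \<Otimes>\<^sub>M LN \<rightarrow>\<^sub>M F \<Otimes>\<^sub>M LN" by simp
qed

text \<open>Rectangles generate the product sigma-field and are stable under intersection; on a
  rectangle the claim is \<open>emeasure_ZN\<close>.\<close>

lemma distr_joint: "distr P (F \<Otimes>\<^sub>M LN) (\<lambda>w. (w, ZN w)) = joint"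
proof (rule measure_eqI_generator_eq[where A="\<lambda>_. space F \<times> space LN", OF Int_stable_pair_measure_generator[of F LN] pair_measure_closed])
  have sp: "space P \<noteq> {}" by (rule not_empty)
  show "sets (distr P (F \<Otimes>\<^sub>M LN) (\<lambda>w. (w, ZN w))) = sigma_sets (space F \<times> space LN) {a \<times> b |a b. a \<in> sets F \<and> b \<in> sets LN}"
    by (simp add: sets_pair_measure)
  show "sets joint = sigma_sets (space F \<times> space LN) {a \<times> b |a b. a \<in> sets F \<and> b \<in> sets LN}"
    unfolding joint_def by (subst sets_bind[OF sets_kernel[OF joint_kernel]]) (auto simp: sp sets_pair_measure)
  fix X assume "X \<in> {a \<times> b |a b. a \<in> sets F \<and> b \<in> sets LN}"
  then obtain B A where X: "X = B \<times> A" "B \<in> sets F" "A \<in> sets LN" by auto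
  have [measurable]: "X \<in> sets (F \<Otimes>\<^sub>M LN)" using X by auto
  have "emeasure (distr P (F \<Otimes>\<^sub>M LN) (\<lambda>w. (w, ZN w))) X = emeasure P {w\<in>space P. w \<in> B \<and> ZN w \<in> A}"
    by (subst emeasure_distr) (auto simp: X intro!: arg_cong[where f="emeasure P"])
  also have "\<dots> = (\<integral>\<^sup>+w. indicator B w * emeasure (DN w) A \<partial>P)"
    by (rule emeasure_ZN[OF X(2,3)])
  also have "\<dots> = (\<integral>\<^sup>+w. emeasure (distr (DN w) (F \<Otimes>\<^sub>M LN) (Pair w)) X \<partial>P)"
  proof (rule nn_integral_cong)
    fix w assume w: "w \<in> space P"
    have "Pair w \<in> DN w \<rightarrow>\<^sub>M F \<Otimes>\<^sub>M LN"
      using w by (simp add: measurable_cong_sets[OF sets_DN[OF w] refl] space_F)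
    then have "emeasure (distr (DN w) (F \<Otimes>\<^sub>M LN) (Pair w)) X = emeasure (DN w) (Pair w -` X \<inter> space (DN w))"
      by (rule emeasure_distr) measurable
    also have "Pair w -` X \<inter> space (DN w) = (if w \<in> B then A else {})"
      using sets.sets_into_space[OF X(3)] sets_eq_imp_space_eq[OF sets_DN[OF w]] by (auto simp: X)
    finally show "indicator B w * emeasure (DN w) A = emeasure (distr (DN w) (F \<Otimes>\<^sub>M LN) (Pair w)) X"
      by (auto split: split_indicator)
  qed
  also have "\<dots> = emeasure joint X"
    unfolding joint_def by (subst emeasure_bind[OF _ joint_kernel]) (auto simp: sp)
  finally show "emeasure (distr P (F \<Otimes>\<^sub>M LN) (\<lambda>w. (w, ZN w))) X = emeasure joint X" .
next
  show "emeasure (distr P (F \<Otimes>\<^sub>M LN) (\<lambda>w. (w, ZN w))) (space F \<times> space LN) \<noteq> \<infinity>"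
    by (subst emeasure_distr) (auto simp: emeasure_eq_measure)
qed auto

lemma integral_ZN_real:
  fixes H :: "'w \<times> (nat \<Rightarrow> 'z) \<Rightarrow> real"
  assumes [measurable]: "H \<in> borel_measurable (F \<Otimes>\<^sub>M LN)" and B: "\<And>x. x \<in> space (F \<Otimes>\<^sub>M LN) \<Longrightarrow> \<bar>H x\<bar> \<le> B"
  shows "(\<integral>w. H (w, ZN w) \<partial>P) = (\<integral>w. (\<integral>z. H (w, z) \<partial>DN w) \<partial>P)"
proof -
  have "(\<integral>w. H (w, ZN w) \<partial>P) = (\<integral>x. H x \<partial>distr P (F \<Otimes>\<^sub>M LN) (\<lambda>w. (w, ZN w)))"
    by (subst integral_distr) auto
  also have "\<dots> = (\<integral>w. (\<integral>x. H x \<partial>distr (DN w) (F \<Otimes>\<^sub>M LN) (Pair w)) \<partial>P)"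
    unfolding distr_joint joint_def
  proof (rule integral_bind[where B=B and B'=1])
    show "(\<lambda>w. distr (DN w) (F \<Otimes>\<^sub>M LN) (Pair w)) \<in> P \<rightarrow>\<^sub>M subprob_algebra (F \<Otimes>\<^sub>M LN)"
      by (rule joint_kernel)
    have "emeasure (distr (DN w) (F \<Otimes>\<^sub>M LN) (Pair w)) (space (distr (DN w) (F \<Otimes>\<^sub>M LN) (Pair w))) \<le> 1"
      if "w \<in> space P" for w
      using measurable_space[OF joint_kernel that]
      by (intro subprob_space.emeasure_space_le_1) (simp add: space_subprob_algebra)
    then show "AE x in P. emeasure (distr (DN x) (F \<Otimes>\<^sub>M LN) (Pair x)) (space (distr (DN x) (F \<Otimes>\<^sub>M LN) (Pair x))) \<le> ennreal 1"
      by (auto intro: AE_I2)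
  qed (use B finite_measure_axioms in auto)
  also have "\<dots> = (\<integral>w. (\<integral>z. H (w, z) \<partial>DN w) \<partial>P)"
  proof (rule Bochner_Integration.integral_cong[OF refl])
    fix w assume w: "w \<in> space P"
    have "Pair w \<in> DN w \<rightarrow>\<^sub>M F \<Otimes>\<^sub>M LN"
      using w by (simp add: measurable_cong_sets[OF sets_DN[OF w] refl] space_F)
    then show "(\<integral>x. H x \<partial>distr (DN w) (F \<Otimes>\<^sub>M LN) (Pair w)) = (\<integral>z. H (w, z) \<partial>DN w)"
      by (rule integral_distr) measurable
  qed
  finally show ?thesis .
qed

lemma measurable_Pair_DN: "w \<in> space P \<Longrightarrow> Pair w \<in> DN w \<rightarrow>\<^sub>M F \<Otimes>\<^sub>M LN"
  by (simp add: measurable_cong_sets[OF sets_DN refl] space_F)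

lemma prob_space_DN: "w \<in> space P \<Longrightarrow> prob_space (DN w)"
  by (intro prob_space_PiM D_prob)

text \<open>Conditioning on the past as an iterated integral. Complex integrands are needed for
  characteristic functions and are handled through real and imaginary parts.\<close>

lemma integral_ZN:
  fixes H :: "'w \<times> (nat \<Rightarrow> 'z) \<Rightarrow> complex"
  assumes [measurable]: "H \<in> borel_measurable (F \<Otimes>\<^sub>M LN)" and B: "\<And>x. x \<in> space (F \<Otimes>\<^sub>M LN) \<Longrightarrow> cmod (H x) \<le> B"
  shows "(\<integral>w. H (w, ZN w) \<partial>P) = (\<integral>w. (\<integral>z. H (w, z) \<partial>DN w) \<partial>P)"
    and "integrable P (\<lambda>w. \<integral>z. H (w, z) \<partial>DN w)"
proof -
  have ZNs: "(w, ZN w) \<in> space (F \<Otimes>\<^sub>M LN)" if "w \<in> space P" for w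
    using measurable_space[OF ZN_measurable that] that by (simp add: space_pair_measure space_F)
  have int1: "integrable P (\<lambda>w. H (w, ZN w))"
    by (rule integrable_const_bound[where B=B]) (auto intro!: AE_I2 B ZNs)
  have int2: "integrable (DN w) (\<lambda>z. H (w, z))" if w: "w \<in> space P" for w
  proof -
    interpret Dw: prob_space "DN w" using w by (rule prob_space_DN)
    have sp: "z \<in> space (DN w) \<Longrightarrow> (w, z) \<in> space (F \<Otimes>\<^sub>M LN)" for z
      using measurable_space[OF measurable_Pair_DN[OF w]] by auto
    show ?thesis
      by (rule Dw.integrable_const_bound[where B=B])
        (auto intro!: AE_I2 B sp measurable_compose[OF measurable_Pair_DN[OF w]])
  qed
  have bnd: "cmod (\<integral>z. H (w, z) \<partial>DN w) \<le> B" if w: "w \<in> space P" for w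
  proof -
    interpret Dw: prob_space "DN w" using w by (rule prob_space_DN)
    have sp: "z \<in> space (DN w) \<Longrightarrow> (w, z) \<in> space (F \<Otimes>\<^sub>M LN)" for z
      using measurable_space[OF measurable_Pair_DN[OF w]] by auto
    have "cmod (\<integral>z. H (w, z) \<partial>DN w) \<le> (\<integral>z. cmod (H (w, z)) \<partial>DN w)" by (rule integral_norm_bound)
    also have "\<dots> \<le> (\<integral>z. B \<partial>DN w)"
      using int2[OF w] by (intro integral_mono) (auto intro!: B sp)
    finally show ?thesis by (simp add: Dw.prob_space)
  qed
  have "(\<lambda>w. \<integral>z. H (w, z) \<partial>DN w) \<in> borel_measurable F"
    by (rule integral_measurable_kernel[OF _ measurable_prob_algebraD[OF DN_kernel]]) simp
  then have meas: "(\<lambda>w. \<integral>z. H (w, z) \<partial>DN w) \<in> borel_measurable P"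
    by (rule measurable_from_subalg[OF subalg])
  then show int3: "integrable P (\<lambda>w. \<integral>z. H (w, z) \<partial>DN w)"
    by (intro integrable_const_bound[where B=B]) (auto intro!: AE_I2 bnd)
  show "(\<integral>w. H (w, ZN w) \<partial>P) = (\<integral>w. (\<integral>z. H (w, z) \<partial>DN w) \<partial>P)"
  proof (rule complex_eqI)
    have "Re (\<integral>w. H (w, ZN w) \<partial>P) = (\<integral>w. Re (H (w, ZN w)) \<partial>P)" using int1 by simp
    also have "\<dots> = (\<integral>w. (\<integral>z. Re (H (w, z)) \<partial>DN w) \<partial>P)"
      using B by (intro integral_ZN_real[where H="\<lambda>x. Re (H x)" and B=B])
        (auto intro: order_trans[OF abs_Re_le_cmod])
    also have "\<dots> = (\<integral>w. Re (\<integral>z. H (w, z) \<partial>DN w) \<partial>P)"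
      by (intro Bochner_Integration.integral_cong) (auto simp: int2)
    also have "\<dots> = Re (\<integral>w. (\<integral>z. H (w, z) \<partial>DN w) \<partial>P)" using int3 by simp
    finally show "Re (\<integral>w. H (w, ZN w) \<partial>P) = Re (\<integral>w. (\<integral>z. H (w, z) \<partial>DN w) \<partial>P)" .
    have "Im (\<integral>w. H (w, ZN w) \<partial>P) = (\<integral>w. Im (H (w, ZN w)) \<partial>P)" using int1 by simp
    also have "\<dots> = (\<integral>w. (\<integral>z. Im (H (w, z)) \<partial>DN w) \<partial>P)"
      using B by (intro integral_ZN_real[where H="\<lambda>x. Im (H x)" and B=B])
        (auto intro: order_trans[OF abs_Im_le_cmod])
    also have "\<dots> = (\<integral>w. Im (\<integral>z. H (w, z) \<partial>DN w) \<partial>P)"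
      by (intro Bochner_Integration.integral_cong) (auto simp: int2)
    also have "\<dots> = Im (\<integral>w. (\<integral>z. H (w, z) \<partial>DN w) \<partial>P)" using int3 by simp
    finally show "Im (\<integral>w. H (w, ZN w) \<partial>P) = Im (\<integral>w. (\<integral>z. H (w, z) \<partial>DN w) \<partial>P)" .
  qed
qed

lemma mean_measurable:
  assumes k: "(\<lambda>(w, z). k w z) \<in> borel_measurable (F \<Otimes>\<^sub>M L)"
  shows "(\<lambda>w. \<integral>z. k w z \<partial>D w :: real) \<in> borel_measurable F"
  by (rule integral_measurable_kernel[OF k measurable_prob_algebraD[OF kernel]])

lemma sample_measurable:
  assumes k: "(\<lambda>(w, z). k w z) \<in> borel_measurable (F \<Otimes>\<^sub>M L)" and l: "l \<in> J"
  shows "(\<lambda>w. k w (Z l w) :: real) \<in> borel_measurable P"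
proof -
  have [measurable]: "Z l \<in> P \<rightarrow>\<^sub>M L" using l by (rule Z_measurable)
  have "(\<lambda>w. (w, Z l w)) \<in> P \<rightarrow>\<^sub>M F \<Otimes>\<^sub>M L" by measurable
  from measurable_compose[OF this k] show ?thesis by simp
qed

lemma section_measurable:
  assumes k: "(\<lambda>(w, z). k w z) \<in> borel_measurable (F \<Otimes>\<^sub>M L)" and w: "w \<in> space P"
  shows "(k w :: _ \<Rightarrow> real) \<in> borel_measurable (D w)"
  using measurable_Pair2[OF k] w by (simp add: measurable_cong_sets[OF D_sets[OF w] refl] space_F)

lemma mean_bounds:
  fixes k :: "'w \<Rightarrow> 'z \<Rightarrow> real"
  assumes k: "(\<lambda>(w, z). k w z) \<in> borel_measurable (F \<Otimes>\<^sub>M L)"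
    and c: "\<And>w z. w \<in> space P \<Longrightarrow> z \<in> space L \<Longrightarrow> \<bar>k w z\<bar> \<le> c" and w: "w \<in> space P"
  shows "integrable (D w) (k w)" "\<bar>\<integral>z. k w z \<partial>D w\<bar> \<le> c" "integrable (D w) (\<lambda>z. (k w z)\<^sup>2)"
    "\<bar>\<integral>z. (k w z)\<^sup>2 \<partial>D w\<bar> \<le> c\<^sup>2" "(\<integral>z. (k w z)\<^sup>2 \<partial>D w) - (\<integral>z. k w z \<partial>D w)\<^sup>2 \<ge> 0"
proof -
  interpret Dw: prob_space "D w" using w by (rule D_prob)
  have kw [measurable]: "k w \<in> borel_measurable (D w)" by (rule section_measurable[OF k w])
  have kb: "\<bar>k w z\<bar> \<le> c" if "z \<in> space (D w)" for z
    using that w c sets_eq_imp_space_eq[OF D_sets[OF w]] by auto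
  have k2: "(k w z)\<^sup>2 \<le> c\<^sup>2" if "z \<in> space (D w)" for z
    using power_mono[OF kb[OF that], of 2] by simp
  show i1: "integrable (D w) (k w)" by (rule Dw.integrable_const_bound[where B=c]) (auto intro!: AE_I2 kb)
  show i2: "integrable (D w) (\<lambda>z. (k w z)\<^sup>2)"
    by (rule Dw.integrable_const_bound[where B="c\<^sup>2"]) (auto intro!: AE_I2 k2)
  have "\<bar>\<integral>z. k w z \<partial>D w\<bar> \<le> (\<integral>z. \<bar>k w z\<bar> \<partial>D w)" by (rule integral_abs_bound)
  also have "\<dots> \<le> (\<integral>z. c \<partial>D w)" using i1 by (intro integral_mono) (auto intro: kb)
  finally show "\<bar>\<integral>z. k w z \<partial>D w\<bar> \<le> c" by (simp add: Dw.prob_space)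
  have "(\<integral>z. (k w z)\<^sup>2 \<partial>D w) \<le> (\<integral>z. c\<^sup>2 \<partial>D w)" using i2 by (intro integral_mono) (auto intro: k2)
  then show "\<bar>\<integral>z. (k w z)\<^sup>2 \<partial>D w\<bar> \<le> c\<^sup>2" by (simp add: Dw.prob_space)
  have "(\<integral>z. (k w z)\<^sup>2 \<partial>D w) - (\<integral>z. k w z \<partial>D w)\<^sup>2 = Dw.variance (k w)"
    by (rule Dw.variance_eq[OF i1 i2, symmetric])
  then show "(\<integral>z. (k w z)\<^sup>2 \<partial>D w) - (\<integral>z. k w z \<partial>D w)\<^sup>2 \<ge> 0" by simp
qed

text \<open>For a frozen past the sample is i.i.d., so \<open>char_power_bound\<close> applies with
  t = u / sqrt N at every point. Its error is a deterministic constant, hence survives integration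
  over the past. Conditional mean and variance remain inside the integral because both are
  random.\<close>

lemma cond_char_bound:
  assumes k [measurable]: "(\<lambda>(w, z). k w z) \<in> borel_measurable (F \<Otimes>\<^sub>M L)"
    and c: "\<And>w z. w \<in> space P \<Longrightarrow> z \<in> space L \<Longrightarrow> \<bar>k w z\<bar> \<le> c" and N: "N \<ge> 1"
  defines "m \<equiv> \<lambda>w. \<integral>z. k w z \<partial>D w"
  defines "v \<equiv> \<lambda>w. (\<integral>z. (k w z)\<^sup>2 \<partial>D w) - (m w)\<^sup>2"
  shows "cmod ((\<integral>w. iexp (u * (sqrt N * ((\<Sum>l\<in>J. k w (Z l w)) / N))) \<partial>P)
      - (\<integral>w. iexp (u * (sqrt N * m w)) * of_real (exp (- u\<^sup>2 * v w / 2)) \<partial>P))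
    \<le> \<bar>u\<bar> ^ 3 * (2 * c) ^ 3 / (6 * sqrt N) + u ^ 4 * c ^ 4 / (8 * real N)"
proof -
  define t where "t = u / sqrt N"
  define e where "e = \<bar>u\<bar> ^ 3 * (2 * c) ^ 3 / (6 * sqrt N) + u ^ 4 * c ^ 4 / (8 * real N)"
  \<comment> \<open>Written as a function of the past and of the whole sample so that the
    disintegration applies; under the product law \<open>DN w\<close> its integral factors into an
    N-th power.\<close>
  define H where "H = (\<lambda>(w, z). \<Prod>l\<in>J. iexp (t * k w (z l)))"
  have comp [measurable]: "(\<lambda>x. k (fst x) (snd x l)) \<in> borel_measurable (F \<Otimes>\<^sub>M LN)" if l [measurable]: "l \<in> J" for l
  proof -
    have "(\<lambda>x. (fst x, snd x l)) \<in> F \<Otimes>\<^sub>M LN \<rightarrow>\<^sub>M F \<Otimes>\<^sub>M L" by measurable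
    from measurable_compose[OF this k] show ?thesis by (simp add: split_beta')
  qed
  have H [measurable]: "H \<in> borel_measurable (F \<Otimes>\<^sub>M LN)"
    unfolding H_def split_beta' by measurable
  have nH: "cmod (H x) \<le> 1" for x by (simp add: H_def split_beta' prod_norm[symmetric])
  have N0: "sqrt N > 0" "N > 0" using N by auto
  have HZ: "iexp (u * (sqrt N * ((\<Sum>l\<in>J. k w (Z l w)) / N))) = H (w, ZN w)" for w
  proof -
    have "sqrt N * (s / N) = s / sqrt N" for s
      using N0 by (simp add: field_simps)
    then have "u * (sqrt N * ((\<Sum>l\<in>J. k w (Z l w)) / N)) = (\<Sum>l\<in>J. t * k w (Z l w))"
      by (simp add: t_def sum_distrib_left sum_divide_distrib)
    then show ?thesis by (simp add: H_def exp_sum sum_distrib_left)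
  qed
  have ck: "cmod ((\<integral>z. H (w, z) \<partial>DN w) - iexp (u * (sqrt N * m w)) * of_real (exp (- u\<^sup>2 * v w / 2))) \<le> e"
    if w: "w \<in> space P" for w
  proof -
    interpret Dw: prob_space "D w" using w by (rule D_prob)
    interpret pr: product_sigma_finite "\<lambda>_. D w" ..
    have kw [measurable]: "k w \<in> borel_measurable (D w)"
      using measurable_Pair2[OF k] w by (simp add: measurable_cong_sets[OF D_sets[OF w] refl] space_F)
    have kb: "\<bar>k w z\<bar> \<le> c" if "z \<in> space (D w)" for z
      using that w c sets_eq_imp_space_eq[OF D_sets[OF w]] by auto
    have "(\<integral>z. H (w, z) \<partial>DN w) = (\<Prod>l\<in>J. \<integral>z. iexp (t * k w z) \<partial>D w)"
      unfolding H_def prod.case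
      by (rule pr.product_integral_prod) (auto intro!: Dw.integrable_const_bound[where B=1])
    also have "\<dots> = (\<integral>z. iexp (t * k w z) \<partial>D w) ^ N" by (simp add: J)
    finally have I: "(\<integral>z. H (w, z) \<partial>DN w) = (\<integral>z. iexp (t * k w z) \<partial>D w) ^ N" .
    have a1: "real N * t * m w = u * (sqrt N * m w)" using N0 by (simp add: t_def field_simps)
    have a2: "- real N * t\<^sup>2 * v w / 2 = - u\<^sup>2 * v w / 2" using N0 by (simp add: t_def power_divide)
    have a3: "real N * (\<bar>t\<bar> ^ 3 * (2 * c) ^ 3 / 6 + t ^ 4 * c ^ 4 / 8) = e"
    proof -
      have "real N * \<bar>t\<bar> ^ 3 = \<bar>u\<bar> ^ 3 / sqrt N"
        using N0 by (simp add: t_def power_divide power3_eq_cube abs_divide field_simps)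
      moreover have "real N * t ^ 4 = u ^ 4 / N"
        using N0 by (simp add: t_def power_divide power4_eq_xxxx field_simps)
      moreover have "real N * (\<bar>t\<bar> ^ 3 * (2 * c) ^ 3 / 6 + t ^ 4 * c ^ 4 / 8)
          = (real N * \<bar>t\<bar> ^ 3) * ((2 * c) ^ 3 / 6) + (real N * t ^ 4) * (c ^ 4 / 8)"
        by (simp add: distrib_left ac_simps)
      ultimately show ?thesis unfolding e_def by (simp add: ac_simps)
    qed
    show ?thesis
      using Dw.char_power_bound[OF kw kb, of t N] unfolding I a1[symmetric] a2[symmetric] a3[symmetric]
      by (simp add: m_def v_def)
  qed
  note H_int = integral_ZN(2)[OF H nH]
  have [measurable]: "m \<in> borel_measurable P" "(\<lambda>w. \<integral>z. (k w z)\<^sup>2 \<partial>D w) \<in> borel_measurable P"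
    unfolding m_def
    by (intro measurable_from_subalg[OF subalg] integral_measurable_kernel[OF _ measurable_prob_algebraD[OF kernel]];
        measurable)+
  then have [measurable]: "v \<in> borel_measurable P" unfolding v_def by measurable
  have v0: "0 \<le> v w" if w: "w \<in> space P" for w
    using mean_bounds(5)[OF k c w] unfolding v_def m_def by simp
  have int2: "integrable P (\<lambda>w. iexp (u * (sqrt N * m w)) * of_real (exp (- u\<^sup>2 * v w / 2)))"
    by (rule integrable_const_bound[where B=1]) (auto simp: norm_mult v0)
  have "cmod ((\<integral>w. iexp (u * (sqrt N * ((\<Sum>l\<in>J. k w (Z l w)) / N))) \<partial>P)
      - (\<integral>w. iexp (u * (sqrt N * m w)) * of_real (exp (- u\<^sup>2 * v w / 2)) \<partial>P))
    = cmod (\<integral>w. (\<integral>z. H (w, z) \<partial>DN w) - iexp (u * (sqrt N * m w)) * of_real (exp (- u\<^sup>2 * v w / 2)) \<partial>P)"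
    unfolding HZ integral_ZN(1)[OF H nH] by (subst Bochner_Integration.integral_diff[OF H_int int2]) simp
  also have "\<dots> \<le> (\<integral>w. cmod ((\<integral>z. H (w, z) \<partial>DN w) - iexp (u * (sqrt N * m w)) * of_real (exp (- u\<^sup>2 * v w / 2))) \<partial>P)"
    by (rule integral_norm_bound)
  also have "\<dots> \<le> (\<integral>w. e \<partial>P)"
    using H_int int2 by (intro integral_mono ck) auto
  also have "\<dots> = e" by (simp add: prob_space)
  finally show ?thesis unfolding e_def .
qed

end

lemma char_bound_tendsto_0: "(\<lambda>N. \<bar>u\<bar> ^ 3 * (2 * c) ^ 3 / (6 * sqrt (real N)) + u ^ 4 * c ^ 4 / (8 * real N)) \<longlonglongrightarrow> (0::real)"
  by real_asymp

section \<open>Limit theorems for arrays of conditionally i.i.d. samples\<close>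

text \<open>The exponent 1/4 is what linearising a ratio requires: the error is a product of two
  deviations, each of which absorbs one half of \<open>sqrt N\<close>.\<close>

abbreviation root4 :: "nat \<Rightarrow> real" where "root4 N \<equiv> sqrt (sqrt (real N))"

locale cond_iid_array = prob_sequence P for P :: "nat \<Rightarrow> 'w measure" +
  fixes F :: "nat \<Rightarrow> 'w measure" and L :: "nat \<Rightarrow> 'z measure"
    and Z :: "nat \<Rightarrow> nat \<Rightarrow> 'w \<Rightarrow> 'z" and D :: "nat \<Rightarrow> 'w \<Rightarrow> 'z measure"
  assumes sample: "N \<ge> 1 \<Longrightarrow> cond_iid_sample (P N) (F N) N {1..N} (L N) (Z N) (D N)"
begin

text \<open>After centring by the conditional mean and dividing by \<open>root4 N\<close>, the
  conditional variance is at most c^2 / sqrt N. The Gaussian factor in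
  \<open>cond_char_bound\<close> then tends to 1, so all characteristic functions of the deviation
  do.\<close>

lemma mean_deviation:
  assumes k: "\<And>N. N \<ge> 1 \<Longrightarrow> (\<lambda>(w, z). k N w z) \<in> borel_measurable (F N \<Otimes>\<^sub>M L N)"
    and c: "\<And>N w z. N \<ge> 1 \<Longrightarrow> w \<in> space (P N) \<Longrightarrow> z \<in> space (L N) \<Longrightarrow> \<bar>k N w z\<bar> \<le> c"
  shows "null_prob P (\<lambda>N w. root4 N * ((\<Sum>l\<in>{1..N}. k N w (Z N l w)) / N - (\<integral>z. k N w z \<partial>D N w)))"
    (is "null_prob P ?X")
proof (rule null_prob_of_char)
  fix N :: nat assume N: "N \<ge> 1"
  interpret cond_iid_sample "P N" "F N" N "{1..N}" "L N" "Z N" "D N" using N by (rule sample)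
  have "(\<lambda>w. \<integral>z. k N w z \<partial>D N w) \<in> borel_measurable (P N)"
    by (rule measurable_from_subalg[OF subalg mean_measurable[OF k[OF N]]])
  then show "?X N \<in> borel_measurable (P N)"
    by (intro borel_measurable_times borel_measurable_diff borel_measurable_divide borel_measurable_sum
        borel_measurable_const sample_measurable[OF k[OF N]])
next
  fix u :: real
  have bound: "cmod ((\<integral>w. iexp (u * ?X N w) \<partial>P N) - 1)
      \<le> (\<bar>u\<bar> ^ 3 * (2 * (2 * c)) ^ 3 / (6 * sqrt N) + u ^ 4 * (2 * c) ^ 4 / (8 * real N)) + u\<^sup>2 * c\<^sup>2 / (2 * sqrt N)"
    if N: "N \<ge> 1" for N
  proof -
    interpret cond_iid_sample "P N" "F N" N "{1..N}" "L N" "Z N" "D N" using N by (rule sample)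
    define m where "m w = (\<integral>z. k N w z \<partial>D N w)" for w
    define v where "v w = (\<integral>z. (k N w z)\<^sup>2 \<partial>D N w) - (m w)\<^sup>2" for w
    \<comment> \<open>The rate is moved inside the sum: \<open>sqrt N / root4 N\<close> equals
      \<open>root4 N\<close>, so the standard scaling of \<open>k'\<close> is the desired scaling of
      the deviation.\<close>
    define k' where "k' w z = (k N w z - m w) / root4 N" for w z
    note [measurable] = k[OF N]
    have mF [measurable]: "m \<in> borel_measurable (F N)"
      unfolding m_def by (rule mean_measurable[OF k[OF N]])
    have mP [measurable]: "m \<in> borel_measurable (P N)" by (rule measurable_from_subalg[OF subalg mF])
    have r: "root4 N \<ge> 1" "root4 N * root4 N = sqrt N" using N by simp_all
    have k' [measurable]: "(\<lambda>(w, z). k' w z) \<in> borel_measurable (F N \<Otimes>\<^sub>M L N)"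
      unfolding k'_def by measurable
    have kc: "\<And>w z. w \<in> space (P N) \<Longrightarrow> z \<in> space (L N) \<Longrightarrow> \<bar>k N w z\<bar> \<le> c" by (rule c[OF N])
    have mb: "integrable (D N w) (k N w)" "\<bar>m w\<bar> \<le> c" "integrable (D N w) (\<lambda>z. (k N w z)\<^sup>2)"
      "\<bar>\<integral>z. (k N w z)\<^sup>2 \<partial>D N w\<bar> \<le> c\<^sup>2" "v w \<ge> 0" if "w \<in> space (P N)" for w
      unfolding v_def m_def by (rule mean_bounds[OF k[OF N] kc that]; assumption)+
    have k'b: "\<bar>k' w z\<bar> \<le> 2 * c" if "w \<in> space (P N)" "z \<in> space (L N)" for w z
    proof -
      have "\<bar>k' w z\<bar> = \<bar>k N w z - m w\<bar> / root4 N" using r by (simp add: k'_def)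
      also have "\<dots> \<le> \<bar>k N w z - m w\<bar> / 1" using r by (intro divide_left_mono) auto
      also have "\<dots> \<le> 2 * c"
        unfolding div_by_1 using kc[OF that] mb(2)[OF that(1)] by linarith
      finally show ?thesis .
    qed
    have m0: "(\<integral>z. k' w z \<partial>D N w) = 0" if w: "w \<in> space (P N)" for w
    proof -
      interpret Dw: prob_space "D N w" using w by (rule D_prob)
      show ?thesis using mb(1)[OF w] by (simp add: k'_def m_def Dw.prob_space)
    qed
    have v': "(\<integral>z. (k' w z)\<^sup>2 \<partial>D N w) = v w / sqrt N" if w: "w \<in> space (P N)" for w
    proof -
      interpret Dw: prob_space "D N w" using w by (rule D_prob)
      have "(\<integral>z. (k' w z)\<^sup>2 \<partial>D N w) = Dw.variance (k N w) / sqrt N"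
        by (simp add: k'_def m_def power_divide)
      moreover have "Dw.variance (k N w) = v w"
        unfolding v_def m_def by (rule Dw.variance_eq[OF mb(1,3)[OF w]])
      ultimately show ?thesis by simp
    qed
    have X: "sqrt N * ((\<Sum>l\<in>{1..N}. k' w (Z N l w)) / N) = ?X N w" for w
    proof -
      have "(\<Sum>l\<in>{1..N}. k' w (Z N l w)) = ((\<Sum>l\<in>{1..N}. k N w (Z N l w)) - N * m w) / root4 N"
        by (simp add: k'_def sum_divide_distrib[symmetric] sum_subtractf)
      then have "sqrt N * ((\<Sum>l\<in>{1..N}. k' w (Z N l w)) / N)
          = sqrt N / root4 N * (((\<Sum>l\<in>{1..N}. k N w (Z N l w)) - N * m w) / N)"
        by simp
      moreover have "sqrt N / root4 N = root4 N" using r by (simp add: divide_eq_eq)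
      moreover have "((\<Sum>l\<in>{1..N}. k N w (Z N l w)) - N * m w) / N = (\<Sum>l\<in>{1..N}. k N w (Z N l w)) / N - m w"
        using N by (simp add: diff_divide_distrib)
      ultimately show ?thesis by (simp only: m_def)
    qed
    define E where "E = (\<integral>w. iexp (u * (sqrt N * (\<integral>z. k' w z \<partial>D N w))) *
      of_real (exp (- u\<^sup>2 * ((\<integral>z. (k' w z)\<^sup>2 \<partial>D N w) - (\<integral>z. k' w z \<partial>D N w)\<^sup>2) / 2)) \<partial>P N)"
    have b1: "cmod ((\<integral>w. iexp (u * ?X N w) \<partial>P N) - E)
        \<le> \<bar>u\<bar> ^ 3 * (2 * (2 * c)) ^ 3 / (6 * sqrt N) + u ^ 4 * (2 * c) ^ 4 / (8 * real N)"
      using cond_char_bound[OF k' k'b N, of u] unfolding X E_def .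
    have vP [measurable]: "v \<in> borel_measurable (P N)"
    proof -
      have "(\<lambda>w. \<integral>z. (k N w z)\<^sup>2 \<partial>D N w) \<in> borel_measurable (P N)"
        by (intro measurable_from_subalg[OF subalg] mean_measurable) measurable
      then show ?thesis unfolding v_def by measurable
    qed
    have v0: "0 \<le> v w" "v w \<le> c\<^sup>2" if w: "w \<in> space (P N)" for w
    proof -
      show "0 \<le> v w" by (rule mb(5)[OF w])
      show "v w \<le> c\<^sup>2" using mb(4)[OF w] zero_le_power2[of "m w"] unfolding v_def by linarith
    qed
    have "E = (\<integral>w. complex_of_real (exp (- (u\<^sup>2 * (v w / sqrt N) / 2))) \<partial>P N)"
      unfolding E_def by (intro Bochner_Integration.integral_cong) (auto simp: m0 v')
    then have E: "E = of_real (\<integral>w. exp (- (u\<^sup>2 * (v w / sqrt N) / 2)) \<partial>P N)" by simp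
    have i: "integrable (P N) (\<lambda>w. exp (- (u\<^sup>2 * (v w / sqrt N) / 2)))"
      by (rule integrable_const_bound[where B=1])
        (auto intro!: AE_I2 divide_nonneg_nonneg mult_nonneg_nonneg v0)
    have "\<bar>(\<integral>w. exp (- (u\<^sup>2 * (v w / sqrt N) / 2)) \<partial>P N) - 1\<bar> = \<bar>\<integral>w. exp (- (u\<^sup>2 * (v w / sqrt N) / 2)) - 1 \<partial>P N\<bar>"
      using i by (simp add: prob_space)
    also have "\<dots> \<le> (\<integral>w. \<bar>exp (- (u\<^sup>2 * (v w / sqrt N) / 2)) - 1\<bar> \<partial>P N)" by (rule integral_abs_bound)
    also have "\<dots> \<le> (\<integral>w. u\<^sup>2 * c\<^sup>2 / (2 * sqrt N) \<partial>P N)"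
    proof (rule integral_mono)
      fix w assume w: "w \<in> space (P N)"
      define y where "y = u\<^sup>2 * (v w / sqrt N) / 2"
      have y0: "0 \<le> y" using v0[OF w] by (simp add: y_def)
      have "\<bar>exp (- y) - 1\<bar> \<le> y" using y0 exp_ge_add_one_self[of "- y"] by simp
      also have "y \<le> u\<^sup>2 * (c\<^sup>2 / sqrt N) / 2"
        unfolding y_def using v0[OF w] by (intro divide_right_mono mult_left_mono) auto
      finally show "\<bar>exp (- (u\<^sup>2 * (v w / sqrt N) / 2)) - 1\<bar> \<le> u\<^sup>2 * c\<^sup>2 / (2 * sqrt N)"
        by (simp add: y_def field_simps)
    qed (use i in auto)
    finally have b2': "\<bar>(\<integral>w. exp (- (u\<^sup>2 * (v w / sqrt N) / 2)) \<partial>P N) - 1\<bar> \<le> u\<^sup>2 * c\<^sup>2 / (2 * sqrt N)"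
      by (simp add: prob_space)
    have "E - 1 = of_real ((\<integral>w. exp (- (u\<^sup>2 * (v w / sqrt N) / 2)) \<partial>P N) - 1)"
      unfolding E by (simp only: of_real_diff of_real_1)
    then have b2: "cmod (E - 1) \<le> u\<^sup>2 * c\<^sup>2 / (2 * sqrt N)" using b2' by (simp only: norm_of_real)
    have "cmod ((\<integral>w. iexp (u * ?X N w) \<partial>P N) - 1) = cmod (((\<integral>w. iexp (u * ?X N w) \<partial>P N) - E) + (E - 1))"
      by simp
    also have "\<dots> \<le> (\<bar>u\<bar> ^ 3 * (2 * (2 * c)) ^ 3 / (6 * sqrt N) + u ^ 4 * (2 * c) ^ 4 / (8 * real N)) + u\<^sup>2 * c\<^sup>2 / (2 * sqrt N)"
      by (rule norm_triangle_mono[OF b1 b2])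
    finally show ?thesis .
  qed
  have "(\<lambda>N. (\<bar>u\<bar> ^ 3 * (2 * (2 * c)) ^ 3 / (6 * sqrt (real N)) + u ^ 4 * (2 * c) ^ 4 / (8 * real N)) + u\<^sup>2 * c\<^sup>2 / (2 * sqrt (real N))) \<longlonglongrightarrow> 0 + 0"
  proof (rule tendsto_add[OF char_bound_tendsto_0])
    show "(\<lambda>N. u\<^sup>2 * c\<^sup>2 / (2 * sqrt (real N))) \<longlonglongrightarrow> 0" by real_asymp
  qed
  then have lim: "(\<lambda>N. (\<bar>u\<bar> ^ 3 * (2 * (2 * c)) ^ 3 / (6 * sqrt (real N)) + u ^ 4 * (2 * c) ^ 4 / (8 * real N)) + u\<^sup>2 * c\<^sup>2 / (2 * sqrt (real N))) \<longlonglongrightarrow> 0"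
    by (simp only: add_0)
  have "(\<lambda>N. (\<integral>w. iexp (u * ?X N w) \<partial>P N) - 1) \<longlonglongrightarrow> 0"
    by (rule Lim_null_comparison[OF eventually_sequentiallyI[of 1, OF bound] lim])
  then show "(\<lambda>N. \<integral>w. iexp (u * ?X N w) \<partial>P N) \<longlonglongrightarrow> 1" by (simp add: LIM_zero_iff)
qed

text \<open>The numerator fluctuates for two reasons: the conditional mean fluctuates with the past,
  with limiting variance \<open>G\<close>, and the sample fluctuates around it, with limiting
  variance \<open>s2\<close>. Conditionally on the past the second part is asymptotically Gaussian
  with a nonrandom variance, so the variances add. The denominator contributes only its limit
  \<open>b\<close>.\<close>

lemma ratio_clt:
  assumes k: "\<And>N. N \<ge> 1 \<Longrightarrow> (\<lambda>(w, z). k N w z) \<in> borel_measurable (F N \<Otimes>\<^sub>M L N)"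
    and kc: "\<And>N w z. N \<ge> 1 \<Longrightarrow> w \<in> space (P N) \<Longrightarrow> z \<in> space (L N) \<Longrightarrow> \<bar>k N w z\<bar> \<le> c"
    and l: "\<And>N. N \<ge> 1 \<Longrightarrow> (\<lambda>(w, z). l N w z) \<in> borel_measurable (F N \<Otimes>\<^sub>M L N)"
    and lc: "\<And>N w z. N \<ge> 1 \<Longrightarrow> w \<in> space (P N) \<Longrightarrow> z \<in> space (L N) \<Longrightarrow> \<bar>l N w z\<bar> \<le> d"
    and b: "b > 0" and s2: "s2 \<ge> 0"
    and l_mean: "null_prob P (\<lambda>N w. root4 N * ((\<integral>z. l N w z \<partial>D N w) - b))"
    and k_mean: "null_prob P (\<lambda>N w. root4 N * (\<integral>z. k N w z \<partial>D N w))"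
    and k_sq: "null_prob P (\<lambda>N w. (\<integral>z. (k N w z)\<^sup>2 \<partial>D N w) - s2)"
    and k_char: "\<And>u. (\<lambda>N. \<integral>w. iexp (u * (sqrt N * (\<integral>z. k N w z \<partial>D N w))) \<partial>P N) \<longlonglongrightarrow> of_real (exp (- u\<^sup>2 * G / 2))"
  shows "(\<lambda>N. \<integral>w. iexp (u * (sqrt N * ((\<Sum>i\<in>{1..N}. k N w (Z N i w)) / (\<Sum>i\<in>{1..N}. l N w (Z N i w))))) \<partial>P N)
    \<longlonglongrightarrow> of_real (exp (- u\<^sup>2 * ((G + s2) / b\<^sup>2) / 2))"
proof -
  define A where "A N w = (\<Sum>i\<in>{1..N}. k N w (Z N i w)) / real N" for N w
  define B where "B N w = (\<Sum>i\<in>{1..N}. l N w (Z N i w)) / real N" for N w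
  define m where "m N w = (\<integral>z. k N w z \<partial>D N w)" for N w
  define v where "v N w = (\<integral>z. (k N w z)\<^sup>2 \<partial>D N w) - (m N w)\<^sup>2" for N w
  define u' where "u' = u / b"
  have meas: "A N \<in> borel_measurable (P N)" "B N \<in> borel_measurable (P N)" "m N \<in> borel_measurable (P N)"
    "v N \<in> borel_measurable (P N)" if N: "N \<ge> 1" for N
  proof -
    interpret cond_iid_sample "P N" "F N" N "{1..N}" "L N" "Z N" "D N" using N by (rule sample)
    show "A N \<in> borel_measurable (P N)" "B N \<in> borel_measurable (P N)"
      unfolding A_def B_def
      by (intro borel_measurable_divide borel_measurable_sum borel_measurable_const
          sample_measurable[OF k[OF N]] sample_measurable[OF l[OF N]]; assumption)+
    show m: "m N \<in> borel_measurable (P N)"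
      unfolding m_def by (rule measurable_from_subalg[OF subalg mean_measurable[OF k[OF N]]])
    note [measurable] = k[OF N]
    have "(\<lambda>w. \<integral>z. (k N w z)\<^sup>2 \<partial>D N w) \<in> borel_measurable (P N)"
      by (intro measurable_from_subalg[OF subalg] mean_measurable) measurable
    with m show "v N \<in> borel_measurable (P N)" unfolding v_def by measurable
  qed
  have v0: "0 \<le> v N w" if N: "N \<ge> 1" and w: "w \<in> space (P N)" for N w
  proof -
    interpret cond_iid_sample "P N" "F N" N "{1..N}" "L N" "Z N" "D N" using N by (rule sample)
    show ?thesis unfolding v_def m_def by (rule mean_bounds(5)[OF k[OF N] kc[OF N] w])
  qed
  have A0: "null_prob P (\<lambda>N w. root4 N * A N w)"
  proof -
    have "null_prob P (\<lambda>N w. root4 N * (A N w - m N w))"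
      unfolding A_def m_def by (rule mean_deviation[where c=c]) (auto intro: k kc)
    from null_prob_add[OF this k_mean[folded m_def]] show ?thesis
      unfolding distrib_left[symmetric] by simp
  qed
  have B0: "null_prob P (\<lambda>N w. root4 N * (B N w - b))"
  proof -
    have "null_prob P (\<lambda>N w. root4 N * (B N w - (\<integral>z. l N w z \<partial>D N w)))"
      unfolding B_def by (rule mean_deviation[where c=d]) (auto intro: l lc)
    from null_prob_add[OF this l_mean] show ?thesis
      unfolding distrib_left[symmetric] by simp
  qed
  have B1: "null_prob P (\<lambda>N w. B N w - b)"
    by (rule null_prob_rate[OF B0]) (intro borel_measurable_diff meas borel_measurable_const; assumption)
  have m0: "null_prob P m"
    by (rule null_prob_rate[OF k_mean[folded m_def] meas(3)])
  \<comment> \<open>The conditional mean tends to 0, so conditional variance and conditional second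
    moment have the same limit.\<close>
  have v1: "null_prob P (\<lambda>N w. v N w - s2)"
  proof -
    have eq: "v N w - s2 = ((\<integral>z. (k N w z)\<^sup>2 \<partial>D N w) - s2) - m N w * m N w" for N w
      by (simp add: v_def power2_eq_square)
    show ?thesis unfolding eq by (rule null_prob_diff[OF k_sq null_prob_mult[OF m0 m0]])
  qed
  \<comment> \<open>The difference equals -(1/b) (root4 N A) (root4 N (B - b)) / B: both factors
    vanish in probability and B tends to b.\<close>
  have diff: "null_prob P (\<lambda>N w. sqrt N * (A N w / B N w) - sqrt N * (A N w / b))"
  proof (rule null_prob_comparison[OF B1 null_prob_divide[OF null_prob_cmult[OF null_prob_mult[OF A0 B0], of "- 1 / b"] B1 b meas(2)], where c="1 + max 1 (2 / b)"])
    fix N :: nat assume N: "1 \<le> N"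
    show "(\<lambda>w. sqrt N * (A N w / B N w) - sqrt N * (A N w / b)) \<in> borel_measurable (P N)"
      using meas[OF N] by measurable
    have r: "root4 N * root4 N = sqrt N" by simp
    have alg: "(x * x) * y * (b - z) / (b * z) = - 1 / b * (x * y * (x * (z - b))) / z" if "z \<noteq> 0" for x y z :: real
      using that b by (simp add: field_simps)
    have eq: "sqrt N * (A N w / B N w) - sqrt N * (A N w / b) = - 1 / b * (root4 N * A N w * (root4 N * (B N w - b))) / B N w"
      if "B N w \<noteq> 0" for w
    proof -
      have "sqrt N * (A N w / B N w) - sqrt N * (A N w / b) = sqrt N * A N w * (b - B N w) / (b * B N w)"
        using that b by (simp add: field_simps)
      also have "\<dots> = (root4 N * root4 N) * A N w * (b - B N w) / (b * B N w)" unfolding r ..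
      also have "\<dots> = - 1 / b * (root4 N * A N w * (root4 N * (B N w - b))) / B N w"
        by (rule alg[OF that])
      finally show ?thesis .
    qed
    show "AE w in P N. min 1 \<bar>sqrt N * (A N w / B N w) - sqrt N * (A N w / b)\<bar>
      \<le> (1 + max 1 (2 / b)) * (min 1 \<bar>B N w - b\<bar> + min 1 \<bar>- 1 / b * (root4 N * A N w * (root4 N * (B N w - b))) / B N w\<bar>)"
    proof (rule AE_I2)
      fix w
      show "min 1 \<bar>sqrt N * (A N w / B N w) - sqrt N * (A N w / b)\<bar>
        \<le> (1 + max 1 (2 / b)) * (min 1 \<bar>B N w - b\<bar> + min 1 \<bar>- 1 / b * (root4 N * A N w * (root4 N * (B N w - b))) / B N w\<bar>)"
      proof (cases "B N w = 0")
        \<comment> \<open>The identity for the difference fails here because division by 0 yields 0.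
          The event is absorbed by the other comparison term, since B = 0 deviates from its limit by
          b.\<close>
        case True
        have "1 \<le> (1 + max 1 (2 / b)) * min 1 b"
        proof (cases "b \<ge> 1")
          case False
          have "1 = (2 / b) * (b / 2)" using b by simp
          also have "\<dots> \<le> (1 + max 1 (2 / b)) * b" using b by (intro mult_mono) auto
          finally show ?thesis using False by simp
        qed simp
        then show ?thesis using True b by simp
      next
        case False
        have "min 1 \<bar>sqrt N * (A N w / B N w) - sqrt N * (A N w / b)\<bar>
          = 1 * (0 + min 1 \<bar>- 1 / b * (root4 N * A N w * (root4 N * (B N w - b))) / B N w\<bar>)"
          unfolding eq[OF False] by simp
        also have "\<dots> \<le> (1 + max 1 (2 / b)) * (min 1 \<bar>B N w - b\<bar> + min 1 \<bar>- 1 / b * (root4 N * A N w * (root4 N * (B N w - b))) / B N w\<bar>)"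
          by (intro mult_mono add_right_mono) auto
        finally show ?thesis .
      qed
    qed
  qed
  have step1: "(\<lambda>N. (\<integral>w. iexp (u * (sqrt N * (A N w / B N w))) \<partial>P N) - (\<integral>w. iexp (u * (sqrt N * (A N w / b))) \<partial>P N)) \<longlonglongrightarrow> 0"
    using char_diff_tendsto[OF _ _ diff _ , where W="\<lambda>_ _. 1" and u=u] meas by simp
  \<comment> \<open>The Gaussian characteristic function conditionally on the past: its phase is the
    conditional mean, its damping the conditional variance.\<close>
  define C where "C N w = iexp (u' * (sqrt (real N) * m N w)) * of_real (exp (- u'\<^sup>2 * v N w / 2))" for N w
  have step2: "(\<lambda>N. (\<integral>w. iexp (u' * (sqrt N * A N w)) \<partial>P N) - (\<integral>w. C N w \<partial>P N)) \<longlonglongrightarrow> 0"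
  proof (rule Lim_null_comparison[OF eventually_sequentiallyI[of 1] char_bound_tendsto_0[of u' c]])
    fix N :: nat assume N: "1 \<le> N"
    interpret cond_iid_sample "P N" "F N" N "{1..N}" "L N" "Z N" "D N" using N by (rule sample)
    show "norm ((\<integral>w. iexp (u' * (sqrt N * A N w)) \<partial>P N) - (\<integral>w. C N w \<partial>P N))
        \<le> \<bar>u'\<bar> ^ 3 * (2 * c) ^ 3 / (6 * sqrt (real N)) + u' ^ 4 * c ^ 4 / (8 * real N)"
      using cond_char_bound[OF k[OF N] kc[OF N] N, of u'] unfolding A_def C_def m_def v_def by simp
  qed
  define e where "e = exp (- u'\<^sup>2 * s2 / 2)"
  have exp_null: "null_prob P (\<lambda>N w. exp (- u'\<^sup>2 * v N w / 2) - e)"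
  proof (rule null_prob_le[OF null_prob_cmult[OF v1, of "u'\<^sup>2 / 2"]])
    fix N :: nat assume N: "1 \<le> N"
    show "(\<lambda>w. exp (- u'\<^sup>2 * v N w / 2) - e) \<in> borel_measurable (P N)" using meas[OF N] by measurable
    show "AE w in P N. \<bar>exp (- u'\<^sup>2 * v N w / 2) - e\<bar> \<le> \<bar>u'\<^sup>2 / 2 * (v N w - s2)\<bar>"
    proof (rule AE_I2)
      fix w assume w: "w \<in> space (P N)"
      have le: "exp (- x) - exp (- y) \<le> \<bar>x - y\<bar>" if "0 \<le> x" "0 \<le> y" for x y :: real
      proof (cases "x \<le> y")
        case True
        have "exp (- x) - exp (- y) = exp (- x) * (1 - exp (- (y - x)))" by (simp add: algebra_simps exp_add[symmetric])
        also have "\<dots> \<le> 1 * (y - x)"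
        proof (rule mult_mono)
          show "1 - exp (- (y - x)) \<le> y - x" using exp_ge_add_one_self[of "- (y - x)"] by linarith
        qed (use that True in auto)
        finally show ?thesis using True by simp
      next
        case False
        then have "exp (- x) \<le> exp (- y)" by simp
        then show ?thesis by linarith
      qed
      define x where "x = u'\<^sup>2 * v N w / 2"
      define y where "y = u'\<^sup>2 * s2 / 2"
      have "0 \<le> x" "0 \<le> y" using v0[OF N w] s2 by (auto simp: x_def y_def)
      from le[OF this] le[OF this(2,1)] have "\<bar>exp (- x) - exp (- y)\<bar> \<le> \<bar>x - y\<bar>" by linarith
      moreover have "x - y = u'\<^sup>2 / 2 * (v N w - s2)" by (simp add: x_def y_def right_diff_distrib)
      moreover have "exp (- u'\<^sup>2 * v N w / 2) = exp (- x)" "e = exp (- y)" by (simp_all add: x_def y_def e_def)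
      ultimately show "\<bar>exp (- u'\<^sup>2 * v N w / 2) - e\<bar> \<le> \<bar>u'\<^sup>2 / 2 * (v N w - s2)\<bar>"
        by (simp only:)
    qed
  qed
  \<comment> \<open>The damping converges in probability to the constant \<open>e\<close> and can
    leave the integral. What remains is the characteristic function of the scaled conditional mean,
    whose limit is the hypothesis \<open>k_char\<close>.\<close>
  have step3: "(\<lambda>N. (\<integral>w. C N w \<partial>P N) - (\<integral>w. iexp (u' * (sqrt N * m N w)) \<partial>P N) * of_real e) \<longlonglongrightarrow> 0"
  proof (rule Lim_null_comparison[OF eventually_sequentiallyI[of 1] null_prob_L1[OF exp_null, of 2]])
    have e1: "0 \<le> e" "e \<le> 1" using s2 by (auto simp: e_def)
    fix N :: nat assume N: "1 \<le> N"
    note [measurable] = meas[OF N]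
    have x1: "exp (- u'\<^sup>2 * v N w / 2) \<le> 1" if "w \<in> space (P N)" for w using v0[OF N that] by simp
    show "AE w in P N. \<bar>exp (- u'\<^sup>2 * v N w / 2) - e\<bar> \<le> 2"
    proof (rule AE_I2)
      fix w assume "w \<in> space (P N)"
      from x1[OF this] e1 exp_ge_zero[of "- u'\<^sup>2 * v N w / 2"]
      show "\<bar>exp (- u'\<^sup>2 * v N w / 2) - e\<bar> \<le> 2" by linarith
    qed
    have i1: "integrable (P N) (C N)" unfolding C_def
      using N x1 by (intro integrable_bounded[where B=1]) (auto simp: norm_mult)
    have i2: "integrable (P N) (\<lambda>w. iexp (u' * (sqrt N * m N w)) * of_real e)"
      using N e1 by (intro integrable_bounded[where B=1]) (auto simp: norm_mult)
    have "(\<integral>w. C N w \<partial>P N) - (\<integral>w. iexp (u' * (sqrt N * m N w)) \<partial>P N) * of_real e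
      = (\<integral>w. C N w - iexp (u' * (sqrt N * m N w)) * of_real e \<partial>P N)"
      by (subst Bochner_Integration.integral_diff[OF i1 i2]) simp
    also have "cmod \<dots> \<le> (\<integral>w. cmod (C N w - iexp (u' * (sqrt N * m N w)) * of_real e) \<partial>P N)"
      by (rule integral_norm_bound)
    also have "\<dots> = (\<integral>w. \<bar>exp (- u'\<^sup>2 * v N w / 2) - e\<bar> \<partial>P N)"
    proof (rule Bochner_Integration.integral_cong[OF refl])
      fix w
      have "C N w - iexp (u' * (sqrt N * m N w)) * of_real e
          = iexp (u' * (sqrt N * m N w)) * of_real (exp (- u'\<^sup>2 * v N w / 2) - e)"
        unfolding C_def of_real_diff by (simp add: algebra_simps)
      then show "cmod (C N w - iexp (u' * (sqrt N * m N w)) * of_real e) = \<bar>exp (- u'\<^sup>2 * v N w / 2) - e\<bar>"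
        by (simp only: norm_mult norm_of_real norm_exp_i_times mult_1_left real_norm_def)
    qed
    finally show "norm ((\<integral>w. C N w \<partial>P N) - (\<integral>w. iexp (u' * (sqrt N * m N w)) \<partial>P N) * of_real e)
      \<le> (\<integral>w. \<bar>exp (- u'\<^sup>2 * v N w / 2) - e\<bar> \<partial>P N)" .
  qed
  have step4: "(\<lambda>N. (\<integral>w. iexp (u' * (sqrt N * m N w)) \<partial>P N) * of_real e) \<longlonglongrightarrow> of_real (exp (- u'\<^sup>2 * G / 2)) * of_real e"
    unfolding m_def by (intro tendsto_mult k_char tendsto_const)
  have "of_real (exp (- u'\<^sup>2 * G / 2)) * of_real e = (of_real (exp (- u\<^sup>2 * ((G + s2) / b\<^sup>2) / 2)) :: complex)"
  proof -
    have "- u'\<^sup>2 * G / 2 + - u'\<^sup>2 * s2 / 2 = - u\<^sup>2 * ((G + s2) / b\<^sup>2) / 2"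
      by (simp add: u'_def power_divide add_divide_distrib diff_divide_distrib distrib_left)
    then show ?thesis unfolding of_real_mult[symmetric] e_def exp_add[symmetric] by simp
  qed
  with step4 have lim: "(\<lambda>N. (\<integral>w. iexp (u' * (sqrt N * m N w)) \<partial>P N) * of_real e) \<longlonglongrightarrow> complex_of_real (exp (- u\<^sup>2 * ((G + s2) / b\<^sup>2) / 2))"
    by simp
  have uu: "u * (sqrt N * (A N w / b)) = u' * (sqrt N * A N w)" for N w by (simp add: u'_def)
  have ratio: "(\<Sum>i\<in>{1..N}. k N w (Z N i w)) / (\<Sum>i\<in>{1..N}. l N w (Z N i w)) = A N w / B N w" for N w
    by (cases "N = 0") (auto simp: A_def B_def)
  from tendsto_add[OF tendsto_add[OF step1[unfolded uu] step2] tendsto_add[OF step3 lim]]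
  show ?thesis unfolding ratio by simp
qed

end

section \<open>Weighted samples satisfying a central limit theorem\<close>

context prob_sequence
begin

text \<open>Based on x/y - p/q = ((x - p) - (p/q)(y - q)) / y, so that only deviations at the given
  rate appear in the numerator. The quotient enters as a separate \<open>z\<close> because
  conditional means equal such quotients only almost surely.\<close>

lemma null_prob_ratio:
  assumes x: "null_prob P (\<lambda>N w. r N * (x N w - p))" and y: "null_prob P (\<lambda>N w. r N * (y N w - q))"
    and y': "null_prob P (\<lambda>N w. y N w - q)" and q: "q > 0"
    and meas: "\<And>N. N \<ge> 1 \<Longrightarrow> x N \<in> borel_measurable (P N)" "\<And>N. N \<ge> 1 \<Longrightarrow> y N \<in> borel_measurable (P N)"
    and pos: "\<And>N. N \<ge> 1 \<Longrightarrow> AE w in P N. 0 < y N w"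
    and z: "\<And>N. N \<ge> 1 \<Longrightarrow> z N \<in> borel_measurable (P N)" "\<And>N. N \<ge> 1 \<Longrightarrow> AE w in P N. z N w = x N w / y N w"
  shows "null_prob P (\<lambda>N w. r N * (z N w - p / q))"
proof (rule null_prob_le)
  show "null_prob P (\<lambda>N w. (r N * (x N w - p) - p / q * (r N * (y N w - q))) / y N w)"
    by (rule null_prob_divide[OF null_prob_diff[OF x null_prob_cmult[OF y]] y' q meas(2)])
  fix N :: nat assume N: "N \<ge> 1"
  show "(\<lambda>w. r N * (z N w - p / q)) \<in> borel_measurable (P N)" using z(1)[OF N] by simp
  show "AE w in P N. \<bar>r N * (z N w - p / q)\<bar> \<le> \<bar>(r N * (x N w - p) - p / q * (r N * (y N w - q))) / y N w\<bar>"
    using pos[OF N] z(2)[OF N]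
  proof eventually_elim
    case (elim w)
    have "r N * (z N w - p / q) = (r N * (x N w - p) - p / q * (r N * (y N w - q))) / y N w"
      using elim q by (simp add: field_simps)
    then show ?case by simp
  qed
qed

end

definition wmean :: "nat \<Rightarrow> (nat \<Rightarrow> 'w \<Rightarrow> 'a) \<Rightarrow> (nat \<Rightarrow> 'w \<Rightarrow> real) \<Rightarrow> ('a \<Rightarrow> real) \<Rightarrow> 'w \<Rightarrow> real" where
  "wmean N xi wt f w = (\<Sum>i\<in>{1..N}. wt i w * f (xi i w)) / (\<Sum>i\<in>{1..N}. wt i w)"

locale weighted_samples = prob_sequence P for P :: "nat \<Rightarrow> 'w measure" +
  fixes mu :: "'a measure" and xi :: "nat \<Rightarrow> nat \<Rightarrow> 'w \<Rightarrow> 'a" and wt :: "nat \<Rightarrow> nat \<Rightarrow> 'w \<Rightarrow> real"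
  assumes prob_mu: "prob_space mu"
    and xi_meas: "N \<ge> 1 \<Longrightarrow> i \<in> {1..N} \<Longrightarrow> xi N i \<in> P N \<rightarrow>\<^sub>M mu"
    and wt_meas: "N \<ge> 1 \<Longrightarrow> i \<in> {1..N} \<Longrightarrow> wt N i \<in> borel_measurable (P N)"
    and wt_nonneg: "N \<ge> 1 \<Longrightarrow> i \<in> {1..N} \<Longrightarrow> w \<in> space (P N) \<Longrightarrow> 0 \<le> wt N i w"
    and wt_pos: "N \<ge> 1 \<Longrightarrow> AE w in P N. 0 < (\<Sum>i\<in>{1..N}. wt N i w)"
begin

sublocale mu: prob_space mu by (rule prob_mu)

abbreviation "avg N \<equiv> wmean N (xi N) (wt N)"

lemma avg_measurable:
  assumes N: "N \<ge> 1" and f: "f \<in> borel_measurable mu"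
  shows "avg N f \<in> borel_measurable (P N)"
proof -
  have "(\<lambda>w. wt N i w * f (xi N i w)) \<in> borel_measurable (P N)" if "i \<in> {1..N}" for i
    using wt_meas[OF N that] measurable_compose[OF xi_meas[OF N that] f] by (rule borel_measurable_times)
  then show ?thesis
    unfolding wmean_def using wt_meas[OF N] by (intro borel_measurable_divide borel_measurable_sum)
qed

text \<open>Holds at every outcome, including those of total weight 0, where the average is 0 by the
  convention for division. Almost sure statements therefore need not be threaded through the
  boundedness arguments.\<close>

lemma avg_bound:
  assumes N: "N \<ge> 1" and w: "w \<in> space (P N)" and f: "\<And>x. x \<in> space mu \<Longrightarrow> \<bar>f x\<bar> \<le> c" and c: "0 \<le> c"
  shows "\<bar>avg N f w\<bar> \<le> c"
proof -
  let ?S = "\<Sum>i\<in>{1..N}. wt N i w"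
  have S: "0 \<le> ?S" using wt_nonneg[OF N _ w] by (intro sum_nonneg) auto
  have "\<bar>\<Sum>i\<in>{1..N}. wt N i w * f (xi N i w)\<bar> \<le> (\<Sum>i\<in>{1..N}. \<bar>wt N i w * f (xi N i w)\<bar>)" by (rule sum_abs)
  also have "\<dots> \<le> (\<Sum>i\<in>{1..N}. wt N i w * c)"
    using wt_nonneg[OF N _ w] measurable_space[OF xi_meas[OF N] w] f
    by (intro sum_mono) (auto simp: abs_mult intro!: mult_left_mono)
  also have "\<dots> = ?S * c" by (simp add: sum_distrib_right)
  finally show ?thesis
    unfolding wmean_def using S c by (cases "?S = 0") (auto simp: abs_divide divide_le_eq mult.commute)
qed

lemma avg_affine:
  assumes "0 < (\<Sum>i\<in>{1..N}. wt N i w)"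
  shows "avg N (\<lambda>x. (f x - a) / b) w = (avg N f w - a) / b"
proof -
  have "(\<Sum>i\<in>{1..N}. wt N i w * ((f (xi N i w) - a) / b))
      = ((\<Sum>i\<in>{1..N}. wt N i w * f (xi N i w)) - a * (\<Sum>i\<in>{1..N}. wt N i w)) / b"
    by (simp add: sum_divide_distrib sum_subtractf sum_distrib_left right_diff_distrib mult.commute[of a] flip: sum_divide_distrib)
  then show ?thesis using assms unfolding wmean_def by (simp add: diff_divide_distrib divide_divide_eq_left mult.commute)
qed

end

text \<open>The test functions are allowed to depend on \<open>N\<close>. This yields a law of large numbers at
  rate \<open>N powr (1/4)\<close> (scale the functions down) and, in the end, handles test functions that
  depend on the other filter.\<close>

locale clt_samples = weighted_samples P mu xi wt for P :: "nat \<Rightarrow> 'w measure" and mu :: "'a measure" and xi wt +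
  fixes G :: "('a \<Rightarrow> real) \<Rightarrow> real"
  assumes G_zero: "G (\<lambda>_. 0) = 0"
    and clt: "\<lbrakk>\<And>N. f N \<in> borel_measurable mu; fl \<in> borel_measurable mu;
      \<And>N x. x \<in> space mu \<Longrightarrow> \<bar>f N x\<bar> \<le> c; \<And>x. x \<in> space mu \<Longrightarrow> \<bar>fl x\<bar> \<le> c;
      \<And>N. (\<integral>x. f N x \<partial>mu) = 0; (\<lambda>N. \<integral>x. \<bar>f N x - fl x\<bar> \<partial>mu) \<longlonglongrightarrow> 0\<rbrakk> \<Longrightarrow>
      (\<lambda>N. \<integral>w. iexp (u * (sqrt N * avg N (f N) w)) \<partial>P N) \<longlonglongrightarrow> of_real (exp (- u\<^sup>2 * G fl / 2))"
begin

text \<open>The centred functions divided by \<open>root4 N\<close> tend to 0 uniformly, so the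
  limit law in \<open>clt\<close> has variance \<open>G (\<lambda>_. 0) = 0\<close>. A
  characteristic function tending to 1 gives convergence to 0 in probability, and
  \<open>sqrt N / root4 N\<close> is again \<open>root4 N\<close>.\<close>

lemma lln_rate:
  assumes g: "\<And>N. g N \<in> borel_measurable mu" and c: "\<And>N x. x \<in> space mu \<Longrightarrow> \<bar>g N x\<bar> \<le> c"
  shows "null_prob P (\<lambda>N w. root4 N * (avg N (g N) w - (\<integral>x. g N x \<partial>mu)))"
proof -
  define f where "f N x = (g N x - (\<integral>x. g N x \<partial>mu)) / root4 N" for N x
  have int: "integrable mu (g N)" for N
    by (rule mu.integrable_const_bound[where B=c]) (auto intro!: AE_I2 c g)
  have c0: "0 \<le> c" using mu.not_empty c abs_ge_zero order_trans by blast
  have m: "\<bar>\<integral>x. g N x \<partial>mu\<bar> \<le> c" for N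
  proof -
    have "\<bar>\<integral>x. g N x \<partial>mu\<bar> \<le> (\<integral>x. \<bar>g N x\<bar> \<partial>mu)" by (rule integral_abs_bound)
    also have "\<dots> \<le> (\<integral>x. c \<partial>mu)" using int by (intro integral_mono) (auto intro: c)
    finally show ?thesis by (simp add: mu.prob_space)
  qed
  have fm: "f N \<in> borel_measurable mu" for N unfolding f_def using g by measurable
  have fr: "\<bar>f N x\<bar> \<le> 2 * c / root4 N" if "x \<in> space mu" for N x
  proof -
    have "\<bar>f N x\<bar> = \<bar>g N x - (\<integral>x. g N x \<partial>mu)\<bar> / root4 N" by (simp add: f_def abs_divide)
    also have "\<dots> \<le> 2 * c / root4 N"
      using c[OF that, of N] m[of N] by (intro divide_right_mono) auto
    finally show ?thesis .
  qed
  have fc: "\<bar>f N x\<bar> \<le> 2 * c" if "x \<in> space mu" for N x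
  proof (cases "N = 0")
    case False
    then have "1 \<le> root4 N" by simp
    then have "2 * c / root4 N \<le> 2 * c / 1" using c0 by (intro divide_left_mono) auto
    with fr[OF that, of N] show ?thesis by simp
  qed (use c0 in \<open>simp add: f_def\<close>)
  have "(\<lambda>N. 2 * c / root4 N) \<longlonglongrightarrow> 0" by real_asymp
  then have f0: "(\<lambda>N. \<integral>x. \<bar>f N x - 0\<bar> \<partial>mu) \<longlonglongrightarrow> 0"
  proof (rule Lim_null_comparison[rotated])
    have "norm (\<integral>x. \<bar>f N x - 0\<bar> \<partial>mu) \<le> 2 * c / root4 N" for N
    proof -
      have "integrable mu (f N)"
        by (rule mu.integrable_const_bound[where B="2 * c"]) (auto intro!: AE_I2 fc fm)
      then have "(\<integral>x. \<bar>f N x\<bar> \<partial>mu) \<le> (\<integral>x. 2 * c / root4 N \<partial>mu)"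
        by (intro integral_mono) (auto intro: fr)
      then show ?thesis by (simp add: mu.prob_space)
    qed
    then show "\<forall>\<^sub>F N in sequentially. norm (\<integral>x. \<bar>f N x - 0\<bar> \<partial>mu) \<le> 2 * c / root4 N" by simp
  qed
  have fi: "(\<integral>x. f N x \<partial>mu) = 0" for N
    unfolding f_def using int by (simp add: mu.prob_space)
  have "null_prob P (\<lambda>N w. sqrt N * avg N (f N) w)"
  proof (rule null_prob_of_char)
    show "(\<lambda>w. sqrt N * avg N (f N) w) \<in> borel_measurable (P N)" if "N \<ge> 1" for N
      using avg_measurable[OF that fm] by simp
    have "(\<lambda>N. \<integral>w. iexp (u * (sqrt N * avg N (f N) w)) \<partial>P N) \<longlonglongrightarrow> of_real (exp (- u\<^sup>2 * G (\<lambda>_. 0) / 2))" for u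
      using clt[OF fm _ fc _ fi f0, of u] c0 by simp
    then show "(\<lambda>N. \<integral>w. iexp (u * (sqrt N * avg N (f N) w)) \<partial>P N) \<longlonglongrightarrow> 1" for u
      by (simp add: G_zero)
  qed
  then show ?thesis
  proof (rule null_prob_le)
    fix N :: nat assume N: "N \<ge> 1"
    show "(\<lambda>w. root4 N * (avg N (g N) w - (\<integral>x. g N x \<partial>mu))) \<in> borel_measurable (P N)"
      using avg_measurable[OF N g] by simp
    show "AE w in P N. \<bar>root4 N * (avg N (g N) w - (\<integral>x. g N x \<partial>mu))\<bar> \<le> \<bar>sqrt N * avg N (f N) w\<bar>"
      using wt_pos[OF N]
    proof eventually_elim
      case (elim w)
      have "sqrt N * (y / root4 N) = root4 N * y" for y
        using N by (simp add: field_simps)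
      then show ?case unfolding f_def avg_affine[OF elim] by simp
    qed
  qed
qed

lemma lln:
  assumes g: "\<And>N. g N \<in> borel_measurable mu" and c: "\<And>N x. x \<in> space mu \<Longrightarrow> \<bar>g N x\<bar> \<le> c"
  shows "null_prob P (\<lambda>N w. avg N (g N) w - (\<integral>x. g N x \<partial>mu))"
proof (rule null_prob_rate)
  show "null_prob P (\<lambda>N w. root4 N * (avg N (g N) w - (\<integral>x. g N x \<partial>mu)))" by (rule lln_rate[OF g c])
qed (intro borel_measurable_diff avg_measurable g borel_measurable_const)

end

section \<open>The initial generation\<close>

lemma (in prob_space) expectation_bounded:
  fixes f :: "'a \<Rightarrow> real"
  assumes f: "f \<in> borel_measurable M" and c: "\<And>x. x \<in> space M \<Longrightarrow> \<bar>f x\<bar> \<le> c"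
  shows "integrable M f" "\<bar>expectation f\<bar> \<le> c"
proof -
  show i: "integrable M f" by (rule integrable_const_bound[where B=c]) (auto intro!: AE_I2 c f)
  have "\<bar>expectation f\<bar> \<le> expectation (\<lambda>x. \<bar>f x\<bar>)" by (rule integral_abs_bound)
  also have "\<dots> \<le> expectation (\<lambda>x. c)" using i by (intro integral_mono) (auto intro: c)
  finally show "\<bar>expectation f\<bar> \<le> c" by (simp add: prob_space)
qed

text \<open>An i.i.d. sample is conditionally i.i.d. given the trivial sigma-field, where
  conditional expectations are constants. This lets the start of each filter use the same ratio
  theorem as the later generations.\<close>

lemma (in prob_space) cond_iid_trivial:
  assumes N: "N \<ge> 1" and indep: "indep_vars (\<lambda>_. L) X {1..N}"
    and distr: "\<And>l. l \<in> {1..N} \<Longrightarrow> distr M L (X l) = R"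
  shows "cond_iid M (sigma (space M) {}) N L X (\<lambda>_. R)"
  unfolding cond_iid_def
proof (intro allI impI)
  fix A :: "nat \<Rightarrow> 'b set"
  assume A: "\<forall>l\<in>{1..N}. A l \<in> sets L"
  let ?F = "sigma (space M) {}" and ?S = "{w \<in> space M. \<forall>l\<in>{1..N}. X l w \<in> A l}"
  have setsF: "sets ?F = {{}, space M}" by (simp add: sigma_sets_empty_eq)
  interpret finite_measure_subalgebra M ?F
    by unfold_locales (auto simp: subalgebra_def setsF)
  have X: "X l \<in> M \<rightarrow>\<^sub>M L" if "l \<in> {1..N}" for l
    using indep that by (auto simp: indep_vars_def)
  have S_eq: "?S = (\<Inter>l\<in>{1..N}. X l -` A l \<inter> space M)" using N by auto
  have S [measurable]: "?S \<in> sets M" unfolding S_eq using A N X by (intro sets.finite_INT) auto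
  have "prob ?S = (\<Prod>l\<in>{1..N}. prob (X l -` A l \<inter> space M))"
    unfolding S_eq using A N by (intro indep_varsD[OF indep]) auto
  also have "\<dots> = (\<Prod>l\<in>{1..N}. measure R (A l))"
    using A X distr[symmetric] by (intro prod.cong refl) (simp add: measure_distr)
  finally have pS: "prob ?S = (\<Prod>l\<in>{1..N}. measure R (A l))" .
  show "AE w in M. real_cond_exp M ?F (indicator ?S) w = (\<Prod>l\<in>{1..N}. measure R (A l))"
  proof (rule real_cond_exp_charact)
    fix B assume "B \<in> sets ?F"
    then consider "B = {}" | "B = space M" unfolding setsF by auto
    then show "(\<integral>w\<in>B. indicator ?S w \<partial>M) = (\<integral>w\<in>B. (\<Prod>l\<in>{1..N}. measure R (A l)) \<partial>M)"
    proof cases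
      case 2
      have "?S \<inter> space M = ?S" by auto
      moreover have "(\<integral>w\<in>B. indicator ?S w \<partial>M) = (\<integral>w. indicator ?S w \<partial>M :: real)"
        unfolding set_lebesgue_integral_def 2 by (intro Bochner_Integration.integral_cong) auto
      moreover have "(\<integral>w\<in>B. (\<Prod>l\<in>{1..N}. measure R (A l)) \<partial>M) = (\<integral>w. (\<Prod>l\<in>{1..N}. measure R (A l)) \<partial>M)"
        unfolding set_lebesgue_integral_def 2 by (intro Bochner_Integration.integral_cong) auto
      ultimately show ?thesis unfolding pS[symmetric] using S by (simp add: prob_space del: Collect_restrict)
    qed (simp add: set_lebesgue_integral_def)
  next
    have "(indicator ?S :: _ \<Rightarrow> real) \<in> borel_measurable M" using S by (rule borel_measurable_indicator)
    then show "integrable M (indicator ?S :: _ \<Rightarrow> real)"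
      by (rule integrable_const_bound[rotated, where B=1]) (auto split: split_indicator)
  qed auto
qed

text \<open>The base case for both filters: importance sampling of \<open>mu\<close>, proportional
  to \<open>om\<close> times \<open>R\<close>, from \<open>R\<close>. There is no past to fluctuate,
  so the whole limiting variance is the second moment of the weighted test function over the squared
  mean weight.\<close>

lemma (in prob_sequence) iid_clt_samples:
  assumes R: "prob_space R" "sets R = sets L" and mu: "prob_space mu" "sets mu = sets L"
    and X: "\<And>N i. N \<ge> 1 \<Longrightarrow> i \<in> {1..N} \<Longrightarrow> X N i \<in> P N \<rightarrow>\<^sub>M L"
    and indep: "\<And>N. N \<ge> 1 \<Longrightarrow> prob_space.indep_vars (P N) (\<lambda>_. L) (X N) {1..N}"
    and distr: "\<And>N i. N \<ge> 1 \<Longrightarrow> i \<in> {1..N} \<Longrightarrow> distr (P N) L (X N i) = R"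
    and om: "om \<in> borel_measurable L" "\<And>x. x \<in> space L \<Longrightarrow> 0 \<le> om x" "\<And>x. x \<in> space L \<Longrightarrow> om x \<le> C"
    and b: "b = (\<integral>x. om x \<partial>R)" "b > 0"
    and mu_eq: "\<And>f c. f \<in> borel_measurable L \<Longrightarrow> (\<And>x. x \<in> space L \<Longrightarrow> \<bar>f x\<bar> \<le> c) \<Longrightarrow>
      b * (\<integral>x. f x \<partial>mu) = (\<integral>x. om x * f x \<partial>R)"
    and pos: "\<And>N. N \<ge> 1 \<Longrightarrow> AE w in P N. 0 < (\<Sum>i\<in>{1..N}. om (X N i w))"
    and G: "\<And>f. G f = (\<integral>x. (om x)\<^sup>2 * (f x)\<^sup>2 \<partial>R) / (\<integral>x. om x \<partial>R)\<^sup>2"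
  shows "clt_samples P mu X (\<lambda>N i w. om (X N i w)) G"
proof -
  interpret R: prob_space R by fact
  have sp: "space R = space L" "space mu = space L" using R mu by (auto dest: sets_eq_imp_space_eq)
  note [measurable_cong] = R(2) mu(2)
  note [measurable] = om(1)
  interpret weighted_samples P mu X "\<lambda>N i w. om (X N i w)"
  proof (intro weighted_samples.intro weighted_samples_axioms.intro)
    show "prob_sequence P" by (rule prob_sequence_axioms)
    show "prob_space mu" by fact
    fix N i :: nat assume N: "N \<ge> 1"
    show "AE w in P N. 0 < (\<Sum>i\<in>{1..N}. om (X N i w))" by (rule pos[OF N])
    assume i: "i \<in> {1..N}"
    from X[OF N i] show "X N i \<in> P N \<rightarrow>\<^sub>M mu" by measurable
    show "(\<lambda>w. om (X N i w)) \<in> borel_measurable (P N)" by (rule measurable_compose[OF X[OF N i] om(1)])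
    fix w assume "w \<in> space (P N)"
    then show "0 \<le> om (X N i w)" using measurable_space[OF X[OF N i]] by (intro om(2))
  qed
  interpret cond_iid_array P "\<lambda>N. sigma (space (P N)) {}" "\<lambda>_. L" X "\<lambda>_ _. R"
  proof (intro cond_iid_array.intro cond_iid_array_axioms.intro prob_sequence_axioms)
    fix N :: nat assume N: "N \<ge> 1"
    interpret PN: prob_space "P N" by (rule prob_P[OF N])
    show "cond_iid_sample (P N) (sigma (space (P N)) {}) N {1..N} L (X N) (\<lambda>_. R)"
    proof
      show "(\<lambda>_. R) \<in> sigma (space (P N)) {} \<rightarrow>\<^sub>M prob_algebra L"
        using R by (intro measurable_const) (simp add: space_prob_algebra)
      show "cond_iid (P N) (sigma (space (P N)) {}) N L (X N) (\<lambda>_. R)"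
        by (rule PN.cond_iid_trivial[OF N indep[OF N] distr[OF N]])
    qed (auto simp: subalgebra_def sigma_sets_empty_eq intro: X[OF N])
  qed
  show ?thesis
  proof
    show "G (\<lambda>_. 0) = 0" by (simp add: G)
    fix f :: "nat \<Rightarrow> 'a \<Rightarrow> real" and fl :: "'a \<Rightarrow> real" and c u :: real
    assume f: "\<And>N. f N \<in> borel_measurable mu" "fl \<in> borel_measurable mu"
      "\<And>N x. x \<in> space mu \<Longrightarrow> \<bar>f N x\<bar> \<le> c" "\<And>x. x \<in> space mu \<Longrightarrow> \<bar>fl x\<bar> \<le> c"
      "\<And>N. (\<integral>x. f N x \<partial>mu) = 0" and lim: "(\<lambda>N. \<integral>x. \<bar>f N x - fl x\<bar> \<partial>mu) \<longlonglongrightarrow> 0"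
    have fm [measurable]: "f N \<in> borel_measurable L" "fl \<in> borel_measurable L" for N using f by (auto cong: measurable_cong_sets[OF mu(2)])
    have C0: "0 \<le> C" using R.not_empty om(2,3) order_trans unfolding sp by blast
    have kf: "\<bar>om x * f N x\<bar> \<le> C * c" if "x \<in> space L" for N x
      using om(2,3)[OF that] f(3)[of x N] that C0 by (auto simp: abs_mult sp intro!: mult_mono)
    define s2 where "s2 = (\<integral>x. (om x)\<^sup>2 * (fl x)\<^sup>2 \<partial>R)"
    \<comment> \<open>Convergence in L1 suffices for squares of bounded functions, since a^2 - b^2 =
      (a + b)(a - b). One factor \<open>om\<close> is bounded by C, the other is kept to turn the
      integral over \<open>R\<close> into one over \<open>mu\<close>.\<close>
    have sq_lim: "(\<lambda>N. (\<integral>x. (om x * f N x)\<^sup>2 \<partial>R) - s2) \<longlonglongrightarrow> 0"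
    proof (rule Lim_null_comparison[OF always_eventually])
      show "(\<lambda>N. C * (2 * c) * (b * (\<integral>x. \<bar>f N x - fl x\<bar> \<partial>mu))) \<longlonglongrightarrow> 0"
        using lim by (auto intro!: tendsto_eq_intros)
      show "\<forall>N. norm ((\<integral>x. (om x * f N x)\<^sup>2 \<partial>R) - s2) \<le> C * (2 * c) * (b * (\<integral>x. \<bar>f N x - fl x\<bar> \<partial>mu))"
      proof
        fix N
        have fd: "\<bar>\<bar>f N x - fl x\<bar>\<bar> \<le> 2 * c" if "x \<in> space L" for x
          using f(3)[of x N] f(4)[of x] that by (auto simp: sp)
        have omc: "\<bar>om x * \<bar>f N x - fl x\<bar>\<bar> \<le> C * (2 * c)" if "x \<in> space L" for x
          using om(2,3)[OF that] fd[OF that] C0 by (auto simp: abs_mult intro!: mult_mono)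
        have b1: "\<bar>(om x * f N x)\<^sup>2\<bar> \<le> (C * c)\<^sup>2" if "x \<in> space R" for x
          using power_mono[OF kf[of x N], of 2] that by (simp add: sp)
        have kfl: "\<bar>om x * fl x\<bar> \<le> C * c" if "x \<in> space L" for x
          using om(2,3)[OF that] f(4)[of x] that C0 by (auto simp: abs_mult sp intro!: mult_mono)
        have b2: "\<bar>(om x)\<^sup>2 * (fl x)\<^sup>2\<bar> \<le> (C * c)\<^sup>2" if "x \<in> space R" for x
          using power_mono[OF kfl[of x], of 2] that by (simp add: sp power_mult_distrib)
        have i1: "integrable R (\<lambda>x. (om x * f N x)\<^sup>2)"
          by (rule R.expectation_bounded(1)[OF _ b1]) measurable
        have i2: "integrable R (\<lambda>x. (om x)\<^sup>2 * (fl x)\<^sup>2)"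
          by (rule R.expectation_bounded(1)[OF _ b2]) measurable
        have i3: "integrable R (\<lambda>x. om x * \<bar>f N x - fl x\<bar>)"
          using omc sp by (intro R.expectation_bounded(1)) auto
        have "\<bar>(\<integral>x. (om x * f N x)\<^sup>2 \<partial>R) - s2\<bar> = \<bar>\<integral>x. (om x * f N x)\<^sup>2 - (om x)\<^sup>2 * (fl x)\<^sup>2 \<partial>R\<bar>"
          unfolding s2_def using i1 i2 by simp
        also have "\<dots> \<le> (\<integral>x. \<bar>(om x * f N x)\<^sup>2 - (om x)\<^sup>2 * (fl x)\<^sup>2\<bar> \<partial>R)" by (rule integral_abs_bound)
        also have "\<dots> \<le> (\<integral>x. C * (2 * c) * (om x * \<bar>f N x - fl x\<bar>) \<partial>R)"
        proof (rule integral_mono)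
          fix x assume "x \<in> space R"
          then have x: "x \<in> space L" by (simp add: sp)
          have "\<bar>(om x * f N x)\<^sup>2 - (om x)\<^sup>2 * (fl x)\<^sup>2\<bar> = om x * \<bar>f N x + fl x\<bar> * (om x * \<bar>f N x - fl x\<bar>)"
          proof -
            have "(om x * f N x)\<^sup>2 - (om x)\<^sup>2 * (fl x)\<^sup>2 = om x * (f N x + fl x) * (om x * (f N x - fl x))"
              by (simp add: power2_eq_square algebra_simps)
            then show ?thesis using om(2)[OF x] by (simp add: abs_mult)
          qed
          also have "\<dots> \<le> C * (2 * c) * (om x * \<bar>f N x - fl x\<bar>)"
            using om(2,3)[OF x] f(3)[of x N] f(4)[of x] x C0
            by (intro mult_right_mono mult_mono) (auto simp: sp)
          finally show "\<bar>(om x * f N x)\<^sup>2 - (om x)\<^sup>2 * (fl x)\<^sup>2\<bar> \<le> C * (2 * c) * (om x * \<bar>f N x - fl x\<bar>)" .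
        qed (use i1 i2 i3 in auto)
        also have "\<dots> = C * (2 * c) * (b * (\<integral>x. \<bar>f N x - fl x\<bar> \<partial>mu))"
          by (subst mu_eq[OF _ fd]) auto
        finally show "norm ((\<integral>x. (om x * f N x)\<^sup>2 \<partial>R) - s2) \<le> C * (2 * c) * (b * (\<integral>x. \<bar>f N x - fl x\<bar> \<partial>mu))"
          by simp
      qed
    qed
    have mean0: "(\<integral>x. om x * f N x \<partial>R) = 0" for N
      using mu_eq[OF fm(1) f(3), of N] f(5)[of N] by (simp add: sp)
    \<comment> \<open>The conditional mean is exactly 0, so this contribution has variance
      0.\<close>
    have char1: "(\<lambda>N. \<integral>w. iexp (u * (sqrt N * (\<integral>x. om x * f N x \<partial>R))) \<partial>P N) \<longlonglongrightarrow> of_real (exp (- u\<^sup>2 * 0 / 2))" for u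
    proof (rule tendsto_eventually, rule eventually_sequentiallyI[of 1])
      fix N :: nat assume "1 \<le> N"
      then interpret PN: prob_space "P N" by (rule prob_P)
      show "(\<integral>w. iexp (u * (sqrt N * (\<integral>x. om x * f N x \<partial>R))) \<partial>P N) = of_real (exp (- u\<^sup>2 * 0 / 2))"
        unfolding mean0 by (simp add: PN.prob_space)
    qed
    have "(\<lambda>N. \<integral>w. iexp (u * (sqrt N * ((\<Sum>i\<in>{1..N}. om (X N i w) * f N (X N i w)) / (\<Sum>i\<in>{1..N}. om (X N i w))))) \<partial>P N)
      \<longlonglongrightarrow> of_real (exp (- u\<^sup>2 * ((0 + s2) / b\<^sup>2) / 2))"
    proof (rule ratio_clt[where k="\<lambda>N w z. om z * f N z" and l="\<lambda>N w z. om z" and c="C * c" and d=C])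
      show "null_prob P (\<lambda>N w. root4 N * ((\<integral>z. om z \<partial>R) - b))"
        "null_prob P (\<lambda>N w. root4 N * (\<integral>z. om z * f N z \<partial>R))"
        unfolding mean0 b(1) by (simp_all add: null_prob_const)
      show "null_prob P (\<lambda>N w. (\<integral>z. (om z * f N z)\<^sup>2 \<partial>R) - s2)"
        by (rule null_prob_const[OF sq_lim])
      show "0 \<le> s2" unfolding s2_def by (rule integral_nonneg_AE) simp
    qed (use om b kf char1 in auto)
    then show "(\<lambda>N. \<integral>w. iexp (u * (sqrt N * avg N (f N) w)) \<partial>P N) \<longlonglongrightarrow> of_real (exp (- u\<^sup>2 * G fl / 2))"
      unfolding wmean_def G s2_def b(1)[symmetric] by simp
  qed
qed

section \<open>One step of importance sampling\<close>

text \<open>The index ranges over a finite set, so the function is a finite sum of pieces, each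
  supported where the index is a fixed j.\<close>

lemma measurable_indexed:
  fixes g :: "nat \<Rightarrow> 'w \<Rightarrow> 'a \<Rightarrow> real"
  assumes g: "\<And>j. j \<in> J \<Longrightarrow> (\<lambda>(w, x). g j w x) \<in> borel_measurable (F \<Otimes>\<^sub>M L)" and J: "finite J"
  shows "(\<lambda>(w, z). g (fst z) w (snd z)) \<in> borel_measurable (F \<Otimes>\<^sub>M (count_space J \<Otimes>\<^sub>M L))"
proof -
  have "(\<lambda>y. \<Sum>j\<in>J. if fst (snd y) = j then g j (fst y) (snd (snd y)) else 0)
      \<in> borel_measurable (F \<Otimes>\<^sub>M (count_space J \<Otimes>\<^sub>M L))"
  proof (rule borel_measurable_sum)
    fix j assume j: "j \<in> J"
    have "(\<lambda>y. (fst y, snd (snd y))) \<in> F \<Otimes>\<^sub>M (count_space J \<Otimes>\<^sub>M L) \<rightarrow>\<^sub>M F \<Otimes>\<^sub>M L" by measurable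
    from measurable_compose[OF this g[OF j]]
    have [measurable]: "(\<lambda>y. g j (fst y) (snd (snd y))) \<in> borel_measurable (F \<Otimes>\<^sub>M (count_space J \<Otimes>\<^sub>M L))" by simp
    have [measurable]: "(\<lambda>y. fst (snd y)) \<in> F \<Otimes>\<^sub>M (count_space J \<Otimes>\<^sub>M L) \<rightarrow>\<^sub>M count_space J" by measurable
    have "{y \<in> space (F \<Otimes>\<^sub>M (count_space J \<Otimes>\<^sub>M L)). fst (snd y) = j} \<in> sets (F \<Otimes>\<^sub>M (count_space J \<Otimes>\<^sub>M L))"
      using j by measurable
    then show "(\<lambda>y. if fst (snd y) = j then g j (fst y) (snd (snd y)) else 0)
        \<in> borel_measurable (F \<Otimes>\<^sub>M (count_space J \<Otimes>\<^sub>M L))"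
      by (intro measurable_If) measurable
  qed
  then show ?thesis
    by (rule measurable_cong[THEN iffD1, rotated]) (use J in \<open>auto simp: space_pair_measure\<close>)
qed

text \<open>One step common to both filters. \<open>K\<close> is the unnormalised kernel carrying
  the old target \<open>mu\<close> to the new target \<open>mu'\<close>; an ancestor is drawn with
  adjustment \<open>theta\<close>, moved by the proposal density \<open>p\<close>, and weighted by
  \<open>om\<close>, where \<open>om * theta * p = K\<close>. In the backward filter the first
  argument of these functions is the later state.\<close>

locale smc_step = clt_samples P mu xi wt G
  for P :: "nat \<Rightarrow> 'w measure" and mu :: "'a measure" and xi wt G +
  fixes lam :: "'a measure" and theta :: "'a \<Rightarrow> real" and p K om :: "'a \<Rightarrow> 'a \<Rightarrow> real" and mu' :: "'a measure"
    and F :: "nat \<Rightarrow> 'w measure" and anc :: "nat \<Rightarrow> nat \<Rightarrow> 'w \<Rightarrow> nat" and xi' :: "nat \<Rightarrow> nat \<Rightarrow> 'w \<Rightarrow> 'a"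
    and tgt :: "nat \<Rightarrow> 'w \<Rightarrow> nat \<times> 'a \<Rightarrow> ennreal" and Ct Co :: real
  assumes sf_lam: "sigma_finite_measure lam"
    and sets_mu: "sets mu = sets lam" and prob_mu': "prob_space mu'" and sets_mu': "sets mu' = sets lam"
    and theta: "theta \<in> borel_measurable lam" "\<And>x. x \<in> space lam \<Longrightarrow> 0 \<le> theta x" "\<And>x. x \<in> space lam \<Longrightarrow> theta x \<le> Ct"
    and p: "markov_density lam p"
    and om: "(\<lambda>(x, x'). om x x') \<in> borel_measurable (lam \<Otimes>\<^sub>M lam)"
      "\<And>x x'. x \<in> space lam \<Longrightarrow> x' \<in> space lam \<Longrightarrow> 0 \<le> om x x'"
      "\<And>x x'. x \<in> space lam \<Longrightarrow> x' \<in> space lam \<Longrightarrow> om x x' \<le> Co"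
    and K_meas: "(\<lambda>(x, x'). K x x') \<in> borel_measurable (lam \<Otimes>\<^sub>M lam)"
    and K_eq: "\<And>x x'. x \<in> space lam \<Longrightarrow> x' \<in> space lam \<Longrightarrow> om x x' * (theta x * p x x') = K x x'"
    and K_pos: "0 < (\<integral>x. (\<integral>x'. K x x' \<partial>lam) \<partial>mu)"
    and mu'_eq: "\<And>f c. f \<in> borel_measurable lam \<Longrightarrow> (\<And>x. x \<in> space lam \<Longrightarrow> \<bar>f x\<bar> \<le> c) \<Longrightarrow>
      (\<integral>x. (\<integral>x'. K x x' \<partial>lam) \<partial>mu) * (\<integral>x. f x \<partial>mu') = (\<integral>x. (\<integral>x'. K x x' * f x' \<partial>lam) \<partial>mu)"
    and sub: "\<And>N. N \<ge> 1 \<Longrightarrow> subalgebra (P N) (F N)"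
    and xi_F: "\<And>N i. N \<ge> 1 \<Longrightarrow> i \<in> {1..N} \<Longrightarrow> xi N i \<in> F N \<rightarrow>\<^sub>M lam"
    and wt_F: "\<And>N i. N \<ge> 1 \<Longrightarrow> i \<in> {1..N} \<Longrightarrow> wt N i \<in> borel_measurable (F N)"
    and anc_meas: "\<And>N i. N \<ge> 1 \<Longrightarrow> i \<in> {1..N} \<Longrightarrow> anc N i \<in> P N \<rightarrow>\<^sub>M count_space {1..N}"
    and xi'_meas: "\<And>N i. N \<ge> 1 \<Longrightarrow> i \<in> {1..N} \<Longrightarrow> xi' N i \<in> P N \<rightarrow>\<^sub>M lam"
    and tgt: "\<And>N w i x. N \<ge> 1 \<Longrightarrow> w \<in> space (P N) \<Longrightarrow> i \<in> {1..N} \<Longrightarrow> x \<in> space lam \<Longrightarrow>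
      tgt N w (i, x) = ennreal (wt N i w) * ennreal (theta (xi N i w) * p (xi N i w) x)"
    and sampling: "\<And>N. N \<ge> 1 \<Longrightarrow> cond_iid (P N) (F N) N (count_space {1..N} \<Otimes>\<^sub>M lam)
      (\<lambda>l w. (anc N l w, xi' N l w)) (\<lambda>w. normalized_density (count_space {1..N} \<Otimes>\<^sub>M lam) (tgt N w))"
    and normalizer: "\<And>N. N \<ge> 1 \<Longrightarrow> AE w in P N. 0 < (\<integral>\<^sup>+z. tgt N w z \<partial>(count_space {1..N} \<Otimes>\<^sub>M lam))"
    and wt'_pos: "\<And>N. N \<ge> 1 \<Longrightarrow> AE w in P N. 0 < (\<Sum>i\<in>{1..N}. om (xi N (anc N i w) w) (xi' N i w))"
begin

sublocale lam: sigma_finite_measure lam by (rule sf_lam)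
sublocale mu': prob_space mu' by (rule prob_mu')

lemma space_mu: "space mu = space lam" "space mu' = space lam"
  using sets_mu sets_mu' by (auto dest: sets_eq_imp_space_eq)

lemma p_meas: "(\<lambda>(x, x'). p x x') \<in> borel_measurable (lam \<Otimes>\<^sub>M lam)"
  using p by (simp add: markov_density_def)

lemma p_density:
  assumes x: "x \<in> space lam"
  shows "p x \<in> borel_measurable lam" "\<And>x'. x' \<in> space lam \<Longrightarrow> 0 \<le> p x x'" "(\<integral>\<^sup>+x'. ennreal (p x x') \<partial>lam) = 1"
    "integrable lam (p x)" "(\<integral>x'. p x x' \<partial>lam) = 1"
proof -
  show m: "p x \<in> borel_measurable lam" and n: "\<And>x'. x' \<in> space lam \<Longrightarrow> 0 \<le> p x x'"
    and i: "(\<integral>\<^sup>+x'. ennreal (p x x') \<partial>lam) = 1"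
    using p x by (auto simp: markov_density_def prob_density_def)
  show "integrable lam (p x)" using m n i by (intro integrableI_nn_integral_finite[where x=1]) (auto intro: AE_I2)
  show "(\<integral>x'. p x x' \<partial>lam) = 1" using m n i by (subst integral_eq_nn_integral) (auto intro: AE_I2)
qed

section \<open>The conditional law of a new generation\<close>

definition nu where "nu N = count_space {1..N::nat} \<Otimes>\<^sub>M lam"
definition S where "S N w = (\<Sum>i\<in>{1..N}. wt N i w * theta (xi N i w))"
text \<open>Selection probabilities of the ancestors. On the null event where the total adjusted
  weight is not positive they are set to the uniform law, so that \<open>D\<close> is a probability
  measure at every outcome and can serve as a kernel.\<close>

definition a where "a N i w = (if S N w > 0 then wt N i w * theta (xi N i w) / S N w else 1 / real N)"
definition D where "D N w = density (nu N) (\<lambda>z. ennreal (a N (fst z) w * p (xi N (fst z) w) (snd z)))"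

lemma sf_nu: "sigma_finite_measure (nu N)"
  unfolding nu_def
  by (intro sigma_finite_pair_measure sf_lam sigma_finite_measure_count_space_finite) simp

lemma xi_space: "N \<ge> 1 \<Longrightarrow> i \<in> {1..N} \<Longrightarrow> w \<in> space (P N) \<Longrightarrow> xi N i w \<in> space lam"
  using measurable_space[OF xi_meas, of N i w] by (simp add: space_mu)

lemma space_FN: "N \<ge> 1 \<Longrightarrow> space (F N) = space (P N)"
  using sub[of N] by (simp add: subalgebra_def)

lemma S_F: "N \<ge> 1 \<Longrightarrow> S N \<in> borel_measurable (F N)"
  unfolding S_def by (intro borel_measurable_sum borel_measurable_times wt_F measurable_compose[OF xi_F theta(1)])

lemma a_F: assumes N: "N \<ge> 1" and i: "i \<in> {1..N}" shows "a N i \<in> borel_measurable (F N)"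
proof -
  note [measurable] = S_F[OF N] wt_F[OF N i] measurable_compose[OF xi_F[OF N i] theta(1)]
  show ?thesis unfolding a_def by measurable
qed

lemma a_nonneg: "N \<ge> 1 \<Longrightarrow> i \<in> {1..N} \<Longrightarrow> w \<in> space (P N) \<Longrightarrow> 0 \<le> a N i w"
  unfolding a_def by (auto intro!: divide_nonneg_nonneg mult_nonneg_nonneg wt_nonneg theta(2) xi_space)

lemma a_sum: "N \<ge> 1 \<Longrightarrow> (\<Sum>i\<in>{1..N}. a N i w) = 1"
proof (cases "S N w > 0")
  case True
  then have "(\<Sum>i\<in>{1..N}. a N i w) = S N w / S N w"
    unfolding a_def by (simp add: sum_divide_distrib[symmetric]) (simp add: S_def)
  then show ?thesis using True by simp
qed (simp add: a_def)

lemma p_xi_F: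
  assumes N: "N \<ge> 1" and i: "i \<in> {1..N}"
    and k: "(\<lambda>(x, x'). k x x') \<in> borel_measurable (lam \<Otimes>\<^sub>M lam)"
  shows "(\<lambda>(w, x). k (xi N i w) x :: real) \<in> borel_measurable (F N \<Otimes>\<^sub>M lam)"
proof -
  note [measurable] = xi_F[OF N i]
  have "(\<lambda>y. (xi N i (fst y), snd y)) \<in> F N \<Otimes>\<^sub>M lam \<rightarrow>\<^sub>M lam \<Otimes>\<^sub>M lam" by measurable
  from measurable_compose[OF this k] show ?thesis by (simp add: split_beta')
qed

lemma dens_F:
  assumes N: "N \<ge> 1"
  shows "(\<lambda>(w, z). a N (fst z) w * p (xi N (fst z) w) (snd z)) \<in> borel_measurable (F N \<Otimes>\<^sub>M nu N)"
  unfolding nu_def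
proof (rule measurable_indexed[where g="\<lambda>j w x. a N j w * p (xi N j w) x"])
  fix j assume j: "j \<in> {1..N}"
  note [measurable] = a_F[OF N j] p_xi_F[OF N j p_meas]
  show "(\<lambda>(w, x). a N j w * p (xi N j w) x) \<in> borel_measurable (F N \<Otimes>\<^sub>M lam)" by measurable
qed simp

lemma dens_nu:
  assumes N: "N \<ge> 1" and w: "w \<in> space (P N)"
  shows "(\<lambda>z. a N (fst z) w * p (xi N (fst z) w) (snd z)) \<in> borel_measurable (nu N)"
    "\<And>z. z \<in> space (nu N) \<Longrightarrow> 0 \<le> a N (fst z) w * p (xi N (fst z) w) (snd z)"
proof -
  show "(\<lambda>z. a N (fst z) w * p (xi N (fst z) w) (snd z)) \<in> borel_measurable (nu N)"
    using measurable_Pair2[OF dens_F[OF N], of w] w by (simp add: space_FN[OF N])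
  show "0 \<le> a N (fst z) w * p (xi N (fst z) w) (snd z)" if "z \<in> space (nu N)" for z
    using that by (auto simp: nu_def space_pair_measure intro!: mult_nonneg_nonneg a_nonneg[OF N _ w] p_density(2) xi_space[OF N _ w])
qed

lemma D_prob:
  assumes N: "N \<ge> 1" and w: "w \<in> space (P N)"
  shows "prob_space (D N w)" "sets (D N w) = sets (nu N)"
proof -
  show "sets (D N w) = sets (nu N)" by (simp add: D_def)
  have "(\<integral>\<^sup>+z. ennreal (a N (fst z) w * p (xi N (fst z) w) (snd z)) \<partial>nu N)
      = (\<integral>\<^sup>+i. \<integral>\<^sup>+x. ennreal (a N i w * p (xi N i w) x) \<partial>lam \<partial>count_space {1..N})"
    using dens_nu(1)[OF N w] unfolding nu_def by (subst lam.nn_integral_fst[symmetric]) auto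
  also have "\<dots> = (\<Sum>i\<in>{1..N}. \<integral>\<^sup>+x. ennreal (a N i w * p (xi N i w) x) \<partial>lam)"
    by (rule nn_integral_count_space_finite) simp
  also have "\<dots> = (\<Sum>i\<in>{1..N}. ennreal (a N i w))"
  proof (rule sum.cong[OF refl])
    fix i assume i: "i \<in> {1..N}"
    have "(\<integral>\<^sup>+x. ennreal (a N i w * p (xi N i w) x) \<partial>lam) = (\<integral>\<^sup>+x. ennreal (a N i w) * ennreal (p (xi N i w) x) \<partial>lam)"
      by (intro nn_integral_cong ennreal_mult' a_nonneg[OF N i w])
    also have "\<dots> = ennreal (a N i w)"
      using p_density(1,3)[OF xi_space[OF N i w]] by (subst nn_integral_cmult) auto
    finally show "(\<integral>\<^sup>+x. ennreal (a N i w * p (xi N i w) x) \<partial>lam) = ennreal (a N i w)" .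
  qed
  also have "\<dots> = 1" using a_nonneg[OF N _ w] a_sum[OF N] by (subst sum_ennreal) auto
  finally have "emeasure (D N w) (space (D N w)) = 1"
    using dens_nu(1)[OF N w] by (simp add: D_def emeasure_density cong: nn_integral_cong)
  then show "prob_space (D N w)" by (rule prob_spaceI)
qed

lemma D_kernel:
  assumes N: "N \<ge> 1"
  shows "D N \<in> F N \<rightarrow>\<^sub>M prob_algebra (nu N)"
proof (rule measurable_prob_algebra_generated[OF sets.sigma_sets_eq[symmetric] sets.Int_stable sets.space_closed])
  fix w assume "w \<in> space (F N)"
  then show "prob_space (D N w)" "sets (D N w) = sets (nu N)" using D_prob[OF N] by (auto simp: space_FN[OF N])
next
  fix A assume A [measurable]: "A \<in> sets (nu N)"
  interpret nu: sigma_finite_measure "nu N" by (rule sf_nu)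
  note [measurable] = dens_F[OF N]
  have "(\<lambda>w. \<integral>\<^sup>+z. ennreal (a N (fst z) w * p (xi N (fst z) w) (snd z)) * indicator A z \<partial>nu N) \<in> borel_measurable (F N)"
    by measurable
  then show "(\<lambda>w. emeasure (D N w) A) \<in> borel_measurable (F N)"
  proof (rule measurable_cong[THEN iffD1, rotated])
    fix w assume "w \<in> space (F N)"
    then show "(\<integral>\<^sup>+z. ennreal (a N (fst z) w * p (xi N (fst z) w) (snd z)) * indicator A z \<partial>nu N) = emeasure (D N w) A"
      using dens_nu(1)[OF N, of w] by (simp add: D_def emeasure_density space_FN[OF N])
  qed
qed

lemma D_integral:
  assumes N: "N \<ge> 1" and w: "w \<in> space (P N)"
    and g: "(\<lambda>z. g (fst z) (snd z)) \<in> borel_measurable (nu N)" and c: "\<And>i x. i \<in> {1..N} \<Longrightarrow> x \<in> space lam \<Longrightarrow> \<bar>g i x\<bar> \<le> c"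
  shows "(\<integral>z. g (fst z) (snd z) \<partial>D N w) = (\<Sum>i\<in>{1..N}. a N i w * (\<integral>x. p (xi N i w) x * g i x \<partial>lam))"
proof -
  interpret Dw: prob_space "D N w" by (rule D_prob(1)[OF N w])
  interpret pr: pair_sigma_finite "count_space {1..N}" lam
    by (intro pair_sigma_finite.intro sf_lam sigma_finite_measure_count_space_finite) simp
  note dm = dens_nu[OF N w]
  have ae: "AE z in nu N. 0 \<le> a N (fst z) w * p (xi N (fst z) w) (snd z)" using dm(2) by (rule AE_I2)
  have spD: "space (D N w) = {1..N} \<times> space lam"
    using sets_eq_imp_space_eq[OF D_prob(2)[OF N w]] by (simp add: nu_def space_pair_measure)
  have "integrable (D N w) (\<lambda>z. g (fst z) (snd z))"
    by (rule Dw.expectation_bounded(1)[where c=c])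
      (use g c in \<open>auto simp: spD measurable_cong_sets[OF D_prob(2)[OF N w] refl]\<close>)
  then have int: "integrable (nu N) (\<lambda>z. a N (fst z) w * p (xi N (fst z) w) (snd z) * g (fst z) (snd z))"
    unfolding D_def using dm ae g by (subst (asm) integrable_density) auto
  have "(\<integral>z. g (fst z) (snd z) \<partial>D N w) = (\<integral>z. a N (fst z) w * p (xi N (fst z) w) (snd z) * g (fst z) (snd z) \<partial>nu N)"
    unfolding D_def using dm ae g by (subst integral_density) auto
  also have "\<dots> = (\<integral>i. (\<integral>x. a N i w * p (xi N i w) x * g i x \<partial>lam) \<partial>count_space {1..N})"
    using pr.integral_fst'[OF int[unfolded nu_def]] by (simp add: nu_def)
  also have "\<dots> = (\<Sum>i\<in>{1..N}. a N i w * (\<integral>x. p (xi N i w) x * g i x \<partial>lam))"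
    by (subst lebesgue_integral_count_space_finite) (auto simp: mult.assoc)
  finally show ?thesis .
qed

text \<open>The proposal has mass 1 from every ancestor, so integrating it out leaves the total
  adjusted weight. The assumption on the normalizer thereby becomes almost sure positivity of
  \<open>S\<close>.\<close>

lemma nn_integral_tgt:
  assumes N: "N \<ge> 1" and w: "w \<in> space (P N)"
  shows "(\<integral>\<^sup>+z. tgt N w z \<partial>nu N) = ennreal (S N w)" "tgt N w \<in> borel_measurable (nu N)"
proof -
  have tgt': "tgt N w z = ennreal (wt N (fst z) w * theta (xi N (fst z) w) * p (xi N (fst z) w) (snd z))"
    if "z \<in> space (nu N)" for z
    using that tgt[OF N w, of "fst z" "snd z"] wt_nonneg[OF N _ w, of "fst z"]
    by (auto simp: nu_def space_pair_measure ennreal_mult'[symmetric] mult.assoc)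
  have gF: "(\<lambda>(w, z). wt N (fst z) w * theta (xi N (fst z) w) * p (xi N (fst z) w) (snd z)) \<in> borel_measurable (F N \<Otimes>\<^sub>M nu N)"
    unfolding nu_def
  proof (rule measurable_indexed[where g="\<lambda>j w x. wt N j w * theta (xi N j w) * p (xi N j w) x"])
    fix j assume j: "j \<in> {1..N}"
    note [measurable] = wt_F[OF N j] p_xi_F[OF N j p_meas] measurable_compose[OF xi_F[OF N j] theta(1)]
    show "(\<lambda>(w, x). wt N j w * theta (xi N j w) * p (xi N j w) x) \<in> borel_measurable (F N \<Otimes>\<^sub>M lam)" by measurable
  qed simp
  have gm [measurable]: "(\<lambda>z. wt N (fst z) w * theta (xi N (fst z) w) * p (xi N (fst z) w) (snd z)) \<in> borel_measurable (nu N)"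
    using measurable_Pair2[OF gF, of w] w by (simp add: space_FN[OF N])
  have "(\<lambda>z. ennreal (wt N (fst z) w * theta (xi N (fst z) w) * p (xi N (fst z) w) (snd z))) \<in> borel_measurable (nu N)" by measurable
  then show "tgt N w \<in> borel_measurable (nu N)"
    by (rule measurable_cong[THEN iffD2, rotated]) (rule tgt')
  have "(\<integral>\<^sup>+z. tgt N w z \<partial>nu N) = (\<integral>\<^sup>+z. ennreal (wt N (fst z) w * theta (xi N (fst z) w) * p (xi N (fst z) w) (snd z)) \<partial>nu N)"
    by (intro nn_integral_cong tgt')
  also have "\<dots> = (\<integral>\<^sup>+i. \<integral>\<^sup>+x. ennreal (wt N i w * theta (xi N i w) * p (xi N i w) x) \<partial>lam \<partial>count_space {1..N})"
    using gm unfolding nu_def by (subst lam.nn_integral_fst[symmetric]) auto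
  also have "\<dots> = (\<Sum>i\<in>{1..N}. \<integral>\<^sup>+x. ennreal (wt N i w * theta (xi N i w) * p (xi N i w) x) \<partial>lam)"
    by (rule nn_integral_count_space_finite) simp
  also have "\<dots> = (\<Sum>i\<in>{1..N}. ennreal (wt N i w * theta (xi N i w)))"
  proof (rule sum.cong[OF refl])
    fix i assume i: "i \<in> {1..N}"
    have n: "0 \<le> wt N i w * theta (xi N i w)"
      by (intro mult_nonneg_nonneg wt_nonneg[OF N i w] theta(2) xi_space[OF N i w])
    have "(\<integral>\<^sup>+x. ennreal (wt N i w * theta (xi N i w) * p (xi N i w) x) \<partial>lam)
        = (\<integral>\<^sup>+x. ennreal (wt N i w * theta (xi N i w)) * ennreal (p (xi N i w) x) \<partial>lam)"
      by (intro nn_integral_cong ennreal_mult' n)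
    also have "\<dots> = ennreal (wt N i w * theta (xi N i w))"
      using p_density(1,3)[OF xi_space[OF N i w]] by (subst nn_integral_cmult) auto
    finally show "(\<integral>\<^sup>+x. ennreal (wt N i w * theta (xi N i w) * p (xi N i w) x) \<partial>lam) = ennreal (wt N i w * theta (xi N i w))" .
  qed
  also have "\<dots> = ennreal (S N w)"
    unfolding S_def by (intro sum_ennreal mult_nonneg_nonneg wt_nonneg[OF N _ w] theta(2) xi_space[OF N _ w])
  finally show "(\<integral>\<^sup>+z. tgt N w z \<partial>nu N) = ennreal (S N w)" .
qed

lemma S_pos: assumes N: "N \<ge> 1" shows "AE w in P N. 0 < S N w"
proof -
  have "AE w in P N. 0 < (\<integral>\<^sup>+z. tgt N w z \<partial>nu N)" using normalizer[OF N] unfolding nu_def .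
  then show ?thesis using AE_space by eventually_elim (simp add: nn_integral_tgt(1)[OF N])
qed

lemma normalized_D:
  assumes N: "N \<ge> 1" and w: "w \<in> space (P N)" and S: "0 < S N w"
  shows "normalized_density (nu N) (tgt N w) = D N w"
  unfolding normalized_density_def D_def nn_integral_tgt(1)[OF N w]
proof (rule density_cong)
  show "(\<lambda>z. tgt N w z / ennreal (S N w)) \<in> borel_measurable (nu N)"
    using nn_integral_tgt(2)[OF N w] by measurable
  show "(\<lambda>z. ennreal (a N (fst z) w * p (xi N (fst z) w) (snd z))) \<in> borel_measurable (nu N)"
    using dens_nu(1)[OF N w] by measurable
  show "AE z in nu N. tgt N w z / ennreal (S N w) = ennreal (a N (fst z) w * p (xi N (fst z) w) (snd z))"
  proof (rule AE_I2)
    fix z assume "z \<in> space (nu N)"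
    then obtain i x where z: "z = (i, x)" "i \<in> {1..N}" "x \<in> space lam" by (auto simp: nu_def space_pair_measure)
    have n: "0 \<le> wt N i w" "0 \<le> theta (xi N i w) * p (xi N i w) x"
      using z by (auto intro!: mult_nonneg_nonneg wt_nonneg[OF N _ w] theta(2) p_density(2) xi_space[OF N _ w])
    have "tgt N w z / ennreal (S N w) = ennreal (wt N i w * (theta (xi N i w) * p (xi N i w) x)) / ennreal (S N w)"
      using n by (simp add: z tgt[OF N w z(2,3)] ennreal_mult)
    also have "\<dots> = ennreal (wt N i w * (theta (xi N i w) * p (xi N i w) x) / S N w)"
      by (intro divide_ennreal mult_nonneg_nonneg[OF n] S)
    also have "wt N i w * (theta (xi N i w) * p (xi N i w) x) / S N w = a N i w * p (xi N i w) x"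
      using S by (simp add: a_def)
    finally show "tgt N w z / ennreal (S N w) = ennreal (a N (fst z) w * p (xi N (fst z) w) (snd z))" by (simp add: z)
  qed
qed

text \<open>The normalised target and the kernel \<open>D\<close> coincide where \<open>S\<close> is
  positive, hence almost surely; conditional identities only see the law up to null sets.\<close>

lemma cond_iid_D:
  assumes N: "N \<ge> 1"
  shows "cond_iid (P N) (F N) N (nu N) (\<lambda>l w. (anc N l w, xi' N l w)) (D N)"
  unfolding cond_iid_def
proof (intro allI impI)
  fix A assume A: "\<forall>l\<in>{1..N}. A l \<in> sets (nu N)"
  have "AE w in P N. real_cond_exp (P N) (F N)
      (indicator {w \<in> space (P N). \<forall>l\<in>{1..N}. (anc N l w, xi' N l w) \<in> A l}) w =
      (\<Prod>l\<in>{1..N}. measure (normalized_density (nu N) (tgt N w)) (A l))"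
    using sampling[OF N] A unfolding cond_iid_def nu_def by blast
  then show "AE w in P N. real_cond_exp (P N) (F N)
      (indicator {w \<in> space (P N). \<forall>l\<in>{1..N}. (anc N l w, xi' N l w) \<in> A l}) w =
      (\<Prod>l\<in>{1..N}. measure (D N w) (A l))"
    using S_pos[OF N] AE_space by eventually_elim (simp add: normalized_D[OF N])
qed

lemma cond_iid_array: "cond_iid_array P F nu (\<lambda>N l w. (anc N l w, xi' N l w)) D"
proof (intro cond_iid_array.intro cond_iid_array_axioms.intro prob_sequence_axioms
    cond_iid_sample.intro cond_iid_sample_axioms.intro refl)
  fix N :: nat assume N: "N \<ge> 1"
  show "prob_space (P N)" by (rule prob_P[OF N])
  show "subalgebra (P N) (F N)" by (rule sub[OF N])
  show "D N \<in> F N \<rightarrow>\<^sub>M prob_algebra (nu N)" by (rule D_kernel[OF N])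
  show "cond_iid (P N) (F N) N (nu N) (\<lambda>l w. (anc N l w, xi' N l w)) (D N)" by (rule cond_iid_D[OF N])
  fix l assume l: "l \<in> {1..N}"
  show "(\<lambda>w. (anc N l w, xi' N l w)) \<in> P N \<rightarrow>\<^sub>M nu N"
    unfolding nu_def using anc_meas[OF N l] xi'_meas[OF N l] by (rule measurable_Pair)
qed

section \<open>Conditional moments as averages over the previous generation\<close>

text \<open>The test function may depend on the ancestor too: the second moment of a weighted
  particle contains a further factor \<open>om x x'\<close>.\<close>

definition J where "J g x = (\<integral>x'. K x x' * g x x' \<partial>lam)"

lemma Co_nonneg: "0 \<le> Co"
proof -
  obtain x where x: "x \<in> space lam" using mu.not_empty by (auto simp: space_mu)
  show ?thesis using om(2,3)[OF x x] by linarith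
qed

lemma K_bounds:
  assumes "x \<in> space lam" "x' \<in> space lam"
  shows "0 \<le> K x x'" "K x x' \<le> Co * theta x * p x x'"
  using assms om(2,3)[OF assms] theta(2)[OF assms(1)] p_density(2)[OF assms]
  unfolding K_eq[OF assms, symmetric] by (auto simp: mult.assoc intro!: mult_right_mono)

lemma K_section: "x \<in> space lam \<Longrightarrow> K x \<in> borel_measurable lam"
  using measurable_Pair2[OF K_meas] by simp

lemma J_integrable:
  assumes g: "(\<lambda>(x, x'). g x x') \<in> borel_measurable (lam \<Otimes>\<^sub>M lam)"
    and c: "\<And>x x'. x \<in> space lam \<Longrightarrow> x' \<in> space lam \<Longrightarrow> \<bar>g x x'\<bar> \<le> c" and x: "x \<in> space lam"
  shows "integrable lam (\<lambda>x'. K x x' * g x x')"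
proof (rule Bochner_Integration.integrable_bound)
  have gx: "g x \<in> borel_measurable lam" using measurable_Pair2[OF g x] by simp
  show "integrable lam (\<lambda>x'. Co * theta x * c * p x x')" using p_density(4)[OF x] by simp
  show "(\<lambda>x'. K x x' * g x x') \<in> borel_measurable lam" by (intro borel_measurable_times K_section[OF x] gx)
  show "AE x' in lam. norm (K x x' * g x x') \<le> norm (Co * theta x * c * p x x')"
  proof (rule AE_I2)
    fix x' assume x': "x' \<in> space lam"
    have "norm (K x x' * g x x') = K x x' * \<bar>g x x'\<bar>" using K_bounds[OF x x'] by (simp add: abs_mult)
    also have "\<dots> \<le> Co * theta x * p x x' * c"
      using K_bounds[OF x x'] c[OF x x'] by (intro mult_mono) auto
    finally show "norm (K x x' * g x x') \<le> norm (Co * theta x * c * p x x')" by (simp add: ac_simps)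
  qed
qed

text \<open>Bounded weights give \<open>K x x' \<le> Co * theta x * p x x'\<close>, and
  \<open>p x\<close> has mass 1. The version that retains \<open>theta x\<close> is what later shows
  that \<open>theta\<close> has a positive mean.\<close>

lemma J_abs_le:
  assumes g: "(\<lambda>(x, x'). g x x') \<in> borel_measurable (lam \<Otimes>\<^sub>M lam)"
    and c: "\<And>x x'. x \<in> space lam \<Longrightarrow> x' \<in> space lam \<Longrightarrow> \<bar>g x x'\<bar> \<le> c" and x: "x \<in> space lam"
  shows "\<bar>J g x\<bar> \<le> Co * theta x * c" "\<bar>J g x\<bar> \<le> Co * Ct * c"
proof -
  have c0: "0 \<le> c" using c[OF x x] by linarith
  have "\<bar>J g x\<bar> \<le> (\<integral>x'. \<bar>K x x' * g x x'\<bar> \<partial>lam)" unfolding J_def by (rule integral_abs_bound)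
  also have "\<dots> \<le> (\<integral>x'. Co * theta x * c * p x x' \<partial>lam)"
  proof (rule integral_mono)
    show "integrable lam (\<lambda>x'. \<bar>K x x' * g x x'\<bar>)" by (rule integrable_abs[OF J_integrable[OF g c x]])
    show "integrable lam (\<lambda>x'. Co * theta x * c * p x x')" using p_density(4)[OF x] by simp
    fix x' assume x': "x' \<in> space lam"
    have "\<bar>K x x' * g x x'\<bar> = K x x' * \<bar>g x x'\<bar>" using K_bounds[OF x x'] by (simp add: abs_mult)
    also have "\<dots> \<le> Co * theta x * p x x' * c"
      using K_bounds[OF x x'] c[OF x x'] by (intro mult_mono) auto
    finally show "\<bar>K x x' * g x x'\<bar> \<le> Co * theta x * c * p x x'" by (simp add: ac_simps)
  qed
  also have "\<dots> = Co * theta x * c" using p_density(5)[OF x] by simp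
  finally show "\<bar>J g x\<bar> \<le> Co * theta x * c" .
  also have "\<dots> \<le> Co * Ct * c"
    using theta(3)[OF x] Co_nonneg c0 by (intro mult_right_mono mult_left_mono)
  finally show "\<bar>J g x\<bar> \<le> Co * Ct * c" .
qed

lemma J_meas:
  assumes g: "(\<lambda>(x, x'). g x x') \<in> borel_measurable (lam \<Otimes>\<^sub>M lam)"
  shows "J g \<in> borel_measurable lam"
proof -
  note [measurable] = g K_meas
  have "(\<lambda>(x, x'). K x x' * g x x') \<in> borel_measurable (lam \<Otimes>\<^sub>M lam)" by measurable
  from lam.borel_measurable_lebesgue_integral[OF this] show ?thesis unfolding J_def by simp
qed

lemma meas_mu: "f \<in> borel_measurable mu \<longleftrightarrow> f \<in> borel_measurable lam"
  and meas_mu': "f \<in> borel_measurable mu' \<longleftrightarrow> f \<in> borel_measurable lam"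
  by (simp_all add: measurable_cong_sets[OF sets_mu refl] measurable_cong_sets[OF sets_mu' refl])

abbreviation "fn f \<equiv> \<lambda>_::'a. f"

lemma fn_meas: "f \<in> borel_measurable lam \<Longrightarrow> (\<lambda>(x, x'). fn f x x') \<in> borel_measurable (lam \<Otimes>\<^sub>M lam)"
  by (simp add: split_beta')

lemma weight_F:
  assumes N: "N \<ge> 1" and g: "(\<lambda>(x, x'). g x x') \<in> borel_measurable (lam \<Otimes>\<^sub>M lam)"
  shows "(\<lambda>(w, z). om (xi N (fst z) w) (snd z) * g (xi N (fst z) w) (snd z)) \<in> borel_measurable (F N \<Otimes>\<^sub>M nu N)"
  unfolding nu_def
proof (rule measurable_indexed[where g="\<lambda>j w x. om (xi N j w) x * g (xi N j w) x"])
  fix j assume j: "j \<in> {1..N}"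
  note [measurable] = p_xi_F[OF N j om(1)] p_xi_F[OF N j g]
  show "(\<lambda>(w, x). om (xi N j w) x * g (xi N j w) x) \<in> borel_measurable (F N \<Otimes>\<^sub>M lam)" by measurable
qed simp

lemma weight_bound:
  assumes c: "\<And>x x'. x \<in> space lam \<Longrightarrow> x' \<in> space lam \<Longrightarrow> \<bar>g x x'\<bar> \<le> c"
    and x: "x \<in> space lam" "x' \<in> space lam"
  shows "\<bar>om x x' * g x x'\<bar> \<le> Co * c"
  using om(2,3)[OF x] c[OF x] Co_nonneg by (auto simp: abs_mult intro!: mult_mono)

text \<open>Adjustment, proposal and weight multiply to \<open>K\<close>, so the design of the
  sampler cancels and the conditional mean is a ratio of two averages of the previous generation. To
  this ratio the induction hypothesis applies.\<close>

lemma mean_ratio: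
  assumes N: "N \<ge> 1" and w: "w \<in> space (P N)" and S: "0 < S N w" and W: "0 < (\<Sum>i\<in>{1..N}. wt N i w)"
    and g: "(\<lambda>(x, x'). g x x') \<in> borel_measurable (lam \<Otimes>\<^sub>M lam)"
    and c: "\<And>x x'. x \<in> space lam \<Longrightarrow> x' \<in> space lam \<Longrightarrow> \<bar>g x x'\<bar> \<le> c"
  shows "(\<integral>z. om (xi N (fst z) w) (snd z) * g (xi N (fst z) w) (snd z) \<partial>D N w) = avg N (J g) w / avg N theta w"
proof -
  have m: "(\<lambda>z. om (xi N (fst z) w) (snd z) * g (xi N (fst z) w) (snd z)) \<in> borel_measurable (nu N)"
    using measurable_Pair2[OF weight_F[OF N g], of w] w by (simp add: space_FN[OF N])
  have "(\<integral>z. om (xi N (fst z) w) (snd z) * g (xi N (fst z) w) (snd z) \<partial>D N w)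
      = (\<Sum>i\<in>{1..N}. a N i w * (\<integral>x. p (xi N i w) x * (om (xi N i w) x * g (xi N i w) x) \<partial>lam))"
    by (rule D_integral[OF N w m, where c="Co * c"]) (intro weight_bound[OF c] xi_space[OF N _ w])
  also have "\<dots> = (\<Sum>i\<in>{1..N}. wt N i w * J g (xi N i w) / S N w)"
  proof (rule sum.cong[OF refl])
    fix i assume i: "i \<in> {1..N}"
    note x = xi_space[OF N i w]
    have "J g (xi N i w) = (\<integral>x. theta (xi N i w) * (p (xi N i w) x * (om (xi N i w) x * g (xi N i w) x)) \<partial>lam)"
      unfolding J_def using K_eq[OF x, symmetric] by (intro Bochner_Integration.integral_cong) auto
    then have "J g (xi N i w) = theta (xi N i w) * (\<integral>x. p (xi N i w) x * (om (xi N i w) x * g (xi N i w) x) \<partial>lam)"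
      by simp
    then show "a N i w * (\<integral>x. p (xi N i w) x * (om (xi N i w) x * g (xi N i w) x) \<partial>lam) = wt N i w * J g (xi N i w) / S N w"
      using S by (simp add: a_def)
  qed
  also have "\<dots> = (\<Sum>i\<in>{1..N}. wt N i w * J g (xi N i w)) / S N w" by (simp add: sum_divide_distrib)
  also have "\<dots> = avg N (J g) w / avg N theta w"
    using W unfolding wmean_def S_def[symmetric] by simp
  finally show ?thesis .
qed

definition "new_var f = (G (\<lambda>x. \<integral>x'. K x x' * f x' \<partial>lam) +
   (\<integral>x. (\<integral>x'. om x x' * K x x' * (f x')\<^sup>2 \<partial>lam) \<partial>mu) * (\<integral>x. theta x \<partial>mu)) / (\<integral>x. (\<integral>x'. K x x' \<partial>lam) \<partial>mu)\<^sup>2"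

lemma mu_integrable:
  fixes f :: "'a \<Rightarrow> real"
  assumes "f \<in> borel_measurable lam" "\<And>x. x \<in> space lam \<Longrightarrow> \<bar>f x\<bar> \<le> c"
  shows "integrable mu f"
  by (rule mu.expectation_bounded(1)[where c=c]) (use assms in \<open>auto simp: meas_mu space_mu\<close>)

text \<open>The total mass of \<open>K\<close> under \<open>mu\<close> is positive and at most
  \<open>Co\<close> times the mean of \<open>theta\<close>.\<close>

lemma theta_mean_pos: "0 < (\<integral>x. theta x \<partial>mu)"
proof -
  define Ki where "Ki x = (\<integral>x'. K x x' \<partial>lam)" for x
  have Ki: "Ki = J (fn (\<lambda>_. 1))" by (simp add: Ki_def J_def fun_eq_iff)
  have b: "\<bar>Ki x\<bar> \<le> Co * theta x" "\<bar>Ki x\<bar> \<le> Co * Ct" if "x \<in> space lam" for x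
    using J_abs_le[OF fn_meas[of "\<lambda>_. 1"], of 1 x] that unfolding Ki by auto
  have Km: "Ki \<in> borel_measurable lam" unfolding Ki by (intro J_meas fn_meas) simp
  have ti: "integrable mu theta" by (rule mu_integrable[where c=Ct]) (auto simp: theta)
  have "0 < (\<integral>x. Ki x \<partial>mu)" using K_pos by (simp add: Ki_def)
  also have "\<dots> \<le> (\<integral>x. Co * theta x \<partial>mu)"
  proof (rule integral_mono)
    show "integrable mu Ki" by (rule mu_integrable[OF Km b(2)])
    show "integrable mu (\<lambda>x. Co * theta x)" using ti by simp
    show "Ki x \<le> Co * theta x" if "x \<in> space mu" for x using b(1)[of x] that by (simp add: space_mu)
  qed
  also have "\<dots> = Co * (\<integral>x. theta x \<partial>mu)" by simp
  finally show ?thesis using Co_nonneg by (simp add: zero_less_mult_iff)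
qed

abbreviation "wt' \<equiv> \<lambda>N i w. om (xi N (anc N i w) w) (xi' N i w)"

lemma new_weighted_samples: "weighted_samples P mu' xi' wt'"
proof (intro weighted_samples.intro weighted_samples_axioms.intro prob_sequence_axioms prob_mu')
  interpret A: cond_iid_array P F nu "\<lambda>N l w. (anc N l w, xi' N l w)" D by (rule cond_iid_array)
  fix N i :: nat assume N: "N \<ge> 1"
  show "AE w in P N. 0 < (\<Sum>i\<in>{1..N}. wt' N i w)" by (rule wt'_pos[OF N])
  assume i: "i \<in> {1..N}"
  show "xi' N i \<in> P N \<rightarrow>\<^sub>M mu'" using xi'_meas[OF N i] by (simp add: measurable_cong_sets[OF refl sets_mu'])
  interpret s: cond_iid_sample "P N" "F N" N "{1..N}" "nu N" "\<lambda>l w. (anc N l w, xi' N l w)" "D N" by (rule A.sample[OF N])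
  show "wt' N i \<in> borel_measurable (P N)"
    using s.sample_measurable[OF weight_F[OF N fn_meas[of "\<lambda>_. 1"]] i] by simp
  fix w assume w: "w \<in> space (P N)"
  have "anc N i w \<in> {1..N}" using measurable_space[OF anc_meas[OF N i] w] by simp
  then show "0 \<le> wt' N i w"
    by (intro om(2) xi_space[OF N _ w] measurable_space[OF xi'_meas[OF N i] w])
qed

text \<open>The conditional mean of a weighted test function is avg(J f) / avg(theta). Its numerator
  obeys the old central limit theorem, because \<open>J\<close> sends functions centred under
  \<open>mu'\<close> to functions centred under \<open>mu\<close> and is continuous in L1. The mean
  weight and the conditional second moment converge to B/q and s2/q, so \<open>ratio_clt\<close>
  applies.\<close>

theorem step_clt: "clt_samples P mu' xi' wt' new_var"
proof (intro clt_samples.intro new_weighted_samples clt_samples_axioms.intro)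
  show "new_var (\<lambda>_. 0) = 0" by (simp add: new_var_def G_zero)
  interpret A: cond_iid_array P F nu "\<lambda>N l w. (anc N l w, xi' N l w)" D by (rule cond_iid_array)
  fix f :: "nat \<Rightarrow> 'a \<Rightarrow> real" and fl :: "'a \<Rightarrow> real" and c u :: real
  assume f': "\<And>N. f N \<in> borel_measurable mu'" "fl \<in> borel_measurable mu'"
    "\<And>N x. x \<in> space mu' \<Longrightarrow> \<bar>f N x\<bar> \<le> c" "\<And>x. x \<in> space mu' \<Longrightarrow> \<bar>fl x\<bar> \<le> c"
    "\<And>N. (\<integral>x. f N x \<partial>mu') = 0" and lim: "(\<lambda>N. \<integral>x. \<bar>f N x - fl x\<bar> \<partial>mu') \<longlonglongrightarrow> 0"
  have fm: "f N \<in> borel_measurable lam" "fl \<in> borel_measurable lam" for N using f' by (auto simp: meas_mu')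
  have fc: "\<bar>f N x\<bar> \<le> c" "\<bar>fl x\<bar> \<le> c" if "x \<in> space lam" for N x using f'(3,4) that by (auto simp: space_mu)
  define q where "q = (\<integral>x. theta x \<partial>mu)"
  define B where "B = (\<integral>x. (\<integral>x'. K x x' \<partial>lam) \<partial>mu)"
  have q: "q > 0" unfolding q_def by (rule theta_mean_pos)
  have B: "B > 0" unfolding B_def by (rule K_pos)
  have B_J: "B = (\<integral>x. J (fn (\<lambda>_. 1)) x \<partial>mu)" by (simp add: B_def J_def)
  \<comment> \<open>The squared weighted test function is \<open>om\<close> times \<open>g2\<close>,
    which brings conditional second moments into the form of \<open>mean_ratio\<close>.\<close>
  define g2 where "g2 h = (\<lambda>x x'. om x x' * (h x')\<^sup>2)" for h :: "'a \<Rightarrow> real"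
  have g2_meas: "(\<lambda>(x, x'). g2 h x x') \<in> borel_measurable (lam \<Otimes>\<^sub>M lam)" if [measurable]: "h \<in> borel_measurable lam" for h
    unfolding g2_def using om(1) by measurable
  have g2_bound: "\<bar>g2 h x x'\<bar> \<le> Co * c\<^sup>2"
    if "\<And>x. x \<in> space lam \<Longrightarrow> \<bar>h x\<bar> \<le> c" "x \<in> space lam" "x' \<in> space lam" for h x x'
    unfolding g2_def using power_mono[OF that(1)[OF that(3)], of 2] by (intro weight_bound that(2,3)) auto
  let ?J1 = "J (fn (\<lambda>_. 1))"
  have one: "(\<lambda>(x, x'). fn (\<lambda>_. 1::real) x x') \<in> borel_measurable (lam \<Otimes>\<^sub>M lam)" by (rule fn_meas) simp
  have J1: "?J1 \<in> borel_measurable lam" "\<bar>?J1 x\<bar> \<le> Co * Ct * 1" if "x \<in> space lam" for x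
    by (rule J_meas[OF one], rule J_abs_le(2)[OF one _ that]) simp
  have J1m: "?J1 \<in> borel_measurable mu" unfolding meas_mu by (rule J_meas[OF one])
  have Jf: "J (fn (f N)) \<in> borel_measurable mu" "J (fn fl) \<in> borel_measurable mu" for N
    unfolding meas_mu by (intro J_meas fn_meas fm)+
  have Jfc: "\<bar>J (fn (f N)) x\<bar> \<le> Co * Ct * c" "\<bar>J (fn fl) x\<bar> \<le> Co * Ct * c" if "x \<in> space mu" for N x
    using that unfolding space_mu by (auto intro!: J_abs_le(2) fn_meas fm fc)
  have J2: "J (g2 (f N)) \<in> borel_measurable mu" "J (g2 fl) \<in> borel_measurable mu" for N
    unfolding meas_mu by (intro J_meas g2_meas fm)+
  have J2c: "\<bar>J (g2 (f N)) x\<bar> \<le> Co * Ct * (Co * c\<^sup>2)" "\<bar>J (g2 fl) x\<bar> \<le> Co * Ct * (Co * c\<^sup>2)" if "x \<in> space mu" for N x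
    using that unfolding space_mu by (auto intro!: J_abs_le(2) g2_meas fm g2_bound fc)
  have thM: "theta \<in> borel_measurable mu" using theta(1) by (simp add: meas_mu)
  have thc: "\<bar>theta x\<bar> \<le> Ct" if "x \<in> space mu" for x using theta(2,3)[of x] that by (simp add: space_mu)
  define d where "d N x = \<bar>f N x - fl x\<bar>" for N x
  have dm: "d N \<in> borel_measurable lam" for N unfolding d_def using fm by measurable
  have dc: "\<bar>d N x\<bar> \<le> 2 * c" if "x \<in> space lam" for N x using fc(1)[OF that, of N] fc(2)[OF that] unfolding d_def by linarith
  \<comment> \<open>The kernel carries the L1 distance under the new target to an integral under the
    old one, up to the normalizer B.\<close>
  have Jd: "(\<integral>x. J (fn (d N)) x \<partial>mu) = B * (\<integral>x. \<bar>f N x - fl x\<bar> \<partial>mu')" for N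
    using mu'_eq[OF dm dc] by (simp add: J_def B_def d_def)
  have Jd_lim: "(\<lambda>N. \<integral>x. J (fn (d N)) x \<partial>mu) \<longlonglongrightarrow> 0"
    unfolding Jd using lim by (auto intro!: tendsto_eq_intros)
  have Jd_int: "integrable mu (J (fn (d N)))" for N
    by (rule mu_integrable[where c="Co * Ct * (2 * c)"]) (intro J_meas fn_meas dm J_abs_le(2) dc; assumption)+
  \<comment> \<open>Nonnegativity of \<open>K\<close> passes a pointwise estimate through the
    integral. It serves twice: with e = 1 for the functions themselves, and with e = Co (2c) for
    their weighted squares.\<close>
  have J_diff_le: "\<bar>J g x - J g' x\<bar> \<le> e * J (fn (d N)) x"
    if "(\<lambda>(x, x'). g x x') \<in> borel_measurable (lam \<Otimes>\<^sub>M lam)" "(\<lambda>(x, x'). g' x x') \<in> borel_measurable (lam \<Otimes>\<^sub>M lam)"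
      and "\<And>x x'. x \<in> space lam \<Longrightarrow> x' \<in> space lam \<Longrightarrow> \<bar>g x x'\<bar> \<le> e'" "\<And>x x'. x \<in> space lam \<Longrightarrow> x' \<in> space lam \<Longrightarrow> \<bar>g' x x'\<bar> \<le> e'"
      and le: "\<And>x x'. x \<in> space lam \<Longrightarrow> x' \<in> space lam \<Longrightarrow> \<bar>g x x' - g' x x'\<bar> \<le> e * d N x'"
      and x: "x \<in> space lam" for g g' e e' N x
  proof -
    note i1 = J_integrable[OF that(1,3) x] and i2 = J_integrable[OF that(2,4) x]
    have i3: "integrable lam (\<lambda>x'. K x x' * d N x')" by (rule J_integrable[OF fn_meas[OF dm] dc x])
    have "J g x - J g' x = (\<integral>x'. K x x' * g x x' - K x x' * g' x x' \<partial>lam)"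
      unfolding J_def by (rule Bochner_Integration.integral_diff[OF i1 i2, symmetric])
    also have "\<bar>\<dots>\<bar> \<le> (\<integral>x'. \<bar>K x x' * g x x' - K x x' * g' x x'\<bar> \<partial>lam)" by (rule integral_abs_bound)
    also have "\<dots> \<le> (\<integral>x'. e * (K x x' * d N x') \<partial>lam)"
    proof (rule integral_mono)
      show "integrable lam (\<lambda>x'. \<bar>K x x' * g x x' - K x x' * g' x x'\<bar>)"
        by (rule integrable_abs[OF Bochner_Integration.integrable_diff[OF i1 i2]])
      show "integrable lam (\<lambda>x'. e * (K x x' * d N x'))" using i3 by simp
      fix x' assume x': "x' \<in> space lam"
      have "\<bar>K x x' * g x x' - K x x' * g' x x'\<bar> = K x x' * \<bar>g x x' - g' x x'\<bar>"
        using K_bounds(1)[OF x x'] by (simp add: right_diff_distrib[symmetric] abs_mult)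
      also have "\<dots> \<le> K x x' * (e * d N x')" by (intro mult_left_mono le x x' K_bounds(1))
      finally show "\<bar>K x x' * g x x' - K x x' * g' x x'\<bar> \<le> e * (K x x' * d N x')" by (simp add: ac_simps)
    qed
    also have "\<dots> = e * J (fn (d N)) x" by (simp add: J_def)
    finally show ?thesis .
  qed
  have Jf_lim: "(\<lambda>N. \<integral>x. \<bar>J (fn (f N)) x - J (fn fl) x\<bar> \<partial>mu) \<longlonglongrightarrow> 0"
  proof (rule Lim_null_comparison[OF always_eventually Jd_lim], rule allI)
    fix N
    have "(\<integral>x. \<bar>J (fn (f N)) x - J (fn fl) x\<bar> \<partial>mu) \<le> (\<integral>x. J (fn (d N)) x \<partial>mu)"
    proof (rule integral_mono[OF _ Jd_int])
      show "integrable mu (\<lambda>x. \<bar>J (fn (f N)) x - J (fn fl) x\<bar>)"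
        by (intro integrable_abs Bochner_Integration.integrable_diff
            mu.expectation_bounded(1)[where c="Co * Ct * c"] Jf Jfc)
      fix x assume "x \<in> space mu"
      then have x: "x \<in> space lam" by (simp add: space_mu)
      show "\<bar>J (fn (f N)) x - J (fn fl) x\<bar> \<le> J (fn (d N)) x"
        using J_diff_le[OF fn_meas[OF fm(1)] fn_meas[OF fm(2)] fc(1) fc(2) _ x, of N 1 N] by (simp add: d_def)
    qed
    then show "norm (\<integral>x. \<bar>J (fn (f N)) x - J (fn fl) x\<bar> \<partial>mu) \<le> (\<integral>x. J (fn (d N)) x \<partial>mu)" by simp
  qed
  define s2 where "s2 = (\<integral>x. J (g2 fl) x \<partial>mu)"
  have J2_lim: "(\<lambda>N. (\<integral>x. J (g2 (f N)) x \<partial>mu) - s2) \<longlonglongrightarrow> 0"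
  proof (rule Lim_null_comparison[OF always_eventually], rule allI)
    show "(\<lambda>N. Co * (2 * c) * (\<integral>x. J (fn (d N)) x \<partial>mu)) \<longlonglongrightarrow> 0"
      using Jd_lim by (auto intro!: tendsto_eq_intros)
    fix N
    have i: "integrable mu (J (g2 (f N)))" "integrable mu (J (g2 fl))"
      by (rule mu.expectation_bounded(1)[OF J2(1) J2c(1)], assumption, rule mu.expectation_bounded(1)[OF J2(2) J2c(2)])
    have "\<bar>(\<integral>x. J (g2 (f N)) x \<partial>mu) - s2\<bar> = \<bar>\<integral>x. J (g2 (f N)) x - J (g2 fl) x \<partial>mu\<bar>"
      unfolding s2_def using i by simp
    also have "\<dots> \<le> (\<integral>x. \<bar>J (g2 (f N)) x - J (g2 fl) x\<bar> \<partial>mu)" by (rule integral_abs_bound)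
    also have "\<dots> \<le> (\<integral>x. Co * (2 * c) * J (fn (d N)) x \<partial>mu)"
    proof (rule integral_mono)
      show "integrable mu (\<lambda>x. \<bar>J (g2 (f N)) x - J (g2 fl) x\<bar>)" using i by simp
      show "integrable mu (\<lambda>x. Co * (2 * c) * J (fn (d N)) x)" using Jd_int by simp
      fix x assume "x \<in> space mu"
      then have x: "x \<in> space lam" by (simp add: space_mu)
      show "\<bar>J (g2 (f N)) x - J (g2 fl) x\<bar> \<le> Co * (2 * c) * J (fn (d N)) x"
      proof (rule J_diff_le[OF g2_meas[OF fm(1)] g2_meas[OF fm(2)] g2_bound[OF fc(1)] g2_bound[OF fc(2)] _ x])
        fix x x' assume xx: "x \<in> space lam" "x' \<in> space lam"
        have "g2 (f N) x x' - g2 fl x x' = om x x' * (f N x' + fl x') * (f N x' - fl x')"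
          by (simp add: g2_def power2_eq_square algebra_simps)
        then have "\<bar>g2 (f N) x x' - g2 fl x x'\<bar> = om x x' * \<bar>f N x' + fl x'\<bar> * d N x'"
          using om(2)[OF xx] by (simp add: abs_mult d_def)
        also have "\<dots> \<le> Co * (2 * c) * d N x'"
          using om(2,3)[OF xx] fc(1)[OF xx(2), of N] fc(2)[OF xx(2)] Co_nonneg
          by (intro mult_right_mono mult_mono) (auto simp: d_def)
        finally show "\<bar>g2 (f N) x x' - g2 fl x x'\<bar> \<le> Co * (2 * c) * d N x'" .
      qed
    qed
    finally show "norm ((\<integral>x. J (g2 (f N)) x \<partial>mu) - s2) \<le> Co * (2 * c) * (\<integral>x. J (fn (d N)) x \<partial>mu)" by simp
  qed
  have Jf0: "(\<integral>x. J (fn (f N)) x \<partial>mu) = 0" for N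
    using mu'_eq[OF fm(1) fc(1), of N] f'(5)[of N] by (simp add: J_def)
  have s2_nonneg: "0 \<le> s2" unfolding s2_def
  proof (rule integral_nonneg_AE, rule AE_I2)
    fix x assume "x \<in> space mu"
    then have x: "x \<in> space lam" by (simp add: space_mu)
    show "0 \<le> J (g2 fl) x" unfolding J_def g2_def
      using x by (intro integral_nonneg_AE AE_I2 mult_nonneg_nonneg K_bounds(1) om(2)) auto
  qed
  have th_rate: "null_prob P (\<lambda>N w. root4 N * (avg N theta w - q))"
    unfolding q_def by (rule lln_rate[OF thM thc])
  have th_null: "null_prob P (\<lambda>N w. avg N theta w - q)"
    unfolding q_def by (rule lln[OF thM thc])
  have th_meas: "avg N theta \<in> borel_measurable (P N)" if "N \<ge> 1" for N by (rule avg_measurable[OF that thM])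
  have th_pos: "AE w in P N. 0 < avg N theta w" if N: "N \<ge> 1" for N
    using S_pos[OF N] wt_pos[OF N] by eventually_elim (simp add: wmean_def S_def)
  define kk where "kk N w z = om (xi N (fst z) w) (snd z) * f N (snd z)" for N w and z :: "nat \<times> 'a"
  define ll where "ll N w z = om (xi N (fst z) w) (snd z)" for N w and z :: "nat \<times> 'a"
  have kk_meas: "(\<lambda>(w, z). kk N w z) \<in> borel_measurable (F N \<Otimes>\<^sub>M nu N)" if N: "N \<ge> 1" for N
    using weight_F[OF N fn_meas[OF fm(1)], of N] by (simp add: kk_def)
  have kk2_meas: "(\<lambda>(w, z). (kk N w z)\<^sup>2) \<in> borel_measurable (F N \<Otimes>\<^sub>M nu N)" if N: "N \<ge> 1" for N
    using kk_meas[OF N] by measurable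
  have ll_meas: "(\<lambda>(w, z). ll N w z) \<in> borel_measurable (F N \<Otimes>\<^sub>M nu N)" if N: "N \<ge> 1" for N
    using weight_F[OF N one] by (simp add: ll_def)
  have mean_meas: "(\<lambda>w. \<integral>z. h w z \<partial>D N w) \<in> borel_measurable (P N)"
    if N: "N \<ge> 1" and h: "(\<lambda>(w, z). h w z :: real) \<in> borel_measurable (F N \<Otimes>\<^sub>M nu N)" for N h
  proof -
    interpret s: cond_iid_sample "P N" "F N" N "{1..N}" "nu N" "\<lambda>l w. (anc N l w, xi' N l w)" "D N" by (rule A.sample[OF N])
    show ?thesis by (rule measurable_from_subalg[OF sub[OF N] s.mean_measurable[OF h]])
  qed
  have kk_mean: "AE w in P N. (\<integral>z. kk N w z \<partial>D N w) = avg N (J (fn (f N))) w / avg N theta w" if N: "N \<ge> 1" for N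
    using S_pos[OF N] wt_pos[OF N] AE_space
    by eventually_elim (simp only: kk_def, rule mean_ratio[OF N _ _ _ fn_meas[OF fm(1)] fc(1)])
  have ll_mean: "AE w in P N. (\<integral>z. ll N w z \<partial>D N w) = avg N ?J1 w / avg N theta w" if N: "N \<ge> 1" for N
    using S_pos[OF N] wt_pos[OF N] AE_space
  proof eventually_elim
    case (elim w)
    then show ?case unfolding ll_def using mean_ratio[OF N _ _ _ one, of w 1] by simp
  qed
  have kk2_mean: "AE w in P N. (\<integral>z. (kk N w z)\<^sup>2 \<partial>D N w) = avg N (J (g2 (f N))) w / avg N theta w" if N: "N \<ge> 1" for N
    using S_pos[OF N] wt_pos[OF N] AE_space
  proof eventually_elim
    case (elim w)
    have "(\<integral>z. (kk N w z)\<^sup>2 \<partial>D N w) = (\<integral>z. om (xi N (fst z) w) (snd z) * g2 (f N) (xi N (fst z) w) (snd z) \<partial>D N w)"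
      by (simp add: kk_def g2_def power2_eq_square ac_simps)
    also have "\<dots> = avg N (J (g2 (f N))) w / avg N theta w"
      by (rule mean_ratio[OF N elim(3,1,2) g2_meas[OF fm(1)] g2_bound[OF fc(1)]])
    finally show ?case .
  qed
  have Jf_rate: "null_prob P (\<lambda>N w. root4 N * (avg N (J (fn (f N))) w - 0))"
    using lln_rate[where g="\<lambda>N. J (fn (f N))", OF Jf(1) Jfc(1)] unfolding Jf0 by simp
  have k_mean: "null_prob P (\<lambda>N w. root4 N * ((\<integral>z. kk N w z \<partial>D N w) - 0 / q))"
    by (rule null_prob_ratio[OF Jf_rate th_rate th_null q avg_measurable[OF _ Jf(1)] th_meas th_pos mean_meas[OF _ kk_meas] kk_mean])
  have J1_rate: "null_prob P (\<lambda>N w. root4 N * (avg N ?J1 w - B))"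
    unfolding B_J using J1m J1(2) by (intro lln_rate[where c="Co * Ct * 1"]) (auto simp: space_mu)
  have l_mean: "null_prob P (\<lambda>N w. root4 N * ((\<integral>z. ll N w z \<partial>D N w) - B / q))"
    by (rule null_prob_ratio[OF J1_rate th_rate th_null q avg_measurable[OF _ J1m] th_meas th_pos mean_meas[OF _ ll_meas] ll_mean])
  have J2_null: "null_prob P (\<lambda>N w. 1 * (avg N (J (g2 (f N))) w - s2))"
    using null_prob_add[OF lln[where g="\<lambda>N. J (g2 (f N))", OF J2(1) J2c(1)] null_prob_const[OF J2_lim]] by simp
  have k_sq: "null_prob P (\<lambda>N w. 1 * ((\<integral>z. (kk N w z)\<^sup>2 \<partial>D N w) - s2 / q))"
    using th_null
    by (intro null_prob_ratio[OF J2_null _ th_null q avg_measurable[OF _ J2(1)] th_meas th_pos mean_meas[OF _ kk2_meas] kk2_mean]) simp_all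
  \<comment> \<open>Replacing avg(theta) by its mean q changes the ratio by a product of two N^(1/4)
    deviations, as in the linearisation of the estimator itself.\<close>
  have diff: "null_prob P (\<lambda>N w. sqrt N * (\<integral>z. kk N w z \<partial>D N w) - sqrt N * avg N (J (fn (f N))) w / q)"
  proof (rule null_prob_le)
    show "null_prob P (\<lambda>N w. (- 1 / q * (root4 N * (avg N (J (fn (f N))) w - 0) * (root4 N * (avg N theta w - q)))) / avg N theta w)"
      by (rule null_prob_divide[OF null_prob_cmult[OF null_prob_mult[OF Jf_rate th_rate]] th_null q th_meas])
    fix N :: nat assume N: "N \<ge> 1"
    show "(\<lambda>w. sqrt N * (\<integral>z. kk N w z \<partial>D N w) - sqrt N * avg N (J (fn (f N))) w / q) \<in> borel_measurable (P N)"
      using mean_meas[OF N kk_meas[OF N]] avg_measurable[OF N Jf(1)] by measurable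
    have alg: "x * x * (y / z) - x * x * y / q = (- 1 / q * (x * (y - 0) * (x * (z - q)))) / z" if "0 < z" for x y z :: real
      using that q by (simp add: field_simps)
    have r: "root4 N * root4 N = sqrt N" by simp
    show "AE w in P N. \<bar>sqrt N * (\<integral>z. kk N w z \<partial>D N w) - sqrt N * avg N (J (fn (f N))) w / q\<bar>
      \<le> \<bar>(- 1 / q * (root4 N * (avg N (J (fn (f N))) w - 0) * (root4 N * (avg N theta w - q)))) / avg N theta w\<bar>"
      using th_pos[OF N] kk_mean[OF N]
    proof eventually_elim
      case (elim w)
      show ?case unfolding elim(2) alg[OF elim(1), symmetric] r by (rule order_refl)
    qed
  qed
  \<comment> \<open>Dividing by q rescales the frequency to u / q in the old central limit theorem,
    whence the factor 1/q^2 on \<open>G\<close>.\<close>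
  have k_char: "(\<lambda>N. \<integral>w. iexp (u * (sqrt N * (\<integral>z. kk N w z \<partial>D N w))) \<partial>P N) \<longlonglongrightarrow> of_real (exp (- u\<^sup>2 * (G (J (fn fl)) / q\<^sup>2) / 2))" for u
  proof -
    have 1: "(\<lambda>N. (\<integral>w. iexp (u * (sqrt N * (\<integral>z. kk N w z \<partial>D N w))) \<partial>P N) - (\<integral>w. iexp (u * (sqrt N * avg N (J (fn (f N))) w / q)) \<partial>P N)) \<longlonglongrightarrow> 0"
      using char_diff_tendsto[OF _ _ diff, where W="\<lambda>_ _. 1" and u=u] mean_meas[OF _ kk_meas] avg_measurable[OF _ Jf(1)] by simp
    have 2: "(\<lambda>N. \<integral>w. iexp (u / q * (sqrt N * avg N (J (fn (f N))) w)) \<partial>P N) \<longlonglongrightarrow> of_real (exp (- (u / q)\<^sup>2 * G (J (fn fl)) / 2))"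
      by (rule clt[OF Jf Jfc Jf0 Jf_lim])
    have 3: "u / q * y = u * (y / q)" for y by simp
    from tendsto_add[OF 1 2[unfolded 3]] show ?thesis by (simp add: power_divide)
  qed
  have main: "(\<lambda>N. \<integral>w. iexp (u * (sqrt N * ((\<Sum>i\<in>{1..N}. kk N w (anc N i w, xi' N i w)) / (\<Sum>i\<in>{1..N}. ll N w (anc N i w, xi' N i w))))) \<partial>P N)
    \<longlonglongrightarrow> of_real (exp (- u\<^sup>2 * ((G (J (fn fl)) / q\<^sup>2 + s2 / q) / (B / q)\<^sup>2) / 2))"
  proof (rule A.ratio_clt[where c="Co * c" and d="Co * 1"])
    show "null_prob P (\<lambda>N w. root4 N * (\<integral>z. kk N w z \<partial>D N w))" using k_mean by simp
    show "null_prob P (\<lambda>N w. (\<integral>z. (kk N w z)\<^sup>2 \<partial>D N w) - s2 / q)" using k_sq by simp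
    show "0 < B / q" "0 \<le> s2 / q" using B q s2_nonneg by auto
    fix N w z assume N: "N \<ge> 1" and w: "w \<in> space (P N)" and z: "z \<in> space (nu N)"
    then have zz: "xi N (fst z) w \<in> space lam" "snd z \<in> space lam"
      by (auto simp: nu_def space_pair_measure intro!: xi_space[OF N _ w])
    show "\<bar>kk N w z\<bar> \<le> Co * c" unfolding kk_def by (rule weight_bound[OF fc(1) zz])
    show "\<bar>ll N w z\<bar> \<le> Co * 1" unfolding ll_def using om(2,3)[OF zz] by simp
  qed (use kk_meas ll_meas l_mean k_char in auto)
  \<comment> \<open>Clearing the powers of q cancels them against the \<open>G\<close> term and
    leaves one factor q at \<open>s2\<close>: this is the mean of \<open>theta\<close> in the
    recursion for the variance.\<close>
  have var: "(G (J (fn fl)) / q\<^sup>2 + s2 / q) / (B / q)\<^sup>2 = new_var fl"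
  proof -
    have s: "s2 = (\<integral>x. (\<integral>x'. om x x' * K x x' * (fl x')\<^sup>2 \<partial>lam) \<partial>mu)"
      by (simp add: s2_def J_def g2_def ac_simps)
    have "(y / q\<^sup>2 + s2 / q) / (B / q)\<^sup>2 = (y + s2 * q) / B\<^sup>2" for y
      using q B by (simp add: field_simps power2_eq_square)
    moreover have "J (fn fl) = (\<lambda>x. \<integral>x'. K x x' * fl x' \<partial>lam)" by (simp add: J_def fun_eq_iff)
    ultimately show ?thesis unfolding new_var_def s[symmetric] B_def[symmetric] q_def[symmetric] by simp
  qed
  show "(\<lambda>N. \<integral>w. iexp (u * (sqrt N * wmean N (xi' N) (wt' N) (f N) w)) \<partial>P N) \<longlonglongrightarrow> of_real (exp (- u\<^sup>2 * new_var fl / 2))"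
    using main unfolding var by (simp add: wmean_def kk_def ll_def)
qed

end

section \<open>The filtering distributions\<close>

lemma sup_norm_bound:
  assumes "sup_norm S f < \<infinity>"
  shows "\<exists>c\<ge>0. \<forall>z\<in>S. f z \<le> ennreal c"
proof -
  obtain c where "0 \<le> c" and c: "sup_norm S f = ennreal c" using assms by (cases "sup_norm S f") auto
  then show ?thesis by (auto simp: sup_norm_def c[symmetric] intro!: exI[of _ c] SUP_upper)
qed

section \<open>Sigma-fields generated by particles and ancestor indices\<close>

lemma sets_particle_sigma:
  "sets (particle_sigma P L N S R xi I) = sigma_sets (space P)
    ({xi u l -` A \<inter> space P | u l A. u \<in> S \<and> l \<in> {1..N} \<and> A \<in> sets L} \<union>
      {I u l -` B \<inter> space P | u l B. u \<in> R \<and> l \<in> {1..N} \<and> B \<subseteq> {1..N}})"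
  unfolding particle_sigma_def by (rule sets_measure_of) auto

lemma space_particle_sigma [simp]: "space (particle_sigma P L N S R xi I) = space P"
  unfolding particle_sigma_def by (rule space_measure_of) auto

lemma particle_sigma_xi:
  assumes "u \<in> S" "l \<in> {1..N}" "xi u l \<in> P \<rightarrow>\<^sub>M L"
  shows "xi u l \<in> particle_sigma P L N S R xi I \<rightarrow>\<^sub>M L"
proof (rule measurableI)
  show "xi u l w \<in> space L" if "w \<in> space (particle_sigma P L N S R xi I)" for w
    using that measurable_space[OF assms(3)] by simp
  show "xi u l -` A \<inter> space (particle_sigma P L N S R xi I) \<in> sets (particle_sigma P L N S R xi I)"
    if "A \<in> sets L" for A
    unfolding sets_particle_sigma space_particle_sigma using assms that by (intro sigma_sets.Basic) blast
qed

lemma particle_sigma_I: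
  assumes "u \<in> R" "l \<in> {1..N}" "I u l \<in> P \<rightarrow>\<^sub>M count_space {1..N}"
  shows "I u l \<in> particle_sigma P L N S R xi I \<rightarrow>\<^sub>M count_space {1..N}"
proof (rule measurableI)
  show "I u l w \<in> space (count_space {1..N})" if "w \<in> space (particle_sigma P L N S R xi I)" for w
    using that measurable_space[OF assms(3)] by simp
  show "I u l -` A \<inter> space (particle_sigma P L N S R xi I) \<in> sets (particle_sigma P L N S R xi I)"
    if "A \<in> sets (count_space {1..N})" for A
    unfolding sets_particle_sigma space_particle_sigma using assms that by (intro sigma_sets.Basic) auto
qed

lemma subalgebra_particle_sigma:
  assumes xi: "\<And>u l. u \<in> S \<Longrightarrow> l \<in> {1..N} \<Longrightarrow> xi u l \<in> P \<rightarrow>\<^sub>M L"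
    and I: "\<And>u l. u \<in> R \<Longrightarrow> l \<in> {1..N} \<Longrightarrow> I u l \<in> P \<rightarrow>\<^sub>M count_space {1..N}"
  shows "subalgebra P (particle_sigma P L N S R xi I)"
  unfolding subalgebra_def sets_particle_sigma
proof (intro conjI sets.sigma_sets_subset subsetI)
  fix Y assume "Y \<in> {xi u l -` A \<inter> space P | u l A. u \<in> S \<and> l \<in> {1..N} \<and> A \<in> sets L} \<union>
      {I u l -` B \<inter> space P | u l B. u \<in> R \<and> l \<in> {1..N} \<and> B \<subseteq> {1..N}}"
  then show "Y \<in> sets P"
  proof
    assume "Y \<in> {xi u l -` A \<inter> space P | u l A. u \<in> S \<and> l \<in> {1..N} \<and> A \<in> sets L}"
    then show ?thesis using xi by (auto intro: measurable_sets)
  next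
    assume "Y \<in> {I u l -` B \<inter> space P | u l B. u \<in> R \<and> l \<in> {1..N} \<and> B \<subseteq> {1..N}}"
    then obtain u l B where "Y = I u l -` B \<inter> space P" "u \<in> R" "l \<in> {1..N}" "B \<subseteq> {1..N}" by blast
    then show ?thesis using measurable_sets[OF I[of u l], of B] by simp
  qed
qed simp

section \<open>Integration against normalised measures\<close>

text \<open>The filters are specified by their values on sets, while the limit theorems need
  integrals of functions. Here a measure given on sets as the normalised image of \<open>nu\<close>
  under \<open>K\<close> is identified with an explicitly constructed one, which also yields
  finiteness and the real-valued identities. It applies to the forward and to the backward
  recursion.\<close>

lemma push_normalized:
  fixes K :: "'a \<Rightarrow> 'a \<Rightarrow> real"
  assumes nu: "prob_space nu" "sets nu = sets lam" and lam: "sigma_finite_measure lam"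
    and K: "(\<lambda>(x, x'). K x x') \<in> borel_measurable (lam \<Otimes>\<^sub>M lam)"
      "\<And>x x'. x \<in> space lam \<Longrightarrow> x' \<in> space lam \<Longrightarrow> 0 \<le> K x x'"
      "\<And>x. x \<in> space lam \<Longrightarrow> (\<integral>\<^sup>+x'. ennreal (K x x') \<partial>lam) \<le> ennreal C"
      "0 < (\<integral>\<^sup>+x. (\<integral>\<^sup>+x'. ennreal (K x x') \<partial>lam) \<partial>nu)"
    and mu: "sets mu = sets lam"
      "\<And>A. A \<in> sets lam \<Longrightarrow> emeasure mu A =
        (\<integral>\<^sup>+x. (\<integral>\<^sup>+x'. ennreal (K x x') * indicator A x' \<partial>lam) \<partial>nu) / (\<integral>\<^sup>+x. (\<integral>\<^sup>+x'. ennreal (K x x') \<partial>lam) \<partial>nu)"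
  shows "\<And>f :: 'a \<Rightarrow> ennreal. f \<in> borel_measurable lam \<Longrightarrow> (\<integral>\<^sup>+x. f x \<partial>mu) =
        (\<integral>\<^sup>+x. (\<integral>\<^sup>+x'. ennreal (K x x') * f x' \<partial>lam) \<partial>nu) / (\<integral>\<^sup>+x. (\<integral>\<^sup>+x'. ennreal (K x x') \<partial>lam) \<partial>nu)"
    and "prob_space mu"
    and "0 < (\<integral>x. (\<integral>x'. K x x' \<partial>lam) \<partial>nu)"
    and "(\<integral>\<^sup>+x. (\<integral>\<^sup>+x'. ennreal (K x x') \<partial>lam) \<partial>nu) < \<infinity>"
    and "\<And>f c. f \<in> borel_measurable lam \<Longrightarrow> (\<And>x. x \<in> space lam \<Longrightarrow> \<bar>f x\<bar> \<le> c) \<Longrightarrow>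
      (\<integral>x. (\<integral>x'. K x x' \<partial>lam) \<partial>nu) * (\<integral>x. f x \<partial>mu) = (\<integral>x. (\<integral>x'. K x x' * f x' \<partial>lam) \<partial>nu)"
proof -
  interpret nu: prob_space nu by fact
  interpret lam: sigma_finite_measure lam by fact
  interpret pr: pair_sigma_finite nu lam ..
  note [measurable_cong] = nu(2) mu(1)
  note [measurable] = K(1)
  have sp: "space nu = space lam" "space mu = space lam" using nu(2) mu(1) by (auto dest: sets_eq_imp_space_eq)
  define Z where "Z = (\<integral>\<^sup>+x. (\<integral>\<^sup>+x'. ennreal (K x x') \<partial>lam) \<partial>nu)"
  have Kn: "(\<lambda>(x, x'). K x x') \<in> borel_measurable (nu \<Otimes>\<^sub>M lam)" by measurable
  have "Z \<le> (\<integral>\<^sup>+x. ennreal C \<partial>nu)" unfolding Z_def using K(3) by (intro nn_integral_mono) (simp add: sp)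
  then have Zf: "Z < \<infinity>" by (simp add: nu.emeasure_space_1 le_less_trans)
  show "(\<integral>\<^sup>+x. (\<integral>\<^sup>+x'. ennreal (K x x') \<partial>lam) \<partial>nu) < \<infinity>" using Zf by (simp add: Z_def)
  have Z0: "0 < Z" using K(4) by (simp add: Z_def)
  define B where "B = enn2real Z"
  have B: "Z = ennreal B" "0 < B" using Zf Z0 by (auto simp: B_def enn2real_positive_iff)
  \<comment> \<open>The unnormalised joint law of old and new state; the target is its second
    marginal divided by the total mass.\<close>
  define kap where "kap = density (nu \<Otimes>\<^sub>M lam) (\<lambda>(x, x'). ennreal (K x x'))"
  have kap_nn: "(\<integral>\<^sup>+y. f (snd y) \<partial>kap) = (\<integral>\<^sup>+x. (\<integral>\<^sup>+x'. ennreal (K x x') * f x' \<partial>lam) \<partial>nu)"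
    if [measurable]: "f \<in> borel_measurable lam" for f :: "'a \<Rightarrow> ennreal"
    unfolding kap_def by (simp add: nn_integral_density split_beta' lam.nn_integral_fst[symmetric])
  have snd_kap: "snd \<in> kap \<rightarrow>\<^sub>M lam" unfolding kap_def by measurable
  define m where "m = density (distr kap lam snd) (\<lambda>_. ennreal (1 / B))"
  have m_nn: "(\<integral>\<^sup>+x. f x \<partial>m) = (\<integral>\<^sup>+x. (\<integral>\<^sup>+x'. ennreal (K x x') * f x' \<partial>lam) \<partial>nu) / Z"
    if [measurable]: "f \<in> borel_measurable lam" for f :: "'a \<Rightarrow> ennreal"
  proof -
    have "(\<integral>\<^sup>+x. f x \<partial>m) = ennreal (1 / B) * (\<integral>\<^sup>+y. f (snd y) \<partial>kap)"
      unfolding m_def by (simp add: nn_integral_density nn_integral_cmult nn_integral_distr snd_kap)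
    then show ?thesis
      using B by (simp add: kap_nn[OF that] divide_ennreal_def inverse_ennreal mult.commute inverse_eq_divide)
  qed
  have "mu = m"
  proof (rule measure_eqI)
    show "sets mu = sets m" by (simp add: m_def mu(1))
    fix A assume "A \<in> sets mu"
    then have A: "A \<in> sets lam" by (simp add: mu(1))
    have "emeasure m A = (\<integral>\<^sup>+x. indicator A x \<partial>m)" using A by (simp add: m_def)
    also have "\<dots> = emeasure mu A" using A by (subst m_nn) (simp_all add: mu(2) Z_def)
    finally show "emeasure mu A = emeasure m A" ..
  qed
  then show nn: "(\<integral>\<^sup>+x. f x \<partial>mu) =
        (\<integral>\<^sup>+x. (\<integral>\<^sup>+x'. ennreal (K x x') * f x' \<partial>lam) \<partial>nu) / (\<integral>\<^sup>+x. (\<integral>\<^sup>+x'. ennreal (K x x') \<partial>lam) \<partial>nu)"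
    if "f \<in> borel_measurable lam" for f :: "'a \<Rightarrow> ennreal"
    using m_nn[OF that] by (simp add: Z_def)
  have "emeasure mu (space mu) = (\<integral>\<^sup>+x. 1 \<partial>mu)" by simp
  also have "\<dots> = 1" using Zf Z0 by (subst nn) (simp_all add: Z_def[symmetric])
  finally show "prob_space mu" by (rule prob_spaceI)
  have int_K: "integrable (nu \<Otimes>\<^sub>M lam) (\<lambda>(x, x'). K x x')"
  proof (rule integrableI_nonneg[OF Kn])
    show "AE y in nu \<Otimes>\<^sub>M lam. 0 \<le> (case y of (x, x') \<Rightarrow> K x x')"
      using K(2) by (intro AE_I2) (auto simp: space_pair_measure sp)
    have "(\<integral>\<^sup>+y. ennreal (case y of (x, x') \<Rightarrow> K x x') \<partial>(nu \<Otimes>\<^sub>M lam)) = Z"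
      unfolding Z_def by (subst lam.nn_integral_fst[symmetric]) auto
    then show "(\<integral>\<^sup>+y. ennreal (case y of (x, x') \<Rightarrow> K x x') \<partial>(nu \<Otimes>\<^sub>M lam)) < \<infinity>" using Zf by simp
  qed
  have real_int: "(\<integral>x. f x \<partial>mu) = (1 / B) * (\<integral>x. (\<integral>x'. K x x' * f x' \<partial>lam) \<partial>nu)"
    if [measurable]: "f \<in> borel_measurable lam" and c: "\<And>x. x \<in> space lam \<Longrightarrow> \<bar>f x\<bar> \<le> c" for f c
  proof -
    have "(\<integral>x. f x \<partial>mu) = (\<integral>x. (1 / B) * f x \<partial>distr kap lam snd)"
      unfolding \<open>mu = m\<close> m_def using B by (subst integral_density) auto
    also have "\<dots> = (1 / B) * (\<integral>y. f (snd y) \<partial>kap)"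
      by (simp add: integral_distr snd_kap)
    also have "(\<integral>y. f (snd y) \<partial>kap) = (\<integral>y. K (fst y) (snd y) * f (snd y) \<partial>(nu \<Otimes>\<^sub>M lam))"
    proof -
      have e: "kap = density (nu \<Otimes>\<^sub>M lam) (\<lambda>y. ennreal (K (fst y) (snd y)))"
        unfolding kap_def by (simp add: split_beta')
      have Kn': "(\<lambda>y. K (fst y) (snd y)) \<in> borel_measurable (nu \<Otimes>\<^sub>M lam)" using Kn by (simp add: split_beta')
      show ?thesis
        unfolding e using K(2) Kn' by (subst integral_density) (auto intro!: AE_I2 simp: space_pair_measure sp)
    qed
    also have "\<dots> = (\<integral>x. (\<integral>x'. K x x' * f x' \<partial>lam) \<partial>nu)"
    proof -
      have "integrable (nu \<Otimes>\<^sub>M lam) (\<lambda>y. K (fst y) (snd y) * f (snd y))"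
      proof (rule Bochner_Integration.integrable_bound)
        show "integrable (nu \<Otimes>\<^sub>M lam) (\<lambda>y. c * (case y of (x, x') \<Rightarrow> K x x'))" using int_K by simp
        have Kn': "(\<lambda>y. K (fst y) (snd y)) \<in> borel_measurable (nu \<Otimes>\<^sub>M lam)" using Kn by (simp add: split_beta')
        show "(\<lambda>y. K (fst y) (snd y) * f (snd y)) \<in> borel_measurable (nu \<Otimes>\<^sub>M lam)"
          using Kn' by measurable
        show "AE y in nu \<Otimes>\<^sub>M lam. norm (K (fst y) (snd y) * f (snd y)) \<le> norm (c * (case y of (x, x') \<Rightarrow> K x x'))"
        proof (rule AE_I2)
          fix y assume "y \<in> space (nu \<Otimes>\<^sub>M lam)"
          then have y: "fst y \<in> space lam" "snd y \<in> space lam" by (auto simp: space_pair_measure sp)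
          have "norm (K (fst y) (snd y) * f (snd y)) = \<bar>f (snd y)\<bar> * \<bar>K (fst y) (snd y)\<bar>" by (simp add: abs_mult)
          also have "\<dots> \<le> \<bar>c\<bar> * \<bar>K (fst y) (snd y)\<bar>" using c[OF y(2)] by (intro mult_right_mono) auto
          finally show "norm (K (fst y) (snd y) * f (snd y)) \<le> norm (c * (case y of (x, x') \<Rightarrow> K x x'))"
            by (simp add: split_beta' abs_mult)
        qed
      qed
      from pr.integral_fst'[OF this] show ?thesis by simp
    qed
    finally show ?thesis .
  qed
  have "prob_space mu" by fact
  then have "(\<integral>x. 1 \<partial>mu) = (1::real)" by (simp add: prob_space.prob_space)
  \<comment> \<open>Testing with the constant 1 identifies the real iterated integral with the
    extended total mass.\<close>
  with real_int[of "\<lambda>_. 1" 1] B(2) have BK: "(\<integral>x. (\<integral>x'. K x x' \<partial>lam) \<partial>nu) = B" by (simp add: field_simps)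
  show "0 < (\<integral>x. (\<integral>x'. K x x' \<partial>lam) \<partial>nu)" unfolding BK by (rule B(2))
  show "(\<integral>x. (\<integral>x'. K x x' \<partial>lam) \<partial>nu) * (\<integral>x. f x \<partial>mu) = (\<integral>x. (\<integral>x'. K x x' * f x' \<partial>lam) \<partial>nu)"
    if "f \<in> borel_measurable lam" "\<And>x. x \<in> space lam \<Longrightarrow> \<bar>f x\<bar> \<le> c" for f c
    unfolding BK using real_int[OF that] B(2) by simp
qed

text \<open>The counterpart of \<open>push_normalized\<close> for reweighting on a single space, as
  needed at the initial time of each filter.\<close>

lemma density_normalized:
  fixes om :: "'a \<Rightarrow> real"
  assumes nu: "prob_space nu" "sets nu = sets lam"
    and om: "om \<in> borel_measurable lam" "\<And>x. x \<in> space lam \<Longrightarrow> 0 \<le> om x" "\<And>x. x \<in> space lam \<Longrightarrow> om x \<le> C"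
    and mu: "sets mu = sets lam"
      "\<And>A. A \<in> sets lam \<Longrightarrow> emeasure mu A = (\<integral>\<^sup>+x. ennreal (om x) * indicator A x \<partial>nu) / (\<integral>\<^sup>+x. ennreal (om x) \<partial>nu)"
    and pos: "0 < (\<integral>\<^sup>+x. ennreal (om x) \<partial>nu)"
  shows "\<And>f :: 'a \<Rightarrow> ennreal. f \<in> borel_measurable lam \<Longrightarrow>
      (\<integral>\<^sup>+x. f x \<partial>mu) = (\<integral>\<^sup>+x. ennreal (om x) * f x \<partial>nu) / (\<integral>\<^sup>+x. ennreal (om x) \<partial>nu)"
    and "prob_space mu" and "0 < (\<integral>x. om x \<partial>nu)" and "(\<integral>\<^sup>+x. ennreal (om x) \<partial>nu) < \<infinity>"
    and "\<And>f. f \<in> borel_measurable lam \<Longrightarrow> (\<integral>x. om x \<partial>nu) * (\<integral>x. f x \<partial>mu) = (\<integral>x. om x * f x \<partial>nu)"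
proof -
  interpret nu: prob_space nu by fact
  note [measurable_cong] = nu(2) mu(1)
  note [measurable] = om(1)
  have sp: "space nu = space lam" using nu(2) by (auto dest: sets_eq_imp_space_eq)
  define Z where "Z = (\<integral>\<^sup>+x. ennreal (om x) \<partial>nu)"
  have "integrable nu om"
    using om(2,3) by (intro nu.integrable_const_bound[where B=C]) (auto intro!: AE_I2 simp: sp)
  then have Z: "Z = ennreal (\<integral>x. om x \<partial>nu)"
    unfolding Z_def using om(2) by (intro nn_integral_eq_integral) (auto intro!: AE_I2 simp: sp)
  show "(\<integral>\<^sup>+x. ennreal (om x) \<partial>nu) < \<infinity>" unfolding Z_def[symmetric] Z by simp
  show B: "0 < (\<integral>x. om x \<partial>nu)" using pos unfolding Z_def[symmetric] Z by simp
  define B where "B = (\<integral>x. om x \<partial>nu)"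
  note B = B[folded B_def] and Z = Z[folded B_def]
  define m where "m = density nu (\<lambda>x. ennreal (om x / B))"
  have m_nn: "(\<integral>\<^sup>+x. f x \<partial>m) = (\<integral>\<^sup>+x. ennreal (om x) * f x \<partial>nu) / Z"
    if [measurable]: "f \<in> borel_measurable lam" for f :: "'a \<Rightarrow> ennreal"
  proof -
    have "(\<integral>\<^sup>+x. f x \<partial>m) = (\<integral>\<^sup>+x. ennreal (om x / B) * f x \<partial>nu)"
      unfolding m_def by (rule nn_integral_density) measurable
    also have "\<dots> = (\<integral>\<^sup>+x. (ennreal (om x) * f x) / Z \<partial>nu)"
    proof (rule nn_integral_cong)
      fix x assume "x \<in> space nu"
      then have "ennreal (om x / B) = ennreal (om x) / Z" using B om(2)[of x] by (simp add: Z divide_ennreal sp)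
      then show "ennreal (om x / B) * f x = (ennreal (om x) * f x) / Z"
        by (simp add: divide_ennreal_def ac_simps)
    qed
    also have "\<dots> = (\<integral>\<^sup>+x. ennreal (om x) * f x \<partial>nu) / Z" by (rule nn_integral_divide) measurable
    finally show ?thesis .
  qed
  have eq: "mu = m"
  proof (rule measure_eqI)
    show "sets mu = sets m" by (simp add: m_def mu(1) nu(2))
    fix A assume "A \<in> sets mu"
    then have A: "A \<in> sets lam" by (simp add: mu(1))
    have "emeasure m A = (\<integral>\<^sup>+x. indicator A x \<partial>m)" using A by (simp add: m_def nu(2))
    also have "\<dots> = emeasure mu A" using A by (subst m_nn) (simp_all add: mu(2) Z_def)
    finally show "emeasure mu A = emeasure m A" ..
  qed
  then show nn: "(\<integral>\<^sup>+x. f x \<partial>mu) = (\<integral>\<^sup>+x. ennreal (om x) * f x \<partial>nu) / (\<integral>\<^sup>+x. ennreal (om x) \<partial>nu)"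
    if "f \<in> borel_measurable lam" for f :: "'a \<Rightarrow> ennreal"
    using m_nn[OF that] by (simp add: Z_def)
  have "emeasure mu (space mu) = (\<integral>\<^sup>+x. 1 \<partial>mu)" by simp
  also have "\<dots> = 1" using Z B by (subst nn) (simp_all add: Z_def[symmetric])
  finally show "prob_space mu" by (rule prob_spaceI)
  show "(\<integral>x. om x \<partial>nu) * (\<integral>x. f x \<partial>mu) = (\<integral>x. om x * f x \<partial>nu)" if [measurable]: "f \<in> borel_measurable lam" for f
  proof -
    have "(\<integral>x. f x \<partial>mu) = (\<integral>x. om x / B * f x \<partial>nu)"
      unfolding eq m_def using om(2) B by (subst integral_density) (auto intro!: AE_I2 simp: sp)
    then show ?thesis using B by (simp add: B_def[symmetric])
  qed
qed

lemma ennreal_mult_div_cancel: "0 < Z \<Longrightarrow> Z < \<infinity> \<Longrightarrow> Z * (X / Z) = (X :: ennreal)"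
  by (metis ennreal_times_divide infinity_ennreal_def less_irrefl mult.commute mult_divide_eq_ennreal)

lemma nn_integral_pos:
  assumes f: "f \<in> borel_measurable M" and pos: "\<And>x. x \<in> space M \<Longrightarrow> 0 < f x" and M: "emeasure M (space M) \<noteq> 0"
  shows "0 < (\<integral>\<^sup>+x. f x \<partial>M)"
proof (rule ccontr)
  assume "\<not> 0 < (\<integral>\<^sup>+x. f x \<partial>M)"
  then have "AE x in M. f x = 0" using f by (simp add: nn_integral_0_iff_AE)
  with AE_space have "AE x in M. False"
  proof eventually_elim
    case (elim x)
    then show ?case using pos[of x] by simp
  qed
  then show False using M by (simp add: ae_filter_eq_bot_iff eventually_False)
qed

lemma nn_integral_density_pos:
  assumes q: "prob_density L q" and f: "f \<in> borel_measurable L" and pos: "\<And>x. x \<in> space L \<Longrightarrow> 0 < f x"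
  shows "0 < (\<integral>\<^sup>+x. ennreal (q x) * f x \<partial>L)"
proof -
  have [measurable]: "q \<in> borel_measurable L" using q by (simp add: prob_density_def)
  have "0 < (\<integral>\<^sup>+x. f x \<partial>density L (\<lambda>x. ennreal (q x)))"
  proof (rule nn_integral_pos)
    have "emeasure (density L (\<lambda>x. ennreal (q x))) (space L) = (\<integral>\<^sup>+x. ennreal (q x) \<partial>L)"
      by (simp add: emeasure_density cong: nn_integral_cong)
    then show "emeasure (density L (\<lambda>x. ennreal (q x))) (space (density L (\<lambda>x. ennreal (q x)))) \<noteq> 0"
      using q by (simp add: prob_density_def)
  qed (use f pos in auto)
  then show ?thesis using f by (simp add: nn_integral_density)
qed

text \<open>Under the convention c/0 = infinity for c > 0, finiteness of the weight forces the
  numerator to vanish wherever the denominator does. Bounded weights thus guarantee that the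
  proposal covers the target, and the product identity has no exceptional points.\<close>

lemma weight_mult_cancel:
  assumes "0 \<le> n" "0 \<le> d" "ennreal n / ennreal d < \<infinity>"
  shows "enn2real (ennreal n / ennreal d) * d = n"
proof (cases "d = 0")
  case True
  then have "n = 0" using assms by (cases "n = 0") (auto simp: ennreal_divide_zero split: if_splits)
  then show ?thesis by simp
next
  case False
  then show ?thesis using assms by (simp add: divide_ennreal)
qed

context two_filter_model
begin

interpretation base: sigma_finite_measure "base M" by (rule sigma_finite_base)

lemma qd_density: "x \<in> space (base M) \<Longrightarrow> prob_density (base M) (qd M x)"
  using markov_q by (simp add: markov_density_def)

lemma qd_nonneg: "x \<in> space (base M) \<Longrightarrow> x' \<in> space (base M) \<Longrightarrow> 0 \<le> qd M x x'"
  using qd_density[of x] by (simp add: prob_density_def)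

lemma base_nonnull: "emeasure (base M) (space (base M)) \<noteq> 0"
proof
  assume "emeasure (base M) (space (base M)) = 0"
  then have "AE x in base M. ennreal (brho M x) = 0" by (intro AE_I[where N="space (base M)"]) auto
  then have "(\<integral>\<^sup>+x. ennreal (brho M x) \<partial>base M) = 0" by (simp add: nn_integral_cong_AE)
  then show False using density_brho by (simp add: prob_density_def)
qed

section \<open>The recursion of the filtering distributions\<close>

definition Kf where "Kf s x x' = qd M x x' * pot M (Suc s) x'"

lemma Kf_measurable: "Suc s \<le> horizon M \<Longrightarrow> (\<lambda>(x, x'). Kf s x x') \<in> borel_measurable (base M \<Otimes>\<^sub>M base M)"
proof -
  assume "Suc s \<le> horizon M"
  from pot_measurable[OF this] have [measurable]: "pot M (Suc s) \<in> borel_measurable (base M)" .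
  show ?thesis unfolding Kf_def by measurable
qed

lemma Kf_nonneg: "Suc s \<le> horizon M \<Longrightarrow> x \<in> space (base M) \<Longrightarrow> x' \<in> space (base M) \<Longrightarrow> 0 \<le> Kf s x x'"
  unfolding Kf_def by (intro mult_nonneg_nonneg qd_nonneg less_imp_le[OF pot_pos])

lemma Kf_nn_integral:
  assumes s: "Suc s \<le> horizon M" and x: "x \<in> space (base M)" and f: "f \<in> borel_measurable (base M)"
  shows "(\<integral>\<^sup>+x'. ennreal (pot M (Suc s) x') * f x' \<partial>Qk M x) = (\<integral>\<^sup>+x'. ennreal (Kf s x x') * f x' \<partial>base M)"
proof -
  note [measurable] = pot_measurable[OF s] f
  have "(\<integral>\<^sup>+x'. ennreal (pot M (Suc s) x') * f x' \<partial>Qk M x)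
      = (\<integral>\<^sup>+x'. ennreal (qd M x x') * (ennreal (pot M (Suc s) x') * f x') \<partial>base M)"
    by (rule nn_integral_Qk[OF x]) measurable
  also have "\<dots> = (\<integral>\<^sup>+x'. ennreal (Kf s x x') * f x' \<partial>base M)"
    using qd_nonneg[OF x] by (intro nn_integral_cong) (simp add: Kf_def ennreal_mult' mult.assoc)
  finally show ?thesis .
qed

lemma Kf_total_pos:
  assumes s: "Suc s \<le> horizon M" and x: "x \<in> space (base M)"
  shows "0 < (\<integral>\<^sup>+x'. ennreal (Kf s x x') \<partial>base M)"
proof -
  have [measurable]: "pot M (Suc s) \<in> borel_measurable (base M)" by (rule pot_measurable[OF s])
  have "0 < (\<integral>\<^sup>+x'. ennreal (qd M x x') * ennreal (pot M (Suc s) x') \<partial>base M)"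
    using pot_pos[OF s] by (intro nn_integral_density_pos[OF qd_density[OF x]]) auto
  also have "\<dots> = (\<integral>\<^sup>+x'. ennreal (Kf s x x') \<partial>base M)"
    using qd_nonneg[OF x] by (intro nn_integral_cong) (simp add: Kf_def ennreal_mult')
  finally show ?thesis .
qed

definition om0 where "om0 x = enn2real (omega0 M x)"

lemma om0_measurable: "om0 \<in> borel_measurable (base M)"
proof -
  have [measurable]: "pot M 0 \<in> borel_measurable (base M)" by (rule pot_measurable) simp
  note [measurable] = dinit_measurable
  show ?thesis unfolding om0_def omega0_def by measurable
qed

text \<open>Writing \<open>init\<close> as \<open>rho\<close> with density \<open>dinit\<close>
  turns the target at time 0 into \<open>rho\<close> reweighted by \<open>om0\<close>. The first
  conclusion, total mass times an integral against the filter, is the form in which the recursion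
  can be iterated.\<close>

lemma phi_0:
  assumes b: "\<And>x. x \<in> space (base M) \<Longrightarrow> omega0 M x \<le> ennreal C" and C: "0 \<le> C"
  shows "\<And>f. f \<in> borel_measurable (base M) \<Longrightarrow> fwd_integral M 0 f = fwd_integral M 0 (\<lambda>_. 1) * (\<integral>\<^sup>+x. f x \<partial>phi M 0)"
    and "0 < fwd_integral M 0 (\<lambda>_. 1)" "fwd_integral M 0 (\<lambda>_. 1) < \<infinity>" "prob_space (phi M 0)"
    and "0 < (\<integral>x. om0 x \<partial>rho M)"
    and "\<And>f. f \<in> borel_measurable (base M) \<Longrightarrow> (\<integral>x. om0 x \<partial>rho M) * (\<integral>x. f x \<partial>phi M 0) = (\<integral>x. om0 x * f x \<partial>rho M)"
proof -
  have [measurable]: "pot M 0 \<in> borel_measurable (base M)" by (rule pot_measurable) simp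
  note [measurable] = dinit_measurable
  note [measurable_cong] = sets_init sets_rho
  have sp: "space (rho M) = space (base M)" "space (init M) = space (base M)"
    using sets_rho sets_init by (auto dest: sets_eq_imp_space_eq)
  have om: "ennreal (om0 x) = omega0 M x" if "x \<in> space (base M)" for x
    using b[OF that] unfolding om0_def by (intro ennreal_enn2real) (auto simp: less_top[symmetric] top_unique)
  have omC: "om0 x \<le> C" if "x \<in> space (base M)" for x
    using b[OF that] C by (simp add: om[OF that, symmetric])
  have om_nonneg: "0 \<le> om0 x" for x by (simp add: om0_def)
  have fwd: "fwd_integral M 0 f = (\<integral>\<^sup>+x. ennreal (om0 x) * f x \<partial>rho M)"
    if [measurable]: "f \<in> borel_measurable (base M)" for f
  proof -
    have "fwd_integral M 0 f = (\<integral>\<^sup>+x. ennreal (pot M 0 x) * f x \<partial>density (rho M) (dinit M))"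
      by (simp add: density_init)
    also have "\<dots> = (\<integral>\<^sup>+x. dinit M x * (ennreal (pot M 0 x) * f x) \<partial>rho M)" by (rule nn_integral_density) measurable
    also have "\<dots> = (\<integral>\<^sup>+x. ennreal (om0 x) * f x \<partial>rho M)"
      by (intro nn_integral_cong) (simp add: om sp omega0_def mult.assoc)
    finally show ?thesis .
  qed
  have fwd1: "fwd_integral M 0 (\<lambda>_. 1) = (\<integral>\<^sup>+x. ennreal (om0 x) \<partial>rho M)" by (subst fwd) auto
  interpret init: prob_space "init M" by (rule prob_init)
  have "0 < (\<integral>\<^sup>+x. ennreal (pot M 0 x) \<partial>init M)"
    using pot_pos[of 0] by (intro nn_integral_pos) (auto simp: sp init.emeasure_space_1[unfolded sp])
  then show pos: "0 < fwd_integral M 0 (\<lambda>_. 1)" by simp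
  have mu: "emeasure (phi M 0) A = (\<integral>\<^sup>+x. ennreal (om0 x) * indicator A x \<partial>rho M) / (\<integral>\<^sup>+x. ennreal (om0 x) \<partial>rho M)"
    if A: "A \<in> sets (base M)" for A
    using emeasure_phi[OF _ A, of 0] A by (simp add: fwd fwd1 del: fwd_integral.simps)
  note dn = density_normalized[OF prob_rho sets_rho om0_measurable om_nonneg omC sets_phi mu pos[unfolded fwd1]]
  show "fwd_integral M 0 (\<lambda>_. 1) < \<infinity>" unfolding fwd1 by (rule dn(4))
  show "prob_space (phi M 0)" by (rule dn(2))
  show "0 < (\<integral>x. om0 x \<partial>rho M)" by (rule dn(3))
  show "(\<integral>x. om0 x \<partial>rho M) * (\<integral>x. f x \<partial>phi M 0) = (\<integral>x. om0 x * f x \<partial>rho M)" if "f \<in> borel_measurable (base M)" for f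
    by (rule dn(5)[OF _ _ that])
  have f1: "(\<integral>\<^sup>+x. ennreal (om0 x) \<partial>rho M) < \<infinity>" by (rule dn(4))
  show "fwd_integral M 0 f = fwd_integral M 0 (\<lambda>_. 1) * (\<integral>\<^sup>+x. f x \<partial>phi M 0)" if f: "f \<in> borel_measurable (base M)" for f
  proof -
    have "(\<integral>\<^sup>+x. f x \<partial>phi M 0) = fwd_integral M 0 f / fwd_integral M 0 (\<lambda>_. 1)"
      unfolding fwd[OF f] fwd1 by (rule dn(1)[OF _ _ f])
    then show ?thesis using ennreal_mult_div_cancel[OF pos f1[folded fwd1]] by simp
  qed
qed

text \<open>The integral at time s + 1 is the one at time s applied to the kernel integral of f. By
  induction it is Z times an integral against \<open>phi M s\<close>, and Z cancels on
  normalisation. A bound on the potential bounds the mass of the kernel, since \<open>qd M x\<close>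
  has mass 1.\<close>

lemma phi_Suc:
  assumes s: "Suc s \<le> horizon M" and C: "\<And>x. x \<in> space (base M) \<Longrightarrow> pot M (Suc s) x \<le> C"
    and IH: "\<And>f. f \<in> borel_measurable (base M) \<Longrightarrow> fwd_integral M s f = fwd_integral M s (\<lambda>_. 1) * (\<integral>\<^sup>+x. f x \<partial>phi M s)"
      "0 < fwd_integral M s (\<lambda>_. 1)" "fwd_integral M s (\<lambda>_. 1) < \<infinity>" "prob_space (phi M s)"
  shows "\<And>f. f \<in> borel_measurable (base M) \<Longrightarrow> fwd_integral M (Suc s) f = fwd_integral M (Suc s) (\<lambda>_. 1) * (\<integral>\<^sup>+x. f x \<partial>phi M (Suc s))"
    and "0 < fwd_integral M (Suc s) (\<lambda>_. 1)" "fwd_integral M (Suc s) (\<lambda>_. 1) < \<infinity>" "prob_space (phi M (Suc s))"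
    and "0 < (\<integral>x. (\<integral>x'. Kf s x x' \<partial>base M) \<partial>phi M s)"
    and "\<And>f c. f \<in> borel_measurable (base M) \<Longrightarrow> (\<And>x. x \<in> space (base M) \<Longrightarrow> \<bar>f x\<bar> \<le> c) \<Longrightarrow>
      (\<integral>x. (\<integral>x'. Kf s x x' \<partial>base M) \<partial>phi M s) * (\<integral>x. f x \<partial>phi M (Suc s)) = (\<integral>x. (\<integral>x'. Kf s x x' * f x' \<partial>base M) \<partial>phi M s)"
proof -
  define Z where "Z = fwd_integral M s (\<lambda>_. 1)"
  have Z: "Z \<noteq> 0" "Z \<noteq> \<infinity>" using IH(2,3) by (auto simp: Z_def)
  interpret phis: prob_space "phi M s" by (rule IH(4))
  note Km = Kf_measurable[OF s]
  note [measurable] = Km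
  have fwd: "fwd_integral M (Suc s) f = Z * (\<integral>\<^sup>+x. (\<integral>\<^sup>+x'. ennreal (Kf s x x') * f x' \<partial>base M) \<partial>phi M s)"
    if f: "f \<in> borel_measurable (base M)" for f
  proof -
    note [measurable] = f
    have "fwd_integral M (Suc s) f = fwd_integral M s (\<lambda>x. \<integral>\<^sup>+x'. ennreal (Kf s x x') * f x' \<partial>base M)"
      unfolding fwd_integral.simps by (rule fwd_integral_cong) (rule Kf_nn_integral[OF s _ f])
    also have "\<dots> = Z * (\<integral>\<^sup>+x. (\<integral>\<^sup>+x'. ennreal (Kf s x x') * f x' \<partial>base M) \<partial>phi M s)"
      unfolding Z_def by (rule IH(1)) measurable
    finally show ?thesis .
  qed
  have fwd1: "fwd_integral M (Suc s) (\<lambda>_. 1) = Z * (\<integral>\<^sup>+x. (\<integral>\<^sup>+x'. ennreal (Kf s x x') \<partial>base M) \<partial>phi M s)"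
    by (subst fwd) auto
  have KC: "(\<integral>\<^sup>+x'. ennreal (Kf s x x') \<partial>base M) \<le> ennreal C" if x: "x \<in> space (base M)" for x
  proof -
    have C0: "0 \<le> C" using C[OF x] pot_pos[OF s x] by linarith
    have "(\<integral>\<^sup>+x'. ennreal (Kf s x x') \<partial>base M) \<le> (\<integral>\<^sup>+x'. ennreal C * ennreal (qd M x x') \<partial>base M)"
    proof (rule nn_integral_mono)
      fix x' assume x': "x' \<in> space (base M)"
      have "Kf s x x' \<le> C * qd M x x'"
        unfolding Kf_def using mult_left_mono[OF C[OF x'] qd_nonneg[OF x x']] by (simp add: mult.commute)
      then show "ennreal (Kf s x x') \<le> ennreal C * ennreal (qd M x x')"
        using C0 by (simp add: ennreal_mult'[symmetric] ennreal_leI)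
    qed
    also have "\<dots> = ennreal C"
      using qd_density[OF x] by (subst nn_integral_cmult) (auto simp: prob_density_def)
    finally show ?thesis .
  qed
  have pos: "0 < (\<integral>\<^sup>+x. (\<integral>\<^sup>+x'. ennreal (Kf s x x') \<partial>base M) \<partial>phi M s)"
  proof (rule nn_integral_pos)
    show "emeasure (phi M s) (space (phi M s)) \<noteq> 0" by (simp add: phis.emeasure_space_1 del: space_phi)
  qed (use Kf_total_pos[OF s] in auto)
  have mu: "emeasure (phi M (Suc s)) A = (\<integral>\<^sup>+x. (\<integral>\<^sup>+x'. ennreal (Kf s x x') * indicator A x' \<partial>base M) \<partial>phi M s)
      / (\<integral>\<^sup>+x. (\<integral>\<^sup>+x'. ennreal (Kf s x x') \<partial>base M) \<partial>phi M s)"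
    if A: "A \<in> sets (base M)" for A
  proof -
    have "emeasure (phi M (Suc s)) A = (Z * (\<integral>\<^sup>+x. (\<integral>\<^sup>+x'. ennreal (Kf s x x') * indicator A x' \<partial>base M) \<partial>phi M s))
        / (Z * (\<integral>\<^sup>+x. (\<integral>\<^sup>+x'. ennreal (Kf s x x') \<partial>base M) \<partial>phi M s))"
      using A unfolding emeasure_phi[OF s A] fwd1 by (subst fwd) auto
    then show ?thesis using Z by (simp add: mult.commute[of Z] divide_mult_eq)
  qed
  note pn = push_normalized[OF IH(4) sets_phi sigma_finite_base Km Kf_nonneg[OF s] KC pos sets_phi mu]
  show "prob_space (phi M (Suc s))" by (rule pn(2))
  show "0 < (\<integral>x. (\<integral>x'. Kf s x x' \<partial>base M) \<partial>phi M s)" by (rule pn(3))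
  have fin: "(\<integral>\<^sup>+x. (\<integral>\<^sup>+x'. ennreal (Kf s x x') \<partial>base M) \<partial>phi M s) < \<infinity>" by (rule pn(4))
  show p1: "0 < fwd_integral M (Suc s) (\<lambda>_. 1)" unfolding fwd1 using Z pos by (simp add: ennreal_zero_less_mult_iff zero_less_iff_neq_zero)
  show f1: "fwd_integral M (Suc s) (\<lambda>_. 1) < \<infinity>" unfolding fwd1 using Z fin by (simp add: ennreal_mult_less_top less_top)
  show "(\<integral>x. (\<integral>x'. Kf s x x' \<partial>base M) \<partial>phi M s) * (\<integral>x. f x \<partial>phi M (Suc s)) = (\<integral>x. (\<integral>x'. Kf s x x' * f x' \<partial>base M) \<partial>phi M s)"
    if "f \<in> borel_measurable (base M)" "\<And>x. x \<in> space (base M) \<Longrightarrow> \<bar>f x\<bar> \<le> c" for f c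
    by (rule pn(5)[OF _ _ _ _ that])
  show "fwd_integral M (Suc s) f = fwd_integral M (Suc s) (\<lambda>_. 1) * (\<integral>\<^sup>+x. f x \<partial>phi M (Suc s))"
    if f: "f \<in> borel_measurable (base M)" for f
  proof -
    let ?X = "\<integral>\<^sup>+x. (\<integral>\<^sup>+x'. ennreal (Kf s x x') * f x' \<partial>base M) \<partial>phi M s"
    let ?Y = "\<integral>\<^sup>+x. (\<integral>\<^sup>+x'. ennreal (Kf s x x') \<partial>base M) \<partial>phi M s"
    have "(\<integral>\<^sup>+x. f x \<partial>phi M (Suc s)) = ?X / ?Y" by (rule pn(1)[OF _ _ _ _ f])
    moreover have "?Y * (?X / ?Y) = ?X"
      by (rule ennreal_mult_div_cancel[OF pos fin])
    ultimately show ?thesis unfolding fwd[OF f] fwd1 by (simp add: mult.assoc)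
  qed
qed

section \<open>The recursion of the backward information filter\<close>

interpretation bb: pair_sigma_finite "base M" "base M" ..

lemma bwd_lik_pos: "t \<le> horizon M \<Longrightarrow> x \<in> space (base M) \<Longrightarrow> 0 < bwd_lik M t x"
proof (induction "horizon M - t" arbitrary: t x)
  case 0
  then show ?case using pot_pos[of "horizon M" x] by (subst bwd_lik.simps) simp
next
  case (Suc k)
  then have t: "t < horizon M" by simp
  have m: "bwd_lik M (Suc t) \<in> borel_measurable (base M)" using t by (intro measurable_bwd_lik) simp
  have "0 < (\<integral>\<^sup>+x'. ennreal (qd M x x') * bwd_lik M (Suc t) x' \<partial>base M)"
    using Suc t by (intro nn_integral_density_pos[OF qd_density] m) auto
  then have "0 < (\<integral>\<^sup>+x'. bwd_lik M (Suc t) x' \<partial>Qk M x)" using nn_integral_Qk[OF Suc.prems(2) m] by simp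
  then show ?case using pot_pos[of t x] Suc.prems t
    by (subst bwd_lik.simps) (simp add: ennreal_zero_less_mult_iff)
qed

lemma psi_nn:
  assumes t: "t \<le> horizon M"
  shows "0 < bwd_integral M t (\<lambda>_. 1)" "bwd_integral M t (\<lambda>_. 1) < \<infinity>"
    and "\<And>f. f \<in> borel_measurable (base M) \<Longrightarrow> bwd_integral M t f = bwd_integral M t (\<lambda>_. 1) * (\<integral>\<^sup>+x. f x \<partial>psi M t)"
    and "prob_space (psi M t)"
proof -
  note [measurable] = measurable_bwd_lik[OF t] gam_measurable[OF t]
  define Z where "Z = bwd_integral M t (\<lambda>_. 1)"
  show pos: "0 < bwd_integral M t (\<lambda>_. 1)"
    unfolding bwd_integral_def
    using gam_pos[OF t] bwd_lik_pos[OF t] base_nonnull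
    by (intro nn_integral_pos) (auto simp: ennreal_zero_less_mult_iff)
  show fin: "bwd_integral M t (\<lambda>_. 1) < \<infinity>" by (rule gam_finite[OF t])
  define m where "m = density (base M) (\<lambda>x. ennreal (gam M t x) * bwd_lik M t x / Z)"
  have m_nn: "(\<integral>\<^sup>+x. f x \<partial>m) = bwd_integral M t f / Z" if [measurable]: "f \<in> borel_measurable (base M)" for f
  proof -
    have "(\<integral>\<^sup>+x. f x \<partial>m) = (\<integral>\<^sup>+x. (ennreal (gam M t x) * bwd_lik M t x * f x) / Z \<partial>base M)"
      unfolding m_def by (subst nn_integral_density) (auto simp: divide_ennreal_def ac_simps)
    also have "\<dots> = bwd_integral M t f / Z"
      unfolding bwd_integral_def by (rule nn_integral_divide) measurable
    finally show ?thesis .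
  qed
  have eq: "psi M t = m"
  proof (rule measure_eqI)
    show "sets (psi M t) = sets m" by (simp add: m_def)
    fix A assume "A \<in> sets (psi M t)"
    then have A: "A \<in> sets (base M)" by simp
    have "emeasure m A = (\<integral>\<^sup>+x. indicator A x \<partial>m)" using A by (simp add: m_def)
    also have "\<dots> = emeasure (psi M t) A" using A by (subst m_nn) (auto simp: emeasure_psi[OF t A] Z_def)
    finally show "emeasure (psi M t) A = emeasure m A" ..
  qed
  show nn: "bwd_integral M t f = bwd_integral M t (\<lambda>_. 1) * (\<integral>\<^sup>+x. f x \<partial>psi M t)" if "f \<in> borel_measurable (base M)" for f
    unfolding eq m_nn[OF that] Z_def by (rule ennreal_mult_div_cancel[OF pos fin, symmetric])
  have "emeasure (psi M t) (space (psi M t)) = (\<integral>\<^sup>+x. 1 \<partial>m)" by (simp add: eq)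
  also have "\<dots> = 1" using pos fin by (subst m_nn) (auto simp: Z_def)
  finally show "prob_space (psi M t)" by (rule prob_spaceI)
qed

lemma Kb_measurable:
  assumes t: "t < horizon M"
  shows "(\<lambda>(x', x). Kb M t x x') \<in> borel_measurable (base M \<Otimes>\<^sub>M base M)"
proof -
  have [measurable]: "gam M t \<in> borel_measurable (base M)" "gam M (Suc t) \<in> borel_measurable (base M)"
    "pot M t \<in> borel_measurable (base M)"
    using t by (auto intro!: gam_measurable pot_measurable)
  show ?thesis unfolding Kb_def by measurable
qed

lemma Kb_nonneg: "t < horizon M \<Longrightarrow> x \<in> space (base M) \<Longrightarrow> x' \<in> space (base M) \<Longrightarrow> 0 \<le> Kb M t x x'"
  unfolding Kb_def
  using gam_pos[of t x] gam_pos[of "Suc t" x'] pot_pos[of t x] qd_nonneg[of x x'] by simp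

text \<open>Multiplying and dividing by gamma at time t + 1 makes the integral at time t an integral
  against the unnormalised filter at time t + 1; the ratio of the two artificial densities ends up
  in \<open>Kb\<close>. Tonelli exchanges the order of integration.\<close>

lemma bwd_integral_step:
  assumes t: "t < horizon M" and f: "f \<in> borel_measurable (base M)"
  shows "bwd_integral M t f = bwd_integral M (Suc t) (\<lambda>x'. \<integral>\<^sup>+x. ennreal (Kb M t x x') * f x \<partial>base M)"
proof -
  have st: "Suc t \<le> horizon M" using t by simp
  have [measurable]: "gam M t \<in> borel_measurable (base M)" "gam M (Suc t) \<in> borel_measurable (base M)"
    "pot M t \<in> borel_measurable (base M)" "bwd_lik M (Suc t) \<in> borel_measurable (base M)"
    using t by (auto intro!: gam_measurable pot_measurable measurable_bwd_lik)
  note [measurable] = f Kb_measurable[OF t]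
  have "bwd_integral M t f = (\<integral>\<^sup>+x. (\<integral>\<^sup>+x'. ennreal (gam M (Suc t) x') * bwd_lik M (Suc t) x' * (ennreal (Kb M t x x') * f x) \<partial>base M) \<partial>base M)"
    unfolding bwd_integral_def
  proof (rule nn_integral_cong)
    fix x assume x: "x \<in> space (base M)"
    have [measurable]: "qd M x \<in> borel_measurable (base M)" using qd_density[OF x] by (simp add: prob_density_def)
    have g: "0 \<le> gam M t x" "0 \<le> pot M t x" using gam_pos[of t x] pot_pos[of t x] t x by auto
    have "ennreal (gam M t x) * bwd_lik M t x * f x
        = ennreal (gam M t x) * ennreal (pot M t x) * f x * (\<integral>\<^sup>+x'. ennreal (qd M x x') * bwd_lik M (Suc t) x' \<partial>base M)"
      using t nn_integral_Qk[OF x, of "bwd_lik M (Suc t)"] by (subst bwd_lik.simps) (simp add: ac_simps)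
    also have "\<dots> = (\<integral>\<^sup>+x'. ennreal (gam M t x) * ennreal (pot M t x) * f x * (ennreal (qd M x x') * bwd_lik M (Suc t) x') \<partial>base M)"
      by (rule nn_integral_cmult[symmetric]) measurable
    also have "\<dots> = (\<integral>\<^sup>+x'. ennreal (gam M (Suc t) x') * bwd_lik M (Suc t) x' * (ennreal (Kb M t x x') * f x) \<partial>base M)"
    proof (rule nn_integral_cong)
      fix x' assume x': "x' \<in> space (base M)"
      have g': "0 < gam M (Suc t) x'" using gam_pos[OF st x'] .
      have "ennreal (gam M t x) * ennreal (pot M t x) * ennreal (qd M x x') = ennreal (gam M t x * pot M t x * qd M x x')"
        using g qd_nonneg[OF x x'] by (simp add: ennreal_mult)
      also have "gam M t x * pot M t x * qd M x x' = gam M (Suc t) x' * Kb M t x x'"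
        using g' by (simp add: Kb_def)
      also have "ennreal (gam M (Suc t) x' * Kb M t x x') = ennreal (gam M (Suc t) x') * ennreal (Kb M t x x')"
        using g' by (intro ennreal_mult') simp
      finally have e: "ennreal (gam M t x) * ennreal (pot M t x) * ennreal (qd M x x') = ennreal (gam M (Suc t) x') * ennreal (Kb M t x x')" .
      have "ennreal (gam M t x) * ennreal (pot M t x) * f x * (ennreal (qd M x x') * bwd_lik M (Suc t) x')
          = (ennreal (gam M t x) * ennreal (pot M t x) * ennreal (qd M x x')) * (f x * bwd_lik M (Suc t) x')"
        by (simp add: ac_simps)
      then show "ennreal (gam M t x) * ennreal (pot M t x) * f x * (ennreal (qd M x x') * bwd_lik M (Suc t) x')
          = ennreal (gam M (Suc t) x') * bwd_lik M (Suc t) x' * (ennreal (Kb M t x x') * f x)"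
        unfolding e by (simp add: ac_simps)
    qed
    finally show "ennreal (gam M t x) * bwd_lik M t x * f x
      = (\<integral>\<^sup>+x'. ennreal (gam M (Suc t) x') * bwd_lik M (Suc t) x' * (ennreal (Kb M t x x') * f x) \<partial>base M)" .
  qed
  also have "\<dots> = (\<integral>\<^sup>+x'. (\<integral>\<^sup>+x. ennreal (gam M (Suc t) x') * bwd_lik M (Suc t) x' * (ennreal (Kb M t x x') * f x) \<partial>base M) \<partial>base M)"
    by (rule bb.Fubini'[symmetric]) measurable
  also have "\<dots> = bwd_integral M (Suc t) (\<lambda>x'. \<integral>\<^sup>+x. ennreal (Kb M t x x') * f x \<partial>base M)"
    unfolding bwd_integral_def by (intro nn_integral_cong nn_integral_cmult) measurable
  finally show ?thesis .
qed

text \<open>The same pattern as forwards, with \<open>Kb\<close> read as a kernel from the later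
  state x' to the earlier state x. Its mass bound is a hypothesis because it comes from the sampler
  rather than from the model.\<close>

lemma psi_step:
  assumes t: "t < horizon M"
    and C: "\<And>x'. x' \<in> space (base M) \<Longrightarrow> (\<integral>\<^sup>+x. ennreal (Kb M t x x') \<partial>base M) \<le> ennreal C"
  shows "0 < (\<integral>x'. (\<integral>x. Kb M t x x' \<partial>base M) \<partial>psi M (Suc t))"
    and "\<And>f c. f \<in> borel_measurable (base M) \<Longrightarrow> (\<And>x. x \<in> space (base M) \<Longrightarrow> \<bar>f x\<bar> \<le> c) \<Longrightarrow>
      (\<integral>x'. (\<integral>x. Kb M t x x' \<partial>base M) \<partial>psi M (Suc t)) * (\<integral>x. f x \<partial>psi M t)
        = (\<integral>x'. (\<integral>x. Kb M t x x' * f x \<partial>base M) \<partial>psi M (Suc t))"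
proof -
  have st: "Suc t \<le> horizon M" and t': "t \<le> horizon M" using t by auto
  note ps = psi_nn[OF st] and pt = psi_nn[OF t']
  note Km = Kb_measurable[OF t]
  note [measurable] = Km
  define Z where "Z = bwd_integral M (Suc t) (\<lambda>_. 1)"
  have Z: "Z \<noteq> 0" "Z \<noteq> \<infinity>" using ps(1,2) by (auto simp: Z_def)
  have step: "bwd_integral M t f = Z * (\<integral>\<^sup>+x'. (\<integral>\<^sup>+x. ennreal (Kb M t x x') * f x \<partial>base M) \<partial>psi M (Suc t))"
    if [measurable]: "f \<in> borel_measurable (base M)" for f
    unfolding bwd_integral_step[OF t that] Z_def by (rule ps(3)) measurable
  have step1: "bwd_integral M t (\<lambda>_. 1) = Z * (\<integral>\<^sup>+x'. (\<integral>\<^sup>+x. ennreal (Kb M t x x') \<partial>base M) \<partial>psi M (Suc t))"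
    by (subst step) auto
  have pos: "0 < (\<integral>\<^sup>+x'. (\<integral>\<^sup>+x. ennreal (Kb M t x x') \<partial>base M) \<partial>psi M (Suc t))"
    using pt(1) unfolding step1 by (simp add: ennreal_zero_less_mult_iff)
  have mu: "emeasure (psi M t) A = (\<integral>\<^sup>+x'. (\<integral>\<^sup>+x. ennreal (Kb M t x x') * indicator A x \<partial>base M) \<partial>psi M (Suc t))
      / (\<integral>\<^sup>+x'. (\<integral>\<^sup>+x. ennreal (Kb M t x x') \<partial>base M) \<partial>psi M (Suc t))"
    if A: "A \<in> sets (base M)" for A
  proof -
    have "emeasure (psi M t) A = (Z * (\<integral>\<^sup>+x'. (\<integral>\<^sup>+x. ennreal (Kb M t x x') * indicator A x \<partial>base M) \<partial>psi M (Suc t)))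
        / (Z * (\<integral>\<^sup>+x'. (\<integral>\<^sup>+x. ennreal (Kb M t x x') \<partial>base M) \<partial>psi M (Suc t)))"
      using A unfolding emeasure_psi[OF t' A] step1 by (subst step) auto
    then show ?thesis using Z by (simp add: mult.commute[of Z] divide_mult_eq)
  qed
  have Kn: "0 \<le> Kb M t x x'" if "x' \<in> space (base M)" "x \<in> space (base M)" for x x'
    by (rule Kb_nonneg[OF t that(2,1)])
  note pn = push_normalized[where K="\<lambda>x' x. Kb M t x x'", OF ps(4) sets_psi sigma_finite_base Km Kn C pos sets_psi mu]
  show "0 < (\<integral>x'. (\<integral>x. Kb M t x x' \<partial>base M) \<partial>psi M (Suc t))" by (rule pn(3))
  show "(\<integral>x'. (\<integral>x. Kb M t x x' \<partial>base M) \<partial>psi M (Suc t)) * (\<integral>x. f x \<partial>psi M t)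
        = (\<integral>x'. (\<integral>x. Kb M t x x' * f x \<partial>base M) \<partial>psi M (Suc t))"
    if "f \<in> borel_measurable (base M)" "\<And>x. x \<in> space (base M) \<Longrightarrow> \<bar>f x\<bar> \<le> c" for f c
    by (rule pn(5)[OF _ _ _ _ that])
qed

definition omT where "omT x = enn2real (bomegaT M x)"

lemma omT_measurable: "omT \<in> borel_measurable (base M)"
proof -
  have [measurable]: "pot M (horizon M) \<in> borel_measurable (base M)" "gam M (horizon M) \<in> borel_measurable (base M)"
    "brho M \<in> borel_measurable (base M)"
    using density_brho by (auto intro!: gam_measurable pot_measurable simp: prob_density_def)
  show ?thesis unfolding omT_def bomegaT_def by measurable
qed

lemma brho_prob: "prob_space (density (base M) (\<lambda>x. ennreal (brho M x)))"
proof (rule prob_spaceI)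
  have [measurable]: "brho M \<in> borel_measurable (base M)" using density_brho by (simp add: prob_density_def)
  have "emeasure (density (base M) (\<lambda>x. ennreal (brho M x))) (space (base M)) = (\<integral>\<^sup>+x. ennreal (brho M x) \<partial>base M)"
    by (simp add: emeasure_density cong: nn_integral_cong)
  then show "emeasure (density (base M) (\<lambda>x. ennreal (brho M x))) (space (density (base M) (\<lambda>x. ennreal (brho M x)))) = 1"
    using density_brho by (simp add: prob_density_def)
qed

text \<open>At the horizon, potential times gamma equals weight times proposal density, so the
  target is the terminal proposal reweighted by \<open>omT\<close>.\<close>

lemma psi_T:
  assumes b: "\<And>x. x \<in> space (base M) \<Longrightarrow> bomegaT M x \<le> ennreal C" and C: "0 \<le> C"
  defines "R \<equiv> density (base M) (\<lambda>x. ennreal (brho M x))"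
  shows "0 < (\<integral>x. omT x \<partial>R)"
    and "\<And>f. f \<in> borel_measurable (base M) \<Longrightarrow> (\<integral>x. omT x \<partial>R) * (\<integral>x. f x \<partial>psi M (horizon M)) = (\<integral>x. omT x * f x \<partial>R)"
proof -
  note psT = psi_nn[OF order_refl]
  have [measurable]: "brho M \<in> borel_measurable (base M)" using density_brho by (simp add: prob_density_def)
  have brho_n: "0 \<le> brho M x" if "x \<in> space (base M)" for x using density_brho that by (simp add: prob_density_def)
  note [measurable] = omT_measurable
  have om_nonneg: "0 \<le> omT x" for x by (simp add: omT_def)
  have omC: "omT x \<le> C" if "x \<in> space (base M)" for x
  proof -
    have "enn2real (bomegaT M x) \<le> enn2real (ennreal C)" using b[OF that] by (intro enn2real_mono) auto
    then show ?thesis using C by (simp add: omT_def)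
  qed
  have bm: "omT x * brho M x = pot M (horizon M) x * gam M (horizon M) x" if x: "x \<in> space (base M)" for x
    unfolding omT_def bomegaT_def
  proof (rule weight_mult_cancel)
    show "0 \<le> pot M (horizon M) x * gam M (horizon M) x"
      using pot_pos[OF order_refl x] gam_pos[OF order_refl x] by simp
    show "ennreal (pot M (horizon M) x * gam M (horizon M) x) / ennreal (brho M x) < \<infinity>"
      using b[OF x] unfolding bomegaT_def by (auto intro: le_less_trans)
  qed (rule brho_n[OF x])
  have bwd: "bwd_integral M (horizon M) f = (\<integral>\<^sup>+x. ennreal (omT x) * f x \<partial>R)" if [measurable]: "f \<in> borel_measurable (base M)" for f
  proof -
    have "(\<integral>\<^sup>+x. ennreal (omT x) * f x \<partial>R) = (\<integral>\<^sup>+x. ennreal (brho M x) * (ennreal (omT x) * f x) \<partial>base M)"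
      unfolding R_def by (rule nn_integral_density) measurable
    also have "\<dots> = bwd_integral M (horizon M) f"
      unfolding bwd_integral_def
    proof (rule nn_integral_cong)
      fix x assume x: "x \<in> space (base M)"
      have "ennreal (brho M x) * ennreal (omT x) = ennreal (omT x * brho M x)"
        using brho_n[OF x] om_nonneg[of x] by (simp add: ennreal_mult' mult.commute)
      also have "\<dots> = ennreal (gam M (horizon M) x) * bwd_lik M (horizon M) x"
        using gam_pos[OF order_refl x] unfolding bm[OF x] by (subst bwd_lik.simps) (simp add: ennreal_mult' mult.commute)
      finally show "ennreal (brho M x) * (ennreal (omT x) * f x) = ennreal (gam M (horizon M) x) * bwd_lik M (horizon M) x * f x"
        by (simp add: mult.assoc[symmetric])
    qed
    finally show ?thesis ..
  qed
  have bwd1: "bwd_integral M (horizon M) (\<lambda>_. 1) = (\<integral>\<^sup>+x. ennreal (omT x) \<partial>R)" by (subst bwd) auto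
  have mu: "emeasure (psi M (horizon M)) A = (\<integral>\<^sup>+x. ennreal (omT x) * indicator A x \<partial>R) / (\<integral>\<^sup>+x. ennreal (omT x) \<partial>R)"
    if A: "A \<in> sets (base M)" for A
    using A unfolding emeasure_psi[OF order_refl A] bwd1 by (subst bwd) auto
  have sR: "sets R = sets (base M)" by (simp add: R_def)
  note dn = density_normalized[OF brho_prob[folded R_def] sR omT_measurable om_nonneg omC sets_psi mu psT(1)[unfolded bwd1]]
  show "0 < (\<integral>x. omT x \<partial>R)" by (rule dn(3))
  show "(\<integral>x. omT x \<partial>R) * (\<integral>x. f x \<partial>psi M (horizon M)) = (\<integral>x. omT x * f x \<partial>R)"
    if "f \<in> borel_measurable (base M)" for f by (rule dn(5)[OF _ _ that])
qed

end

section \<open>Central limit theorems for the two filters\<close>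

text \<open>The particle picked by a random ancestor index: measurable because the index takes only
  finitely many values.\<close>

lemma measurable_lineage:
  assumes "\<And>j. j \<in> {1..N::nat} \<Longrightarrow> X j \<in> F \<rightarrow>\<^sub>M L" "A \<in> F \<rightarrow>\<^sub>M count_space {1..N}"
  shows "(\<lambda>w. X (A w) w) \<in> F \<rightarrow>\<^sub>M L"
  by (rule measurable_compose_countable'[OF assms]) (auto intro: countable_finite)

lemma AE_sum_enn2real_pos:
  assumes "AE w in P. 0 < (\<Sum>l\<in>J. W l w)" "\<And>l w. l \<in> J \<Longrightarrow> w \<in> space P \<Longrightarrow> W l w = ennreal (enn2real (W l w))"
  shows "AE w in P. 0 < (\<Sum>l\<in>J. enn2real (W l w))"
  using assms(1) AE_space
proof eventually_elim
  case (elim w)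
  have "(\<Sum>l\<in>J. W l w) = (\<Sum>l\<in>J. ennreal (enn2real (W l w)))" by (rule sum.cong) (auto intro: assms(2) elim)
  also have "\<dots> = ennreal (\<Sum>l\<in>J. enn2real (W l w))" by (rule sum_ennreal) simp
  finally show ?case using elim(1) by simp
qed

lemma le_ennreal_finite: "x \<le> ennreal c \<Longrightarrow> x < \<infinity>"
  by (rule le_less_trans) auto

lemma enn_eq: "x < \<infinity> \<Longrightarrow> x = ennreal (enn2real x)"
  by (simp add: less_top)

locale two_filter_clt = two_filter_model M for M :: "'a smoothing_model" +
  fixes P :: "nat \<Rightarrow> 'w measure"
    and xi bxi :: "nat \<Rightarrow> nat \<Rightarrow> nat \<Rightarrow> 'w \<Rightarrow> 'a"
    and I bI :: "nat \<Rightarrow> nat \<Rightarrow> nat \<Rightarrow> 'w \<Rightarrow> nat"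
  assumes particles: "\<And>N. N \<ge> 1 \<Longrightarrow> two_filters (P N) M N (xi N) (I N) (bxi N) (bI N)"
    and bound_g: "\<And>u. u \<le> horizon M \<Longrightarrow> sup_norm (space (base M)) (\<lambda>x. ennreal (pot M u x)) < \<infinity>"
    and bound_omega0: "sup_norm (space (base M)) (omega0 M) < \<infinity>"
    and bound_omega: "\<And>u. 1 \<le> u \<Longrightarrow> u \<le> horizon M \<Longrightarrow>
      sup_norm (space (base M) \<times> space (base M)) (\<lambda>(x, x'). omega M u x x') < \<infinity>"
    and bound_fadj: "\<And>u. 1 \<le> u \<Longrightarrow> u \<le> horizon M \<Longrightarrow>
      sup_norm (space (base M)) (\<lambda>x. ennreal (fadj M u x)) < \<infinity>"
    and bound_badj: "\<And>u. u < horizon M \<Longrightarrow>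
      sup_norm (space (base M)) (\<lambda>x. ennreal (badj M u x / gam M (Suc u) x)) < \<infinity>"
    and bound_bomegaT: "sup_norm (space (base M)) (bomegaT M) < \<infinity>"
    and bound_bomega: "\<And>u. u < horizon M \<Longrightarrow>
      sup_norm (space (base M) \<times> space (base M)) (\<lambda>(x, x'). bomega M u x x') < \<infinity>"
begin

lemma fwd: "N \<ge> 1 \<Longrightarrow> forward_filter (P N) M N (xi N) (I N)"
  and bwd: "N \<ge> 1 \<Longrightarrow> backward_filter (P N) M N (bxi N) (bI N)"
  using particles[of N] by (auto simp: two_filters_def)

sublocale prob_sequence P
proof (rule prob_sequence.intro)
  fix N :: nat assume "N \<ge> 1"
  from fwd[OF this] show "prob_space (P N)" by (simp add: forward_filter_def)
qed

abbreviation "fwt N s i w \<equiv> enn2real (fwd_weight M (xi N) (I N) s i w)"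
abbreviation "bwt N t i w \<equiv> enn2real (bwd_weight M (bxi N) (bI N) t i w)"

lemmas fwd_xi = forward_filter.xi_measurable[OF fwd]
  and fwd_I = forward_filter.I_measurable[OF fwd]
  and bwd_xi = backward_filter.xi_measurable[OF bwd]
  and bwd_I = backward_filter.I_measurable[OF bwd]

lemma omega0_finite: assumes x: "x \<in> space (base M)" shows "omega0 M x < \<infinity>"
proof -
  from sup_norm_bound[OF bound_omega0] obtain c where "\<forall>z\<in>space (base M). omega0 M z \<le> ennreal c" by blast
  from bspec[OF this x] show ?thesis by (rule le_ennreal_finite)
qed

lemma omega_bound:
  assumes u: "1 \<le> u" "u \<le> horizon M"
  shows "\<exists>c\<ge>0. \<forall>x\<in>space (base M). \<forall>x'\<in>space (base M). omega M u x x' \<le> ennreal c"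
  using sup_norm_bound[OF bound_omega[OF u]] by auto

lemma bomega_bound:
  assumes u: "u < horizon M"
  shows "\<exists>c\<ge>0. \<forall>x\<in>space (base M). \<forall>x'\<in>space (base M). bomega M u x x' \<le> ennreal c"
  using sup_norm_bound[OF bound_bomega[OF u]] by auto

lemma bomegaT_finite: assumes x: "x \<in> space (base M)" shows "bomegaT M x < \<infinity>"
proof -
  from sup_norm_bound[OF bound_bomegaT] obtain c where "\<forall>z\<in>space (base M). bomegaT M z \<le> ennreal c" by blast
  from bspec[OF this x] show ?thesis by (rule le_ennreal_finite)
qed

text \<open>The weights are bounded on the state space, hence finite there, so passing to real
  numbers by \<open>enn2real\<close> loses nothing.\<close>

lemma fwd_weight_eq:
  assumes N: "N \<ge> 1" and s: "s \<le> horizon M" and i: "i \<in> {1..N}" and w: "w \<in> space (P N)"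
  shows "fwd_weight M (xi N) (I N) s i w = ennreal (fwt N s i w)"
proof (cases "s = 0")
  case True
  have "xi N 0 i w \<in> space (base M)" by (rule measurable_space[OF fwd_xi[OF N _ i] w]) simp
  from enn_eq[OF omega0_finite[OF this]] show ?thesis unfolding fwd_weight_def if_P[OF True] .
next
  case False
  then have s1: "1 \<le> s" "s - 1 \<le> horizon M" using s by auto
  from omega_bound[OF s1(1) s] obtain c where c: "\<forall>x\<in>space (base M). \<forall>x'\<in>space (base M). omega M s x x' \<le> ennreal c" by blast
  have "I N s i w \<in> {1..N}" using measurable_space[OF fwd_I[OF N s1(1) s i] w] by simp
  then have "omega M s (xi N (s - 1) (I N s i w) w) (xi N s i w) \<le> ennreal c"
    by (intro c[rule_format] measurable_space[OF fwd_xi[OF N _ _] w] s s1 i)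
  from enn_eq[OF le_ennreal_finite[OF this]] show ?thesis using False by (simp only: fwd_weight_def if_False)
qed

lemma bwd_weight_eq:
  assumes N: "N \<ge> 1" and t: "t \<le> horizon M" and i: "i \<in> {1..N}" and w: "w \<in> space (P N)"
  shows "bwd_weight M (bxi N) (bI N) t i w = ennreal (bwt N t i w)"
proof (cases "t < horizon M")
  case False
  from enn_eq[OF bomegaT_finite[OF measurable_space[OF bwd_xi[OF N t i] w]]]
  show ?thesis using False by (simp only: bwd_weight_def if_False)
next
  case True
  then have t1: "Suc t \<le> horizon M" by simp
  from bomega_bound[OF True] obtain c where c: "\<forall>x\<in>space (base M). \<forall>x'\<in>space (base M). bomega M t x x' \<le> ennreal c" by blast
  have "bI N t i w \<in> {1..N}" using measurable_space[OF bwd_I[OF N True i] w] by simp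
  then have "bomega M t (bxi N t i w) (bxi N (Suc t) (bI N t i w) w) \<le> ennreal c"
    by (intro c[rule_format] measurable_space[OF bwd_xi[OF N _ _] w] t t1 i)
  from enn_eq[OF le_ennreal_finite[OF this]] show ?thesis using True by (simp only: bwd_weight_def if_True)
qed

lemma omega_measurable:
  assumes u: "1 \<le> u" "u \<le> horizon M"
  shows "(\<lambda>(x, x'). omega M u x x') \<in> borel_measurable (base M \<Otimes>\<^sub>M base M)"
proof -
  have [measurable]: "pot M u \<in> borel_measurable (base M)" "fadj M u \<in> borel_measurable (base M)"
    "(\<lambda>(x, x'). fprop M u x x') \<in> borel_measurable (base M \<Otimes>\<^sub>M base M)"
    using u markov_fprop[OF u] by (auto intro!: pot_measurable fadj_measurable simp: markov_density_def)
  show ?thesis unfolding omega_def by measurable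
qed

lemma bomega_measurable:
  assumes u: "u < horizon M"
  shows "(\<lambda>(x, x'). bomega M u x x') \<in> borel_measurable (base M \<Otimes>\<^sub>M base M)"
proof -
  have [measurable]: "pot M u \<in> borel_measurable (base M)" "gam M u \<in> borel_measurable (base M)"
    "badj M u \<in> borel_measurable (base M)" "(\<lambda>(x, x'). bprop M u x x') \<in> borel_measurable (base M \<Otimes>\<^sub>M base M)"
    using u markov_bprop[OF u] by (auto intro!: pot_measurable gam_measurable badj_measurable simp: markov_density_def)
  show ?thesis unfolding bomega_def by measurable
qed

text \<open>Stated for an arbitrary sigma-field: the weights are needed relative to the past of a
  generation, to the full forward history, and to the whole space.\<close>

lemma fwd_weight_measurable:
  assumes N: "N \<ge> 1" and s: "s \<le> horizon M" and i: "i \<in> {1..N}"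
    and xi: "\<And>u j. u \<in> {..s} \<Longrightarrow> j \<in> {1..N} \<Longrightarrow> xi N u j \<in> F \<rightarrow>\<^sub>M base M"
    and I: "\<And>j. 1 \<le> s \<Longrightarrow> j \<in> {1..N} \<Longrightarrow> I N s j \<in> F \<rightarrow>\<^sub>M count_space {1..N}"
  shows "fwt N s i \<in> borel_measurable F"
proof (cases "s = 0")
  case True
  have "(\<lambda>w. om0 (xi N 0 i w)) \<in> borel_measurable F"
    by (rule measurable_compose[OF xi om0_measurable]) (use i in auto)
  then show ?thesis using True by (simp add: fwd_weight_def om0_def)
next
  case False
  then have s1: "1 \<le> s" by simp
  have "(\<lambda>w. (xi N (s - 1) (I N s i w) w, xi N s i w)) \<in> F \<rightarrow>\<^sub>M base M \<Otimes>\<^sub>M base M"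
    by (intro measurable_Pair measurable_lineage[OF xi I[OF s1 i]] xi i) auto
  from measurable_compose[OF this omega_measurable[OF s1 s]] show ?thesis
    using False by (simp add: fwd_weight_def)
qed

lemma bwd_weight_measurable:
  assumes N: "N \<ge> 1" and t: "t \<le> horizon M" and i: "i \<in> {1..N}"
    and xi: "\<And>u j. t \<le> u \<Longrightarrow> u \<le> horizon M \<Longrightarrow> j \<in> {1..N} \<Longrightarrow> bxi N u j \<in> F \<rightarrow>\<^sub>M base M"
    and I: "\<And>j. t < horizon M \<Longrightarrow> j \<in> {1..N} \<Longrightarrow> bI N t j \<in> F \<rightarrow>\<^sub>M count_space {1..N}"
  shows "bwt N t i \<in> borel_measurable F"
proof (cases "t < horizon M")
  case False
  have "(\<lambda>w. omT (bxi N t i w)) \<in> borel_measurable F"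
    by (rule measurable_compose[OF xi omT_measurable]) (use i t in auto)
  then show ?thesis using False by (simp add: bwd_weight_def omT_def)
next
  case True
  have "(\<lambda>w. (bxi N t i w, bxi N (Suc t) (bI N t i w) w)) \<in> F \<rightarrow>\<^sub>M base M \<Otimes>\<^sub>M base M"
    using True by (intro measurable_Pair measurable_lineage[OF xi I[OF True i]] xi i) auto
  from measurable_compose[OF this bomega_measurable[OF True]] show ?thesis
    using True by (simp add: bwd_weight_def)
qed

definition "fwd_past N S R = particle_sigma (P N) (base M) N S R (xi N) (I N)"
definition "bwd_past N S R = particle_sigma (P N) (base M) N S R (bxi N) (bI N)"

lemma fwd_past_measurable:
  assumes N: "N \<ge> 1" and S: "S \<subseteq> {..horizon M}" and R: "R \<subseteq> {1..horizon M}"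
  shows "subalgebra (P N) (fwd_past N S R)"
    and "u \<in> S \<Longrightarrow> j \<in> {1..N} \<Longrightarrow> xi N u j \<in> fwd_past N S R \<rightarrow>\<^sub>M base M"
    and "u \<in> R \<Longrightarrow> j \<in> {1..N} \<Longrightarrow> I N u j \<in> fwd_past N S R \<rightarrow>\<^sub>M count_space {1..N}"
proof -
  have xi: "xi N u j \<in> P N \<rightarrow>\<^sub>M base M" if "u \<in> S" "j \<in> {1..N}" for u j
    using that S by (intro fwd_xi[OF N]) auto
  have I: "I N u j \<in> P N \<rightarrow>\<^sub>M count_space {1..N}" if "u \<in> R" "j \<in> {1..N}" for u j
    using that R by (intro fwd_I[OF N]) auto
  show "subalgebra (P N) (fwd_past N S R)"
    unfolding fwd_past_def by (rule subalgebra_particle_sigma[OF xi I])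
  show "u \<in> S \<Longrightarrow> j \<in> {1..N} \<Longrightarrow> xi N u j \<in> fwd_past N S R \<rightarrow>\<^sub>M base M"
    unfolding fwd_past_def using particle_sigma_xi[where xi="xi N" and P="P N", of u S j N "base M"] xi[of u j] by simp
  show "u \<in> R \<Longrightarrow> j \<in> {1..N} \<Longrightarrow> I N u j \<in> fwd_past N S R \<rightarrow>\<^sub>M count_space {1..N}"
    unfolding fwd_past_def using particle_sigma_I[where I="I N" and P="P N", of u R j N] I[of u j] by simp
qed

lemma bwd_past_measurable:
  assumes N: "N \<ge> 1" and S: "S \<subseteq> {..horizon M}" and R: "R \<subseteq> {..<horizon M}"
  shows "subalgebra (P N) (bwd_past N S R)"
    and "u \<in> S \<Longrightarrow> j \<in> {1..N} \<Longrightarrow> bxi N u j \<in> bwd_past N S R \<rightarrow>\<^sub>M base M"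
    and "u \<in> R \<Longrightarrow> j \<in> {1..N} \<Longrightarrow> bI N u j \<in> bwd_past N S R \<rightarrow>\<^sub>M count_space {1..N}"
proof -
  have xi: "bxi N u j \<in> P N \<rightarrow>\<^sub>M base M" if "u \<in> S" "j \<in> {1..N}" for u j
    using that S by (intro bwd_xi[OF N]) auto
  have I: "bI N u j \<in> P N \<rightarrow>\<^sub>M count_space {1..N}" if "u \<in> R" "j \<in> {1..N}" for u j
    using that R by (intro bwd_I[OF N]) auto
  show "subalgebra (P N) (bwd_past N S R)"
    unfolding bwd_past_def by (rule subalgebra_particle_sigma[OF xi I])
  show "u \<in> S \<Longrightarrow> j \<in> {1..N} \<Longrightarrow> bxi N u j \<in> bwd_past N S R \<rightarrow>\<^sub>M base M"
    unfolding bwd_past_def using particle_sigma_xi[where xi="bxi N" and P="P N", of u S j N "base M"] xi[of u j] by simp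
  show "u \<in> R \<Longrightarrow> j \<in> {1..N} \<Longrightarrow> bI N u j \<in> bwd_past N S R \<rightarrow>\<^sub>M count_space {1..N}"
    unfolding bwd_past_def using particle_sigma_I[where I="bI N" and P="P N", of u R j N] I[of u j] by simp
qed

lemma phi_props:
  "s \<le> horizon M \<Longrightarrow> (\<forall>f. f \<in> borel_measurable (base M) \<longrightarrow> fwd_integral M s f = fwd_integral M s (\<lambda>_. 1) * (\<integral>\<^sup>+x. f x \<partial>phi M s)) \<and>
    0 < fwd_integral M s (\<lambda>_. 1) \<and> fwd_integral M s (\<lambda>_. 1) < \<infinity> \<and> prob_space (phi M s)"
proof (induction s)
  case 0
  from sup_norm_bound[OF bound_omega0] obtain C where C: "0 \<le> C" "\<forall>x\<in>space (base M). omega0 M x \<le> ennreal C" by blast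
  from phi_0(1-4)[OF bspec[OF C(2)] C(1)] show ?case by auto
next
  case (Suc s)
  from sup_norm_bound[OF bound_g[OF Suc.prems]]
  obtain C where C: "0 \<le> C" "\<forall>x\<in>space (base M). ennreal (pot M (Suc s) x) \<le> ennreal C" by blast
  then have C': "pot M (Suc s) x \<le> C" if "x \<in> space (base M)" for x using that by (simp add: ennreal_le_iff)
  have "s \<le> horizon M" using Suc.prems by simp
  note IH = Suc.IH[OF this]
  show ?case
    by (intro conjI allI impI phi_Suc(1-4)[OF Suc.prems C']; use IH in blast)
qed

lemmas phi_prob = phi_props[THEN conjunct2, THEN conjunct2, THEN conjunct2]

lemma fwt_pos: "N \<ge> 1 \<Longrightarrow> s \<le> horizon M \<Longrightarrow> AE w in P N. 0 < (\<Sum>i\<in>{1..N}. fwt N s i w)"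
  by (rule AE_sum_enn2real_pos[OF forward_filter.sum_weights_pos[OF fwd]]) (auto intro: fwd_weight_eq)

lemma bwt_pos: "N \<ge> 1 \<Longrightarrow> t \<le> horizon M \<Longrightarrow> AE w in P N. 0 < (\<Sum>i\<in>{1..N}. bwt N t i w)"
  by (rule AE_sum_enn2real_pos[OF backward_filter.sum_weights_pos[OF bwd]]) (auto intro: bwd_weight_eq)

lemma fwd_clt_0: "clt_samples P (phi M 0) (\<lambda>N. xi N 0) (\<lambda>N i w. fwt N 0 i w) (Gam_fwd M 0)"
proof -
  from sup_norm_bound[OF bound_omega0] obtain C where C: "0 \<le> C" "\<forall>x\<in>space (base M). omega0 M x \<le> ennreal C" by blast
  note p0 = phi_0[OF bspec[OF C(2)] C(1)]
  have eq: "(\<lambda>N i w. fwt N 0 i w) = (\<lambda>N i w. om0 (xi N 0 i w))"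
    by (simp add: fwd_weight_def om0_def fun_eq_iff)
  show ?thesis
    unfolding eq
  proof (rule iid_clt_samples[OF prob_rho sets_rho phi_prob sets_phi])
    show "om0 \<in> borel_measurable (base M)" by (rule om0_measurable)
    show "om0 x \<le> C" if "x \<in> space (base M)" for x
      using bspec[OF C(2) that] C(1) enn2real_mono[of "omega0 M x" "ennreal C"] by (simp add: om0_def)
    show "(\<integral>x. om0 x \<partial>rho M) * (\<integral>x. f x \<partial>phi M 0) = (\<integral>x. om0 x * f x \<partial>rho M)"
      if "f \<in> borel_measurable (base M)" for f using p0(6) that by simp
    show "0 < (\<integral>x. om0 x \<partial>rho M)" using p0(5) by simp
    show "Gam_fwd M 0 f = (\<integral>x. (om0 x)\<^sup>2 * (f x)\<^sup>2 \<partial>rho M) / (\<integral>x. om0 x \<partial>rho M)\<^sup>2" for f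
      by (simp add: om0_def)
    fix N :: nat assume N: "N \<ge> 1"
    show "prob_space.indep_vars (P N) (\<lambda>_. base M) (xi N 0) {1..N}"
      by (rule forward_filter.indep_initial[OF fwd[OF N]])
    show "AE w in P N. 0 < (\<Sum>i\<in>{1..N}. om0 (xi N 0 i w))"
      using fwt_pos[OF N, of 0] by (simp add: fwd_weight_def om0_def)
    fix i assume i: "i \<in> {1..N}"
    show "xi N 0 i \<in> P N \<rightarrow>\<^sub>M base M" by (rule fwd_xi[OF N _ i]) simp
    show "distr (P N) (base M) (xi N 0 i) = rho M" by (rule forward_filter.distr_initial[OF fwd[OF N] i])
  qed (auto simp: om0_def)
qed

text \<open>Induction forwards in time. The step is \<open>smc_step\<close> with kernel
  \<open>Kf s\<close>, adjustment \<open>fadj\<close> and proposal \<open>fprop\<close>;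
  \<open>weight_mult_cancel\<close> supplies the factorisation of the kernel also where the proposal
  vanishes.\<close>

lemma fwd_clt: "s \<le> horizon M \<Longrightarrow> clt_samples P (phi M s) (\<lambda>N. xi N s) (\<lambda>N i w. fwt N s i w) (Gam_fwd M s)"
proof (induction s)
  case 0
  show ?case by (rule fwd_clt_0)
next
  case (Suc s)
  note ss = Suc.prems
  have s: "s \<le> horizon M" and s1: "1 \<le> Suc s" using ss by auto
  define om where "om x x' = enn2real (omega M (Suc s) x x')" for x x'
  define F where "F N = fwd_past N {..<Suc s} {1..<Suc s}" for N
  from omega_bound[OF s1 ss] obtain Co where Co: "0 \<le> Co"
    "\<forall>x\<in>space (base M). \<forall>x'\<in>space (base M). omega M (Suc s) x x' \<le> ennreal Co" by blast
  from sup_norm_bound[OF bound_fadj[OF s1 ss]] obtain Ct where Ct: "0 \<le> Ct"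
    "\<forall>x\<in>space (base M). ennreal (fadj M (Suc s) x) \<le> ennreal Ct" by blast
  from sup_norm_bound[OF bound_g[OF ss]] obtain C where C: "0 \<le> C"
    "\<forall>x\<in>space (base M). ennreal (pot M (Suc s) x) \<le> ennreal C" by blast
  have C': "pot M (Suc s) x \<le> C" if "x \<in> space (base M)" for x using C that by (simp add: ennreal_le_iff)
  have pS: "0 < (\<integral>x. (\<integral>x'. Kf s x x' \<partial>base M) \<partial>phi M s)"
    "(\<integral>x. (\<integral>x'. Kf s x x' \<partial>base M) \<partial>phi M s) * (\<integral>x. f x \<partial>phi M (Suc s)) = (\<integral>x. (\<integral>x'. Kf s x x' * f x' \<partial>base M) \<partial>phi M s)"
    if "f \<in> borel_measurable (base M)" "\<And>x. x \<in> space (base M) \<Longrightarrow> \<bar>f x\<bar> \<le> c" for f c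
    by (rule phi_Suc(5,6)[OF ss C']; use phi_props[OF s] that in blast)+
  interpret S: smc_step P "phi M s" "\<lambda>N. xi N s" "\<lambda>N i w. fwt N s i w" "Gam_fwd M s" "base M"
    "fadj M (Suc s)" "fprop M (Suc s)" "Kf s" om "phi M (Suc s)" F "\<lambda>N. I N (Suc s)" "\<lambda>N. xi N (Suc s)"
    "\<lambda>N. fwd_target M (xi N) (I N) (Suc s)" Ct Co
  proof (intro smc_step.intro smc_step_axioms.intro)
    show "clt_samples P (phi M s) (\<lambda>N. xi N s) (\<lambda>N i w. fwt N s i w) (Gam_fwd M s)" by (rule Suc.IH[OF s])
    show "sigma_finite_measure (base M)" by (rule sigma_finite_base)
    show "prob_space (phi M (Suc s))" by (rule phi_prob[OF ss])
    show "fadj M (Suc s) \<in> borel_measurable (base M)" by (rule fadj_measurable[OF s1 ss])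
    show "0 \<le> fadj M (Suc s) x" if "x \<in> space (base M)" for x by (rule fadj_nonneg[OF s1 ss that])
    show "fadj M (Suc s) x \<le> Ct" if "x \<in> space (base M)" for x using Ct that by (simp add: ennreal_le_iff)
    show "markov_density (base M) (fprop M (Suc s))" by (rule markov_fprop[OF s1 ss])
    show "(\<lambda>(x, x'). om x x') \<in> borel_measurable (base M \<Otimes>\<^sub>M base M)"
    proof -
      note [measurable] = omega_measurable[OF s1 ss]
      show ?thesis unfolding om_def by measurable
    qed
    show "0 \<le> om x x'" for x x' by (simp add: om_def)
    show "om x x' \<le> Co" if "x \<in> space (base M)" "x' \<in> space (base M)" for x x'
      using Co that enn2real_mono[of "omega M (Suc s) x x'" "ennreal Co"] by (simp add: om_def)
    show "(\<lambda>(x, x'). Kf s x x') \<in> borel_measurable (base M \<Otimes>\<^sub>M base M)" by (rule Kf_measurable[OF ss])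
    show "om x x' * (fadj M (Suc s) x * fprop M (Suc s) x x') = Kf s x x'"
      if x: "x \<in> space (base M)" and x': "x' \<in> space (base M)" for x x'
      unfolding om_def omega_def Kf_def
    proof (rule weight_mult_cancel)
      show "0 \<le> qd M x x' * pot M (Suc s) x'" using Kf_nonneg[OF ss x x'] by (simp add: Kf_def)
      show "0 \<le> fadj M (Suc s) x * fprop M (Suc s) x x'"
        using fadj_nonneg[OF s1 ss x] markov_fprop[OF s1 ss] x x' by (auto simp: markov_density_def prob_density_def)
      show "ennreal (qd M x x' * pot M (Suc s) x') / ennreal (fadj M (Suc s) x * fprop M (Suc s) x x') < \<infinity>"
        using Co(2) x x' unfolding omega_def by (blast intro: le_ennreal_finite)
    qed
    show "0 < (\<integral>x. (\<integral>x'. Kf s x x' \<partial>base M) \<partial>phi M s)" by (rule pS(1)[of "\<lambda>_. 0" 0]) auto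
    show "(\<integral>x. (\<integral>x'. Kf s x x' \<partial>base M) \<partial>phi M s) * (\<integral>x. f x \<partial>phi M (Suc s)) = (\<integral>x. (\<integral>x'. Kf s x x' * f x' \<partial>base M) \<partial>phi M s)"
      if "f \<in> borel_measurable (base M)" "\<And>x. x \<in> space (base M) \<Longrightarrow> \<bar>f x\<bar> \<le> c" for f c
      by (rule pS(2)[OF that])
  next
    fix N :: nat assume N: "N \<ge> 1"
    have sub: "{..<Suc s} \<subseteq> {..horizon M}" "{1..<Suc s} \<subseteq> {1..horizon M}" using s by auto
    note pm = fwd_past_measurable[OF N sub, folded F_def]
    show "subalgebra (P N) (F N)" by (rule pm(1))
    show "cond_iid (P N) (F N) N (count_space {1..N} \<Otimes>\<^sub>M base M) (\<lambda>l w. (I N (Suc s) l w, xi N (Suc s) l w))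
      (\<lambda>w. normalized_density (count_space {1..N} \<Otimes>\<^sub>M base M) (fwd_target M (xi N) (I N) (Suc s) w))"
      unfolding F_def fwd_past_def by (rule forward_filter.sampling[OF fwd[OF N] s1 ss])
    show "AE w in P N. 0 < (\<integral>\<^sup>+z. fwd_target M (xi N) (I N) (Suc s) w z \<partial>(count_space {1..N} \<Otimes>\<^sub>M base M))"
      by (rule forward_filter.normalizer_pos[OF fwd[OF N] s1 ss])
    show "AE w in P N. 0 < (\<Sum>i\<in>{1..N}. om (xi N s (I N (Suc s) i w) w) (xi N (Suc s) i w))"
      using fwt_pos[OF N ss] by (simp add: fwd_weight_def om_def)
    fix i assume i: "i \<in> {1..N}"
    show "xi N s i \<in> F N \<rightarrow>\<^sub>M base M" by (rule pm(2)[OF _ i]) simp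
    show "(\<lambda>w. fwt N s i w) \<in> borel_measurable (F N)"
      by (rule fwd_weight_measurable[OF N s i]) (use pm in auto)
    show "I N (Suc s) i \<in> P N \<rightarrow>\<^sub>M count_space {1..N}" by (rule fwd_I[OF N s1 ss i])
    show "xi N (Suc s) i \<in> P N \<rightarrow>\<^sub>M base M" by (rule fwd_xi[OF N ss i])
    fix w x assume w: "w \<in> space (P N)" and x: "x \<in> space (base M)"
    show "fwd_target M (xi N) (I N) (Suc s) w (i, x)
        = ennreal (fwt N s i w) * ennreal (fadj M (Suc s) (xi N s i w) * fprop M (Suc s) (xi N s i w) x)"
      using fwd_weight_eq[OF N s i w] by (simp add: fwd_target_def)
  qed auto
  have "S.wt' = (\<lambda>N i w. fwt N (Suc s) i w)" by (simp add: fun_eq_iff fwd_weight_def om_def)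
  moreover have "S.new_var = Gam_fwd M (Suc s)"
    by (simp add: fun_eq_iff S.new_var_def om_def Kf_def mult.assoc)
  ultimately show ?case using S.step_clt by (simp only:)
qed

text \<open>No bound on gamma itself is available, so the mass of the kernel is controlled through
  the factorisation of \<open>Kb\<close> into weight, adjusted inverse gamma and proposal: the first
  two are bounded and the proposal has mass 1.\<close>

lemma Kb_total_le:
  assumes t: "t < horizon M"
  shows "\<exists>C. \<forall>x'\<in>space (base M). (\<integral>\<^sup>+x. ennreal (Kb M t x x') \<partial>base M) \<le> ennreal C"
proof -
  from bomega_bound[OF t] obtain Co where Co: "0 \<le> Co"
    "\<forall>x\<in>space (base M). \<forall>x'\<in>space (base M). bomega M t x x' \<le> ennreal Co" by blast
  from sup_norm_bound[OF bound_badj[OF t]] obtain Ct where Ct: "0 \<le> Ct"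
    "\<forall>x\<in>space (base M). ennreal (badj M t x / gam M (Suc t) x) \<le> ennreal Ct" by blast
  show ?thesis
  proof (intro exI ballI)
    fix x' assume x': "x' \<in> space (base M)"
    have bp: "bprop M t x' \<in> borel_measurable (base M)" "(\<integral>\<^sup>+x. ennreal (bprop M t x' x) \<partial>base M) = 1"
      using markov_bprop[OF t] x' by (auto simp: markov_density_def prob_density_def)
    have "(\<integral>\<^sup>+x. ennreal (Kb M t x x') \<partial>base M) \<le> (\<integral>\<^sup>+x. ennreal (Co * Ct) * ennreal (bprop M t x' x) \<partial>base M)"
    proof (rule nn_integral_mono)
      fix x assume x: "x \<in> space (base M)"
      have b: "0 \<le> bprop M t x' x" using markov_bprop[OF t] x x' by (auto simp: markov_density_def prob_density_def)
      have g: "0 < gam M (Suc t) x'" using gam_pos[of "Suc t" x'] t x' by simp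
      have "enn2real (bomega M t x x') * (badj M t x' * bprop M t x' x) = gam M t x * pot M t x * qd M x x'"
        unfolding bomega_def
      proof (rule weight_mult_cancel)
        show "0 \<le> gam M t x * pot M t x * qd M x x'"
          using gam_pos[of t x] pot_pos[of t x] qd_nonneg[OF x x'] t x by simp
        show "0 \<le> badj M t x' * bprop M t x' x" using badj_nonneg[OF t x'] b by simp
        show "ennreal (gam M t x * pot M t x * qd M x x') / ennreal (badj M t x' * bprop M t x' x) < \<infinity>"
          using Co(2) x x' unfolding bomega_def by (blast intro: le_ennreal_finite)
      qed
      then have "Kb M t x x' = enn2real (bomega M t x x') * (badj M t x' / gam M (Suc t) x') * bprop M t x' x"
        using g by (simp add: Kb_def)
      also have "\<dots> \<le> Co * Ct * bprop M t x' x"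
      proof (intro mult_right_mono mult_mono b)
        show "enn2real (bomega M t x x') \<le> Co"
          using Co x x' enn2real_mono[of "bomega M t x x'" "ennreal Co"] by simp
        show "badj M t x' / gam M (Suc t) x' \<le> Ct" using Ct x' by (simp add: ennreal_le_iff)
        show "0 \<le> badj M t x' / gam M (Suc t) x'" using badj_nonneg[OF t x'] g by simp
      qed (rule Co)
      finally show "ennreal (Kb M t x x') \<le> ennreal (Co * Ct) * ennreal (bprop M t x' x)"
        using Co(1) Ct(1) by (simp add: ennreal_mult'[symmetric] ennreal_leI)
    qed
    also have "\<dots> = ennreal (Co * Ct)" using bp by (simp add: nn_integral_cmult)
    finally show "(\<integral>\<^sup>+x. ennreal (Kb M t x x') \<partial>base M) \<le> ennreal (Co * Ct)" .
  qed
qed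

lemma bwd_clt_T: "clt_samples P (psi M (horizon M)) (\<lambda>N. bxi N (horizon M)) (\<lambda>N i w. bwt N (horizon M) i w) (Gam_bwd M (horizon M))"
proof -
  define R where "R = density (base M) (\<lambda>x. ennreal (brho M x))"
  have [measurable]: "brho M \<in> borel_measurable (base M)" using density_brho by (simp add: prob_density_def)
  have brho_n: "0 \<le> brho M x" if "x \<in> space (base M)" for x using density_brho that by (simp add: prob_density_def)
  from sup_norm_bound[OF bound_bomegaT] obtain C where C: "0 \<le> C" "\<forall>x\<in>space (base M). bomegaT M x \<le> ennreal C" by blast
  note pT = psi_T[OF bspec[OF C(2)] C(1), folded R_def]
  have eq: "(\<lambda>N i w. bwt N (horizon M) i w) = (\<lambda>N i w. omT (bxi N (horizon M) i w))"
    by (simp add: bwd_weight_def omT_def fun_eq_iff)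
  have R_int: "(\<integral>x. f x \<partial>R) = (\<integral>x. brho M x * f x \<partial>base M)" if "f \<in> borel_measurable (base M)" for f :: "'a \<Rightarrow> real"
    unfolding R_def using that brho_n by (subst integral_density) (auto intro!: AE_I2)
  note [measurable] = omT_measurable
  have "clt_samples P (psi M (horizon M)) (\<lambda>N. bxi N (horizon M)) (\<lambda>N i w. omT (bxi N (horizon M) i w))
    (\<lambda>f. (\<integral>x. (omT x)\<^sup>2 * (f x)\<^sup>2 \<partial>R) / (\<integral>x. omT x \<partial>R)\<^sup>2)"
  proof (rule iid_clt_samples[OF brho_prob[folded R_def] _ psi_nn(4)[OF order_refl] sets_psi])
    show "sets R = sets (base M)" by (simp add: R_def)
    show "omT \<in> borel_measurable (base M)" by (rule omT_measurable)
    show "omT x \<le> C" if "x \<in> space (base M)" for x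
      using bspec[OF C(2) that] C(1) enn2real_mono[of "bomegaT M x" "ennreal C"] by (simp add: omT_def)
    show "(\<integral>x. omT x \<partial>R) * (\<integral>x. f x \<partial>psi M (horizon M)) = (\<integral>x. omT x * f x \<partial>R)"
      if "f \<in> borel_measurable (base M)" for f using pT(2) that by simp
    show "0 < (\<integral>x. omT x \<partial>R)" using pT(1) by simp
    fix N :: nat assume N: "N \<ge> 1"
    show "prob_space.indep_vars (P N) (\<lambda>_. base M) (bxi N (horizon M)) {1..N}"
      by (rule backward_filter.indep_terminal[OF bwd[OF N]])
    show "AE w in P N. 0 < (\<Sum>i\<in>{1..N}. omT (bxi N (horizon M) i w))"
      using bwt_pos[OF N order_refl] by (simp add: bwd_weight_def omT_def)
    fix i assume i: "i \<in> {1..N}"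
    show "bxi N (horizon M) i \<in> P N \<rightarrow>\<^sub>M base M" by (rule bwd_xi[OF N order_refl i])
    show "distr (P N) (base M) (bxi N (horizon M) i) = R"
      unfolding R_def by (rule backward_filter.distr_terminal[OF bwd[OF N] i])
  qed (auto simp: omT_def)
  then interpret C: clt_samples P "psi M (horizon M)" "\<lambda>N. bxi N (horizon M)" "\<lambda>N i w. omT (bxi N (horizon M) i w)"
    "\<lambda>f. (\<integral>x. (omT x)\<^sup>2 * (f x)\<^sup>2 \<partial>R) / (\<integral>x. omT x \<partial>R)\<^sup>2" .
  \<comment> \<open>The variance is defined by integrals over the base measure, the base case works
    with the proposal law. They are matched only on measurable functions, which is why the central
    limit theorem is transferred function by function below.\<close>
  have G: "Gam_bwd M (horizon M) f = (\<integral>x. (omT x)\<^sup>2 * (f x)\<^sup>2 \<partial>R) / (\<integral>x. omT x \<partial>R)\<^sup>2"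
    if [measurable]: "f \<in> borel_measurable (base M)" for f
    by (subst Gam_bwd.simps) (simp add: R_int omT_def[symmetric] mult.assoc)
  show ?thesis
    unfolding eq
  proof (intro clt_samples.intro C.weighted_samples_axioms clt_samples_axioms.intro)
    show "Gam_bwd M (horizon M) (\<lambda>_. 0) = 0" by (subst G) auto
    fix f :: "nat \<Rightarrow> 'a \<Rightarrow> real" and fl :: "'a \<Rightarrow> real" and c u :: real
    assume a: "\<And>N. f N \<in> borel_measurable (psi M (horizon M))" "fl \<in> borel_measurable (psi M (horizon M))"
      "\<And>N x. x \<in> space (psi M (horizon M)) \<Longrightarrow> \<bar>f N x\<bar> \<le> c" "\<And>x. x \<in> space (psi M (horizon M)) \<Longrightarrow> \<bar>fl x\<bar> \<le> c"
      "\<And>N. (\<integral>x. f N x \<partial>psi M (horizon M)) = 0" "(\<lambda>N. \<integral>x. \<bar>f N x - fl x\<bar> \<partial>psi M (horizon M)) \<longlonglongrightarrow> 0"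
    have "fl \<in> borel_measurable (base M)" using a(2) by (simp cong: measurable_cong_sets)
    then have Gfl: "Gam_bwd M (horizon M) fl = (\<integral>x. (omT x)\<^sup>2 * (fl x)\<^sup>2 \<partial>R) / (\<integral>x. omT x \<partial>R)\<^sup>2" by (rule G)
    show "(\<lambda>N. \<integral>w. iexp (u * (sqrt N * wmean N (bxi N (horizon M)) (\<lambda>i w. omT (bxi N (horizon M) i w)) (f N) w)) \<partial>P N)
      \<longlonglongrightarrow> of_real (exp (- u\<^sup>2 * Gam_bwd M (horizon M) fl / 2))"
      unfolding Gfl by (rule C.clt[where c=c]; fact a)
  qed
qed

text \<open>Induction downwards from the horizon. The ancestor is the later state, so the two
  arguments of weight and kernel are exchanged. The factor 1/gamma of the sampling density is part
  of the adjustment \<open>theta\<close>, which keeps \<open>theta\<close> bounded by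
  assumption.\<close>

lemma bwd_clt: "t \<le> horizon M \<Longrightarrow> clt_samples P (psi M t) (\<lambda>N. bxi N t) (\<lambda>N i w. bwt N t i w) (Gam_bwd M t)"
proof (induction "horizon M - t" arbitrary: t)
  case 0
  then have "t = horizon M" by simp
  then show ?case using bwd_clt_T by simp
next
  case (Suc k)
  then have t: "t < horizon M" and st: "Suc t \<le> horizon M" and t': "t \<le> horizon M" by auto
  define om where "om x' x = enn2real (bomega M t x x')" for x' x
  define F where "F N = bwd_past N {t<..horizon M} {t<..<horizon M}" for N
  from bomega_bound[OF t] obtain Co where Co: "0 \<le> Co"
    "\<forall>x\<in>space (base M). \<forall>x'\<in>space (base M). bomega M t x x' \<le> ennreal Co" by blast
  from sup_norm_bound[OF bound_badj[OF t]] obtain Ct where Ct: "0 \<le> Ct"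
    "\<forall>x\<in>space (base M). ennreal (badj M t x / gam M (Suc t) x) \<le> ennreal Ct" by blast
  from Kb_total_le[OF t] obtain C where C: "\<forall>x'\<in>space (base M). (\<integral>\<^sup>+x. ennreal (Kb M t x x') \<partial>base M) \<le> ennreal C" by blast
  note pS = psi_step[OF t bspec[OF C]]
  define theta where "theta x = badj M t x / gam M (Suc t) x" for x
  interpret S: smc_step P "psi M (Suc t)" "\<lambda>N. bxi N (Suc t)" "\<lambda>N i w. bwt N (Suc t) i w" "Gam_bwd M (Suc t)" "base M"
    theta "bprop M t" "\<lambda>x' x. Kb M t x x'" om "psi M t" F "\<lambda>N. bI N t" "\<lambda>N. bxi N t"
    "\<lambda>N. bwd_target M (bxi N) (bI N) t" Ct Co
  proof (intro smc_step.intro smc_step_axioms.intro)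
    show "clt_samples P (psi M (Suc t)) (\<lambda>N. bxi N (Suc t)) (\<lambda>N i w. bwt N (Suc t) i w) (Gam_bwd M (Suc t))"
      using Suc by (intro Suc.hyps(1)) auto
    show "sigma_finite_measure (base M)" by (rule sigma_finite_base)
    show "prob_space (psi M t)" by (rule psi_nn(4)[OF t'])
    show "theta \<in> borel_measurable (base M)"
      unfolding theta_def by (intro borel_measurable_divide badj_measurable gam_measurable t st)
    show "0 \<le> theta x" if "x \<in> space (base M)" for x
      unfolding theta_def using badj_nonneg[OF t that] gam_pos[OF st that] by simp
    show "theta x \<le> Ct" if "x \<in> space (base M)" for x unfolding theta_def using Ct that by (simp add: ennreal_le_iff)
    show "markov_density (base M) (bprop M t)" by (rule markov_bprop[OF t])
    show "(\<lambda>(x, x'). om x x') \<in> borel_measurable (base M \<Otimes>\<^sub>M base M)"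
    proof -
      note [measurable] = bomega_measurable[OF t]
      show ?thesis unfolding om_def by measurable
    qed
    show "0 \<le> om x x'" for x x' by (simp add: om_def)
    show "om x' x \<le> Co" if "x' \<in> space (base M)" "x \<in> space (base M)" for x x'
      using Co that enn2real_mono[of "bomega M t x x'" "ennreal Co"] by (simp add: om_def)
    show "(\<lambda>(x', x). Kb M t x x') \<in> borel_measurable (base M \<Otimes>\<^sub>M base M)" by (rule Kb_measurable[OF t])
    show "om x' x * (theta x' * bprop M t x' x) = Kb M t x x'"
      if x': "x' \<in> space (base M)" and x: "x \<in> space (base M)" for x x'
    proof -
      have b: "0 \<le> bprop M t x' x" using markov_bprop[OF t] x x' by (auto simp: markov_density_def prob_density_def)
      have "om x' x * (badj M t x' * bprop M t x' x) = gam M t x * pot M t x * qd M x x'"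
        unfolding om_def bomega_def
      proof (rule weight_mult_cancel)
        show "0 \<le> gam M t x * pot M t x * qd M x x'"
          using gam_pos[of t x] pot_pos[of t x] qd_nonneg[OF x x'] t x by simp
        show "0 \<le> badj M t x' * bprop M t x' x" using badj_nonneg[OF t x'] b by simp
        show "ennreal (gam M t x * pot M t x * qd M x x') / ennreal (badj M t x' * bprop M t x' x) < \<infinity>"
          using Co(2) x x' unfolding bomega_def by (blast intro: le_ennreal_finite)
      qed
      then show ?thesis by (simp add: Kb_def theta_def)
    qed
    show "0 < (\<integral>x'. (\<integral>x. Kb M t x x' \<partial>base M) \<partial>psi M (Suc t))" using pS(1) by simp
    show "(\<integral>x'. (\<integral>x. Kb M t x x' \<partial>base M) \<partial>psi M (Suc t)) * (\<integral>x. f x \<partial>psi M t)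
        = (\<integral>x'. (\<integral>x. Kb M t x x' * f x \<partial>base M) \<partial>psi M (Suc t))"
      if "f \<in> borel_measurable (base M)" "\<And>x. x \<in> space (base M) \<Longrightarrow> \<bar>f x\<bar> \<le> c" for f c
      by (rule pS(2)[OF _ that])
  next
    fix N :: nat assume N: "N \<ge> 1"
    have sub: "{t<..horizon M} \<subseteq> {..horizon M}" "{t<..<horizon M} \<subseteq> {..<horizon M}" by auto
    note pm = bwd_past_measurable[OF N sub, folded F_def]
    show "subalgebra (P N) (F N)" by (rule pm(1))
    show "cond_iid (P N) (F N) N (count_space {1..N} \<Otimes>\<^sub>M base M) (\<lambda>l w. (bI N t l w, bxi N t l w))
      (\<lambda>w. normalized_density (count_space {1..N} \<Otimes>\<^sub>M base M) (bwd_target M (bxi N) (bI N) t w))"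
      unfolding F_def bwd_past_def by (rule backward_filter.sampling[OF bwd[OF N] t])
    show "AE w in P N. 0 < (\<integral>\<^sup>+z. bwd_target M (bxi N) (bI N) t w z \<partial>(count_space {1..N} \<Otimes>\<^sub>M base M))"
      by (rule backward_filter.normalizer_pos[OF bwd[OF N] t])
    show "AE w in P N. 0 < (\<Sum>i\<in>{1..N}. om (bxi N (Suc t) (bI N t i w) w) (bxi N t i w))"
      using bwt_pos[OF N t'] t by (simp add: bwd_weight_def om_def)
    fix i assume i: "i \<in> {1..N}"
    show "bxi N (Suc t) i \<in> F N \<rightarrow>\<^sub>M base M" by (rule pm(2)[OF _ i]) (use t in simp)
    show "(\<lambda>w. bwt N (Suc t) i w) \<in> borel_measurable (F N)"
      by (rule bwd_weight_measurable[OF N st i]) (use pm in auto)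
    show "bI N t i \<in> P N \<rightarrow>\<^sub>M count_space {1..N}" by (rule bwd_I[OF N t i])
    show "bxi N t i \<in> P N \<rightarrow>\<^sub>M base M" by (rule bwd_xi[OF N t' i])
    fix w x assume w: "w \<in> space (P N)" and x: "x \<in> space (base M)"
    show "bwd_target M (bxi N) (bI N) t w (i, x)
        = ennreal (bwt N (Suc t) i w) * ennreal (theta (bxi N (Suc t) i w) * bprop M t (bxi N (Suc t) i w) x)"
      using bwd_weight_eq[OF N st i w] by (simp add: bwd_target_def theta_def)
  qed auto
  have "S.wt' = (\<lambda>N i w. bwt N t i w)" using t by (simp add: fun_eq_iff bwd_weight_def om_def)
  moreover have "S.new_var = Gam_bwd M t"
    unfolding fun_eq_iff using t by (subst Gam_bwd.simps) (simp add: S.new_var_def om_def theta_def)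
  ultimately show ?case using S.step_clt by (simp only:)
qed

end

section \<open>The two-filter estimator\<close>

text \<open>If uniformity failed, a bad function could be selected at infinitely many N. These
  selections form one admissible sequence, to which \<open>clt\<close> applies and contradicts the
  choice. Uniformity is what permits a test function that depends on independent randomness.\<close>

lemma (in clt_samples) uniform_clt:
  assumes fl: "fl \<in> borel_measurable mu" "\<And>x. x \<in> space mu \<Longrightarrow> \<bar>fl x\<bar> \<le> c" "(\<integral>x. fl x \<partial>mu) = 0"
    and d: "d \<longlonglongrightarrow> 0" "\<And>N. 0 \<le> d N" and e: "0 < e"
  shows "\<forall>\<^sub>F N in sequentially. \<forall>f. f \<in> borel_measurable mu \<and> (\<forall>x\<in>space mu. \<bar>f x\<bar> \<le> c) \<and> (\<integral>x. f x \<partial>mu) = 0 \<and>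
    (\<integral>x. \<bar>f x - fl x\<bar> \<partial>mu) \<le> d N \<longrightarrow>
    cmod ((\<integral>w. iexp (u * (sqrt N * avg N f w)) \<partial>P N) - of_real (exp (- u\<^sup>2 * G fl / 2))) < e"
proof -
  define adm where "adm N f \<longleftrightarrow> f \<in> borel_measurable mu \<and> (\<forall>x\<in>space mu. \<bar>f x\<bar> \<le> c) \<and> (\<integral>x. f x \<partial>mu) = 0 \<and>
    (\<integral>x. \<bar>f x - fl x\<bar> \<partial>mu) \<le> d N" for N f
  define bad where "bad N f \<longleftrightarrow> adm N f \<and>
    \<not> cmod ((\<integral>w. iexp (u * (sqrt N * avg N f w)) \<partial>P N) - of_real (exp (- u\<^sup>2 * G fl / 2))) < e" for N f
  \<comment> \<open>Where no bad function exists the limit function is taken, which keeps the whole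
    sequence admissible.\<close>
  define f where "f N = (if \<exists>f. bad N f then SOME f. bad N f else fl)" for N
  have bad_f: "bad N (f N)" if "bad N g" for N g
  proof -
    have ex: "\<exists>g. bad N g" using that by blast
    show ?thesis unfolding f_def if_P[OF ex] by (rule someI_ex[OF ex])
  qed
  have adm_fl: "adm N fl" for N unfolding adm_def using fl d(2) by auto
  have adm: "adm N (f N)" for N
  proof (cases "\<exists>g. bad N g")
    case True
    then obtain g where "bad N g" by blast
    from bad_f[OF this] show ?thesis by (simp add: bad_def)
  qed (simp add: f_def adm_fl)
  have "(\<lambda>N. \<integral>x. \<bar>f N x - fl x\<bar> \<partial>mu) \<longlonglongrightarrow> 0"
    by (rule Lim_null_comparison[OF always_eventually d(1)]) (use adm in \<open>auto simp: adm_def\<close>)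
  then have "(\<lambda>N. \<integral>w. iexp (u * (sqrt N * avg N (f N) w)) \<partial>P N) \<longlonglongrightarrow> of_real (exp (- u\<^sup>2 * G fl / 2))"
    using adm fl by (intro clt[where c=c]) (auto simp: adm_def)
  then have "\<forall>\<^sub>F N in sequentially. dist (\<integral>w. iexp (u * (sqrt N * avg N (f N) w)) \<partial>P N) (of_real (exp (- u\<^sup>2 * G fl / 2))) < e"
    using e by (rule tendstoD)
  then show ?thesis
  proof eventually_elim
    case (elim N)
    then have "\<not> bad N (f N)" by (simp add: bad_def dist_norm)
    then have "\<not> bad N g" for g using bad_f by blast
    then show ?case by (auto simp: bad_def adm_def)
  qed
qed

text \<open>The identity map, read once into \<open>A\<close> and once into \<open>B\<close>, gives
  two independent random variables. Their joint law is a product, so the two occurrences of the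
  outcome may be integrated separately.\<close>

lemma (in prob_space) indep_subalgebras_Fubini:
  fixes H :: "'a \<times> 'a \<Rightarrow> 'b::{banach, second_countable_topology}"
  assumes A: "subalgebra M A" and B: "subalgebra M B" and indep: "indep_set (sets A) (sets B)"
    and H: "H \<in> borel_measurable (A \<Otimes>\<^sub>M B)" and c: "\<And>w w'. w \<in> space M \<Longrightarrow> w' \<in> space M \<Longrightarrow> norm (H (w, w')) \<le> c"
  shows "(\<integral>w. H (w, w) \<partial>M) = (\<integral>w'. (\<integral>w. H (w, w') \<partial>M) \<partial>M)"
    and "integrable M (\<lambda>w'. \<integral>w. H (w, w') \<partial>M)"
proof -
  have idA [measurable]: "(\<lambda>w. w) \<in> M \<rightarrow>\<^sub>M A" and idB [measurable]: "(\<lambda>w. w) \<in> M \<rightarrow>\<^sub>M B"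
    by (rule measurable_subalgebra_id[OF A], rule measurable_subalgebra_id[OF B])
  note [measurable] = H
  \<comment> \<open>The sigma-field generated by the identity into a sub-sigma-field is that
    sub-sigma-field, so independence of the variables is the given independence of sets.\<close>
  have gen: "sigma_sets (space M) {(\<lambda>w. w) -` Y \<inter> space M | Y. Y \<in> sets C} = sets C" if C: "subalgebra M C" for C
  proof -
    have sp: "space C = space M" using C by (simp add: subalgebra_def)
    have "Y \<inter> space M = Y" if "Y \<in> sets C" for Y using sets.sets_into_space[OF that] sp by auto
    then have "(\<lambda>Y. (\<lambda>w. w) -` Y \<inter> space M) ` sets C = (\<lambda>Y. Y) ` sets C" by (intro image_cong) auto
    then have "{(\<lambda>w. w) -` Y \<inter> space M | Y. Y \<in> sets C} = sets C" by (simp add: Setcompr_eq_image)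
    then show ?thesis using sets.sigma_sets_eq[of C] by (simp add: sp)
  qed
  have "indep_var A (\<lambda>w. w) B (\<lambda>w. w)"
    unfolding indep_var_eq gen[OF A] gen[OF B] using indep by simp
  then have d: "distr M A (\<lambda>w. w) \<Otimes>\<^sub>M distr M B (\<lambda>w. w) = distr M (A \<Otimes>\<^sub>M B) (\<lambda>w. (w, w))"
    by (simp add: indep_var_distribution_eq)
  interpret DA: prob_space "distr M A (\<lambda>w. w)" by (rule prob_space_distr[OF idA])
  interpret DB: prob_space "distr M B (\<lambda>w. w)" by (rule prob_space_distr[OF idB])
  interpret pr: pair_prob_space "distr M A (\<lambda>w. w)" "distr M B (\<lambda>w. w)" ..
  have sp: "space A = space M" "space B = space M" using A B by (auto simp: subalgebra_def)
  have int: "integrable (distr M A (\<lambda>w. w) \<Otimes>\<^sub>M distr M B (\<lambda>w. w)) H"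
    by (rule pr.P.integrable_const_bound[where B=c]) (auto intro!: AE_I2 c simp: space_pair_measure sp)
  have inner: "(\<integral>w. H (w, w') \<partial>distr M A (\<lambda>w. w)) = (\<integral>w. H (w, w') \<partial>M)" if w': "w' \<in> space M" for w'
  proof -
    have "(\<lambda>w. H (w, w')) \<in> borel_measurable A" by (rule measurable_Pair1[OF H]) (simp add: sp w')
    then show ?thesis by (subst integral_distr) auto
  qed
  have int2: "integrable (distr M B (\<lambda>w. w)) (\<lambda>w'. \<integral>w. H (w, w') \<partial>distr M A (\<lambda>w. w))"
    using pr.integrable_snd[of "\<lambda>x y. H (x, y)"] int by simp
  have m2: "(\<lambda>w'. \<integral>w. H (w, w') \<partial>distr M A (\<lambda>w. w)) \<in> borel_measurable B"
    using borel_measurable_integrable[OF int2] by simp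
  have "(\<integral>w. H (w, w) \<partial>M) = (\<integral>y. H y \<partial>distr M (A \<Otimes>\<^sub>M B) (\<lambda>w. (w, w)))" by (subst integral_distr) auto
  also have "\<dots> = (\<integral>w'. (\<integral>w. H (w, w') \<partial>distr M A (\<lambda>w. w)) \<partial>distr M B (\<lambda>w. w))"
    unfolding d[symmetric] using pr.integral_snd[of "\<lambda>x y. H (x, y)"] int by simp
  also have "\<dots> = (\<integral>w'. (\<integral>w. H (w, w') \<partial>distr M A (\<lambda>w. w)) \<partial>M)"
    by (rule integral_distr[OF idB m2])
  also have "\<dots> = (\<integral>w'. (\<integral>w. H (w, w') \<partial>M) \<partial>M)" by (intro Bochner_Integration.integral_cong inner) auto
  finally show "(\<integral>w. H (w, w) \<partial>M) = (\<integral>w'. (\<integral>w. H (w, w') \<partial>M) \<partial>M)" .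
  have "integrable M (\<lambda>w'. \<integral>w. H (w, w') \<partial>distr M A (\<lambda>w. w))"
    using int2 by (simp add: integrable_distr_eq[OF idB m2])
  then show "integrable M (\<lambda>w'. \<integral>w. H (w, w') \<partial>M)"
    using Bochner_Integration.integrable_cong[OF refl inner] by (rule iffD1[rotated])
qed

text \<open>Variance 0 is the Dirac mass and is treated separately; a positive variance gives the
  image of the standard normal law under scaling by \<open>sqrt v\<close>.\<close>

lemma normal_law_char:
  assumes v: "0 \<le> v"
  shows "real_distribution (normal_law 0 v)" "char (normal_law 0 v) u = of_real (exp (- u\<^sup>2 * v / 2))"
proof -
  have "real_distribution (normal_law 0 v) \<and> char (normal_law 0 v) u = of_real (exp (- u\<^sup>2 * v / 2))"
  proof (cases "v = 0")
    case True
    interpret R: prob_space "return borel (0::real)" by (rule prob_space_return) simp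
    show ?thesis using True
      by (simp add: normal_law_def real_distribution_def real_distribution_axioms_def R.prob_space_axioms char_def integral_return)
  next
    case False
    then have s: "0 < sqrt v" using v by simp
    interpret S: real_distribution std_normal_distribution by (rule real_dist_normal_dist)
    have [simp]: "distr std_normal_distribution borel (\<lambda>x. sqrt v * x) = normal_law 0 v"
    proof -
      have "distr std_normal_distribution lborel (\<lambda>x. x) = std_normal_distribution"
        by (rule distr_id2) simp
      then have "distributed std_normal_distribution lborel (\<lambda>x. x) (\<lambda>x. ennreal (std_normal_density x))"
        unfolding distributed_def by simp
      from S.normal_density_affine[OF this, of "sqrt v" 0] s
      have "distr std_normal_distribution lborel (\<lambda>x. 0 + sqrt v * x) = density lborel (\<lambda>x. ennreal (normal_density (0 + sqrt v * 0) (\<bar>sqrt v\<bar> * 1) x))"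
        by (intro distributed_distr_eq_density) auto
      moreover have "distr std_normal_distribution lborel (\<lambda>x. 0 + sqrt v * x) = distr std_normal_distribution borel (\<lambda>x. sqrt v * x)"
        by (rule distr_cong) auto
      moreover have "\<bar>sqrt v\<bar> * 1 = sqrt v" "0 + sqrt v * 0 = 0" using s by auto
      ultimately show ?thesis unfolding normal_law_def if_not_P[OF False] by (simp only:)
    qed
    have "real_distribution (normal_law 0 v)"
      using S.real_distribution_distr[of "\<lambda>x. sqrt v * x"] by simp
    moreover have "char (normal_law 0 v) u = char std_normal_distribution (sqrt v * u)"
      unfolding char_def \<open>distr std_normal_distribution borel (\<lambda>x. sqrt v * x) = normal_law 0 v\<close>[symmetric]
      by (subst integral_distr) (auto simp: ac_simps)
    moreover have "- (sqrt v * u)\<^sup>2 / 2 = - u\<^sup>2 * v / 2" using v by (simp add: power_mult_distrib)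
    ultimately show ?thesis by (simp only: char_std_normal_distribution)
  qed
  then show "real_distribution (normal_law 0 v)" "char (normal_law 0 v) u = of_real (exp (- u\<^sup>2 * v / 2))" by auto
qed

context clt_samples
begin

lemma avg_sum_integral:
  assumes N: "N \<ge> 1" and w: "w \<in> space (P N)"
    and h: "\<And>i. i \<in> {1..N} \<Longrightarrow> integrable nu (\<lambda>x. h x (xi N i w))"
  shows "(\<integral>x. avg N (h x) w \<partial>nu) = avg N (\<lambda>y. \<integral>x. h x y \<partial>nu) w"
    and "integrable nu (\<lambda>x. avg N (h x) w)"
proof -
  have i: "integrable nu (\<lambda>x. wt N i w * h x (xi N i w))" if "i \<in> {1..N}" for i
    by (rule integrable_mult_right[OF h[OF that]])
  show "(\<integral>x. avg N (h x) w \<partial>nu) = avg N (\<lambda>y. \<integral>x. h x y \<partial>nu) w"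
    unfolding wmean_def by (subst integral_divide_zero, subst Bochner_Integration.integral_sum[OF i]) auto
  show "integrable nu (\<lambda>x. avg N (h x) w)"
    unfolding wmean_def by (intro Bochner_Integration.integrable_divide Bochner_Integration.integrable_sum i)
qed

text \<open>Limits of characteristic functions have modulus at most 1; taking u = 1 gives exp (-G/2)
  <= 1. The abstract variance functional is thereby nonnegative without inspecting its
  recursion.\<close>

lemma G_nonneg:
  assumes fl: "fl \<in> borel_measurable mu" "\<And>x. x \<in> space mu \<Longrightarrow> \<bar>fl x\<bar> \<le> c" "(\<integral>x. fl x \<partial>mu) = 0"
  shows "0 \<le> G fl"
proof -
  have "(\<lambda>N. \<integral>w. iexp (1 * (sqrt N * avg N fl w)) \<partial>P N) \<longlonglongrightarrow> of_real (exp (- 1\<^sup>2 * G fl / 2))"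
    by (rule clt[where c=c]) (use fl in auto)
  then have "cmod (of_real (exp (- 1\<^sup>2 * G fl / 2))) \<le> 1"
  proof (rule Lim_norm_ubound[rotated])
    show "\<forall>\<^sub>F N in sequentially. cmod (\<integral>w. iexp (1 * (sqrt N * avg N fl w)) \<partial>P N) \<le> 1"
    proof (rule eventually_sequentiallyI[of 1])
      fix N :: nat assume "1 \<le> N"
      then interpret PN: prob_space "P N" by (rule prob_P)
      have "cmod (\<integral>w. iexp (1 * (sqrt N * avg N fl w)) \<partial>P N) \<le> (\<integral>w. cmod (iexp (1 * (sqrt N * avg N fl w))) \<partial>P N)"
        by (rule integral_norm_bound)
      then show "cmod (\<integral>w. iexp (1 * (sqrt N * avg N fl w)) \<partial>P N) \<le> 1" by (simp add: PN.prob_space)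
    qed
  qed simp
  then show ?thesis by simp
qed

end

context two_filter_clt
begin

text \<open>For frozen backward particles the conditional characteristic function splits exactly
  into a phase, the backward average of \<open>h2\<close>, and the characteristic function of a
  forward average of a centred function. The latter tends to the constant \<open>L1\<close>, so the
  limit is a product and the variances add.\<close>

lemma two_filter_clt_char:
  assumes s: "s \<le> horizon M" and t: "t \<le> horizon M"
    and hm: "h \<in> borel_measurable (base M \<Otimes>\<^sub>M base M)"
    and hc: "\<And>x y. x \<in> space (base M) \<Longrightarrow> y \<in> space (base M) \<Longrightarrow> \<bar>h (x, y)\<bar> \<le> c"
    and h0: "(\<integral>z. h z \<partial>(phi M s \<Otimes>\<^sub>M psi M t)) = 0"
  shows "(\<lambda>N. \<integral>w. iexp (u * (sqrt N * two_filter_estimator M N (xi N) (I N) (bxi N) (bI N) s t h w)) \<partial>P N)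
    \<longlonglongrightarrow> of_real (exp (- u\<^sup>2 * Gam_two M s t h / 2))"
    and "0 \<le> Gam_two M s t h"
proof -
  interpret A: clt_samples P "phi M s" "\<lambda>N. xi N s" "\<lambda>N i w. fwt N s i w" "Gam_fwd M s" by (rule fwd_clt[OF s])
  interpret B: clt_samples P "psi M t" "\<lambda>N. bxi N t" "\<lambda>N i w. bwt N t i w" "Gam_bwd M t" by (rule bwd_clt[OF t])
  interpret AB: pair_prob_space "phi M s" "psi M t" ..
  note [measurable] = hm
  have c0: "0 \<le> c"
  proof -
    obtain x where "x \<in> space (base M)" using A.mu.not_empty by auto
    from hc[OF this this] show ?thesis by linarith
  qed
  have hx: "(\<lambda>y. h (x, y)) \<in> borel_measurable (base M)" if "x \<in> space (base M)" for x
    using measurable_Pair2[OF hm that] .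
  have hy: "(\<lambda>x. h (x, y)) \<in> borel_measurable (base M)" if "y \<in> space (base M)" for y
    using measurable_Pair1[OF hm that] .
  define h1 where "h1 x = (\<integral>y. h (x, y) \<partial>psi M t)" for x
  define h2 where "h2 y = (\<integral>x. h (x, y) \<partial>phi M s)" for y
  have h1m: "h1 \<in> borel_measurable (base M)"
    unfolding h1_def by measurable
  have h2m: "h2 \<in> borel_measurable (base M)"
    unfolding h2_def by measurable
  have h1c: "\<bar>h1 x\<bar> \<le> c" if x: "x \<in> space (base M)" for x
    unfolding h1_def by (rule B.mu.expectation_bounded(2)) (use hx[OF x] hc[OF x] in auto)
  have h2c: "\<bar>h2 y\<bar> \<le> c" if y: "y \<in> space (base M)" for y
    unfolding h2_def by (rule A.mu.expectation_bounded(2)) (use hy[OF y] hc[OF _ y] in auto)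
  have h_int: "integrable (phi M s \<Otimes>\<^sub>M psi M t) h"
    by (rule AB.P.expectation_bounded(1)[where c=c]) (auto simp: space_pair_measure hc)
  have h1_0: "(\<integral>x. h1 x \<partial>phi M s) = 0" unfolding h1_def using AB.integral_fst'[OF h_int] h0 by simp
  have h2_0: "(\<integral>y. h2 y \<partial>psi M t) = 0" unfolding h2_def using AB.integral_snd[of "\<lambda>x y. h (x, y)"] h_int h0 by simp
  \<comment> \<open>The test function seen by the forward filter: \<open>h\<close> averaged over the
    backward particles. It depends on the outcome and on N.\<close>
  define F where "F N w x = B.avg N (\<lambda>y. h (x, y)) w" for N w x
  define est where "est N w = A.avg N (F N w) w" for N w
  have est: "two_filter_estimator M N (xi N) (I N) (bxi N) (bI N) s t h w = est N w" for N w
    unfolding two_filter_estimator_def est_def F_def wmean_def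
    by (simp add: sum_distrib_left sum_divide_distrib ac_simps)
  have bxi_sp: "bxi N t i w \<in> space (base M)" if "N \<ge> 1" "i \<in> {1..N}" "w \<in> space (P N)" for N i w
    by (rule measurable_space[OF bwd_xi[OF that(1) t that(2)] that(3)])
  have Fm: "F N w \<in> borel_measurable (base M)" if "N \<ge> 1" "w \<in> space (P N)" for N w
    unfolding F_def wmean_def using hy[OF bxi_sp[OF that(1) _ that(2)]]
    by (intro borel_measurable_divide borel_measurable_sum borel_measurable_times borel_measurable_const)
  have Fc: "\<bar>F N w x\<bar> \<le> c" if "N \<ge> 1" "w \<in> space (P N)" "x \<in> space (base M)" for N w x
    unfolding F_def by (rule B.avg_bound[OF that(1,2)]) (use hc that c0 in auto)
  have F_int: "(\<integral>x. F N w x \<partial>phi M s) = B.avg N h2 w" if N: "N \<ge> 1" and w: "w \<in> space (P N)" for N w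
    unfolding F_def h2_def
  proof (rule B.avg_sum_integral(1)[OF N w])
    fix i assume i: "i \<in> {1..N}"
    show "integrable (phi M s) (\<lambda>x. h (x, bxi N t i w))"
      by (rule A.mu.expectation_bounded(1)[where c=c]) (use hy[OF bxi_sp[OF N i w]] hc bxi_sp[OF N i w] in auto)
  qed
  define Ff where "Ff N = fwd_past N {..horizon M} {1..horizon M}" for N
  define Fb where "Fb N = bwd_past N {..horizon M} {..<horizon M}" for N
  have Ff: "subalgebra (P N) (Ff N)" "\<And>i. i \<in> {1..N} \<Longrightarrow> xi N s i \<in> Ff N \<rightarrow>\<^sub>M base M"
    "\<And>i. i \<in> {1..N} \<Longrightarrow> (\<lambda>w. fwt N s i w) \<in> borel_measurable (Ff N)" if N: "N \<ge> 1" for N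
  proof -
    note pm = fwd_past_measurable[OF N order_refl order_refl, folded Ff_def]
    show "subalgebra (P N) (Ff N)" by (rule pm(1))
    show "xi N s i \<in> Ff N \<rightarrow>\<^sub>M base M" if "i \<in> {1..N}" for i using s by (intro pm(2)[OF _ that]) simp
    show "(\<lambda>w. fwt N s i w) \<in> borel_measurable (Ff N)" if "i \<in> {1..N}" for i
      by (rule fwd_weight_measurable[OF N s that]) (use pm s in auto)
  qed
  have Fb: "subalgebra (P N) (Fb N)" "\<And>i. i \<in> {1..N} \<Longrightarrow> bxi N t i \<in> Fb N \<rightarrow>\<^sub>M base M"
    "\<And>i. i \<in> {1..N} \<Longrightarrow> (\<lambda>w. bwt N t i w) \<in> borel_measurable (Fb N)" if N: "N \<ge> 1" for N
  proof -
    note pm = bwd_past_measurable[OF N order_refl order_refl, folded Fb_def]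
    show "subalgebra (P N) (Fb N)" by (rule pm(1))
    show "bxi N t i \<in> Fb N \<rightarrow>\<^sub>M base M" if "i \<in> {1..N}" for i using t by (intro pm(2)[OF _ that]) simp
    show "(\<lambda>w. bwt N t i w) \<in> borel_measurable (Fb N)" if "i \<in> {1..N}" for i
      by (rule bwd_weight_measurable[OF N t that]) (use pm t in auto)
  qed
  \<comment> \<open>Forward and backward randomness are given separate arguments, so that
    independence turns the diagonal integral into an iterated one.\<close>
  define H where "H N y = iexp (u * (sqrt (real N) * A.avg N (F N (snd y)) (fst y)))" for N and y :: "'w \<times> 'w"
  have Hm: "H N \<in> borel_measurable (Ff N \<Otimes>\<^sub>M Fb N)" if N: "N \<ge> 1" for N
  proof -
    note [measurable] = Ff(2,3)[OF N] Fb(2,3)[OF N]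
    have hij: "(\<lambda>y. h (xi N s i (fst y), bxi N t j (snd y))) \<in> borel_measurable (Ff N \<Otimes>\<^sub>M Fb N)"
      if [measurable]: "i \<in> {1..N}" "j \<in> {1..N}" for i j by measurable
    have wi: "(\<lambda>y. fwt N s i (fst y)) \<in> borel_measurable (Ff N \<Otimes>\<^sub>M Fb N)" if "i \<in> {1..N}" for i
      by (rule measurable_compose[OF measurable_fst Ff(3)[OF N that]])
    have wj: "(\<lambda>y. bwt N t j (snd y)) \<in> borel_measurable (Ff N \<Otimes>\<^sub>M Fb N)" if "j \<in> {1..N}" for j
      by (rule measurable_compose[OF measurable_snd Fb(3)[OF N that]])
    have "(\<lambda>y. A.avg N (F N (snd y)) (fst y)) \<in> borel_measurable (Ff N \<Otimes>\<^sub>M Fb N)"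
      unfolding wmean_def F_def
      by (intro borel_measurable_divide borel_measurable_sum borel_measurable_times wi wj hij)
    then show ?thesis unfolding H_def by measurable
  qed
  have H1: "cmod (H N y) \<le> 1" for N y unfolding H_def by simp
  have Fub: "(\<integral>w. H N (w, w) \<partial>P N) = (\<integral>w'. (\<integral>w. H N (w, w') \<partial>P N) \<partial>P N)"
    "integrable (P N) (\<lambda>w'. \<integral>w. H N (w, w') \<partial>P N)" if N: "N \<ge> 1" for N
  proof -
    interpret tf: two_filters "P N" M N "xi N" "I N" "bxi N" "bI N" by (rule particles[OF N])
    have "tf.fwd.indep_set (sets (Ff N)) (sets (Fb N))"
      unfolding Ff_def Fb_def fwd_past_def bwd_past_def by (rule tf.indep_filters)
    from tf.fwd.indep_subalgebras_Fubini[OF Ff(1)[OF N] Fb(1)[OF N] this Hm[OF N] H1]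
    show "(\<integral>w. H N (w, w) \<partial>P N) = (\<integral>w'. (\<integral>w. H N (w, w') \<partial>P N) \<partial>P N)"
      "integrable (P N) (\<lambda>w'. \<integral>w. H N (w, w') \<partial>P N)" by auto
  qed
  \<comment> \<open>The L1 distance of the random test function from its limit; \<open>a\<close> is
    its expectation.\<close>
  define k where "k N w = (\<integral>x. \<bar>F N w x - h1 x\<bar> \<partial>phi M s)" for N w
  define a where "a N = (\<integral>w. k N w \<partial>P N)" for N
  have Pair_m: "(\<lambda>y. \<bar>F N (fst y) (snd y) - h1 (snd y)\<bar>) \<in> borel_measurable (P N \<Otimes>\<^sub>M phi M s)" if N: "N \<ge> 1" for N
  proof -
    have wj: "(\<lambda>y. bwt N t j (fst y)) \<in> borel_measurable (P N \<Otimes>\<^sub>M phi M s)" if "j \<in> {1..N}" for j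
      by (rule measurable_compose[OF measurable_fst B.wt_meas[OF N that]])
    have hj: "(\<lambda>y. h (snd y, bxi N t j (fst y))) \<in> borel_measurable (P N \<Otimes>\<^sub>M phi M s)" if "j \<in> {1..N}" for j
    proof -
      have [measurable]: "bxi N t j \<in> P N \<rightarrow>\<^sub>M base M" by (rule bwd_xi[OF N t that])
      show ?thesis by measurable
    qed
    have "(\<lambda>y. F N (fst y) (snd y)) \<in> borel_measurable (P N \<Otimes>\<^sub>M phi M s)"
      unfolding F_def wmean_def by (intro borel_measurable_divide borel_measurable_sum borel_measurable_times wj hj)
    then show ?thesis using h1m by measurable
  qed
  have k_bound: "0 \<le> k N w" "k N w \<le> 2 * c" if "N \<ge> 1" "w \<in> space (P N)" for N w
  proof -
    show "0 \<le> k N w" unfolding k_def by (rule integral_nonneg_AE) simp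
    have "\<bar>k N w\<bar> \<le> 2 * c" unfolding k_def
    proof (rule A.mu.expectation_bounded(2))
      show "(\<lambda>x. \<bar>F N w x - h1 x\<bar>) \<in> borel_measurable (phi M s)" using Fm[OF that] h1m by simp
      show "\<bar>\<bar>F N w x - h1 x\<bar>\<bar> \<le> 2 * c" if x: "x \<in> space (phi M s)" for x
        using Fc[OF \<open>N \<ge> 1\<close> \<open>w \<in> space (P N)\<close>, of x] h1c[of x] x by simp
    qed
    then show "k N w \<le> 2 * c" by simp
  qed
  have k_int: "integrable (P N) (k N)" if N: "N \<ge> 1" for N
  proof -
    have "k N \<in> borel_measurable (P N)"
      unfolding k_def using A.mu.borel_measurable_lebesgue_integral[of "\<lambda>w x. \<bar>F N w x - h1 x\<bar>" "P N"] Pair_m[OF N]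
      by (simp add: split_beta')
    then show ?thesis using k_bound[OF N] by (intro integrable_bounded[OF N, where B="2 * c"]) (auto intro!: AE_I2)
  qed
  have a_nonneg: "0 \<le> a N" if "N \<ge> 1" for N
    unfolding a_def using k_bound(1)[OF that] by (intro integral_nonneg_AE AE_I2)
  \<comment> \<open>After exchanging the integrals, the backward law of large numbers applies for
    each fixed x, and dominated convergence finishes. The index is shifted because nothing controls
    \<open>P 0\<close>.\<close>
  have a_lim: "a \<longlonglongrightarrow> 0"
  proof -
    have eq: "a N = (\<integral>x. (\<integral>w. \<bar>F N w x - h1 x\<bar> \<partial>P N) \<partial>phi M s)"
      and meas: "(\<lambda>x. \<integral>w. \<bar>F N w x - h1 x\<bar> \<partial>P N) \<in> borel_measurable (phi M s)" if N: "N \<ge> 1" for N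
    proof -
      interpret PN: prob_space "P N" by (rule prob_P[OF N])
      interpret pr: pair_prob_space "P N" "phi M s" ..
      have "integrable (P N \<Otimes>\<^sub>M phi M s) (\<lambda>y. \<bar>F N (fst y) (snd y) - h1 (snd y)\<bar>)"
      proof (rule pr.P.expectation_bounded(1)[OF Pair_m[OF N]])
        fix y assume "y \<in> space (P N \<Otimes>\<^sub>M phi M s)"
        then have y: "fst y \<in> space (P N)" "snd y \<in> space (base M)" by (auto simp: space_pair_measure)
        show "\<bar>\<bar>F N (fst y) (snd y) - h1 (snd y)\<bar>\<bar> \<le> 2 * c" using Fc[OF N y] h1c[OF y(2)] by simp
      qed
      then have i: "integrable (P N \<Otimes>\<^sub>M phi M s) (\<lambda>(w, x). \<bar>F N w x - h1 x\<bar>)" by (simp add: split_beta')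
      show "a N = (\<integral>x. (\<integral>w. \<bar>F N w x - h1 x\<bar> \<partial>P N) \<partial>phi M s)"
        unfolding a_def k_def by (rule pr.Fubini_integral[OF i, symmetric])
      show "(\<lambda>x. \<integral>w. \<bar>F N w x - h1 x\<bar> \<partial>P N) \<in> borel_measurable (phi M s)"
        using pr.integrable_snd[OF i] by (rule borel_measurable_integrable)
    qed
    have "(\<lambda>N. \<integral>x. (\<integral>w. \<bar>F (Suc N) w x - h1 x\<bar> \<partial>P (Suc N)) \<partial>phi M s) \<longlonglongrightarrow> (\<integral>x. 0 \<partial>phi M s)"
    proof (rule integral_dominated_convergence[where w="\<lambda>_. 2 * c"])
      show "(\<lambda>x. \<integral>w. \<bar>F (Suc N) w x - h1 x\<bar> \<partial>P (Suc N)) \<in> borel_measurable (phi M s)" for N by (rule meas) simp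
      show "AE x in phi M s. (\<lambda>N. \<integral>w. \<bar>F (Suc N) w x - h1 x\<bar> \<partial>P (Suc N)) \<longlonglongrightarrow> 0"
      proof (rule AE_I2)
        fix x assume "x \<in> space (phi M s)"
        then have x: "x \<in> space (base M)" by simp
        have "null_prob P (\<lambda>N w. F N w x - h1 x)"
          unfolding F_def h1_def using hx[OF x] hc[OF x] by (intro B.lln[where c=c]) auto
        then have "(\<lambda>N. \<integral>w. \<bar>F N w x - h1 x\<bar> \<partial>P N) \<longlonglongrightarrow> 0"
        proof (rule null_prob_L1)
          fix N :: nat assume N: "N \<ge> 1"
          show "AE w in P N. \<bar>F N w x - h1 x\<bar> \<le> 2 * c"
          proof (rule AE_I2)
            fix w assume "w \<in> space (P N)"
            from Fc[OF N this x] h1c[OF x] show "\<bar>F N w x - h1 x\<bar> \<le> 2 * c" by simp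
          qed
        qed
        then show "(\<lambda>N. \<integral>w. \<bar>F (Suc N) w x - h1 x\<bar> \<partial>P (Suc N)) \<longlonglongrightarrow> 0" by (rule LIMSEQ_Suc)
      qed
      show "AE x in phi M s. norm (\<integral>w. \<bar>F (Suc N) w x - h1 x\<bar> \<partial>P (Suc N)) \<le> 2 * c" for N
      proof (rule AE_I2)
        fix x assume "x \<in> space (phi M s)"
        then have x: "x \<in> space (base M)" by simp
        have N: "1 \<le> Suc N" by simp
        interpret PN: prob_space "P (Suc N)" by (rule prob_P[OF N])
        have m: "(\<lambda>w. F (Suc N) w x) \<in> borel_measurable (P (Suc N))"
          unfolding F_def using hx[OF x] by (intro B.avg_measurable[OF N]) simp
        have "\<bar>\<integral>w. \<bar>F (Suc N) w x - h1 x\<bar> \<partial>P (Suc N)\<bar> \<le> 2 * c"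
        proof (rule PN.expectation_bounded(2))
          show "(\<lambda>w. \<bar>F (Suc N) w x - h1 x\<bar>) \<in> borel_measurable (P (Suc N))" using m by measurable
          fix w assume "w \<in> space (P (Suc N))"
          from Fc[OF N this x] h1c[OF x] show "\<bar>\<bar>F (Suc N) w x - h1 x\<bar>\<bar> \<le> 2 * c" by simp
        qed
        then show "norm (\<integral>w. \<bar>F (Suc N) w x - h1 x\<bar> \<partial>P (Suc N)) \<le> 2 * c" by simp
      qed
    qed auto
    then have "(\<lambda>N. a (Suc N)) \<longlonglongrightarrow> 0" by (simp add: eq)
    then show ?thesis by (rule LIMSEQ_imp_Suc)
  qed
  define L1 :: complex where "L1 = of_real (exp (- u\<^sup>2 * Gam_fwd M s h1 / 2))"
  \<comment> \<open>A radius that vanishes, but more slowly than \<open>a\<close>: both d and a/d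
    are then small. The second summand keeps it positive where \<open>a\<close> is 0, and the
    absolute value covers index 0, where the sign of \<open>a\<close> is unknown.\<close>
  define d where "d N = sqrt \<bar>a N\<bar> + 1 / (real N + 1)" for N
  have d_pos: "0 < d N" for N unfolding d_def by (intro add_nonneg_pos) auto
  have d_lim: "d \<longlonglongrightarrow> 0"
  proof -
    have "(\<lambda>N. sqrt \<bar>a N\<bar>) \<longlonglongrightarrow> sqrt \<bar>0\<bar>" by (intro tendsto_real_sqrt tendsto_rabs a_lim)
    moreover have "(\<lambda>N. 1 / (real N + 1)) \<longlonglongrightarrow> 0" by real_asymp
    ultimately show ?thesis unfolding d_def using tendsto_add by fastforce
  qed
  have ad: "a N / d N \<le> sqrt \<bar>a N\<bar>" if N: "N \<ge> 1" for N
  proof -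
    have "a N = sqrt \<bar>a N\<bar> * sqrt \<bar>a N\<bar>" using a_nonneg[OF N] by simp
    also have "\<dots> \<le> sqrt \<bar>a N\<bar> * d N" by (intro mult_left_mono) (auto simp: d_def)
    finally show ?thesis using d_pos[of N] by (simp add: divide_le_eq)
  qed
  \<comment> \<open>Subtracting the exact forward mean of \<open>F\<close>, which is the backward
    average of \<open>h2\<close>, makes the function admissible. The subtracted mean carries the
    backward fluctuation and becomes the factor \<open>E2\<close>.\<close>
  define f where "f N w x = F N w x - B.avg N h2 w" for N w x
  define C where "C N w' = (\<integral>w. iexp (u * (sqrt (real N) * A.avg N (f N w') w)) \<partial>P N)" for N w'
  define E2 where "E2 N w' = iexp (u * (sqrt (real N) * B.avg N h2 w'))" for N w'
  have h2_avg: "\<bar>B.avg N h2 w\<bar> \<le> c" if "N \<ge> 1" "w \<in> space (P N)" for N w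
    by (rule B.avg_bound[OF that]) (use h2c c0 in auto)
  have fm: "f N w' \<in> borel_measurable (phi M s)" if "N \<ge> 1" "w' \<in> space (P N)" for N w'
    unfolding f_def using Fm[OF that] by simp
  have fc: "\<bar>f N w' x\<bar> \<le> 2 * c" if "N \<ge> 1" "w' \<in> space (P N)" "x \<in> space (base M)" for N w' x
    unfolding f_def using Fc[OF that] h2_avg[OF that(1,2)] by linarith
  have Fi: "integrable (phi M s) (F N w')" if "N \<ge> 1" "w' \<in> space (P N)" for N w'
    by (rule A.mu.expectation_bounded(1)[where c=c]) (use Fm[OF that] Fc[OF that] in auto)
  have h1i: "integrable (phi M s) h1" by (rule A.mu.expectation_bounded(1)[where c=c]) (use h1m h1c in auto)
  have f0: "(\<integral>x. f N w' x \<partial>phi M s) = 0" if "N \<ge> 1" "w' \<in> space (P N)" for N w'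
    unfolding f_def using Fi[OF that] F_int[OF that] by (simp add: A.mu.prob_space[unfolded space_phi])
  \<comment> \<open>The backward average of \<open>h2\<close> is itself the integral of
    \<open>F - h1\<close>, hence at most \<open>k\<close>; centring therefore only doubles the
    distance.\<close>
  have fd: "(\<integral>x. \<bar>f N w' x - h1 x\<bar> \<partial>phi M s) \<le> 2 * k N w'" if N: "N \<ge> 1" and w': "w' \<in> space (P N)" for N w'
  proof -
    have "\<bar>B.avg N h2 w'\<bar> = \<bar>\<integral>x. F N w' x - h1 x \<partial>phi M s\<bar>"
      using Fi[OF N w'] h1i F_int[OF N w'] h1_0 by simp
    also have "\<dots> \<le> k N w'" unfolding k_def by (rule integral_abs_bound)
    finally have b: "\<bar>B.avg N h2 w'\<bar> \<le> k N w'" .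
    have i1: "integrable (phi M s) (\<lambda>x. \<bar>F N w' x - h1 x\<bar>)" using Fi[OF N w'] h1i by auto
    have i2: "integrable (phi M s) (\<lambda>x. \<bar>f N w' x - h1 x\<bar>)" unfolding f_def using Fi[OF N w'] h1i by auto
    have "(\<integral>x. \<bar>f N w' x - h1 x\<bar> \<partial>phi M s) \<le> (\<integral>x. \<bar>F N w' x - h1 x\<bar> + k N w' \<partial>phi M s)"
    proof (rule integral_mono[OF i2])
      show "integrable (phi M s) (\<lambda>x. \<bar>F N w' x - h1 x\<bar> + k N w')" using i1 by auto
      show "\<bar>f N w' x - h1 x\<bar> \<le> \<bar>F N w' x - h1 x\<bar> + k N w'" for x unfolding f_def using b by linarith
    qed
    also have "\<dots> = 2 * k N w'" using i1 by (simp add: A.mu.prob_space[unfolded space_phi] k_def)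
    finally show ?thesis .
  qed
  have inner: "(\<integral>w. H N (w, w') \<partial>P N) = E2 N w' * C N w'" if N: "N \<ge> 1" and w': "w' \<in> space (P N)" for N w'
  proof -
    have A1: "A.avg N (F N w') \<in> borel_measurable (P N)" by (rule A.avg_measurable[OF N]) (use Fm[OF N w'] in simp)
    have A2: "A.avg N (f N w') \<in> borel_measurable (P N)" by (rule A.avg_measurable[OF N fm[OF N w']])
    have "(\<integral>w. H N (w, w') \<partial>P N) = (\<integral>w. E2 N w' * iexp (u * (sqrt (real N) * A.avg N (f N w') w)) \<partial>P N)"
    proof (rule integral_cong_AE)
      show "AE w in P N. H N (w, w') = E2 N w' * iexp (u * (sqrt (real N) * A.avg N (f N w') w))"
        using A.wt_pos[OF N]
      proof eventually_elim
        case (elim w)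
        have "A.avg N (f N w') w = A.avg N (F N w') w - B.avg N h2 w'"
          using A.avg_affine[OF elim, of "F N w'" "B.avg N h2 w'" 1] by (simp add: f_def[abs_def])
        then have e: "A.avg N (F N w') w = B.avg N h2 w' + A.avg N (f N w') w" by simp
        show ?case unfolding H_def E2_def fst_conv snd_conv e by (simp add: exp_add[symmetric] distrib_left)
      qed
      show "(\<lambda>w. H N (w, w')) \<in> borel_measurable (P N)" unfolding H_def using A1 by simp
      show "(\<lambda>w. E2 N w' * iexp (u * (sqrt (real N) * A.avg N (f N w') w))) \<in> borel_measurable (P N)" using A2 by simp
    qed
    also have "\<dots> = E2 N w' * C N w'" unfolding C_def by simp
    finally show ?thesis .
  qed
  have C1: "cmod (C N w') \<le> 1" if N: "N \<ge> 1" for N w'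
  proof -
    interpret PN: prob_space "P N" by (rule prob_P[OF N])
    have "cmod (C N w') \<le> (\<integral>w. cmod (iexp (u * (sqrt (real N) * A.avg N (f N w') w))) \<partial>P N)"
      unfolding C_def by (rule integral_norm_bound)
    then show ?thesis by (simp add: PN.prob_space)
  qed
  have G1: "0 \<le> Gam_fwd M s h1" by (rule A.G_nonneg[where c=c]) (use h1m h1c h1_0 in auto)
  have G2: "0 \<le> Gam_bwd M t h2" by (rule B.G_nonneg[where c=c]) (use h2m h2c h2_0 in auto)
  have L1: "cmod L1 \<le> 1" unfolding L1_def using G1 by simp
  have main: "(\<lambda>N. (\<integral>w. H N (w, w) \<partial>P N) - (\<integral>w'. E2 N w' \<partial>P N) * L1) \<longlonglongrightarrow> 0"
  proof (rule tendstoI)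
    fix e :: real assume e: "0 < e"
    have ev1: "\<forall>\<^sub>F N in sequentially. \<forall>g. g \<in> borel_measurable (phi M s) \<and> (\<forall>x\<in>space (phi M s). \<bar>g x\<bar> \<le> 2 * c) \<and>
      (\<integral>x. g x \<partial>phi M s) = 0 \<and> (\<integral>x. \<bar>g x - h1 x\<bar> \<partial>phi M s) \<le> d N \<longrightarrow>
      cmod ((\<integral>w. iexp (u * (sqrt N * A.avg N g w)) \<partial>P N) - of_real (exp (- u\<^sup>2 * Gam_fwd M s h1 / 2))) < e / 2"
    proof (rule A.uniform_clt[OF _ _ h1_0 d_lim])
      show "h1 \<in> borel_measurable (phi M s)" using h1m by simp
      show "\<bar>h1 x\<bar> \<le> 2 * c" if "x \<in> space (phi M s)" for x using h1c[of x] that c0 by simp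
    qed (use e d_pos in \<open>auto intro: less_imp_le\<close>)
    have "(\<lambda>N. 4 * sqrt \<bar>a N\<bar>) \<longlonglongrightarrow> 4 * sqrt \<bar>0\<bar>" by (intro tendsto_mult tendsto_const tendsto_real_sqrt tendsto_rabs a_lim)
    then have "\<forall>\<^sub>F N in sequentially. 4 * sqrt \<bar>a N\<bar> < e / 2" by (rule order_tendstoD(2)) (use e in simp)
    with ev1 eventually_ge_at_top[of 1]
    show "\<forall>\<^sub>F N in sequentially. dist ((\<integral>w. H N (w, w) \<partial>P N) - (\<integral>w'. E2 N w' \<partial>P N) * L1) 0 < e"
    proof eventually_elim
      case (elim N)
      note N = elim(2)
      interpret PN: prob_space "P N" by (rule prob_P[OF N])
      \<comment> \<open>Markov's inequality in pointwise form: inside the ball the uniform limit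
        theorem applies; outside, d < 2k, so the trivial bound 2 is below 4k/d.\<close>
      have pt: "cmod (C N w' - L1) \<le> e / 2 + 4 * k N w' / d N" if w': "w' \<in> space (P N)" for w'
      proof (cases "(\<integral>x. \<bar>f N w' x - h1 x\<bar> \<partial>phi M s) \<le> d N")
        case True
        have "cmod (C N w' - L1) < e / 2" unfolding C_def L1_def
          using elim(1) fm[OF N w'] fc[OF N w'] f0[OF N w'] True by simp
        moreover have "0 \<le> 4 * k N w' / d N" using k_bound(1)[OF N w'] d_pos[of N] by simp
        ultimately show ?thesis by linarith
      next
        case False
        then have "d N < 2 * k N w'" using fd[OF N w'] by linarith
        then have "2 \<le> 4 * k N w' / d N" using d_pos[of N] by (simp add: le_divide_eq)
        moreover have "cmod (C N w' - L1) \<le> 2" using norm_triangle_ineq4[of "C N w'" L1] C1[OF N, of w'] L1 by linarith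
        ultimately show ?thesis using e by linarith
      qed
      have m2: "E2 N \<in> borel_measurable (P N)" unfolding E2_def using B.avg_measurable[OF N, of h2] h2m by simp
      have n2: "cmod (E2 N w') = 1" for w' unfolding E2_def by simp
      have i2: "integrable (P N) (\<lambda>w'. E2 N w' * L1)" using m2 n2 L1
        by (intro PN.integrable_const_bound[where B=1]) (auto simp: norm_mult)
      have "(\<integral>w. H N (w, w) \<partial>P N) - (\<integral>w'. E2 N w' \<partial>P N) * L1 = (\<integral>w'. (\<integral>w. H N (w, w') \<partial>P N) - E2 N w' * L1 \<partial>P N)"
        unfolding Fub(1)[OF N] using Fub(2)[OF N] i2 by simp
      also have "cmod \<dots> \<le> (\<integral>w'. cmod ((\<integral>w. H N (w, w') \<partial>P N) - E2 N w' * L1) \<partial>P N)" by (rule integral_norm_bound)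
      also have "\<dots> \<le> (\<integral>w'. e / 2 + 4 * k N w' / d N \<partial>P N)"
      proof (rule integral_mono)
        show "integrable (P N) (\<lambda>w'. cmod ((\<integral>w. H N (w, w') \<partial>P N) - E2 N w' * L1))"
          using Fub(2)[OF N] i2 by auto
        show "integrable (P N) (\<lambda>w'. e / 2 + 4 * k N w' / d N)" using k_int[OF N] by auto
        fix w' assume w': "w' \<in> space (P N)"
        have "(\<integral>w. H N (w, w') \<partial>P N) - E2 N w' * L1 = E2 N w' * (C N w' - L1)"
          unfolding inner[OF N w'] by (simp add: right_diff_distrib)
        then show "cmod ((\<integral>w. H N (w, w') \<partial>P N) - E2 N w' * L1) \<le> e / 2 + 4 * k N w' / d N"
          using pt[OF w'] by (simp add: norm_mult n2)
      qed
      also have "\<dots> = e / 2 + 4 * (a N / d N)" using k_int[OF N] by (simp add: PN.prob_space a_def)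
      also have "\<dots> \<le> e / 2 + 4 * sqrt \<bar>a N\<bar>" using ad[OF N] by simp
      also have "\<dots> < e" using elim(3) by simp
      finally show ?case by (simp add: dist_norm)
    qed
  qed
  have "(\<lambda>N. (\<integral>w'. E2 N w' \<partial>P N) * L1) \<longlonglongrightarrow> of_real (exp (- u\<^sup>2 * Gam_bwd M t h2 / 2)) * L1"
    unfolding E2_def
  proof (intro tendsto_mult tendsto_const B.clt[where c=c])
    show "(\<lambda>N. \<integral>x. \<bar>h2 x - h2 x\<bar> \<partial>psi M t) \<longlonglongrightarrow> 0" by simp
  qed (use h2m h2c h2_0 in auto)
  from tendsto_add[OF main this]
  have "(\<lambda>N. \<integral>w. H N (w, w) \<partial>P N) \<longlonglongrightarrow> of_real (exp (- u\<^sup>2 * Gam_bwd M t h2 / 2)) * L1" by simp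
  moreover have "of_real (exp (- u\<^sup>2 * Gam_bwd M t h2 / 2)) * L1 = complex_of_real (exp (- u\<^sup>2 * Gam_two M s t h / 2))"
    unfolding L1_def of_real_mult[symmetric] exp_add[symmetric] Gam_two_def h1_def[symmetric] h2_def[symmetric]
    by (simp add: h1_def[abs_def] h2_def[abs_def] algebra_simps diff_divide_distrib)
  ultimately show "(\<lambda>N. \<integral>w. iexp (u * (sqrt N * two_filter_estimator M N (xi N) (I N) (bxi N) (bI N) s t h w)) \<partial>P N)
    \<longlonglongrightarrow> of_real (exp (- u\<^sup>2 * Gam_two M s t h / 2))"
    unfolding est est_def H_def by simp
  show "0 \<le> Gam_two M s t h"
    using G1 G2 by (simp add: Gam_two_def h1_def[abs_def] h2_def[abs_def])
qed

end

theorem theorem4: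
  fixes M :: "'a smoothing_model"
    and P :: "nat \<Rightarrow> 'w measure"
    and xi bxi :: "nat \<Rightarrow> nat \<Rightarrow> nat \<Rightarrow> 'w \<Rightarrow> 'a"
    and I bI :: "nat \<Rightarrow> nat \<Rightarrow> nat \<Rightarrow> 'w \<Rightarrow> nat"
    and h :: "'a \<times> 'a \<Rightarrow> real"
    and s t :: nat
  assumes model: "two_filter_model M"
    and particles: "\<And>N. N \<ge> 1 \<Longrightarrow> two_filters (P N) M N (xi N) (I N) (bxi N) (bI N)"
    and bound_q: "sup_norm (space (base M) \<times> space (base M))
      (\<lambda>(x, x'). ennreal (qd M x x')) < \<infinity>"
    and bound_g: "\<And>u. u \<le> horizon M \<Longrightarrow>
      sup_norm (space (base M)) (\<lambda>x. ennreal (pot M u x)) < \<infinity>"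
    and bound_omega0: "sup_norm (space (base M)) (omega0 M) < \<infinity>"
    and bound_omega: "\<And>u. 1 \<le> u \<Longrightarrow> u \<le> horizon M \<Longrightarrow>
      sup_norm (space (base M) \<times> space (base M)) (\<lambda>(x, x'). omega M u x x') < \<infinity>"
    and bound_fadj: "\<And>u. 1 \<le> u \<Longrightarrow> u \<le> horizon M \<Longrightarrow>
      sup_norm (space (base M)) (\<lambda>x. ennreal (fadj M u x)) < \<infinity>"
    and bound_fprop: "\<And>u. 1 \<le> u \<Longrightarrow> u \<le> horizon M \<Longrightarrow>
      sup_norm (space (base M) \<times> space (base M)) (\<lambda>(x, x'). ennreal (fprop M u x x')) < \<infinity>"
    and bound_badj: "\<And>u. u < horizon M \<Longrightarrow>
      sup_norm (space (base M)) (\<lambda>x. ennreal (badj M u x / gam M (Suc u) x)) < \<infinity>"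
    and bound_bprop: "\<And>u. u < horizon M \<Longrightarrow>
      sup_norm (space (base M) \<times> space (base M)) (\<lambda>(x', x). ennreal (bprop M u x' x)) < \<infinity>"
    and bound_bomegaT: "sup_norm (space (base M)) (bomegaT M) < \<infinity>"
    and bound_bomega: "\<And>u. u < horizon M \<Longrightarrow>
      sup_norm (space (base M) \<times> space (base M)) (\<lambda>(x, x'). bomega M u x x') < \<infinity>"
    and bound_sadj: "\<And>u. 1 \<le> u \<Longrightarrow> u < horizon M \<Longrightarrow>
      sup_norm (space (base M) \<times> space (base M))
        (\<lambda>(x, x'). ennreal (sadj M u x x' * inverse (gam M (Suc u) x'))) < \<infinity>"
    and bound_q_gam: "\<And>u. 1 \<le> u \<Longrightarrow> u < horizon M \<Longrightarrow>
      sup_norm (space (base M) \<times> space (base M))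
        (\<lambda>(x, x'). ennreal (qd M x x' * inverse (gam M (Suc u) x'))) < \<infinity>"
    and bound_somega: "\<And>u. 1 \<le> u \<Longrightarrow> u < horizon M \<Longrightarrow>
      sup_norm (space (base M) \<times> space (base M) \<times> space (base M))
        (\<lambda>(x, x', x''). somega M u x x' x'') < \<infinity>"
    and bound_sprop: "\<And>u. 1 \<le> u \<Longrightarrow> u < horizon M \<Longrightarrow>
      sup_norm (space (base M) \<times> space (base M) \<times> space (base M))
        (\<lambda>(x, x', x''). ennreal (sprop M u x x' x'')) < \<infinity>"
    and times: "s < t" "t \<le> horizon M"
    and h_measurable: "h \<in> borel_measurable (base M \<Otimes>\<^sub>M base M)"
    and h_bounded: "bounded (h ` (space (base M) \<times> space (base M)))"
  shows "weak_conv_m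
    (\<lambda>N. distr (P N) borel (\<lambda>w. sqrt (real N) *
       (two_filter_estimator M N (xi N) (I N) (bxi N) (bI N) s t h w -
        (\<integral>z. h z \<partial>(phi M s \<Otimes>\<^sub>M psi M t)))))
    (normal_law 0
       (Gam_two M s t (\<lambda>z. h z - (\<integral>z'. h z' \<partial>(phi M s \<Otimes>\<^sub>M psi M t)))))"
proof -
  interpret two_filter_clt M P xi bxi I bI
    by (intro two_filter_clt.intro two_filter_clt_axioms.intro)
      (fact model particles bound_g bound_omega0 bound_omega bound_fadj bound_badj bound_bomegaT bound_bomega)+
  have s: "s \<le> horizon M" and t: "t \<le> horizon M" using times by auto
  interpret A: prob_space "phi M s" by (rule phi_prob[OF s])
  interpret B: prob_space "psi M t" by (rule psi_nn(4)[OF t])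
  interpret AB: pair_prob_space "phi M s" "psi M t" ..
  define m where "m = (\<integral>z. h z \<partial>(phi M s \<Otimes>\<^sub>M psi M t))"
  define h' where "h' z = h z - m" for z
  obtain c where c: "\<bar>h (x, y)\<bar> \<le> c" if "x \<in> space (base M)" "y \<in> space (base M)" for x y
    using h_bounded unfolding bounded_iff by (auto simp: image_iff Bex_def)
  note [measurable] = h_measurable
  have h'm: "h' \<in> borel_measurable (base M \<Otimes>\<^sub>M base M)" unfolding h'_def by measurable
  have h'c: "\<bar>h' (x, y)\<bar> \<le> c + \<bar>m\<bar>" if "x \<in> space (base M)" "y \<in> space (base M)" for x y
    using c[OF that] by (simp add: h'_def)
  have "integrable (phi M s \<Otimes>\<^sub>M psi M t) h"
    by (rule AB.P.expectation_bounded(1)[where c=c]) (auto simp: space_pair_measure c)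
  then have h'0: "(\<integral>z. h' z \<partial>(phi M s \<Otimes>\<^sub>M psi M t)) = 0"
    unfolding h'_def m_def by (simp add: AB.P.prob_space)
  let ?est = "\<lambda>N h. two_filter_estimator M N (xi N) (I N) (bxi N) (bI N) s t h"
  have est_meas: "?est N g \<in> borel_measurable (P N)"
    if N: "N \<ge> 1" and [measurable]: "g \<in> borel_measurable (base M \<Otimes>\<^sub>M base M)" for N g
    unfolding two_filter_estimator_def
  proof (intro borel_measurable_sum borel_measurable_times borel_measurable_divide)
    fix i j assume i: "i \<in> {1..N}" and j: "j \<in> {1..N}"
    have [measurable]: "xi N s i \<in> P N \<rightarrow>\<^sub>M base M" "bxi N t j \<in> P N \<rightarrow>\<^sub>M base M"
      by (rule fwd_xi[OF N s i], rule bwd_xi[OF N t j])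
    show "(\<lambda>w. g (xi N s i w, bxi N t j w)) \<in> borel_measurable (P N)" by measurable
  qed (intro fwd_weight_measurable bwd_weight_measurable fwd_xi bwd_xi fwd_I bwd_I; use N s t in auto)+
  \<comment> \<open>Normalised weights sum to 1 only where both total weights are positive, so
    centring \<open>h\<close> and centring the estimator agree almost surely.\<close>
  have est_eq: "AE w in P N. ?est N h' w = ?est N h w - m" if N: "N \<ge> 1" for N
    using fwt_pos[OF N s] bwt_pos[OF N t]
  proof eventually_elim
    case (elim w)
    have "(\<Sum>i\<in>{1..N}. \<Sum>j\<in>{1..N}. fwt N s i w / (\<Sum>l\<in>{1..N}. fwt N s l w) * (bwt N t j w / (\<Sum>l\<in>{1..N}. bwt N t l w)) * m)
        = (\<Sum>i\<in>{1..N}. fwt N s i w) / (\<Sum>l\<in>{1..N}. fwt N s l w) * ((\<Sum>j\<in>{1..N}. bwt N t j w) / (\<Sum>l\<in>{1..N}. bwt N t l w)) * m"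
      by (simp only: sum_distrib_right[symmetric] sum_distrib_left[symmetric] sum_divide_distrib[symmetric])
    also have "\<dots> = m" using elim by simp
    finally show ?case
      unfolding two_filter_estimator_def h'_def by (simp add: right_diff_distrib sum_subtractf)
  qed
  have var_nonneg: "0 \<le> Gam_two M s t h'" by (rule two_filter_clt_char(2)[OF s t h'm h'c h'0])
  have "weak_conv_m (\<lambda>N. distr (P N) borel (\<lambda>w. sqrt (real N) * (?est N h w - m))) (normal_law 0 (Gam_two M s t h'))"
  proof (rule weak_conv_of_char)
    show "(\<lambda>w. sqrt (real N) * (?est N h w - m)) \<in> borel_measurable (P N)" if "N \<ge> 1" for N
      using est_meas[OF that h_measurable] by measurable
    show "real_distribution (normal_law 0 (Gam_two M s t h'))" by (rule normal_law_char(1)[OF var_nonneg])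
    fix u
    have "(\<lambda>N. \<integral>w. iexp (u * (sqrt (real N) * (?est N h w - m))) \<partial>P N)
      \<longlonglongrightarrow> of_real (exp (- u\<^sup>2 * Gam_two M s t h' / 2))"
    proof (rule Lim_transform_eventually[OF two_filter_clt_char(1)[OF s t h'm h'c h'0]])
      show "\<forall>\<^sub>F N in sequentially. (\<integral>w. iexp (u * (sqrt (real N) * ?est N h' w)) \<partial>P N)
          = (\<integral>w. iexp (u * (sqrt (real N) * (?est N h w - m))) \<partial>P N)"
      proof (rule eventually_sequentiallyI[of 1])
        fix N :: nat assume N: "1 \<le> N"
        note [measurable] = est_meas[OF N h_measurable] est_meas[OF N h'm]
        show "(\<integral>w. iexp (u * (sqrt (real N) * ?est N h' w)) \<partial>P N)
          = (\<integral>w. iexp (u * (sqrt (real N) * (?est N h w - m))) \<partial>P N)"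
        proof (rule integral_cong_AE)
          show "AE w in P N. iexp (u * (sqrt (real N) * ?est N h' w)) = iexp (u * (sqrt (real N) * (?est N h w - m)))"
            using est_eq[OF N] by eventually_elim simp
        qed measurable
      qed
    qed
    then show "(\<lambda>N. \<integral>w. iexp (u * (sqrt (real N) * (?est N h w - m))) \<partial>P N) \<longlonglongrightarrow> char (normal_law 0 (Gam_two M s t h')) u"
      unfolding normal_law_char(2)[OF var_nonneg] .
  qed
  then show ?thesis unfolding h'_def[abs_def] m_def .
qed

end
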